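(* Let $I_{\mathcal T}:\mathbf{MT}_{\mathcal T}\hookrightarrow\mathbf{MT}$ be the inclusion of the full subcategory of fiber-terminal MT-algebras. It is a morphism of SFC-categories $$\mathbf{MT}_{\mathcal T}\xrightarrow{\;I_{\mathcal T}\;}\mathbf{MT}.$$ The functor $\mathsf{Dual}$ yields maps in $\mathbf{SADJ}$ as follows. The objects are the adjunctions (left adjoint first) (A1) $\mathsf{pt}_{\mathcal M}\dashv\mathcal P$ between $\mathbf{MT}$ and $\mathbf{Top}^{\mathrm{op}}$, the adjunction $\mathsf{Dual}$ of $\mathbf{MT}$; (A2) $\mathsf{pt}_{\mathcal M}\dashv\mathcal P$ between $\mathbf{MT}_{\mathcal T}$ and $\mathbf{Top}_D^{\mathrm{op}}$, the adjunction $\mathsf{Dual}$ of $\mathbf{MT}_{\mathcal T}$; (A3) $\mathsf{pt}_{\mathcal T}\dashv\Omega$ between $\mathbf{Frm}_{\mathcal T}$ and $\mathbf{Top}_{\mathcal T}^{\mathrm{op}}$, where $\mathbf{Top}_{\mathcal T}=\mathbf{Top}_D$; (A4) $\mathsf{pt}_{\mathcal{LE}}\dashv\Omega$ between $\mathbf{Frm}_{\mathcal{LE}}$ and $\mathbf{Top}_D^{\mathrm{op}}$. The maps in $\mathbf{SADJ}$ are $\mathsf{Dual}(I_{\mathcal T})$ from (A2) to (A1), with functors the full inclusions $I_{\mathcal T}$ and $\mathbf{Top}_D^{\mathrm{op}}\hookrightarrow\mathbf{Top}^{\mathrm{op}}$; the map from (A2) to (A3) with functors the equivalence $\mathcal O_{\mathcal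 M}I_{\mathcal T}:\mathbf{MT}_{\mathcal T}\to\mathbf{Frm}_{\mathcal T}$ and the equality $\mathbf{Top}_D^{\mathrm{op}}=\mathbf{Top}_{\mathcal T}^{\mathrm{op}}$; and the map from (A3) to (A4) with functors the inclusion $\mathbf{Frm}_{\mathcal T}\hookrightarrow\mathbf{Frm}_{\mathcal{LE}}$ and the equality $\mathbf{Top}_{\mathcal T}^{\mathrm{op}}=\mathbf{Top}_D^{\mathrm{op}}$.
   Context: $\mathbf{Frm}$: frames and frame homomorphisms; $\mathbf 2=\{0<1\}$; $\mathbf{Top}$: topological spaces; $\mathbf{Top}_D$: the full subcategory of $T_D$-spaces (every point is the intersection of an open and a closed set); $\mathbb S$: the Sierpinski space; $|\cdot|$: underlying sets/functions; $\Omega(X)$: the frame of opens of $X$. SFC-categories. For a faithful $U:\mathcal A\to\mathcal B$, a morphism $U(A)\to U(A')$ lifts if it is $U(p)$ for some $p:A\to A'$; a cartesian lift of a family $\{f_i:X\to U(C)\}$ is $(\overline X,\theta:U(\overline X)\cong X)$ such that $h:U(D)\to U(\overline X)$ lifts iff all $f_i\theta h$ lift. A PFC-category is $(\mathcal O_{\mathcal C},\mathcal C,\mathbf 2_{\mathcal C},\iota_{\mathcal C})$ with $\mathcal O_{\mathcal C}:\mathcal C\to\mathbf{Frm}$ faithful, $\mathbf 2_{\mathcal C}\in\mathcal C$, $\iota_{\mathcal C}:\mathcal O_{\mathcal C}\mathbf 2_{\mathcal C}\cong\mathbf 2$. $\mathbf{Top}_{\mathcal C}\subseteq\mathbf{Top}$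 is the full subcategory of the $X$ such that $\{|\iota_{\mathcal C}^{-1}|\circ\chi_x:\mathbf{Top}(X,\mathbb S)\to|\mathcal O_{\mathcal C}\mathbf 2_{\mathcal C}|\mid x\in X\}$, $\chi_x(g)=g(x)$, has a cartesian lift $(\Omega_{\mathcal C}X,\theta_{\mathcal C,X})$ w.r.t. $|\mathcal O_{\mathcal C}(-)|$; $\mathsf{pt}_{\mathcal C}(C)=\mathcal C(C,\mathbf 2_{\mathcal C})$ with opens $\{f\mid\iota_{\mathcal C}(\mathcal O_{\mathcal C}f(a))=1\}$, $a\in\mathcal O_{\mathcal C}C$. It is an SFC-category if $\mathbb S$ and all $\mathsf{pt}_{\mathcal C}(C)$ lie in $\mathbf{Top}_{\mathcal C}$. A morphism of SFC-categories $(H,\alpha,i):\mathcal C\to\mathcal D$ is a functor $H$ with a natural isomorphism $\alpha:\mathcal O_{\mathcal D}H\to\mathcal O_{\mathcal C}$ and an isomorphism $i:H\mathbf 2_{\mathcal C}\to\mathbf 2_{\mathcal D}$ with $\iota_{\mathcal D}\mathcal O_{\mathcal D}(i)=\iota_{\mathcal C}\alpha_{\mathbf 2_{\mathcal C}}$, such that for $X\in\mathbf{Top}_{\mathcal C}$, $(H\Omega_{\mathcal C}X,\theta_{\mathcal C,X}|\alpha_{\Omega_{\mathcal C}X}|)$ is a cartesian lift w.r.t. $|\mathcal O_{\mathcal D}(-)|$ of $\{|\alpha_{\mathbf 2_{\mathcal C}}^{-1}||\iota_{\mathcal C}^{-1}|\chi_x\}$. A morphism is denoted by its functor $H$ when $\alpha$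 and $i$ are clear; here they are identities. $\mathbf{MT}$ and $\mathbf{MT}_{\mathcal T}$ are taken with distinguished object $\mathbf 2_{\mathcal M}$ and (the restriction of) $\mathcal O_{\mathcal M}$; all isomorphisms $\iota$ are identities. $\mathbf{Top}_{\mathcal T}$ denotes the category $\mathbf{Top}_{\mathcal C}$ for $\mathcal C=\mathbf{MT}_{\mathcal T}$. Adjunction morphisms. For adjunctions $F\dashv G$ (unit $\eta$) and $P\dashv Q$ (counit $\delta$), a right adjunction morphism consists of functors $U,V$ and a mate-pair $\zeta:UG\to QV$, $\xi:PU\to VF$ (i.e. $\xi=\delta_{VF}\circ P\zeta_F\circ PU\eta$) with $\zeta$ invertible; it is strong if $\xi$ is also invertible. $\mathbf{RADJ}$ (resp. $\mathbf{SADJ}$) is the 2-category of adjunctions with right (resp. strong) adjunction morphisms. The 2-functor $\mathsf{Dual}$ from SFC-categories to $\mathbf{RADJ}$ sends an SFC-category to the adjunction $\mathsf{pt}_{\mathcal C}\dashv\Omega_{\mathcal C}$ between $\mathcal C$ and $\mathbf{Top}_{\mathcal C}^{\mathrm{op}}$ (on morphisms, $\mathsf{pt}_{\mathcal C}$ is precomposition and $\Omega_{\mathcal C}$ lifts precomposition). It sends a morphism $(H,\alpha,i):\mathcal C\to\mathcal D$ (for which $\mathbf{Top}_{\mathcal C}\subseteq\mathbf{Top}_{\mathcal D}$) to the right adjunction morphism given by $H$, the inclusion $\mathbf{Top}_{\mathcal C}^{\mathrm{op}}\subseteq\mathbf{Top}_{\mathcal D}^{\mathrm{op}}$, the isomorphism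 $\zeta^H_X:H\Omega_{\mathcal C}X\to\Omega_{\mathcal D}X$ with underlying function $\theta_{\mathcal D,X}^{-1}\theta_{\mathcal C,X}|\alpha_{\Omega_{\mathcal C}X}|$, and the continuous maps $\xi^H_C:\mathsf{pt}_{\mathcal C}C\to\mathsf{pt}_{\mathcal D}HC$, $f\mapsto i\circ H(f)$. The natural transformations of the other two maps are of the same form: the identity on underlying frames, and $f\mapsto H(f)$ on spectra, $H$ being the first functor. MT-algebras. An MT-algebra is a pair $(L,M)$ with $M$ a complete Boolean algebra and $L\subseteq M$ a subframe (of open elements); all MT-algebras are assumed to be $T_0$: every element of $M$ is a join of elements $\bigwedge_ia_i\wedge\neg a$ with $a,a_i\in L$. Morphisms in $\mathbf{MT}$ are complete Boolean homomorphisms mapping opens to opens. $\mathcal O_{\mathcal M}(L,M)=L$ (faithful), $\mathbf 2_{\mathcal M}=(\mathbf 2,\mathbf 2)$. $\mathsf{pt}_{\mathcal M}(L,M)=\mathbf{MT}((L,M),\mathbf 2_{\mathcal M})$ with opens $\{f\mid f(a)=1\}$, $a\in L$. $\mathcal P$ sends a space $X$ to $(\Omega X,\mathcal P X)$, with $\mathcal P X$ the powerset, and a continuous map to the preimage map. An object $C$ of $\mathbf{MT}$ is fiber-terminal if for every $D\in\mathbf{MT}$ and isomorphism $\theta:\mathcal O_{\mathcal M}(D)\cong\mathcal O_{\mathcal M}(C)$ there is $p:D\to C$ with $\mathcal O_{\mathcal M}(p)=\theta$. $\mathbf{Frm}_{\mathcal T}\subseteq\mathbf{Frm}$ is the essential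 image of $\mathcal O_{\mathcal M}I_{\mathcal T}$: its objects are the frames isomorphic to some $\mathcal O_{\mathcal M}(C)$ with $C$ fiber-terminal, and its morphisms the frame maps which up to these isomorphisms are of the form $\mathcal O_{\mathcal M}(p)$ for $p$ a morphism of $\mathbf{MT}_{\mathcal T}$. $\mathsf{pt}_{\mathcal T}(L)=\mathbf{Frm}_{\mathcal T}(L,\mathbf 2)$ with opens $\{f\mid f(a)=1\}$, $a\in L$. For a frame $L$, $\mathcal SL$ is the coframe of sublocales of $L$ under inclusion, $\mathfrak o(a)=\{a\to x\mid x\in L\}$, and $\mathcal FL\subseteq\mathcal SL$ is the complete Boolean algebra of all joins of sublocales ${\uparrow}a\cap\mathfrak o(b)$, in which $L$ embeds by $a\mapsto\mathfrak o(a)$ (the Funayama embedding). $\mathbf{Frm}_{\mathcal{LE}}$: frames with locally exact maps, i.e. frame maps $f:L\to M$ that extend along the Funayama embeddings to a homomorphism of complete Boolean algebras $\mathcal FL\to\mathcal FM$. $\mathsf{pt}_{\mathcal{LE}}(L)=\mathbf{Frm}_{\mathcal{LE}}(L,\mathbf 2)$ with opens $\{f\mid f(a)=1\}$, $a\in L$.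
   Formalization: Top is taken to consist of T0-spaces: for a non-T0 space X the pair (ΩX, PX) is not a T0 MT-algebra, so P is undefined there, and the two-point indiscrete space would lie in Top_T without being T_D. *)

theory Defs
  imports
    "HOL-Analysis.Abstract_Topological_Spaces"
    "HOL-Algebra.Complete_Lattice"
    "HOL-Library.Nat_Bijection"
begin

section \<open>The universe of small sets\<close>

text \<open>
  "Small" structures live in a Grothendieck-style universe: a type whose elements are (codes of)
  sets of elements of that type, closed under subsets, powersets, unions and replacement.
  Everything below is stated for an arbitrary such universe. An infinite set is not required, so
  the hereditarily finite sets are an instance as well as every universe in the usual sense.
\<close>

class universe =
  fixes elts :: "'a \<Rightarrow> 'a set"
  assumes elts_ext: "elts x = elts y \<Longrightarrow> x = y"
    and elts_subset: "A \<subseteq> elts x \<Longrightarrow> \<exists>y. elts y = A"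
    and elts_power: "\<exists>y. elts y = {z. elts z \<subseteq> elts x}"
    and elts_union: "\<exists>y. elts y = (\<Union>z\<in>elts x. elts z)"
    and elts_replacement: "\<exists>y. elts y = f ` elts x"

instantiation nat :: universe
begin

definition elts_nat :: "nat \<Rightarrow> nat set"
  where "elts_nat = set_decode"

instance
proof
  have coded: "\<exists>y::nat. elts y = A" if "finite A" for A
    using that set_encode_inverse unfolding elts_nat_def by blast
  show "x = y" if "elts x = elts y" for x y :: nat
    using that unfolding elts_nat_def by (metis set_decode_inverse)
  show "\<exists>y. elts y = A" if "A \<subseteq> elts x" for A and x :: nat
    using that finite_subset[of A "set_decode x"] coded unfolding elts_nat_def by simp
  show "\<exists>y. elts y = {z. elts z \<subseteq> elts x}" for x :: nat
  proof (rule coded)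
    have "{z. elts z \<subseteq> elts x} \<subseteq> {..x}"
      unfolding elts_nat_def using subset_decode_imp_le by auto
    then show "finite {z. elts z \<subseteq> elts x}"
      using finite_subset by blast
  qed
  show "\<exists>y. elts y = (\<Union>z\<in>elts x. elts z)" for x :: nat
    by (rule coded) (simp add: elts_nat_def)
  show "\<exists>y. elts y = f ` elts x" for f :: "nat \<Rightarrow> nat" and x :: nat
    by (rule coded) (simp add: elts_nat_def)
qed

end

definition small :: "'u::universe set \<Rightarrow> bool"
  where "small A \<longleftrightarrow> A \<in> range elts"

definition vset :: "'u::universe set \<Rightarrow> 'u"
  where "vset A = (THE v. elts v = A)"

definition v0 :: "'u::universe"
  where "v0 = vset {}"

definition v1 :: "'u::universe"
  where "v1 = vset {v0}"

definition vpair :: "'u::universe \<Rightarrow> 'u \<Rightarrow> 'u"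
  where "vpair x y = vset {vset {x}, vset {x, y}}"

text \<open>Functions between small sets are coded in the universe by their graphs.\<close>

definition lam :: "'u::universe set \<Rightarrow> ('u \<Rightarrow> 'u) \<Rightarrow> 'u"
  where "lam A f = vset ((\<lambda>x. vpair x (f x)) ` A)"

definition app :: "'u::universe \<Rightarrow> 'u \<Rightarrow> 'u"
  where "app f x = (THE y. vpair x y \<in> elts f)"

definition vdom :: "'u::universe \<Rightarrow> 'u set"
  where "vdom f = {x. \<exists>y. vpair x y \<in> elts f}"

definition vcomp :: "'u::universe \<Rightarrow> 'u \<Rightarrow> 'u"
  where "vcomp g f = lam (vdom f) (\<lambda>x. app g (app f x))"

definition vid :: "'u::universe set \<Rightarrow> 'u"
  where "vid A = lam A (\<lambda>x. x)"

definition maps :: "'u::universe set \<Rightarrow> 'u set \<Rightarrow> 'u set"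
  where "maps A B = {lam A f | f. f \<in> A \<rightarrow> B}"


section \<open>Categories, functors, adjunctions\<close>

text \<open>
  Hom-sets for different pairs of objects may overlap (a function code does not record its
  codomain), so the arrow part of a functor takes source and target as arguments.
\<close>

record ('o, 'm) cat =
  Ob :: "'o set"
  Hom :: "'o \<Rightarrow> 'o \<Rightarrow> 'm set"
  Idt :: "'o \<Rightarrow> 'm"
  Cmp :: "'m \<Rightarrow> 'm \<Rightarrow> 'm"

definition is_category :: "('o, 'm) cat \<Rightarrow> bool" where
  "is_category C \<longleftrightarrow>
     (\<forall>a\<in>Ob C. Idt C a \<in> Hom C a a) \<and>
     (\<forall>a\<in>Ob C. \<forall>b\<in>Ob C. \<forall>c\<in>Ob C. \<forall>f\<in>Hom C a b. \<forall>g\<in>Hom C b c. Cmp C g f \<in> Hom C a c) \<and>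
     (\<forall>a\<in>Ob C. \<forall>b\<in>Ob C. \<forall>f\<in>Hom C a b. Cmp C f (Idt C a) = f \<and> Cmp C (Idt C b) f = f) \<and>
     (\<forall>a\<in>Ob C. \<forall>b\<in>Ob C. \<forall>c\<in>Ob C. \<forall>d\<in>Ob C.
        \<forall>f\<in>Hom C a b. \<forall>g\<in>Hom C b c. \<forall>h\<in>Hom C c d. Cmp C h (Cmp C g f) = Cmp C (Cmp C h g) f)"

definition op_cat :: "('o, 'm) cat \<Rightarrow> ('o, 'm) cat" where
  "op_cat C = \<lparr>Ob = Ob C, Hom = (\<lambda>a b. Hom C b a), Idt = Idt C, Cmp = (\<lambda>g f. Cmp C f g)\<rparr>"

definition full_subcat :: "('o, 'm) cat \<Rightarrow> ('o \<Rightarrow> bool) \<Rightarrow> ('o, 'm) cat" where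
  "full_subcat C P = C\<lparr>Ob := {a \<in> Ob C. P a}\<rparr>"

definition is_subcategory :: "('o, 'm) cat \<Rightarrow> ('o, 'm) cat \<Rightarrow> bool" where
  "is_subcategory C D \<longleftrightarrow> is_category C \<and> is_category D \<and> Ob C \<subseteq> Ob D \<and>
     (\<forall>a\<in>Ob C. \<forall>b\<in>Ob C. Hom C a b \<subseteq> Hom D a b) \<and>
     (\<forall>a\<in>Ob C. Idt C a = Idt D a) \<and>
     (\<forall>a\<in>Ob C. \<forall>b\<in>Ob C. \<forall>c\<in>Ob C. \<forall>f\<in>Hom C a b. \<forall>g\<in>Hom C b c. Cmp C g f = Cmp D g f)"

definition is_full_subcategory :: "('o, 'm) cat \<Rightarrow> ('o, 'm) cat \<Rightarrow> bool" where
  "is_full_subcategory C D \<longleftrightarrow> is_subcategory C D \<and>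
     (\<forall>a\<in>Ob C. \<forall>b\<in>Ob C. Hom C a b = Hom D a b)"

definition inverse_arrows :: "('o, 'm) cat \<Rightarrow> 'o \<Rightarrow> 'o \<Rightarrow> 'm \<Rightarrow> 'm \<Rightarrow> bool" where
  "inverse_arrows C a b f g \<longleftrightarrow> f \<in> Hom C a b \<and> g \<in> Hom C b a \<and>
     Cmp C g f = Idt C a \<and> Cmp C f g = Idt C b"

definition is_iso :: "('o, 'm) cat \<Rightarrow> 'o \<Rightarrow> 'o \<Rightarrow> 'm \<Rightarrow> bool" where
  "is_iso C a b f \<longleftrightarrow> (\<exists>g. inverse_arrows C a b f g)"

definition inv_arr :: "('o, 'm) cat \<Rightarrow> 'o \<Rightarrow> 'o \<Rightarrow> 'm \<Rightarrow> 'm" where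
  "inv_arr C a b f = (THE g. inverse_arrows C a b f g)"

record ('o, 'm, 'p, 'n) func =
  fo :: "'o \<Rightarrow> 'p"
  fa :: "'o \<Rightarrow> 'o \<Rightarrow> 'm \<Rightarrow> 'n"

definition is_functor :: "('o, 'm) cat \<Rightarrow> ('p, 'n) cat \<Rightarrow> ('o, 'm, 'p, 'n) func \<Rightarrow> bool" where
  "is_functor C D F \<longleftrightarrow> is_category C \<and> is_category D \<and>
     (\<forall>a\<in>Ob C. fo F a \<in> Ob D) \<and>
     (\<forall>a\<in>Ob C. \<forall>b\<in>Ob C. \<forall>f\<in>Hom C a b. fa F a b f \<in> Hom D (fo F a) (fo F b)) \<and>
     (\<forall>a\<in>Ob C. fa F a a (Idt C a) = Idt D (fo F a)) \<and>
     (\<forall>a\<in>Ob C. \<forall>b\<in>Ob C. \<forall>c\<in>Ob C. \<forall>f\<in>Hom C a b. \<forall>g\<in>Hom C b c.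
        fa F a c (Cmp C g f) = Cmp D (fa F b c g) (fa F a b f))"

definition is_faithful :: "('o, 'm) cat \<Rightarrow> ('o, 'm, 'p, 'n) func \<Rightarrow> bool" where
  "is_faithful C F \<longleftrightarrow> (\<forall>a\<in>Ob C. \<forall>b\<in>Ob C. inj_on (fa F a b) (Hom C a b))"

definition functors_agree ::
  "('o, 'm) cat \<Rightarrow> ('o, 'm, 'p, 'n) func \<Rightarrow> ('o, 'm, 'p, 'n) func \<Rightarrow> bool" where
  "functors_agree C F G \<longleftrightarrow> (\<forall>a\<in>Ob C. fo F a = fo G a) \<and>
     (\<forall>a\<in>Ob C. \<forall>b\<in>Ob C. \<forall>f\<in>Hom C a b. fa F a b f = fa G a b f)"

text \<open>The inclusion functor of a subcategory, in particular the identity functor.\<close>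

definition incl :: "('o, 'm, 'o, 'm) func" where
  "incl = \<lparr>fo = (\<lambda>a. a), fa = (\<lambda>a b f. f)\<rparr>"

definition func_comp ::
  "('p, 'n, 'q, 'k) func \<Rightarrow> ('o, 'm, 'p, 'n) func \<Rightarrow> ('o, 'm, 'q, 'k) func" where
  "func_comp G F = \<lparr>fo = (\<lambda>a. fo G (fo F a)), fa = (\<lambda>a b f. fa G (fo F a) (fo F b) (fa F a b f))\<rparr>"

definition is_nat_trans ::
  "('o, 'm) cat \<Rightarrow> ('p, 'n) cat \<Rightarrow> ('o, 'm, 'p, 'n) func \<Rightarrow> ('o, 'm, 'p, 'n) func \<Rightarrow>
   ('o \<Rightarrow> 'n) \<Rightarrow> bool" where
  "is_nat_trans C D F G t \<longleftrightarrow> (\<forall>a\<in>Ob C. t a \<in> Hom D (fo F a) (fo G a)) \<and>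
     (\<forall>a\<in>Ob C. \<forall>b\<in>Ob C. \<forall>f\<in>Hom C a b. Cmp D (t b) (fa F a b f) = Cmp D (fa G a b f) (t a))"

definition is_nat_iso ::
  "('o, 'm) cat \<Rightarrow> ('p, 'n) cat \<Rightarrow> ('o, 'm, 'p, 'n) func \<Rightarrow> ('o, 'm, 'p, 'n) func \<Rightarrow>
   ('o \<Rightarrow> 'n) \<Rightarrow> bool" where
  "is_nat_iso C D F G t \<longleftrightarrow> is_nat_trans C D F G t \<and>
     (\<forall>a\<in>Ob C. is_iso D (fo F a) (fo G a) (t a))"

definition is_equivalence ::
  "('o, 'm) cat \<Rightarrow> ('p, 'n) cat \<Rightarrow> ('o, 'm, 'p, 'n) func \<Rightarrow> bool" where
  "is_equivalence C D F \<longleftrightarrow> is_functor C D F \<and>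
     (\<exists>G. is_functor D C G \<and>
       (\<exists>s. is_nat_iso C C incl (func_comp G F) s) \<and> (\<exists>t. is_nat_iso D D (func_comp F G) incl t))"

record ('a, 'm, 'b, 'n) adjn =
  LC :: "('a, 'm) cat"
  RC :: "('b, 'n) cat"
  LF :: "('a, 'm, 'b, 'n) func"
  RF :: "('b, 'n, 'a, 'm) func"
  unit :: "'a \<Rightarrow> 'm"
  counit :: "'b \<Rightarrow> 'n"

definition is_adjunction :: "('a, 'm, 'b, 'n) adjn \<Rightarrow> bool" where
  "is_adjunction A \<longleftrightarrow>
     is_functor (LC A) (RC A) (LF A) \<and> is_functor (RC A) (LC A) (RF A) \<and>
     is_nat_trans (LC A) (LC A) incl (func_comp (RF A) (LF A)) (unit A) \<and>
     is_nat_trans (RC A) (RC A) (func_comp (LF A) (RF A)) incl (counit A) \<and>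
     (\<forall>c\<in>Ob (LC A).
        Cmp (RC A) (counit A (fo (LF A) c)) (fa (LF A) c (fo (RF A) (fo (LF A) c)) (unit A c)) =
        Idt (RC A) (fo (LF A) c)) \<and>
     (\<forall>d\<in>Ob (RC A).
        Cmp (LC A) (fa (RF A) (fo (LF A) (fo (RF A) d)) d (counit A d)) (unit A (fo (RF A) d)) =
        Idt (LC A) (fo (RF A) d))"

definition adjunctions_agree :: "('a, 'm, 'b, 'n) adjn \<Rightarrow> ('a, 'm, 'b, 'n) adjn \<Rightarrow> bool" where
  "adjunctions_agree A B \<longleftrightarrow> LC A = LC B \<and> RC A = RC B \<and>
     functors_agree (LC A) (LF A) (LF B) \<and> functors_agree (RC A) (RF A) (RF B) \<and>
     (\<forall>c\<in>Ob (LC A). unit A c = unit B c) \<and> (\<forall>d\<in>Ob (RC A). counit A d = counit B d)"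

text \<open>Adjunction morphisms from \<open>F \<stileturn> G\<close> to \<open>P \<stileturn> Q\<close>: functors \<open>U, V\<close>
  and transformations \<open>\<zeta> : U G \<rightarrow> Q V\<close>, \<open>\<xi> : P U \<rightarrow> V F\<close>.\<close>

record ('a, 'm, 'b, 'n, 'c, 'k, 'd, 'l) adjn_mor =
  UF :: "('a, 'm, 'c, 'k) func"
  VF :: "('b, 'n, 'd, 'l) func"
  zeta :: "'b \<Rightarrow> 'k"
  xi :: "'a \<Rightarrow> 'l"

definition is_RADJ_map ::
  "('a, 'm, 'b, 'n) adjn \<Rightarrow> ('c, 'k, 'd, 'l) adjn \<Rightarrow>
   ('a, 'm, 'b, 'n, 'c, 'k, 'd, 'l) adjn_mor \<Rightarrow> bool" where
  "is_RADJ_map A B M \<longleftrightarrow> is_adjunction A \<and> is_adjunction B \<and>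
     is_functor (LC A) (LC B) (UF M) \<and> is_functor (RC A) (RC B) (VF M) \<and>
     is_nat_iso (RC A) (LC B) (func_comp (UF M) (RF A)) (func_comp (RF B) (VF M)) (zeta M) \<and>
     is_nat_trans (LC A) (RC B) (func_comp (LF B) (UF M)) (func_comp (VF M) (LF A)) (xi M) \<and>
     (\<forall>c\<in>Ob (LC A).
        let Fc = fo (LF A) c; GFc = fo (RF A) Fc; VFc = fo (VF M) Fc; QVFc = fo (RF B) VFc;
            Uc = fo (UF M) c; UGFc = fo (UF M) GFc
        in xi M c = Cmp (RC B) (counit B VFc)
             (Cmp (RC B) (fa (LF B) UGFc QVFc (zeta M Fc))
                         (fa (LF B) Uc UGFc (fa (UF M) c GFc (unit A c)))))"

definition is_SADJ_map ::
  "('a, 'm, 'b, 'n) adjn \<Rightarrow> ('c, 'k, 'd, 'l) adjn \<Rightarrow>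
   ('a, 'm, 'b, 'n, 'c, 'k, 'd, 'l) adjn_mor \<Rightarrow> bool" where
  "is_SADJ_map A B M \<longleftrightarrow> is_RADJ_map A B M \<and>
     is_nat_iso (LC A) (RC B) (func_comp (LF B) (UF M)) (func_comp (VF M) (LF A)) (xi M)"

definition lifts ::
  "('o, 'm) cat \<Rightarrow> ('o, 'm, 'p, 'n) func \<Rightarrow> 'o \<Rightarrow> 'o \<Rightarrow> 'n \<Rightarrow> bool" where
  "lifts A U a a' h \<longleftrightarrow> (\<exists>p\<in>Hom A a a'. fa U a a' p = h)"

text \<open>The family, a set \<open>Fs\<close> of arrows from \<open>X\<close> to \<open>U c\<close>, has the cartesian lift
  \<open>(Xb, \<theta>)\<close>.\<close>

definition is_cartesian_lift ::
  "('o, 'm) cat \<Rightarrow> ('p, 'n) cat \<Rightarrow> ('o, 'm, 'p, 'n) func \<Rightarrow>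
   'p \<Rightarrow> 'o \<Rightarrow> 'n set \<Rightarrow> 'o \<Rightarrow> 'n \<Rightarrow> bool" where
  "is_cartesian_lift A B U X c Fs Xb \<theta> \<longleftrightarrow>
     Xb \<in> Ob A \<and> is_iso B (fo U Xb) X \<theta> \<and>
     (\<forall>D\<in>Ob A. \<forall>h\<in>Hom B (fo U D) (fo U Xb).
        lifts A U D Xb h \<longleftrightarrow> (\<forall>f\<in>Fs. lifts A U D c (Cmp B f (Cmp B \<theta> h))))"


section \<open>Sets, spaces and frames\<close>

definition SetC :: "('u::universe set, 'u) cat" where
  "SetC = \<lparr>Ob = {A. small A}, Hom = maps, Idt = vid, Cmp = vcomp\<rparr>"

text \<open>Spaces are \<open>T\<^sub>0\<close>. This convention accompanies that of MT-algebras being \<open>T\<^sub>0\<close>: the pair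
  \<open>(\<Omega> X, \<P> X)\<close> is a \<open>T\<^sub>0\<close> MT-algebra exactly if \<open>X\<close> is a \<open>T\<^sub>0\<close>-space, and
  the two-point indiscrete space would otherwise belong to \<open>Top\<^sub>\<T>\<close> without being \<open>T\<^sub>D\<close>.\<close>

definition Top :: "('u::universe topology, 'u) cat" where
  "Top = \<lparr>Ob = {X. small (topspace X) \<and> t0_space X},
          Hom = (\<lambda>X Y. {f \<in> maps (topspace X) (topspace Y). continuous_map X Y (app f)}),
          Idt = (\<lambda>X. vid (topspace X)), Cmp = vcomp\<rparr>"

definition td_space :: "'a topology \<Rightarrow> bool" where
  "td_space X \<longleftrightarrow> (\<forall>x\<in>topspace X. \<exists>U K. openin X U \<and> closedin X K \<and> U \<inter> K = {x})"

definition TopD :: "('u::universe topology, 'u) cat" where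
  "TopD = full_subcat Top td_space"

definition Sierp :: "'u::universe topology" where
  "Sierp = topology (\<lambda>U. U = {} \<or> U = {v1} \<or> U = {v0, v1})"

definition is_frame :: "'a gorder \<Rightarrow> bool" where
  "is_frame L \<longleftrightarrow> complete_lattice L \<and>
     (\<forall>a\<in>carrier L. \<forall>S. S \<subseteq> carrier L \<longrightarrow>
        a \<sqinter>\<^bsub>L\<^esub> (\<Squnion>\<^bsub>L\<^esub> S) = \<Squnion>\<^bsub>L\<^esub> ((\<lambda>s. a \<sqinter>\<^bsub>L\<^esub> s) ` S))"

definition is_frame_hom :: "'a gorder \<Rightarrow> 'b gorder \<Rightarrow> ('a \<Rightarrow> 'b) \<Rightarrow> bool" where
  "is_frame_hom L M f \<longleftrightarrow> f \<in> carrier L \<rightarrow> carrier M \<and> f \<top>\<^bsub>L\<^esub> = \<top>\<^bsub>M\<^esub> \<and>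
     (\<forall>a\<in>carrier L. \<forall>b\<in>carrier L. f (a \<sqinter>\<^bsub>L\<^esub> b) = f a \<sqinter>\<^bsub>M\<^esub> f b) \<and>
     (\<forall>S. S \<subseteq> carrier L \<longrightarrow> f (\<Squnion>\<^bsub>L\<^esub> S) = \<Squnion>\<^bsub>M\<^esub> (f ` S))"

definition Frm :: "('u::universe gorder, 'u) cat" where
  "Frm = \<lparr>Ob = {L. small (carrier L) \<and> is_frame L},
          Hom = (\<lambda>L M. {f \<in> maps (carrier L) (carrier M). is_frame_hom L M (app f)}),
          Idt = (\<lambda>L. vid (carrier L)), Cmp = vcomp\<rparr>"

text \<open>A family of small sets ordered by inclusion, its members coded in the universe.\<close>

definition set_order :: "'u::universe set set \<Rightarrow> 'u gorder" where
  "set_order \<A> = \<lparr>carrier = vset ` \<A>, eq = (=), le = (\<lambda>x y. elts x \<subseteq> elts y)\<rparr>"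

definition opens :: "'u::universe topology \<Rightarrow> 'u gorder" where
  "opens X = set_order {U. openin X U}"

text \<open>The two-element chain is the powerset of a one-element set.\<close>

definition two :: "'u::universe gorder" where
  "two = set_order {{}, {v0}}"


section \<open>SFC-categories and Dual\<close>

record ('o, 'u) pfc =
  Cat :: "('o, 'u) cat"
  OF :: "('o, 'u, 'u gorder, 'u) func"
  Two :: 'o
  iota :: 'u

definition is_pfc :: "('o, 'u::universe, 'x) pfc_scheme \<Rightarrow> bool" where
  "is_pfc C \<longleftrightarrow> is_functor (Cat C) Frm (OF C) \<and> is_faithful (Cat C) (OF C) \<and>
     Two C \<in> Ob (Cat C) \<and> is_iso Frm (fo (OF C) (Two C)) two (iota C)"

definition underlying :: "('o, 'u::universe, 'x) pfc_scheme \<Rightarrow> ('o, 'u, 'u set, 'u) func" where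
  "underlying C = \<lparr>fo = (\<lambda>c. carrier (fo (OF C) c)), fa = fa (OF C)\<rparr>"

definition iota_inv :: "('o, 'u::universe, 'x) pfc_scheme \<Rightarrow> 'u" where
  "iota_inv C = inv_arr Frm (fo (OF C) (Two C)) two (iota C)"

definition chi :: "'u::universe topology \<Rightarrow> 'u \<Rightarrow> 'u" where
  "chi X x = lam (Hom Top X Sierp) (\<lambda>g. app g x)"

definition point_family :: "('o, 'u::universe, 'x) pfc_scheme \<Rightarrow> 'u topology \<Rightarrow> 'u set" where
  "point_family C X = {vcomp (iota_inv C) (chi X x) | x. x \<in> topspace X}"

definition is_space_lift ::
  "('o, 'u::universe, 'x) pfc_scheme \<Rightarrow> 'u topology \<Rightarrow> 'o \<Rightarrow> 'u \<Rightarrow> bool" where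
  "is_space_lift C X c \<theta> \<longleftrightarrow>
     is_cartesian_lift (Cat C) SetC (underlying C) (Hom Top X Sierp) (Two C) (point_family C X) c \<theta>"

definition TopC :: "('o, 'u::universe, 'x) pfc_scheme \<Rightarrow> ('u topology, 'u) cat" where
  "TopC C = full_subcat Top (\<lambda>X. \<exists>c \<theta>. is_space_lift C X c \<theta>)"

definition ptC :: "('o, 'u::universe, 'x) pfc_scheme \<Rightarrow> 'o \<Rightarrow> 'u topology" where
  "ptC C c = topology (\<lambda>U. \<exists>a\<in>carrier (fo (OF C) c).
     U = {f \<in> Hom (Cat C) c (Two C). app (iota C) (app (fa (OF C) c (Two C) f) a) = v1})"

text \<open>Cartesian lifts are determined up to isomorphism only, so an SFC-category carries the
  choice of the lifts \<open>(\<Omega>\<^sub>C X, \<theta>\<^sub>C\<^sub>,\<^sub>X)\<close> as part of its data.\<close>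

record ('o, 'u) sfc = "('o, 'u) pfc" +
  Om :: "'u topology \<Rightarrow> 'o"
  Th :: "'u topology \<Rightarrow> 'u"

definition is_sfc :: "('o, 'u::universe) sfc \<Rightarrow> bool" where
  "is_sfc C \<longleftrightarrow> is_pfc C \<and> Sierp \<in> Ob (TopC C) \<and>
     (\<forall>c\<in>Ob (Cat C). ptC C c \<in> Ob (TopC C)) \<and>
     (\<forall>X\<in>Ob (TopC C). is_space_lift C X (Om C X) (Th C X))"

definition Th_inv :: "('o, 'u::universe) sfc \<Rightarrow> 'u topology \<Rightarrow> 'u" where
  "Th_inv C X = inv_arr SetC (fo (underlying C) (Om C X)) (Hom Top X Sierp) (Th C X)"

definition lift_of :: "('o, 'u::universe, 'x) pfc_scheme \<Rightarrow> 'o \<Rightarrow> 'o \<Rightarrow> 'u \<Rightarrow> 'u" where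
  "lift_of C c d h = (THE p. p \<in> Hom (Cat C) c d \<and> fa (underlying C) c d p = h)"

text \<open>The adjunction \<open>pt\<^sub>C \<stileturn> \<Omega>\<^sub>C\<close> with its evaluation unit and counit. An arrow from \<open>X\<close>
  to \<open>Y\<close> in \<open>TopC\<^sup>o\<^sup>p\<close> is a continuous map from \<open>Y\<close> to \<open>X\<close>.\<close>

definition Dual :: "('o, 'u::universe) sfc \<Rightarrow> ('o, 'u, 'u topology, 'u) adjn" where
  "Dual C = \<lparr>
     LC = Cat C,
     RC = op_cat (TopC C),
     LF = \<lparr>fo = ptC C,
           fa = (\<lambda>c d p. lam (Hom (Cat C) d (Two C)) (\<lambda>f. Cmp (Cat C) f p))\<rparr>,
     RF = \<lparr>fo = Om C,
           fa = (\<lambda>X Y g. lift_of C (Om C X) (Om C Y)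
                  (vcomp (Th_inv C Y) (vcomp (lam (Hom Top X Sierp) (\<lambda>u. vcomp u g)) (Th C X))))\<rparr>,
     unit = (\<lambda>c. lift_of C c (Om C (ptC C c))
              (vcomp (Th_inv C (ptC C c))
                (lam (carrier (fo (OF C) c)) (\<lambda>a. lam (Hom (Cat C) c (Two C))
                   (\<lambda>f. app (iota C) (app (fa (OF C) c (Two C) f) a)))))),
     counit = (\<lambda>X. lam (topspace X) (\<lambda>x. lift_of C (Om C X) (Two C)
                (vcomp (iota_inv C) (vcomp (chi X x) (Th C X)))))\<rparr>"

record ('o, 'p, 'u) sfc_mor =
  HF :: "('o, 'u, 'p, 'u) func"
  alpha :: "'o \<Rightarrow> 'u"
  ii :: 'u

definition is_sfc_mor ::
  "('o, 'u::universe) sfc \<Rightarrow> ('p, 'u) sfc \<Rightarrow> ('o, 'p, 'u) sfc_mor \<Rightarrow> bool" where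
  "is_sfc_mor C D M \<longleftrightarrow>
     is_functor (Cat C) (Cat D) (HF M) \<and>
     is_nat_iso (Cat C) Frm (func_comp (OF D) (HF M)) (OF C) (alpha M) \<and>
     is_iso (Cat D) (fo (HF M) (Two C)) (Two D) (ii M) \<and>
     vcomp (iota D) (fa (OF D) (fo (HF M) (Two C)) (Two D) (ii M)) =
       vcomp (iota C) (alpha M (Two C)) \<and>
     (let \<alpha>inv = inv_arr Frm (fo (OF D) (fo (HF M) (Two C))) (fo (OF C) (Two C)) (alpha M (Two C))
      in \<forall>X\<in>Ob (TopC C). is_cartesian_lift (Cat D) SetC (underlying D)
           (Hom Top X Sierp) (fo (HF M) (Two C))
           {vcomp \<alpha>inv (vcomp (iota_inv C) (chi X x)) | x. x \<in> topspace X}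
           (fo (HF M) (Om C X)) (vcomp (Th C X) (alpha M (Om C X))))"

definition Dual_map ::
  "('o, 'u::universe) sfc \<Rightarrow> ('p, 'u) sfc \<Rightarrow> ('o, 'p, 'u) sfc_mor \<Rightarrow>
   ('o, 'u, 'u topology, 'u, 'p, 'u, 'u topology, 'u) adjn_mor" where
  "Dual_map C D M = \<lparr>
     UF = HF M,
     VF = incl,
     zeta = (\<lambda>X. lift_of D (fo (HF M) (Om C X)) (Om D X)
              (vcomp (Th_inv D X) (vcomp (Th C X) (alpha M (Om C X))))),
     xi = (\<lambda>c. lam (Hom (Cat C) c (Two C))
              (\<lambda>f. Cmp (Cat D) (ii M) (fa (HF M) c (Two C) f)))\<rparr>"


section \<open>MT-algebras\<close>

definition is_complement :: "'a gorder \<Rightarrow> 'a \<Rightarrow> 'a \<Rightarrow> bool" where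
  "is_complement M a b \<longleftrightarrow> b \<in> carrier M \<and> a \<sqinter>\<^bsub>M\<^esub> b = \<bottom>\<^bsub>M\<^esub> \<and> a \<squnion>\<^bsub>M\<^esub> b = \<top>\<^bsub>M\<^esub>"

definition compl :: "'a gorder \<Rightarrow> 'a \<Rightarrow> 'a" where
  "compl M a = (THE b. is_complement M a b)"

definition is_cba :: "'a gorder \<Rightarrow> bool" where
  "is_cba M \<longleftrightarrow> complete_lattice M \<and>
     (\<forall>a\<in>carrier M. \<forall>b\<in>carrier M. \<forall>c\<in>carrier M.
        a \<sqinter>\<^bsub>M\<^esub> (b \<squnion>\<^bsub>M\<^esub> c) = (a \<sqinter>\<^bsub>M\<^esub> b) \<squnion>\<^bsub>M\<^esub> (a \<sqinter>\<^bsub>M\<^esub> c)) \<and>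
     (\<forall>a\<in>carrier M. \<exists>b. is_complement M a b)"

definition is_cba_hom :: "'a gorder \<Rightarrow> 'b gorder \<Rightarrow> ('a \<Rightarrow> 'b) \<Rightarrow> bool" where
  "is_cba_hom M N f \<longleftrightarrow> f \<in> carrier M \<rightarrow> carrier N \<and>
     (\<forall>S. S \<subseteq> carrier M \<longrightarrow> f (\<Squnion>\<^bsub>M\<^esub> S) = \<Squnion>\<^bsub>N\<^esub> (f ` S) \<and> f (\<Sqinter>\<^bsub>M\<^esub> S) = \<Sqinter>\<^bsub>N\<^esub> (f ` S)) \<and>
     (\<forall>a\<in>carrier M. f (compl M a) = compl N (f a))"

definition is_subframe :: "'a set \<Rightarrow> 'a gorder \<Rightarrow> bool" where
  "is_subframe L M \<longleftrightarrow> L \<subseteq> carrier M \<and> \<top>\<^bsub>M\<^esub> \<in> L \<and>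
     (\<forall>a\<in>L. \<forall>b\<in>L. a \<sqinter>\<^bsub>M\<^esub> b \<in> L) \<and> (\<forall>S. S \<subseteq> L \<longrightarrow> \<Squnion>\<^bsub>M\<^esub> S \<in> L)"

text \<open>MT-algebras are \<open>T\<^sub>0\<close> by convention. A pair \<open>(L, M)\<close> consists of the set of open elements
  and the ambient complete Boolean algebra.\<close>

type_synonym 'u mt = "'u set \<times> 'u gorder"

definition is_mt :: "'a mt \<Rightarrow> bool" where
  "is_mt A \<longleftrightarrow> (case A of (L, M) \<Rightarrow> is_cba M \<and> is_subframe L M \<and>
     (\<forall>m\<in>carrier M. \<exists>S. S \<subseteq> {(\<Sqinter>\<^bsub>M\<^esub> B) \<sqinter>\<^bsub>M\<^esub> compl M a | B a. B \<subseteq> L \<and> a \<in> L} \<and> m = \<Squnion>\<^bsub>M\<^esub> S))"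

definition MT :: "('u::universe mt, 'u) cat" where
  "MT = \<lparr>Ob = {A. small (carrier (snd A)) \<and> is_mt A},
         Hom = (\<lambda>A B. {f \<in> maps (carrier (snd A)) (carrier (snd B)).
                  is_cba_hom (snd A) (snd B) (app f) \<and> app f ` fst A \<subseteq> fst B}),
         Idt = (\<lambda>A. vid (carrier (snd A))), Cmp = vcomp\<rparr>"

definition OM :: "('u::universe mt, 'u, 'u gorder, 'u) func" where
  "OM = \<lparr>fo = (\<lambda>A. (snd A)\<lparr>carrier := fst A\<rparr>), fa = (\<lambda>A B f. lam (fst A) (app f))\<rparr>"

definition twoM :: "'u::universe mt" where
  "twoM = (carrier two, two)"

definition fiber_terminal :: "'u::universe mt \<Rightarrow> bool" where
  "fiber_terminal C \<longleftrightarrow> (\<forall>D\<in>Ob MT. \<forall>\<theta>. is_iso Frm (fo OM D) (fo OM C) \<theta> \<longrightarrow>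
     (\<exists>p\<in>Hom MT D C. fa OM D C p = \<theta>))"

definition MTT :: "('u::universe mt, 'u) cat" where
  "MTT = full_subcat MT fiber_terminal"

definition powerset_mt :: "'u::universe topology \<Rightarrow> 'u mt" where
  "powerset_mt X = (carrier (opens X), set_order (Pow (topspace X)))"

text \<open>The bijection from \<open>\<Omega> X\<close> to \<open>Top(X, \<S>)\<close> sending an open set to its characteristic map.\<close>

definition char_map :: "'u::universe topology \<Rightarrow> 'u" where
  "char_map X = lam (carrier (opens X))
     (\<lambda>u. lam (topspace X) (\<lambda>x. if x \<in> elts u then v1 else v0))"

definition MT_sfc :: "('u::universe mt, 'u) sfc" where
  "MT_sfc = \<lparr>Cat = MT, OF = OM, Two = twoM, iota = vid (carrier two),
             Om = powerset_mt, Th = char_map\<rparr>"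

definition MTT_sfc :: "('u::universe mt, 'u) sfc" where
  "MTT_sfc = MT_sfc\<lparr>Cat := MTT\<rparr>"

definition IT :: "('u::universe mt, 'u mt, 'u) sfc_mor" where
  "IT = \<lparr>HF = incl, alpha = (\<lambda>C. Idt Frm (fo OM C)), ii = Idt MT twoM\<rparr>"


section \<open>The categories of frames\<close>

definition FrmT :: "('u::universe gorder, 'u) cat" where
  "FrmT = \<lparr>Ob = {L \<in> Ob Frm. \<exists>C\<in>Ob MTT. \<exists>\<theta>. is_iso Frm (fo OM C) L \<theta>},
           Hom = (\<lambda>L L'. {f \<in> Hom Frm L L'. \<exists>C\<in>Ob MTT. \<exists>C'\<in>Ob MTT. \<exists>p\<in>Hom MTT C C'. \<exists>\<theta> \<theta>'.
                    is_iso Frm (fo OM C) L \<theta> \<and> is_iso Frm (fo OM C') L' \<theta>' \<and>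
                    vcomp f \<theta> = vcomp \<theta>' (fa OM C C' p)}),
           Idt = Idt Frm, Cmp = Cmp Frm\<rparr>"

definition heyting_imp :: "'a gorder \<Rightarrow> 'a \<Rightarrow> 'a \<Rightarrow> 'a" where
  "heyting_imp L a b = \<Squnion>\<^bsub>L\<^esub> {c \<in> carrier L. a \<sqinter>\<^bsub>L\<^esub> c \<sqsubseteq>\<^bsub>L\<^esub> b}"

definition is_sublocale :: "'a gorder \<Rightarrow> 'a set \<Rightarrow> bool" where
  "is_sublocale L S \<longleftrightarrow> S \<subseteq> carrier L \<and> (\<forall>B. B \<subseteq> S \<longrightarrow> \<Sqinter>\<^bsub>L\<^esub> B \<in> S) \<and>
     (\<forall>a\<in>carrier L. \<forall>s\<in>S. heyting_imp L a s \<in> S)"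

definition sublocales :: "'a gorder \<Rightarrow> 'a set gorder" where
  "sublocales L = \<lparr>carrier = {S. is_sublocale L S}, eq = (=), le = (\<subseteq>)\<rparr>"

definition open_sublocale :: "'a gorder \<Rightarrow> 'a \<Rightarrow> 'a set" where
  "open_sublocale L a = {heyting_imp L a x | x. x \<in> carrier L}"

definition closed_sublocale :: "'a gorder \<Rightarrow> 'a \<Rightarrow> 'a set" where
  "closed_sublocale L a = {x \<in> carrier L. a \<sqsubseteq>\<^bsub>L\<^esub> x}"

definition Funayama :: "'a gorder \<Rightarrow> 'a set gorder" where
  "Funayama L = (sublocales L)\<lparr>carrier :=
     {\<Squnion>\<^bsub>sublocales L\<^esub> \<F> | \<F>.
        \<F> \<subseteq> {closed_sublocale L a \<inter> open_sublocale L b | a b. a \<in> carrier L \<and> b \<in> carrier L}}\<rparr>"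

definition locally_exact :: "'a gorder \<Rightarrow> 'b gorder \<Rightarrow> ('a \<Rightarrow> 'b) \<Rightarrow> bool" where
  "locally_exact L M f \<longleftrightarrow> is_frame_hom L M f \<and>
     (\<exists>g. is_cba_hom (Funayama L) (Funayama M) g \<and>
        (\<forall>a\<in>carrier L. g (open_sublocale L a) = open_sublocale M (f a)))"

definition FrmLE :: "('u::universe gorder, 'u) cat" where
  "FrmLE = Frm\<lparr>Hom := (\<lambda>L M. {f \<in> Hom Frm L M. locally_exact L M (app f)})\<rparr>"


section \<open>The concrete adjunctions\<close>

text \<open>
  \<open>pt_adj K t opn und R T\<close> is the adjunction between \<open>K\<close> and the opposite of the category \<open>T\<close>
  of spaces, where \<open>pt c = K(c, t)\<close> has the opens \<open>{f. f a = 1}\<close> for \<open>a \<in> opn c\<close>, and where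
  \<open>R\<close> sends continuous maps to preimage maps; \<open>und c\<close> is the set on which arrows out of \<open>c\<close> are
  defined. Its unit is \<open>m \<mapsto> {f. f m = 1}\<close>, and its counit is, as a continuous map,
  \<open>x \<mapsto> (A \<mapsto> [x \<in> A])\<close>.
\<close>

definition pt_space :: "'u::universe set \<Rightarrow> 'u set \<Rightarrow> 'u topology" where
  "pt_space H L = topology (\<lambda>U. \<exists>a\<in>L. U = {f \<in> H. app f a = v1})"

definition pt_adj ::
  "('o, 'u::universe) cat \<Rightarrow> 'o \<Rightarrow> ('o \<Rightarrow> 'u set) \<Rightarrow> ('o \<Rightarrow> 'u set) \<Rightarrow>
   ('u topology \<Rightarrow> 'o) \<Rightarrow> ('u topology, 'u) cat \<Rightarrow> ('o, 'u, 'u topology, 'u) adjn" where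
  "pt_adj K t opn und R T = \<lparr>
     LC = K,
     RC = op_cat T,
     LF = \<lparr>fo = (\<lambda>c. pt_space (Hom K c t) (opn c)),
           fa = (\<lambda>c d p. lam (Hom K d t) (\<lambda>f. vcomp f p))\<rparr>,
     RF = \<lparr>fo = R,
           fa = (\<lambda>X Y g. lam (und (R X)) (\<lambda>A. vset {y \<in> topspace Y. app g y \<in> elts A}))\<rparr>,
     unit = (\<lambda>c. lam (und c) (\<lambda>m. vset {f \<in> Hom K c t. app f m = v1})),
     counit = (\<lambda>X. lam (topspace X) (\<lambda>x. lam (und (R X)) (\<lambda>A. if x \<in> elts A then v1 else v0)))\<rparr>"

definition A1 :: "('u::universe mt, 'u, 'u topology, 'u) adjn" where
  "A1 = pt_adj MT twoM fst (\<lambda>A. carrier (snd A)) powerset_mt Top"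

definition A2 :: "('u::universe mt, 'u, 'u topology, 'u) adjn" where
  "A2 = pt_adj MTT twoM fst (\<lambda>A. carrier (snd A)) powerset_mt TopD"

definition TopT :: "('u::universe topology, 'u) cat" where
  "TopT = TopC MTT_sfc"

definition A3 :: "('u::universe gorder, 'u, 'u topology, 'u) adjn" where
  "A3 = pt_adj FrmT two carrier carrier opens TopT"

definition A4 :: "('u::universe gorder, 'u, 'u topology, 'u) adjn" where
  "A4 = pt_adj FrmLE two carrier carrier opens TopD"

text \<open>The maps from \<open>A2\<close> to \<open>A3\<close> and from \<open>A3\<close> to \<open>A4\<close>: the components of \<open>\<zeta>\<close> are identities,
  and those of \<open>\<xi>\<close> are \<open>f \<mapsto> H f\<close> for the first functor \<open>H\<close>.\<close>

definition map23 ::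
  "('u::universe mt, 'u, 'u topology, 'u, 'u gorder, 'u, 'u topology, 'u) adjn_mor" where
  "map23 = \<lparr>
     UF = func_comp OM incl,
     VF = incl,
     zeta = (\<lambda>X. Idt Frm (opens X)),
     xi = (\<lambda>C. lam (Hom MTT C twoM) (\<lambda>f. fa OM C twoM f))\<rparr>"

definition map34 ::
  "('u::universe gorder, 'u, 'u topology, 'u, 'u gorder, 'u, 'u topology, 'u) adjn_mor" where
  "map34 = \<lparr>
     UF = incl,
     VF = incl,
     zeta = (\<lambda>X. Idt Frm (opens X)),
     xi = (\<lambda>L. lam (Hom FrmT L two) (\<lambda>f. f))\<rparr>"

end

theory Submission imports Defs begin

text \<open>
  All four adjunctions have the same shape. Arrows from \<open>C\<close> to the two-element object are the
  points of \<open>C\<close>, and the right adjoint sends a space \<open>X\<close> to an object \<open>R X\<close> of subsets of \<open>X\<close> such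
  that a map \<open>C \<rightarrow> R X\<close> respecting open elements is an arrow iff, for every \<open>x \<in> X\<close>, its
  composite with ``membership of \<open>x\<close>'' is a point of \<open>C\<close>. The locale \<open>pt_duality\<close> derives the
  adjunction from this universal property, with the evaluations as unit and counit. For \<open>MT\<close> it
  holds because a map into a powerset preserves joins, meets and complements iff it does so at
  each point (\<open>cba_hom_powerset_iff\<close>), and full subcategories inherit it
  (\<open>pt_duality_full_subcategory\<close>).

  The fiber-terminal algebras are controlled by the Funayama algebra \<open>\<F>L\<close> of a frame \<open>L\<close>. It is a
  complete Boolean algebra since the differences \<open>\<up>a \<inter> \<oo>(b)\<close> generate it under joins and behave
  like a base (\<open>cba_from_dense_set\<close>, \<open>difference_disjoint\<close>, \<open>difference_cover\<close>), so that it is an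
  MT-algebra over \<open>L\<close>. A fiber-terminal algebra over \<open>L\<close> therefore receives a map from it, and this
  map is an isomorphism (\<open>fiber_terminal_funayama_iso\<close>). Two things follow. A fiber-terminal algebra
  is generated by differences of open elements, hence its points are locally closed
  (\<open>cba_point_isolated\<close>) and its spectrum is \<open>T\<^sub>D\<close>. And a frame map between frames of open elements of
  fiber-terminal algebras lifts to these algebras iff it is locally exact
  (\<open>locally_exact_iff_lifts\<close>); hence \<open>Frm\<^sub>T\<close> is a full subcategory of \<open>Frm\<^sub>L\<^sub>E\<close>, and the functor
  from \<open>MT\<^sub>T\<close> to \<open>Frm\<^sub>T\<close> is fully faithful and essentially surjective.

  Conversely, the powerset algebra of a \<open>T\<^sub>D\<close>-space \<open>X\<close> is fiber-terminal
  (\<open>powerset_mt_fiber_terminal\<close>): if \<open>{x}\<close> is the intersection of an open \<open>U\<close> and a closed \<open>K\<close>, then in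
  every MT-algebra over the frame of opens of \<open>X\<close> the element \<open>U \<and> \<not>(U - K)\<close> is an atom, which is a
  point inducing the point \<open>x\<close> of the frame. In particular the powerset of \<open>X\<close> is the Funayama
  algebra of its opens, which gives the universal property for locally exact maps
  (\<open>locally_exact_opens_iff\<close>). Moreover \<open>Top\<^sub>T = Top\<^sub>D\<close>: for a \<open>T\<^sub>D\<close>-space the powerset algebra gives
  the cartesian lift, and a space with a cartesian lift to some fiber-terminal \<open>C\<close> is embedded in
  the spectrum of \<open>C\<close>, which is \<open>T\<^sub>D\<close> (\<open>MTT_space_lift_td\<close>).

  Finally, each of the three functors is bijective on points and leaves the open elements
  unchanged, so that it induces homeomorphisms of spectra; this makes the adjunction
  morphisms strong (\<open>pt_duality_morphism\<close>).
\<close>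

section \<open>Small sets and coded functions\<close>

lemma small_elts [simp]: "small (elts x)"
  by (simp add: small_def)

lemma small_subset: "small B \<Longrightarrow> A \<subseteq> B \<Longrightarrow> small A"
  unfolding small_def using elts_subset by (metis rangeE rangeI)

lemma elts_vset [simp]: "small A \<Longrightarrow> elts (vset A) = A"
proof -
  assume "small A"
  then obtain v where v: "elts v = A"
    by (auto simp: small_def)
  then have "(THE v. elts v = A) = v"
    by (blast intro: elts_ext)
  with v show ?thesis
    by (simp add: vset_def)
qed

lemma vset_elts [simp]: "vset (elts x) = x"
  by (rule elts_ext) simp

lemma vset_eq_iff: "small A \<Longrightarrow> small B \<Longrightarrow> vset A = vset B \<longleftrightarrow> A = B"
  by (metis elts_vset)

lemma small_empty [simp]: "small {}"
  using small_subset[OF small_elts] by blast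

lemma small_image [simp]:
  fixes f :: "'u::universe \<Rightarrow> 'u"
  assumes "small A"
  shows "small (f ` A)"
proof -
  obtain x where "A = elts x"
    using assms by (auto simp: small_def)
  moreover obtain y where "elts y = f ` elts x"
    using elts_replacement[of f x] by blast
  ultimately show ?thesis
    by (metis small_elts)
qed

lemma small_UN_elts:
  fixes A :: "'u::universe set"
  assumes "small A"
  shows "small (\<Union>z\<in>A. elts z)"
proof -
  obtain x where "A = elts x"
    using assms by (auto simp: small_def)
  moreover obtain y where "elts y = (\<Union>z\<in>elts x. elts z)"
    using elts_union[of x] by blast
  ultimately show ?thesis
    by (metis small_elts)
qed

lemma small_powerset_codes:
  fixes A :: "'u::universe set"
  assumes "small A"
  shows "small (vset ` Pow A)"
proof -
  obtain x where x: "A = elts x"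
    using assms by (auto simp: small_def)
  obtain y where y: "elts y = {z. elts z \<subseteq> elts x}"
    using elts_power by blast
  have "elts (vset B) = B" if "B \<subseteq> A" for B
    using that assms small_subset elts_vset by blast
  then have "vset ` Pow A \<subseteq> elts y"
    by (auto simp: y x[symmetric])
  then show ?thesis
    using small_subset small_elts by blast
qed

lemma elts_v0 [simp]: "elts v0 = {}"
  by (simp add: v0_def)

lemma small_v0 [simp]: "small {v0}"
proof -
  obtain y :: 'a where y: "elts y = {z. elts z \<subseteq> elts v0}"
    using elts_power by blast
  have "{v0} \<subseteq> elts y"
    by (simp add: y)
  then show ?thesis
    using small_subset small_elts by blast
qed

lemma elts_v1 [simp]: "elts v1 = {v0}"
  by (simp add: v1_def)

lemma v0_neq_v1 [simp]: "v0 \<noteq> v1" "v1 \<noteq> v0"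
  using elts_v0 elts_v1 by (metis insert_not_empty)+

lemma small_v0_v1 [simp]: "small {v0, v1}"
proof -
  obtain y :: 'a where y: "elts y = {z. elts z \<subseteq> elts v1}"
    using elts_power by blast
  have "{v0, v1} \<subseteq> elts y"
    by (simp add: y)
  then show ?thesis
    using small_subset small_elts by blast
qed

lemma small_pair [simp]: "small {x, y}"
proof -
  have "{x, y} = (\<lambda>z. if z = v0 then x else y) ` {v0, v1}"
    by auto
  then show ?thesis
    using small_image small_v0_v1 by metis
qed

lemma small_singleton [simp]: "small {x}"
  using small_pair[of x x] by simp

lemma vpair_inject [simp]: "vpair x y = vpair x' y' \<longleftrightarrow> x = x' \<and> y = y'"
proof
  assume "vpair x y = vpair x' y'"
  then have "{vset {x}, vset {x, y}} = {vset {x'}, vset {x', y'}}"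
    unfolding vpair_def by (metis elts_vset small_pair)
  moreover have "vset {x} = vset {x'} \<longleftrightarrow> x = x'" "vset {x} = vset {x', y'} \<longleftrightarrow> x = x' \<and> x = y'"
    "vset {x, y} = vset {x'} \<longleftrightarrow> x = x' \<and> y = x'"
    "vset {x, y} = vset {x', y'} \<longleftrightarrow> {x, y} = {x', y'}"
    by (auto simp: vset_eq_iff)
  ultimately show "x = x' \<and> y = y'"
    by (auto simp: doubleton_eq_iff)
qed simp

lemma elts_lam: "small A \<Longrightarrow> elts (lam A f) = (\<lambda>x. vpair x (f x)) ` A"
  unfolding lam_def by simp

lemma app_lam [simp]: "small A \<Longrightarrow> x \<in> A \<Longrightarrow> app (lam A f) x = f x"
  by (auto simp: app_def elts_lam)

lemma vdom_lam [simp]: "small A \<Longrightarrow> vdom (lam A f) = A"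
  by (simp add: vdom_def elts_lam image_iff)

lemma lam_cong: "(\<And>x. x \<in> A \<Longrightarrow> f x = g x) \<Longrightarrow> lam A f = lam A g"
  unfolding lam_def by (rule arg_cong[where f = vset]) (auto intro: image_cong)

lemma lam_eqD: "lam A f = lam A g \<Longrightarrow> small A \<Longrightarrow> x \<in> A \<Longrightarrow> f x = g x"
  using app_lam[of A x f] app_lam[of A x g] by simp

lemma maps_I: "f \<in> A \<rightarrow> B \<Longrightarrow> lam A f \<in> maps A B"
  by (auto simp: maps_def)

lemma lam_app: "small A \<Longrightarrow> f \<in> maps A B \<Longrightarrow> lam A (app f) = f"
  unfolding maps_def by (auto intro: lam_cong)

lemma app_maps: "f \<in> maps A B \<Longrightarrow> small A \<Longrightarrow> x \<in> A \<Longrightarrow> app f x \<in> B"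
  unfolding maps_def by auto

lemma maps_ext:
  assumes "small A" "f \<in> maps A B" "g \<in> maps A C" "\<And>x. x \<in> A \<Longrightarrow> app f x = app g x"
  shows "f = g"
proof -
  have "f = lam A (app f)" "g = lam A (app g)"
    using lam_app[OF assms(1,2)] lam_app[OF assms(1,3)] by simp_all
  moreover have "lam A (app f) = lam A (app g)"
    using assms(4) by (rule lam_cong)
  ultimately show ?thesis by simp
qed

lemma vdom_maps: "small A \<Longrightarrow> f \<in> maps A B \<Longrightarrow> vdom f = A"
  unfolding maps_def by auto

lemma vcomp_eq_lam: "small A \<Longrightarrow> f \<in> maps A B \<Longrightarrow> vcomp g f = lam A (\<lambda>x. app g (app f x))"
  by (simp add: vcomp_def vdom_maps)

lemma vcomp_lam [simp]: "small A \<Longrightarrow> vcomp g (lam A f) = lam A (\<lambda>x. app g (f x))"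
  by (auto simp: vcomp_def intro!: lam_cong)

lemma app_vcomp:
  "small A \<Longrightarrow> f \<in> maps A B \<Longrightarrow> x \<in> A \<Longrightarrow> app (vcomp g f) x = app g (app f x)"
  by (simp add: vcomp_eq_lam)

lemma vcomp_maps:
  "small A \<Longrightarrow> small B \<Longrightarrow> f \<in> maps A B \<Longrightarrow> g \<in> maps B C \<Longrightarrow> vcomp g f \<in> maps A C"
  by (auto simp: vcomp_eq_lam intro!: maps_I dest: app_maps)

lemma vcomp_assoc:
  assumes "small A" "small B" "f \<in> maps A B" "g \<in> maps B C"
  shows "vcomp h (vcomp g f) = vcomp (vcomp h g) f"
proof -
  have "vcomp h (vcomp g f) = lam A (\<lambda>x. app h (app g (app f x)))"
    using assms by (auto simp: vcomp_eq_lam)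
  also have "\<dots> = vcomp (vcomp h g) f"
    using assms app_maps[OF assms(3,1)]
    by (auto simp: vcomp_eq_lam[of A f B] app_vcomp[of B g C] intro!: lam_cong)
  finally show ?thesis .
qed

lemma app_vid [simp]: "small A \<Longrightarrow> x \<in> A \<Longrightarrow> app (vid A) x = x"
  by (simp add: vid_def)

lemma vid_maps: "vid A \<in> maps A A"
  unfolding vid_def by (rule maps_I) simp

lemma vcomp_vid_right: "small A \<Longrightarrow> f \<in> maps A B \<Longrightarrow> vcomp f (vid A) = f"
  by (simp add: vid_def lam_app)

lemma vcomp_vid_left: "small A \<Longrightarrow> small B \<Longrightarrow> f \<in> maps A B \<Longrightarrow> vcomp (vid B) f = f"
proof -
  assume a: "small A" "small B" "f \<in> maps A B"
  then have "vcomp (vid B) f = lam A (app f)"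
    using app_maps[of f A B] by (auto simp: vcomp_eq_lam intro!: lam_cong)
  with a show ?thesis by (simp add: lam_app)
qed

lemma small_maps:
  fixes A B :: "'u::universe set"
  assumes "small A" "small B"
  shows "small (maps A B)"
proof -
  define T where "T = (\<Union>z\<in>(\<lambda>a. vset (vpair a ` B)) ` A. elts z)"
  have T: "small T"
    unfolding T_def by (rule small_UN_elts) (simp add: assms)
  have "maps A B \<subseteq> vset ` Pow T"
  proof
    fix f assume "f \<in> maps A B"
    then obtain h where h: "f = lam A h" "h \<in> A \<rightarrow> B"
      by (auto simp: maps_def)
    have "(\<lambda>x. vpair x (h x)) ` A \<subseteq> T"
      using h(2) assms by (force simp: T_def)
    then show "f \<in> vset ` Pow T"
      unfolding h(1) lam_def by blast
  qed
  then show ?thesis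
    using small_powerset_codes[OF T] small_subset by blast
qed

section \<open>Complete lattices and complete Boolean algebras\<close>

lemma sup_eqI:
  assumes L: "partial_order L" and S: "S \<subseteq> carrier L" and s: "s \<in> carrier L"
    and le: "\<And>y. y \<in> carrier L \<Longrightarrow> s \<sqsubseteq>\<^bsub>L\<^esub> y \<longleftrightarrow> (\<forall>x\<in>S. x \<sqsubseteq>\<^bsub>L\<^esub> y)"
  shows "\<Squnion>\<^bsub>L\<^esub> S = s"
proof -
  interpret partial_order L by (rule L)
  have "\<forall>x\<in>S. x \<sqsubseteq>\<^bsub>L\<^esub> s"
    using le[OF s] s by simp
  then have lub: "least L s (Upper L S)"
    using S s le by (auto simp: least_def Upper_def)
  then show ?thesis
    unfolding sup_def using least_unique by blast
qed

lemma inf_eqI: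
  assumes L: "partial_order L" and S: "S \<subseteq> carrier L" and s: "s \<in> carrier L"
    and le: "\<And>y. y \<in> carrier L \<Longrightarrow> y \<sqsubseteq>\<^bsub>L\<^esub> s \<longleftrightarrow> (\<forall>x\<in>S. y \<sqsubseteq>\<^bsub>L\<^esub> x)"
  shows "\<Sqinter>\<^bsub>L\<^esub> S = s"
proof -
  interpret partial_order L by (rule L)
  have "\<forall>x\<in>S. s \<sqsubseteq>\<^bsub>L\<^esub> x"
    using le[OF s] s by simp
  then have glb: "greatest L s (Lower L S)"
    using S s le by (auto simp: greatest_def Lower_def)
  then show ?thesis
    unfolding inf_def using greatest_unique by blast
qed

lemma complete_lattice_from_sups:
  assumes eq: "eq L = (=)"
    and refl: "\<And>x. x \<in> carrier L \<Longrightarrow> x \<sqsubseteq>\<^bsub>L\<^esub> x"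
    and antisym: "\<And>x y. x \<in> carrier L \<Longrightarrow> y \<in> carrier L \<Longrightarrow> x \<sqsubseteq>\<^bsub>L\<^esub> y \<Longrightarrow> y \<sqsubseteq>\<^bsub>L\<^esub> x \<Longrightarrow> x = y"
    and trans: "\<And>x y z. x \<in> carrier L \<Longrightarrow> y \<in> carrier L \<Longrightarrow> z \<in> carrier L \<Longrightarrow>
      x \<sqsubseteq>\<^bsub>L\<^esub> y \<Longrightarrow> y \<sqsubseteq>\<^bsub>L\<^esub> z \<Longrightarrow> x \<sqsubseteq>\<^bsub>L\<^esub> z"
    and sups: "\<And>S. S \<subseteq> carrier L \<Longrightarrow>
      \<exists>s\<in>carrier L. \<forall>y\<in>carrier L. s \<sqsubseteq>\<^bsub>L\<^esub> y \<longleftrightarrow> (\<forall>x\<in>S. x \<sqsubseteq>\<^bsub>L\<^esub> y)"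
  shows "complete_lattice L"
proof -
  interpret partial_order L
    by unfold_locales (use eq refl antisym in \<open>auto intro: trans\<close>)
  show ?thesis
  proof (rule complete_latticeI)
    fix A assume A: "A \<subseteq> carrier L"
    obtain t where t: "t \<in> carrier L" "\<forall>y\<in>carrier L. t \<sqsubseteq>\<^bsub>L\<^esub> y \<longleftrightarrow> (\<forall>x\<in>A. x \<sqsubseteq>\<^bsub>L\<^esub> y)"
      using sups[OF A] by blast
    then have "\<forall>x\<in>A. x \<sqsubseteq>\<^bsub>L\<^esub> t"
      using refl by blast
    then have "least L t (Upper L A)"
      using A t by (auto simp: least_def Upper_def)
    then show "\<exists>s. least L s (Upper L A)" ..
    let ?B = "{y \<in> carrier L. \<forall>x\<in>A. y \<sqsubseteq>\<^bsub>L\<^esub> x}"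
    obtain s where s: "s \<in> carrier L" "\<forall>y\<in>carrier L. s \<sqsubseteq>\<^bsub>L\<^esub> y \<longleftrightarrow> (\<forall>x\<in>?B. x \<sqsubseteq>\<^bsub>L\<^esub> y)"
      using sups[of ?B] by auto
    have "\<forall>x\<in>?B. x \<sqsubseteq>\<^bsub>L\<^esub> s"
      using s refl by blast
    moreover have "s \<sqsubseteq>\<^bsub>L\<^esub> x" if "x \<in> A" for x
    proof -
      have "x \<in> carrier L" "\<forall>z\<in>?B. z \<sqsubseteq>\<^bsub>L\<^esub> x"
        using A that by auto
      then show ?thesis
        using s(2) by simp
    qed
    moreover have "Lower L A = ?B"
      using A by (auto simp: Lower_def)
    ultimately have "greatest L s (Lower L A)"
      using s(1) by (simp add: greatest_def)
    then show "\<exists>i. greatest L i (Lower L A)" ..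
  qed
qed

context complete_lattice
begin

lemma partial_order: "partial_order L" ..

lemma sup_le_iff: "S \<subseteq> carrier L \<Longrightarrow> y \<in> carrier L \<Longrightarrow> \<Squnion>S \<sqsubseteq> y \<longleftrightarrow> (\<forall>x\<in>S. x \<sqsubseteq> y)"
  by (meson le_trans subsetD sup_closed sup_least sup_upper)

lemma le_inf_iff: "S \<subseteq> carrier L \<Longrightarrow> y \<in> carrier L \<Longrightarrow> y \<sqsubseteq> \<Sqinter>S \<longleftrightarrow> (\<forall>x\<in>S. y \<sqsubseteq> x)"
  by (meson le_trans subsetD inf_closed inf_greatest inf_lower)

lemma join_le_iff:
  "x \<in> carrier L \<Longrightarrow> y \<in> carrier L \<Longrightarrow> z \<in> carrier L \<Longrightarrow> x \<squnion> y \<sqsubseteq> z \<longleftrightarrow> x \<sqsubseteq> z \<and> y \<sqsubseteq> z"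
  unfolding join_def using sup_le_iff[of "{x, y}" z] by simp

lemma le_meet_iff:
  "x \<in> carrier L \<Longrightarrow> y \<in> carrier L \<Longrightarrow> z \<in> carrier L \<Longrightarrow> z \<sqsubseteq> x \<sqinter> y \<longleftrightarrow> z \<sqsubseteq> x \<and> z \<sqsubseteq> y"
  unfolding meet_def using le_inf_iff[of "{x, y}" z] by simp

lemma le_bottom_iff: "x \<in> carrier L \<Longrightarrow> x \<sqsubseteq> \<bottom> \<longleftrightarrow> x = \<bottom>"
  using bottom_lower[of x] le_antisym[of x "\<bottom>"] by auto

lemma top_le_iff: "x \<in> carrier L \<Longrightarrow> \<top> \<sqsubseteq> x \<longleftrightarrow> x = \<top>"
  using top_higher[of x] le_antisym[of x "\<top>"] by auto

lemma sup_empty_eq: "\<Squnion>{} = \<bottom>"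
  by (rule sup_eqI[OF partial_order]) (auto simp: bottom_lower)

lemma inf_empty_eq: "\<Sqinter>{} = \<top>"
  by (rule inf_eqI[OF partial_order]) (auto simp: top_higher)

lemma eq_by_upper:
  "x \<in> carrier L \<Longrightarrow> y \<in> carrier L \<Longrightarrow> (\<And>z. z \<in> carrier L \<Longrightarrow> x \<sqsubseteq> z \<longleftrightarrow> y \<sqsubseteq> z) \<Longrightarrow> x = y"
  using le_refl le_antisym by blast

lemma eq_by_lower:
  "x \<in> carrier L \<Longrightarrow> y \<in> carrier L \<Longrightarrow> (\<And>z. z \<in> carrier L \<Longrightarrow> z \<sqsubseteq> x \<longleftrightarrow> z \<sqsubseteq> y) \<Longrightarrow> x = y"
  using le_refl le_antisym by blast

lemma meet_eq_left: "x \<in> carrier L \<Longrightarrow> y \<in> carrier L \<Longrightarrow> x \<sqsubseteq> y \<longleftrightarrow> x \<sqinter> y = x"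
  using eq_by_lower[of "x \<sqinter> y" x] le_meet_iff[of x y] le_trans[of _ x y] le_refl[of x] meet_closed[of x y]
  by (metis meet_right)


lemma meet_top [simp]: "x \<in> carrier L \<Longrightarrow> x \<sqinter> \<top> = x" "x \<in> carrier L \<Longrightarrow> \<top> \<sqinter> x = x"
  by (rule eq_by_lower; use le_meet_iff top_higher in auto)+

lemma join_bottom [simp]: "x \<in> carrier L \<Longrightarrow> x \<squnion> \<bottom> = x" "x \<in> carrier L \<Longrightarrow> \<bottom> \<squnion> x = x"
  by (rule eq_by_upper; use join_le_iff bottom_lower in auto)+

lemma join_commute: "x \<squnion> y = y \<squnion> x"
  by (simp add: join_def insert_commute)

lemma meet_commute: "x \<sqinter> y = y \<sqinter> x"
  by (simp add: meet_def insert_commute)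

end

locale complete_boolean_algebra =
  fixes M :: "'a gorder" (structure)
  assumes cba: "is_cba M"

sublocale complete_boolean_algebra \<subseteq> complete_lattice M
  using cba by (simp add: is_cba_def)

context complete_boolean_algebra
begin

lemma distrib:
  "a \<in> carrier M \<Longrightarrow> b \<in> carrier M \<Longrightarrow> c \<in> carrier M \<Longrightarrow> a \<sqinter> (b \<squnion> c) = (a \<sqinter> b) \<squnion> (a \<sqinter> c)"
  using cba by (simp add: is_cba_def)

lemma complement_unique:
  assumes a: "a \<in> carrier M" and b: "is_complement M a b" and c: "is_complement M a c"
  shows "b = c"
proof -
  have le: "x \<sqsubseteq> y" if "is_complement M a x" "is_complement M a y" for x y
  proof -
    have x: "x \<in> carrier M" "a \<sqinter> x = \<bottom>" and y: "y \<in> carrier M" "a \<squnion> y = \<top>"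
      using that by (auto simp: is_complement_def)
    have "x = x \<sqinter> (a \<squnion> y)"
      using x y by simp
    also have "\<dots> = (x \<sqinter> a) \<squnion> (x \<sqinter> y)"
      using a x y by (intro distrib)
    also have "\<dots> = x \<sqinter> y"
      using x y by (simp add: meet_commute[of x a])
    finally show ?thesis
      using x y meet_eq_left by simp
  qed
  show ?thesis
    using le[OF b c] le[OF c b] b c by (auto simp: is_complement_def)
qed

lemma is_complement_compl: "a \<in> carrier M \<Longrightarrow> is_complement M a (compl M a)"
  unfolding compl_def using complement_unique[of a] cba unfolding is_cba_def by (blast intro: theI)

lemma compl_eqI: "a \<in> carrier M \<Longrightarrow> is_complement M a b \<Longrightarrow> compl M a = b"
  using complement_unique is_complement_compl by blast

lemma compl_closed [simp]: "a \<in> carrier M \<Longrightarrow> compl M a \<in> carrier M"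
  using is_complement_compl by (simp add: is_complement_def)

lemma meet_compl [simp]: "a \<in> carrier M \<Longrightarrow> a \<sqinter> compl M a = \<bottom>"
  "a \<in> carrier M \<Longrightarrow> compl M a \<sqinter> a = \<bottom>"
  using is_complement_compl[of a] by (simp_all add: is_complement_def meet_commute)

lemma join_compl [simp]: "a \<in> carrier M \<Longrightarrow> a \<squnion> compl M a = \<top>"
  "a \<in> carrier M \<Longrightarrow> compl M a \<squnion> a = \<top>"
  using is_complement_compl[of a] by (simp_all add: is_complement_def join_commute)

lemma compl_compl [simp]: "a \<in> carrier M \<Longrightarrow> compl M (compl M a) = a"
  by (rule compl_eqI) (auto simp: is_complement_def)

lemma meet_le_iff:
  assumes "a \<in> carrier M" "b \<in> carrier M" "c \<in> carrier M"
  shows "b \<sqinter> a \<sqsubseteq> c \<longleftrightarrow> b \<sqsubseteq> compl M a \<squnion> c"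
proof
  assume le: "b \<sqinter> a \<sqsubseteq> c"
  have "b = b \<sqinter> (compl M a \<squnion> a)"
    using assms by simp
  also have "\<dots> = (b \<sqinter> compl M a) \<squnion> (b \<sqinter> a)"
    using assms by (intro distrib) simp_all
  also have "\<dots> \<sqsubseteq> compl M a \<squnion> c"
  proof -
    have "b \<sqinter> compl M a \<sqsubseteq> compl M a \<squnion> c"
      using assms by (intro le_trans[OF meet_right join_left]) simp_all
    moreover have "b \<sqinter> a \<sqsubseteq> compl M a \<squnion> c"
      using assms by (intro le_trans[OF le join_right]) simp_all
    ultimately show ?thesis
      using assms by (simp add: join_le_iff)
  qed
  finally show "b \<sqsubseteq> compl M a \<squnion> c" .
next
  assume le: "b \<sqsubseteq> compl M a \<squnion> c"
  have "b \<sqinter> a \<sqsubseteq> a \<sqinter> (compl M a \<squnion> c)"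
    using assms by (simp add: le_meet_iff meet_right le_trans[OF meet_left le])
  also have "\<dots> = a \<sqinter> c"
    using assms by (simp add: distrib)
  also have "\<dots> \<sqsubseteq> c"
    using assms meet_right by blast
  finally show "b \<sqinter> a \<sqsubseteq> c"
    using assms by simp
qed

lemma le_compl_iff:
  "a \<in> carrier M \<Longrightarrow> b \<in> carrier M \<Longrightarrow> b \<sqsubseteq> compl M a \<longleftrightarrow> b \<sqinter> a = \<bottom>"
  using meet_le_iff[of a b "\<bottom>"] le_bottom_iff by simp

lemma le_iff_meet_compl:
  "a \<in> carrier M \<Longrightarrow> b \<in> carrier M \<Longrightarrow> b \<sqsubseteq> a \<longleftrightarrow> b \<sqinter> compl M a = \<bottom>"
  using le_compl_iff[of "compl M a" b] by simp

lemma compl_antimono: "a \<in> carrier M \<Longrightarrow> b \<in> carrier M \<Longrightarrow> a \<sqsubseteq> compl M b \<longleftrightarrow> b \<sqsubseteq> compl M a"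
  using le_compl_iff[of a b] le_compl_iff[of b a] by (simp add: meet_commute)

lemma compl_le_iff: "a \<in> carrier M \<Longrightarrow> b \<in> carrier M \<Longrightarrow> compl M a \<sqsubseteq> b \<longleftrightarrow> compl M b \<sqsubseteq> a"
  using compl_antimono[of "compl M a" "compl M b"] by simp

lemma meet_sup_distrib:
  assumes a: "a \<in> carrier M" and S: "S \<subseteq> carrier M"
  shows "a \<sqinter> \<Squnion>S = \<Squnion>((\<lambda>s. a \<sqinter> s) ` S)"
proof (rule sup_eqI[OF partial_order, symmetric])
  have le: "a \<sqinter> s \<sqsubseteq> y \<longleftrightarrow> s \<sqsubseteq> compl M a \<squnion> y" if "s \<in> carrier M" "y \<in> carrier M" for s y
    using that a meet_le_iff[of a s y] by (simp add: meet_commute)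
  show "a \<sqinter> \<Squnion>S \<sqsubseteq> y \<longleftrightarrow> (\<forall>x\<in>(\<lambda>s. a \<sqinter> s) ` S. x \<sqsubseteq> y)" if "y \<in> carrier M" for y
    using a S that le sup_le_iff[of S "compl M a \<squnion> y"] by (auto simp: subset_iff)
qed (use a S in auto)

lemma compl_sup:
  assumes S: "S \<subseteq> carrier M"
  shows "compl M (\<Squnion>S) = \<Sqinter>(compl M ` S)"
proof (rule inf_eqI[OF partial_order, symmetric])
  show "y \<sqsubseteq> compl M (\<Squnion>S) \<longleftrightarrow> (\<forall>x\<in>compl M ` S. y \<sqsubseteq> x)" if "y \<in> carrier M" for y
    using S that compl_antimono[of y] sup_le_iff[of S "compl M y"] by (auto simp: subset_iff)
qed (use S in auto)

lemma compl_inf: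
  assumes S: "S \<subseteq> carrier M"
  shows "compl M (\<Sqinter>S) = \<Squnion>(compl M ` S)"
proof (rule sup_eqI[OF partial_order, symmetric])
  show "compl M (\<Sqinter>S) \<sqsubseteq> y \<longleftrightarrow> (\<forall>x\<in>compl M ` S. x \<sqsubseteq> y)" if "y \<in> carrier M" for y
    using S that compl_le_iff[of _ y] le_inf_iff[of S "compl M y"] by (auto simp: subset_iff)
qed (use S in auto)

lemma inf_eq_compl_sup: "S \<subseteq> carrier M \<Longrightarrow> \<Sqinter>S = compl M (\<Squnion>(compl M ` S))"
  using compl_inf[of S] compl_compl[of "\<Sqinter>S"] by simp

lemma is_frame: "is_frame M"
  unfolding is_frame_def using meet_sup_distrib complete_lattice_axioms by blast

end

lemma is_cba_homI:
  assumes M: "is_cba M" and N: "is_cba N" and f: "f \<in> carrier M \<rightarrow> carrier N"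
    and sup: "\<And>S. S \<subseteq> carrier M \<Longrightarrow> f (\<Squnion>\<^bsub>M\<^esub> S) = \<Squnion>\<^bsub>N\<^esub> (f ` S)"
    and compl: "\<And>a. a \<in> carrier M \<Longrightarrow> f (compl M a) = compl N (f a)"
  shows "is_cba_hom M N f"
proof -
  interpret M: complete_boolean_algebra M by unfold_locales (rule M)
  interpret N: complete_boolean_algebra N by unfold_locales (rule N)
  have "f (\<Sqinter>\<^bsub>M\<^esub> S) = \<Sqinter>\<^bsub>N\<^esub> (f ` S)" if S: "S \<subseteq> carrier M" for S
  proof -
    have "f ` S \<subseteq> carrier N" "compl M ` S \<subseteq> carrier M"
      using S f by auto
    moreover have "f ` compl M ` S = compl N ` f ` S"
      unfolding image_image using S compl by (intro image_cong) auto
    ultimately show ?thesis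
      using S by (simp add: M.inf_eq_compl_sup N.inf_eq_compl_sup compl sup)
  qed
  then show ?thesis
    using f sup compl by (simp add: is_cba_hom_def)
qed

lemma cba_hom_closed: "is_cba_hom M N f \<Longrightarrow> a \<in> carrier M \<Longrightarrow> f a \<in> carrier N"
  by (auto simp: is_cba_hom_def)

lemma cba_hom_sup: "is_cba_hom M N f \<Longrightarrow> S \<subseteq> carrier M \<Longrightarrow> f (\<Squnion>\<^bsub>M\<^esub> S) = \<Squnion>\<^bsub>N\<^esub> (f ` S)"
  by (simp add: is_cba_hom_def)

lemma cba_hom_inf: "is_cba_hom M N f \<Longrightarrow> S \<subseteq> carrier M \<Longrightarrow> f (\<Sqinter>\<^bsub>M\<^esub> S) = \<Sqinter>\<^bsub>N\<^esub> (f ` S)"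
  by (simp add: is_cba_hom_def)

lemma cba_hom_compl: "is_cba_hom M N f \<Longrightarrow> a \<in> carrier M \<Longrightarrow> f (compl M a) = compl N (f a)"
  by (simp add: is_cba_hom_def)

lemma cba_hom_meet:
  "is_cba_hom M N f \<Longrightarrow> a \<in> carrier M \<Longrightarrow> b \<in> carrier M \<Longrightarrow> f (a \<sqinter>\<^bsub>M\<^esub> b) = f a \<sqinter>\<^bsub>N\<^esub> f b"
  unfolding meet_def using cba_hom_inf[of M N f "{a, b}"] by simp

lemma cba_hom_top:
  assumes "is_cba M" "is_cba N" "is_cba_hom M N f"
  shows "f \<top>\<^bsub>M\<^esub> = \<top>\<^bsub>N\<^esub>"
proof -
  interpret M: complete_boolean_algebra M by unfold_locales (rule assms)
  interpret N: complete_boolean_algebra N by unfold_locales (rule assms)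
  show ?thesis
    using cba_hom_inf[OF assms(3), of "{}"] by (simp add: M.inf_empty_eq N.inf_empty_eq)
qed

lemma cba_hom_mono:
  assumes "is_cba M" "is_cba N" "is_cba_hom M N f" "a \<in> carrier M" "b \<in> carrier M" "a \<sqsubseteq>\<^bsub>M\<^esub> b"
  shows "f a \<sqsubseteq>\<^bsub>N\<^esub> f b"
proof -
  interpret M: complete_boolean_algebra M by unfold_locales (rule assms)
  interpret N: complete_boolean_algebra N by unfold_locales (rule assms)
  show ?thesis
    using assms cba_hom_meet[OF assms(3-5)] cba_hom_closed[OF assms(3)]
    by (simp add: M.meet_eq_left N.meet_eq_left)
qed

lemma is_cba_hom_cong:
  assumes "is_cba M" "\<And>a. a \<in> carrier M \<Longrightarrow> f a = g a"
  shows "is_cba_hom M N f \<longleftrightarrow> is_cba_hom M N g"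
proof -
  interpret M: complete_boolean_algebra M by unfold_locales (rule assms)
  have "f ` S = g ` S" if "S \<subseteq> carrier M" for S
    using that assms(2) by (auto intro!: image_cong)
  then show ?thesis
    using assms(2) by (auto simp: is_cba_hom_def Pi_iff)
qed

lemma is_cba_hom_id: "is_cba_hom M M (\<lambda>x. x)"
  by (simp add: is_cba_hom_def)

lemma is_cba_hom_comp:
  assumes f: "is_cba_hom M N f" and g: "is_cba_hom N P g"
  shows "is_cba_hom M P (\<lambda>x. g (f x))"
proof -
  have "f ` S \<subseteq> carrier N" if "S \<subseteq> carrier M" for S
    using that f by (auto simp: is_cba_hom_def)
  then show ?thesis
    using f g by (auto simp: is_cba_hom_def image_image Pi_iff)
qed

lemma is_cba_hom_inverse:
  assumes M: "is_cba M" and N: "is_cba N" and f: "is_cba_hom M N f"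
    and bij: "bij_betw f (carrier M) (carrier N)"
  shows "is_cba_hom N M (inv_into (carrier M) f)" (is "is_cba_hom N M ?g")
proof (rule is_cba_homI[OF N M])
  interpret M: complete_boolean_algebra M by unfold_locales (rule M)
  interpret N: complete_boolean_algebra N by unfold_locales (rule N)
  have g: "?g b \<in> carrier M" "f (?g b) = b" if "b \<in> carrier N" for b
    using bij that by (auto simp: bij_betw_def inv_into_into f_inv_into_f)
  have inj: "a = ?g b" if "a \<in> carrier M" "f a = b" for a b
    using bij that by (auto simp: bij_betw_def)
  show "?g \<in> carrier N \<rightarrow> carrier M"
    using g by blast
  show "?g (\<Squnion>\<^bsub>N\<^esub> S) = \<Squnion>\<^bsub>M\<^esub> (?g ` S)" if S: "S \<subseteq> carrier N" for S
  proof (rule inj[symmetric])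
    have sub: "?g ` S \<subseteq> carrier M" using S g by blast
    then show "\<Squnion>\<^bsub>M\<^esub> (?g ` S) \<in> carrier M" by simp
    have "(\<lambda>b. f (?g b)) ` S = (\<lambda>b. b) ` S"
      using S g by (intro image_cong) auto
    then have "f ` ?g ` S = S" by (simp add: image_image)
    then show "f (\<Squnion>\<^bsub>M\<^esub> (?g ` S)) = \<Squnion>\<^bsub>N\<^esub> S"
      using cba_hom_sup[OF f sub] by simp
  qed
  show "?g (compl N b) = compl M (?g b)" if b: "b \<in> carrier N" for b
    by (rule inj[symmetric]) (use b g cba_hom_compl[OF f] in auto)
qed

section \<open>Frames and subframes\<close>

locale frame =
  fixes L :: "'a gorder" (structure)
  assumes frame: "is_frame L"

sublocale frame \<subseteq> complete_lattice L
  using frame by (simp add: is_frame_def)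

context frame
begin

lemma meet_sup_distrib:
  "a \<in> carrier L \<Longrightarrow> S \<subseteq> carrier L \<Longrightarrow> a \<sqinter> \<Squnion>S = \<Squnion>((\<lambda>s. a \<sqinter> s) ` S)"
  using frame by (simp add: is_frame_def)

end

context
  fixes M :: "'a gorder" and L :: "'a set"
  assumes M: "complete_lattice M" and L: "is_subframe L M"
begin

interpretation complete_lattice M by (rule M)

private lemma sub: "L \<subseteq> carrier M" and sup_in: "S \<subseteq> L \<Longrightarrow> \<Squnion>\<^bsub>M\<^esub> S \<in> L"
  and meet_in: "a \<in> L \<Longrightarrow> b \<in> L \<Longrightarrow> a \<sqinter>\<^bsub>M\<^esub> b \<in> L" and top_in: "\<top>\<^bsub>M\<^esub> \<in> L"
  using L by (auto simp: is_subframe_def)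

lemma subframe_complete_lattice: "complete_lattice (M\<lparr>carrier := L\<rparr>)"
proof (rule complete_lattice_from_sups)
  fix S assume "S \<subseteq> carrier (M\<lparr>carrier := L\<rparr>)"
  then show "\<exists>s\<in>carrier (M\<lparr>carrier := L\<rparr>). \<forall>y\<in>carrier (M\<lparr>carrier := L\<rparr>).
      s \<sqsubseteq>\<^bsub>M\<lparr>carrier := L\<rparr>\<^esub> y \<longleftrightarrow> (\<forall>x\<in>S. x \<sqsubseteq>\<^bsub>M\<lparr>carrier := L\<rparr>\<^esub> y)"
    using sup_in[of S] sub sup_le_iff[of S] by (intro bexI[of _ "\<Squnion>\<^bsub>M\<^esub> S"]) (auto simp: subset_iff)
qed (use sub eq_is_equal in \<open>auto simp: subset_iff intro: le_refl le_antisym le_trans\<close>)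

lemma subframe_sup: "S \<subseteq> L \<Longrightarrow> \<Squnion>\<^bsub>M\<lparr>carrier := L\<rparr>\<^esub> S = \<Squnion>\<^bsub>M\<^esub> S"
  by (rule sup_eqI[OF complete_lattice.partial_order[OF subframe_complete_lattice]])
    (use sub sup_in sup_le_iff[of S] in \<open>auto simp: subset_iff\<close>)

lemma subframe_meet: "a \<in> L \<Longrightarrow> b \<in> L \<Longrightarrow> a \<sqinter>\<^bsub>M\<lparr>carrier := L\<rparr>\<^esub> b = a \<sqinter>\<^bsub>M\<^esub> b"
  unfolding meet_def[of "M\<lparr>carrier := L\<rparr>"]
  by (rule inf_eqI[OF complete_lattice.partial_order[OF subframe_complete_lattice]])
    (use sub meet_in le_meet_iff in \<open>auto simp: subset_iff\<close>)

lemma subframe_top: "\<top>\<^bsub>M\<lparr>carrier := L\<rparr>\<^esub> = \<top>\<^bsub>M\<^esub>"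
proof -
  interpret L: complete_lattice "M\<lparr>carrier := L\<rparr>" by (rule subframe_complete_lattice)
  show ?thesis
    using L.top_le_iff[of "\<top>\<^bsub>M\<^esub>"] L.top_closed sub top_in top_higher by auto
qed

lemma subframe_is_frame: "is_frame M \<Longrightarrow> is_frame (M\<lparr>carrier := L\<rparr>)"
  unfolding is_frame_def
proof (intro conjI ballI allI impI)
  fix a S assume a: "a \<in> carrier (M\<lparr>carrier := L\<rparr>)" and S: "S \<subseteq> carrier (M\<lparr>carrier := L\<rparr>)"
    and M: "complete_lattice M \<and> (\<forall>a\<in>carrier M. \<forall>S\<subseteq>carrier M. a \<sqinter>\<^bsub>M\<^esub> \<Squnion>\<^bsub>M\<^esub> S = \<Squnion>\<^bsub>M\<^esub> ((\<sqinter>\<^bsub>M\<^esub>) a ` S))"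
  have "(\<lambda>s. a \<sqinter>\<^bsub>M\<^esub> s) ` S \<subseteq> L" "S \<subseteq> L" "a \<in> L"
    using a S meet_in by auto
  moreover have "(\<lambda>s. a \<sqinter>\<^bsub>M\<lparr>carrier := L\<rparr>\<^esub> s) ` S = (\<lambda>s. a \<sqinter>\<^bsub>M\<^esub> s) ` S"
    using a S subframe_meet by (intro image_cong) auto
  moreover have "a \<in> carrier M" "S \<subseteq> carrier M"
    using a S sub by auto
  ultimately show "a \<sqinter>\<^bsub>M\<lparr>carrier := L\<rparr>\<^esub> \<Squnion>\<^bsub>M\<lparr>carrier := L\<rparr>\<^esub> S =
      \<Squnion>\<^bsub>M\<lparr>carrier := L\<rparr>\<^esub> ((\<lambda>s. a \<sqinter>\<^bsub>M\<lparr>carrier := L\<rparr>\<^esub> s) ` S)"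
    using M by (simp add: subframe_sup subframe_meet sup_in)
qed (rule subframe_complete_lattice)

end

section \<open>Families of sets ordered by inclusion\<close>

lemma set_order_simps [simp]:
  "carrier (set_order \<A>) = vset ` \<A>" "eq (set_order \<A>) = (=)"
  "x \<sqsubseteq>\<^bsub>set_order \<A>\<^esub> y \<longleftrightarrow> elts x \<subseteq> elts y"
  by (auto simp: set_order_def)

lemma set_order_carrier_update: "(set_order \<A>)\<lparr>carrier := vset ` \<B>\<rparr> = set_order \<B>"
  by (simp add: set_order_def)

text \<open>
  A topology on a small set, as a family of subsets; the order of its codes by inclusion is a frame.
  Besides topologies, the powerset is of this form.
\<close>

locale set_frame =
  fixes X :: "'u::universe set" and \<A> :: "'u set set"
  assumes small_X: "small X" and sub: "\<And>A. A \<in> \<A> \<Longrightarrow> A \<subseteq> X" and whole: "X \<in> \<A>"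
    and Un: "\<And>\<B>. \<B> \<subseteq> \<A> \<Longrightarrow> \<Union>\<B> \<in> \<A>" and Int: "\<And>A B. A \<in> \<A> \<Longrightarrow> B \<in> \<A> \<Longrightarrow> A \<inter> B \<in> \<A>"
begin

lemma small_members: "A \<in> \<A> \<Longrightarrow> small A"
  using small_X sub small_subset by blast

lemma in_carrier_iff: "x \<in> vset ` \<A> \<longleftrightarrow> elts x \<in> \<A>"
  using small_members by (auto simp: image_iff) (metis vset_elts)

lemma elts_sub: "x \<in> vset ` \<A> \<Longrightarrow> elts x \<subseteq> X"
  using in_carrier_iff sub by blast

lemma UN_elts: "S \<subseteq> vset ` \<A> \<Longrightarrow> (\<Union>x\<in>S. elts x) \<in> \<A>"
  using Un[of "elts ` S"] in_carrier_iff by auto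

lemma complete: "complete_lattice (set_order \<A>)"
proof (rule complete_lattice_from_sups)
  fix S assume S: "S \<subseteq> carrier (set_order \<A>)"
  have "vset (\<Union>x\<in>S. elts x) \<in> carrier (set_order \<A>)"
    using UN_elts[of S] S by simp
  moreover have "elts (vset (\<Union>x\<in>S. elts x)) = (\<Union>x\<in>S. elts x)"
    using UN_elts[of S] S small_members by simp
  ultimately show "\<exists>s\<in>carrier (set_order \<A>). \<forall>y\<in>carrier (set_order \<A>).
      s \<sqsubseteq>\<^bsub>set_order \<A>\<^esub> y \<longleftrightarrow> (\<forall>x\<in>S. x \<sqsubseteq>\<^bsub>set_order \<A>\<^esub> y)"
    by (intro bexI[of _ "vset (\<Union>x\<in>S. elts x)"]) auto
qed (auto intro: elts_ext)

lemma sup: "S \<subseteq> vset ` \<A> \<Longrightarrow> \<Squnion>\<^bsub>set_order \<A>\<^esub> S = vset (\<Union>x\<in>S. elts x)"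
  by (rule sup_eqI[OF complete_lattice.partial_order[OF complete]])
    (use UN_elts[of S] small_members in auto)

lemma elts_sup: "S \<subseteq> vset ` \<A> \<Longrightarrow> elts (\<Squnion>\<^bsub>set_order \<A>\<^esub> S) = (\<Union>x\<in>S. elts x)"
  using sup UN_elts[of S] small_members by simp

lemma meet:
  assumes "x \<in> vset ` \<A>" "y \<in> vset ` \<A>"
  shows "x \<sqinter>\<^bsub>set_order \<A>\<^esub> y = vset (elts x \<inter> elts y)"
  unfolding meet_def
  by (rule inf_eqI[OF complete_lattice.partial_order[OF complete]])
    (use assms in_carrier_iff Int small_members in auto)

lemma elts_meet:
  assumes "x \<in> vset ` \<A>" "y \<in> vset ` \<A>"
  shows "elts (x \<sqinter>\<^bsub>set_order \<A>\<^esub> y) = elts x \<inter> elts y"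
  using meet[OF assms] assms in_carrier_iff Int small_members by simp

lemma top: "\<top>\<^bsub>set_order \<A>\<^esub> = vset X"
proof -
  interpret complete_lattice "set_order \<A>" by (rule complete)
  show ?thesis
    by (rule top_le_iff[THEN iffD1, symmetric])
      (use whole small_X elts_sub top_closed top_higher[of "vset X"] top_le_iff in auto)
qed

lemma is_frame: "is_frame (set_order \<A>)"
  unfolding is_frame_def
proof (intro conjI ballI allI impI)
  fix a S assume a: "a \<in> carrier (set_order \<A>)" and S: "S \<subseteq> carrier (set_order \<A>)"
  interpret complete_lattice "set_order \<A>" by (rule complete)
  have "(\<lambda>s. a \<sqinter>\<^bsub>set_order \<A>\<^esub> s) ` S \<subseteq> carrier (set_order \<A>)"
    using a S meet_closed by blast
  then show "a \<sqinter>\<^bsub>set_order \<A>\<^esub> \<Squnion>\<^bsub>set_order \<A>\<^esub> S = \<Squnion>\<^bsub>set_order \<A>\<^esub> ((\<lambda>s. a \<sqinter>\<^bsub>set_order \<A>\<^esub> s) ` S)"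
    using a S sup_closed[of S] elts_meet
    by (intro elts_ext) (auto simp: elts_sup elts_meet subset_iff simp del: sup_closed)
qed (rule complete)

end

lemma set_frame_Pow: "small X \<Longrightarrow> set_frame X (Pow X)"
  by unfold_locales auto

lemma set_frame_opens: "small (topspace X) \<Longrightarrow> set_frame (topspace X) {U. openin X U}"
  by unfold_locales (auto dest: openin_subset)

text \<open>
  The powerset of a small set, as a complete Boolean algebra of codes.
\<close>

locale small_set =
  fixes X :: "'u::universe set"
  assumes small_X: "small X"

sublocale small_set \<subseteq> pow: set_frame X "Pow X"
  by (rule set_frame_Pow) (rule small_X)

context small_set
begin

lemma pow_in_iff: "x \<in> vset ` Pow X \<longleftrightarrow> elts x \<subseteq> X"
  using pow.in_carrier_iff by simp

lemma pow_complement: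
  assumes "x \<in> vset ` Pow X"
  shows "is_complement (set_order (Pow X)) x (vset (X - elts x))"
proof -
  interpret complete_lattice "set_order (Pow X)" by (rule pow.complete)
  have small: "small (X - A)" for A
    using small_X small_subset by blast
  have c: "vset (X - elts x) \<in> vset ` Pow X"
    by blast
  have "x \<sqinter>\<^bsub>set_order (Pow X)\<^esub> vset (X - elts x) = \<bottom>\<^bsub>set_order (Pow X)\<^esub>"
    by (rule elts_ext) (use assms c small in \<open>auto simp: pow.elts_meet pow.elts_sup simp flip: sup_empty_eq\<close>)
  moreover have "x \<squnion>\<^bsub>set_order (Pow X)\<^esub> vset (X - elts x) = \<top>\<^bsub>set_order (Pow X)\<^esub>"
    unfolding join_def pow.top
    by (rule elts_ext) (use assms c small small_X pow_in_iff in \<open>auto simp: pow.elts_sup\<close>)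
  ultimately show ?thesis
    using c by (simp add: is_complement_def)
qed

lemma pow_cba: "is_cba (set_order (Pow X))"
  unfolding is_cba_def
proof (intro conjI ballI)
  interpret complete_lattice "set_order (Pow X)" by (rule pow.complete)
  fix a assume a: "a \<in> carrier (set_order (Pow X))"
  then show "\<exists>b. is_complement (set_order (Pow X)) a b"
    using pow_complement by auto
  fix b c assume bc: "b \<in> carrier (set_order (Pow X))" "c \<in> carrier (set_order (Pow X))"
  have "{b, c} \<subseteq> carrier (set_order (Pow X))"
    using bc by blast
  then have "a \<sqinter>\<^bsub>set_order (Pow X)\<^esub> (\<Squnion>\<^bsub>set_order (Pow X)\<^esub> {b, c}) =
      \<Squnion>\<^bsub>set_order (Pow X)\<^esub> ((\<lambda>s. a \<sqinter>\<^bsub>set_order (Pow X)\<^esub> s) ` {b, c})"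
    using pow.is_frame a by (simp only: is_frame_def)
  then show "a \<sqinter>\<^bsub>set_order (Pow X)\<^esub> (b \<squnion>\<^bsub>set_order (Pow X)\<^esub> c) =
      (a \<sqinter>\<^bsub>set_order (Pow X)\<^esub> b) \<squnion>\<^bsub>set_order (Pow X)\<^esub> (a \<sqinter>\<^bsub>set_order (Pow X)\<^esub> c)"
    by (simp add: join_def)
qed (rule pow.complete)

lemma elts_pow_compl:
  "x \<in> vset ` Pow X \<Longrightarrow> elts (compl (set_order (Pow X)) x) = X - elts x"
proof -
  assume x: "x \<in> vset ` Pow X"
  interpret complete_boolean_algebra "set_order (Pow X)" by unfold_locales (rule pow_cba)
  have "small (X - elts x)"
    using small_X small_subset by blast
  then show ?thesis
    using compl_eqI[OF _ pow_complement[OF x]] x by simp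
qed

lemma elts_pow_inf:
  assumes "S \<subseteq> vset ` Pow X"
  shows "elts (\<Sqinter>\<^bsub>set_order (Pow X)\<^esub> S) = {x \<in> X. \<forall>A\<in>S. x \<in> elts A}"
proof -
  have s: "small {x \<in> X. \<forall>A\<in>S. x \<in> elts A}"
    by (rule small_subset[OF small_X]) blast
  have "\<Sqinter>\<^bsub>set_order (Pow X)\<^esub> S = vset {x \<in> X. \<forall>A\<in>S. x \<in> elts A}"
    by (rule inf_eqI[OF complete_lattice.partial_order[OF pow.complete]])
      (use assms s in \<open>auto simp: pow_in_iff\<close>)
  with s show ?thesis by simp
qed

end

section \<open>Points\<close>

text \<open>
  The points of a complete Boolean algebra and of a frame, as the sets of elements that a
  homomorphism to the two-element algebra sends to the top element.
\<close>

definition cba_point :: "'a gorder \<Rightarrow> 'a set \<Rightarrow> bool" where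
  "cba_point M P \<longleftrightarrow> P \<subseteq> carrier M \<and>
     (\<forall>S. S \<subseteq> carrier M \<longrightarrow> (\<Squnion>\<^bsub>M\<^esub> S \<in> P \<longleftrightarrow> (\<exists>s\<in>S. s \<in> P)) \<and> (\<Sqinter>\<^bsub>M\<^esub> S \<in> P \<longleftrightarrow> S \<subseteq> P)) \<and>
     (\<forall>a\<in>carrier M. compl M a \<in> P \<longleftrightarrow> a \<notin> P)"

definition frame_point :: "'a gorder \<Rightarrow> 'a set \<Rightarrow> bool" where
  "frame_point L P \<longleftrightarrow> P \<subseteq> carrier L \<and> \<top>\<^bsub>L\<^esub> \<in> P \<and>
     (\<forall>a\<in>carrier L. \<forall>b\<in>carrier L. a \<sqinter>\<^bsub>L\<^esub> b \<in> P \<longleftrightarrow> a \<in> P \<and> b \<in> P) \<and>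
     (\<forall>S. S \<subseteq> carrier L \<longrightarrow> (\<Squnion>\<^bsub>L\<^esub> S \<in> P \<longleftrightarrow> (\<exists>s\<in>S. s \<in> P)))"

lemma ex_in_sub_iff: "S \<subseteq> C \<Longrightarrow> (\<exists>s\<in>S. s \<in> C \<and> Q s) \<longleftrightarrow> (\<exists>s\<in>S. Q s)"
  by blast

lemma all_in_sub_iff: "S \<subseteq> C \<Longrightarrow> S \<subseteq> {m \<in> C. Q m} \<longleftrightarrow> (\<forall>s\<in>S. Q s)"
  by blast

text \<open>Homomorphisms to a powerset are families of points, and likewise for frames of sets.\<close>

lemma (in small_set) cba_hom_powerset_iff:
  assumes M: "is_cba M" and f: "f \<in> carrier M \<rightarrow> vset ` Pow X"
  shows "is_cba_hom M (set_order (Pow X)) f \<longleftrightarrow> (\<forall>x\<in>X. cba_point M {m \<in> carrier M. x \<in> elts (f m)})"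
proof -
  interpret M: complete_boolean_algebra M by unfold_locales (rule M)
  have sub: "f a \<in> vset ` Pow X" if "a \<in> carrier M" for a
    using f that by blast
  have eq_iff: "p = q \<longleftrightarrow> (\<forall>x\<in>X. x \<in> elts p \<longleftrightarrow> x \<in> elts q)"
    if "p \<in> vset ` Pow X" "q \<in> vset ` Pow X" for p q
  proof -
    have "elts p \<subseteq> X" "elts q \<subseteq> X"
      using that pow_in_iff by auto
    then show ?thesis
      by (auto intro!: elts_ext)
  qed
  interpret P: complete_boolean_algebra "set_order (Pow X)" by unfold_locales (rule pow_cba)
  have sup: "f (\<Squnion>\<^bsub>M\<^esub> S) = \<Squnion>\<^bsub>set_order (Pow X)\<^esub> (f ` S) \<longleftrightarrow>
      (\<forall>x\<in>X. x \<in> elts (f (\<Squnion>\<^bsub>M\<^esub> S)) \<longleftrightarrow> (\<exists>s\<in>S. x \<in> elts (f s)))"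
    and inf: "f (\<Sqinter>\<^bsub>M\<^esub> S) = \<Sqinter>\<^bsub>set_order (Pow X)\<^esub> (f ` S) \<longleftrightarrow>
      (\<forall>x\<in>X. x \<in> elts (f (\<Sqinter>\<^bsub>M\<^esub> S)) \<longleftrightarrow> (\<forall>s\<in>S. x \<in> elts (f s)))" if S: "S \<subseteq> carrier M" for S
  proof -
    have fS: "f ` S \<subseteq> vset ` Pow X"
      using S sub by blast
    then have "\<Squnion>\<^bsub>set_order (Pow X)\<^esub> (f ` S) \<in> vset ` Pow X" "\<Sqinter>\<^bsub>set_order (Pow X)\<^esub> (f ` S) \<in> vset ` Pow X"
      using P.sup_closed[of "f ` S"] P.inf_closed[of "f ` S"] by auto
    then show "f (\<Squnion>\<^bsub>M\<^esub> S) = \<Squnion>\<^bsub>set_order (Pow X)\<^esub> (f ` S) \<longleftrightarrow>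
      (\<forall>x\<in>X. x \<in> elts (f (\<Squnion>\<^bsub>M\<^esub> S)) \<longleftrightarrow> (\<exists>s\<in>S. x \<in> elts (f s)))"
      "f (\<Sqinter>\<^bsub>M\<^esub> S) = \<Sqinter>\<^bsub>set_order (Pow X)\<^esub> (f ` S) \<longleftrightarrow>
      (\<forall>x\<in>X. x \<in> elts (f (\<Sqinter>\<^bsub>M\<^esub> S)) \<longleftrightarrow> (\<forall>s\<in>S. x \<in> elts (f s)))"
      using eq_iff[OF sub] S M.sup_closed M.inf_closed
      by (simp_all add: pow.elts_sup[OF fS] elts_pow_inf[OF fS])
  qed
  have compl: "f (compl M a) = compl (set_order (Pow X)) (f a) \<longleftrightarrow>
      (\<forall>x\<in>X. x \<in> elts (f (compl M a)) \<longleftrightarrow> x \<notin> elts (f a))" if "a \<in> carrier M" for a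
  proof -
    have "compl (set_order (Pow X)) (f a) \<in> vset ` Pow X"
      using P.compl_closed[of "f a"] sub[OF that] by simp
    then show ?thesis
      using eq_iff[OF sub] that elts_pow_compl[OF sub[OF that]] by simp
  qed
  have "is_cba_hom M (set_order (Pow X)) f \<longleftrightarrow>
      (\<forall>S. S \<subseteq> carrier M \<longrightarrow> (\<forall>x\<in>X. x \<in> elts (f (\<Squnion>\<^bsub>M\<^esub> S)) \<longleftrightarrow> (\<exists>s\<in>S. x \<in> elts (f s))) \<and>
        (\<forall>x\<in>X. x \<in> elts (f (\<Sqinter>\<^bsub>M\<^esub> S)) \<longleftrightarrow> (\<forall>s\<in>S. x \<in> elts (f s)))) \<and>
      (\<forall>a\<in>carrier M. \<forall>x\<in>X. x \<in> elts (f (compl M a)) \<longleftrightarrow> x \<notin> elts (f a))"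
    using f by (simp add: is_cba_hom_def sup inf compl)
  moreover have "cba_point M {m \<in> carrier M. x \<in> elts (f m)} \<longleftrightarrow>
      (\<forall>S. S \<subseteq> carrier M \<longrightarrow> (x \<in> elts (f (\<Squnion>\<^bsub>M\<^esub> S)) \<longleftrightarrow> (\<exists>s\<in>S. x \<in> elts (f s))) \<and>
        (x \<in> elts (f (\<Sqinter>\<^bsub>M\<^esub> S)) \<longleftrightarrow> (\<forall>s\<in>S. x \<in> elts (f s)))) \<and>
      (\<forall>a\<in>carrier M. x \<in> elts (f (compl M a)) \<longleftrightarrow> x \<notin> elts (f a))" for x
    by (simp add: cba_point_def ex_in_sub_iff all_in_sub_iff)
  moreover have "(\<forall>S. Q S \<longrightarrow> (\<forall>x\<in>X. A x S) \<and> (\<forall>x\<in>X. B x S)) \<and> (\<forall>a\<in>C. \<forall>x\<in>X. D x a) \<longleftrightarrow>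
      (\<forall>x\<in>X. (\<forall>S. Q S \<longrightarrow> A x S \<and> B x S) \<and> (\<forall>a\<in>C. D x a))"
    for Q A B D and C :: "'b set"
    by blast
  ultimately show ?thesis
    by (simp only:)
qed

lemma (in set_frame) frame_hom_set_frame_iff:
  assumes L: "is_frame L" and f: "f \<in> carrier L \<rightarrow> vset ` \<A>"
  shows "is_frame_hom L (set_order \<A>) f \<longleftrightarrow> (\<forall>x\<in>X. frame_point L {m \<in> carrier L. x \<in> elts (f m)})"
proof -
  interpret L: frame L by unfold_locales (rule L)
  have fin: "f a \<in> vset ` \<A>" if "a \<in> carrier L" for a
    using f that by blast
  have eq_iff: "p = q \<longleftrightarrow> (\<forall>x\<in>X. x \<in> elts p \<longleftrightarrow> x \<in> elts q)"
    if "p \<in> vset ` \<A>" "q \<in> vset ` \<A>" for p q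
    using elts_sub[OF that(1)] elts_sub[OF that(2)] by (auto intro!: elts_ext)
  interpret P: complete_lattice "set_order \<A>" by (rule complete)
  have sup: "f (\<Squnion>\<^bsub>L\<^esub> S) = \<Squnion>\<^bsub>set_order \<A>\<^esub> (f ` S) \<longleftrightarrow>
      (\<forall>x\<in>X. x \<in> elts (f (\<Squnion>\<^bsub>L\<^esub> S)) \<longleftrightarrow> (\<exists>s\<in>S. x \<in> elts (f s)))" if S: "S \<subseteq> carrier L" for S
  proof -
    have fS: "f ` S \<subseteq> vset ` \<A>"
      using S fin by blast
    then have "\<Squnion>\<^bsub>set_order \<A>\<^esub> (f ` S) \<in> vset ` \<A>"
      using P.sup_closed[of "f ` S"] by auto
    then show ?thesis
      using eq_iff[OF fin] S L.sup_closed by (simp add: elts_sup[OF fS])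
  qed
  have meet: "f (a \<sqinter>\<^bsub>L\<^esub> b) = f a \<sqinter>\<^bsub>set_order \<A>\<^esub> f b \<longleftrightarrow>
      (\<forall>x\<in>X. x \<in> elts (f (a \<sqinter>\<^bsub>L\<^esub> b)) \<longleftrightarrow> x \<in> elts (f a) \<and> x \<in> elts (f b))"
    if "a \<in> carrier L" "b \<in> carrier L" for a b
  proof -
    have "f a \<sqinter>\<^bsub>set_order \<A>\<^esub> f b \<in> vset ` \<A>"
      using P.meet_closed[of "f a" "f b"] fin that by simp
    then show ?thesis
      using eq_iff[OF fin] that by (simp add: elts_meet fin)
  qed
  have top: "f \<top>\<^bsub>L\<^esub> = \<top>\<^bsub>set_order \<A>\<^esub> \<longleftrightarrow> (\<forall>x\<in>X. x \<in> elts (f \<top>\<^bsub>L\<^esub>))"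
    using eq_iff[OF fin, of "\<top>\<^bsub>L\<^esub>" "vset X"] whole small_X by (simp add: top)
  have "is_frame_hom L (set_order \<A>) f \<longleftrightarrow> (\<forall>x\<in>X. x \<in> elts (f \<top>\<^bsub>L\<^esub>)) \<and>
      (\<forall>a\<in>carrier L. \<forall>b\<in>carrier L. \<forall>x\<in>X. x \<in> elts (f (a \<sqinter>\<^bsub>L\<^esub> b)) \<longleftrightarrow> x \<in> elts (f a) \<and> x \<in> elts (f b)) \<and>
      (\<forall>S. S \<subseteq> carrier L \<longrightarrow> (\<forall>x\<in>X. x \<in> elts (f (\<Squnion>\<^bsub>L\<^esub> S)) \<longleftrightarrow> (\<exists>s\<in>S. x \<in> elts (f s))))"
    using f by (simp add: is_frame_hom_def sup meet top)
  moreover have "frame_point L {m \<in> carrier L. x \<in> elts (f m)} \<longleftrightarrow> x \<in> elts (f \<top>\<^bsub>L\<^esub>) \<and>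
      (\<forall>a\<in>carrier L. \<forall>b\<in>carrier L. x \<in> elts (f (a \<sqinter>\<^bsub>L\<^esub> b)) \<longleftrightarrow> x \<in> elts (f a) \<and> x \<in> elts (f b)) \<and>
      (\<forall>S. S \<subseteq> carrier L \<longrightarrow> (x \<in> elts (f (\<Squnion>\<^bsub>L\<^esub> S)) \<longleftrightarrow> (\<exists>s\<in>S. x \<in> elts (f s))))" for x
    by (simp add: frame_point_def ex_in_sub_iff)
  moreover have "(\<forall>x\<in>X. A x) \<and> (\<forall>a\<in>C. \<forall>b\<in>C. \<forall>x\<in>X. B x a b) \<and> (\<forall>S. Q S \<longrightarrow> (\<forall>x\<in>X. D x S)) \<longleftrightarrow>
      (\<forall>x\<in>X. A x \<and> (\<forall>a\<in>C. \<forall>b\<in>C. B x a b) \<and> (\<forall>S. Q S \<longrightarrow> D x S))"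
    for Q A B D and C :: "'b set"
    by blast
  ultimately show ?thesis
    by (simp only:)
qed

lemma two_eq_Pow: "two = set_order (Pow {v0})"
  unfolding two_def by (rule arg_cong[where f = set_order]) auto

lemma carrier_two [simp]: "carrier two = {v0, v1}"
  by (auto simp: two_def v0_def v1_def)

lemma vset_Pow_v0: "vset ` Pow {v0} = {v0, v1}"
  using carrier_two by (simp only: two_eq_Pow set_order_simps)

interpretation one: small_set "{v0}"
  by unfold_locales simp

lemma two_frame: "is_frame two"
  unfolding two_eq_Pow by (rule one.pow.is_frame)

lemma v0_in_iff: "x \<in> {v0, v1} \<Longrightarrow> v0 \<in> elts x \<longleftrightarrow> x = v1"
  by auto

lemma cba_hom_two_iff:
  assumes M: "is_cba M" and f: "f \<in> carrier M \<rightarrow> {v0, v1}"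
  shows "is_cba_hom M two f \<longleftrightarrow> cba_point M {m \<in> carrier M. f m = v1}"
proof -
  have "{m \<in> carrier M. v0 \<in> elts (f m)} = {m \<in> carrier M. f m = v1}"
    using f v0_in_iff by blast
  with f show ?thesis
    using one.cba_hom_powerset_iff[OF M, of f, unfolded vset_Pow_v0] by (simp add: two_eq_Pow)
qed

lemma frame_hom_two_iff:
  assumes M: "is_frame M" and f: "f \<in> carrier M \<rightarrow> {v0, v1}"
  shows "is_frame_hom M two f \<longleftrightarrow> frame_point M {m \<in> carrier M. f m = v1}"
proof -
  have "{m \<in> carrier M. v0 \<in> elts (f m)} = {m \<in> carrier M. f m = v1}"
    using f v0_in_iff by blast
  with f show ?thesis
    using one.pow.frame_hom_set_frame_iff[OF M, of f, unfolded vset_Pow_v0] by (simp add: two_eq_Pow)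
qed

lemma cba_point_mono:
  assumes M: "is_cba M" and P: "cba_point M P" and "a \<in> P" "b \<in> carrier M" "a \<sqsubseteq>\<^bsub>M\<^esub> b"
  shows "b \<in> P"
proof -
  interpret complete_boolean_algebra M by unfold_locales (rule M)
  have a: "a \<in> carrier M"
    using P assms(3) by (auto simp: cba_point_def)
  have "\<Squnion>\<^bsub>M\<^esub> {a, b} = b"
    using a assms le_trans by (intro sup_eqI[OF partial_order]) auto
  moreover have "\<Squnion>\<^bsub>M\<^esub> {a, b} \<in> P"
    using P a assms by (simp add: cba_point_def)
  ultimately show ?thesis by simp
qed

lemma cba_point_meet:
  "cba_point M P \<Longrightarrow> a \<in> carrier M \<Longrightarrow> b \<in> carrier M \<Longrightarrow> a \<sqinter>\<^bsub>M\<^esub> b \<in> P \<longleftrightarrow> a \<in> P \<and> b \<in> P"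
  unfolding meet_def by (simp add: cba_point_def)

lemma cba_point_subframe:
  assumes M: "is_cba M" and L: "is_subframe L M" and P: "cba_point M P"
  shows "frame_point (M\<lparr>carrier := L\<rparr>) (P \<inter> L)"
proof -
  interpret complete_boolean_algebra M by unfold_locales (rule M)
  note sf = subframe_sup[OF complete_lattice_axioms L] subframe_meet[OF complete_lattice_axioms L]
    subframe_top[OF complete_lattice_axioms L]
  have sub: "L \<subseteq> carrier M" "\<top>\<^bsub>M\<^esub> \<in> L" "\<And>S. S \<subseteq> L \<Longrightarrow> \<Squnion>\<^bsub>M\<^esub> S \<in> L" "\<And>a b. a \<in> L \<Longrightarrow> b \<in> L \<Longrightarrow> a \<sqinter>\<^bsub>M\<^esub> b \<in> L"
    using L by (auto simp: is_subframe_def)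
  have "\<top>\<^bsub>M\<^esub> \<in> P"
    using P inf_empty_eq by (metis cba_point_def empty_subsetI)
  moreover have "\<Squnion>\<^bsub>M\<^esub> S \<in> P \<longleftrightarrow> (\<exists>s\<in>S. s \<in> P \<and> s \<in> L)" if "S \<subseteq> L" for S
  proof -
    have "S \<subseteq> carrier M" using that sub by blast
    then have "\<Squnion>\<^bsub>M\<^esub> S \<in> P \<longleftrightarrow> (\<exists>s\<in>S. s \<in> P)"
      using P by (simp add: cba_point_def)
    then show ?thesis using that by blast
  qed
  moreover have "a \<sqinter>\<^bsub>M\<^esub> b \<in> P \<longleftrightarrow> a \<in> P \<and> b \<in> P" if "a \<in> L" "b \<in> L" for a b
    using that sub(1) cba_point_meet[OF P] by blast
  ultimately show ?thesis
    unfolding frame_point_def using sub by (simp add: sf)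
qed

text \<open>
  The elements above \<open>n\<close> form a point if \<open>n\<close> is an atom, that is, nonzero and either below or disjoint
  from every element.
\<close>

lemma cba_point_atom:
  assumes M: "is_cba M" and n: "n \<in> carrier M" "n \<noteq> \<bottom>\<^bsub>M\<^esub>"
    and atom: "\<And>e. e \<in> carrier M \<Longrightarrow> n \<sqsubseteq>\<^bsub>M\<^esub> e \<or> n \<sqinter>\<^bsub>M\<^esub> e = \<bottom>\<^bsub>M\<^esub>"
  shows "cba_point M {e \<in> carrier M. n \<sqsubseteq>\<^bsub>M\<^esub> e}"
proof -
  interpret complete_boolean_algebra M by unfold_locales (rule M)
  have compl: "n \<sqsubseteq>\<^bsub>M\<^esub> compl M e \<longleftrightarrow> \<not> n \<sqsubseteq>\<^bsub>M\<^esub> e" if "e \<in> carrier M" for e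
    using atom[OF that] le_compl_iff[OF that n(1)] n meet_eq_left[OF n(1) that] by auto
  have "n \<sqsubseteq>\<^bsub>M\<^esub> \<Squnion>\<^bsub>M\<^esub> S \<longleftrightarrow> (\<exists>s\<in>S. n \<sqsubseteq>\<^bsub>M\<^esub> s)" if S: "S \<subseteq> carrier M" for S
  proof -
    have "n \<sqsubseteq>\<^bsub>M\<^esub> \<Squnion>\<^bsub>M\<^esub> S \<longleftrightarrow> \<not> n \<sqsubseteq>\<^bsub>M\<^esub> \<Sqinter>\<^bsub>M\<^esub> (compl M ` S)"
      using S compl[of "\<Squnion>\<^bsub>M\<^esub> S"] by (simp add: compl_sup)
    also have "\<dots> \<longleftrightarrow> \<not> (\<forall>s\<in>S. n \<sqsubseteq>\<^bsub>M\<^esub> compl M s)"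
    proof -
      have "compl M ` S \<subseteq> carrier M"
        using S by auto
      then show ?thesis
        using n le_inf_iff[of "compl M ` S" n] by simp
    qed
    also have "\<dots> \<longleftrightarrow> (\<exists>s\<in>S. n \<sqsubseteq>\<^bsub>M\<^esub> s)"
      using S compl by (auto simp: subset_iff)
    finally show ?thesis .
  qed
  then show ?thesis
    using compl le_inf_iff n(1) by (auto simp: cba_point_def subset_iff)
qed

text \<open>
  An algebra generated under joins by differences of open elements. This is the pointfree
  counterpart of the \<open>T\<^sub>D\<close> axiom: the points of such an algebra are locally closed.
\<close>

definition difference_generated :: "'a set \<Rightarrow> 'a gorder \<Rightarrow> bool" where
  "difference_generated L M \<longleftrightarrow>
     (\<forall>m\<in>carrier M. \<exists>S. S \<subseteq> {b \<sqinter>\<^bsub>M\<^esub> compl M a | a b. a \<in> L \<and> b \<in> L} \<and> m = \<Squnion>\<^bsub>M\<^esub> S)"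

text \<open>
  The meet of a point \<open>P\<close> lies in \<open>P\<close>; being a join of differences it is itself a difference
  \<open>b \<and> \<not> a\<close>, and \<open>P\<close> is the only point containing it.
\<close>

lemma cba_point_isolated:
  assumes M: "is_cba M" and L: "L \<subseteq> carrier M" "difference_generated L M" and P: "cba_point M P"
  shows "\<exists>a\<in>L. \<exists>b\<in>L. b \<in> P \<and> a \<notin> P \<and> (\<forall>Q. cba_point M Q \<and> b \<in> Q \<and> a \<notin> Q \<longrightarrow> Q = P)"
proof -
  interpret complete_boolean_algebra M by unfold_locales (rule M)
  have sub: "P \<subseteq> carrier M"
    using P by (simp add: cba_point_def)
  define n where "n = \<Sqinter>\<^bsub>M\<^esub> P"
  have n: "n \<in> carrier M" "n \<in> P"
    using P sub by (auto simp: n_def cba_point_def)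
  have least: "n \<sqsubseteq>\<^bsub>M\<^esub> e" if "e \<in> P" for e
    using that sub inf_lower by (auto simp: n_def)
  obtain S where S: "S \<subseteq> {b \<sqinter>\<^bsub>M\<^esub> compl M a | a b. a \<in> L \<and> b \<in> L}" "n = \<Squnion>\<^bsub>M\<^esub> S"
    using L(2) n(1) by (auto simp: difference_generated_def)
  have "b \<sqinter>\<^bsub>M\<^esub> compl M a \<in> carrier M" if "a \<in> L" "b \<in> L" for a b
    using that L(1) by (simp add: subset_iff)
  then have SM: "S \<subseteq> carrier M"
    using S(1) by blast
  then obtain d where d: "d \<in> S" "d \<in> P"
    using P n(2) unfolding S(2) by (auto simp: cba_point_def)
  have "d \<sqsubseteq>\<^bsub>M\<^esub> n"
    unfolding S(2) using SM d by (intro sup_upper) auto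
  then have dn: "d = n"
    using least[OF d(2)] d n(1) sub by (intro le_antisym) auto
  obtain a b where ab: "a \<in> L" "b \<in> L" "n = b \<sqinter>\<^bsub>M\<^esub> compl M a"
    using S(1) d(1) dn by blast
  have abM: "a \<in> carrier M" "b \<in> carrier M"
    using ab L(1) by auto
  have iff: "n \<in> Q \<longleftrightarrow> b \<in> Q \<and> a \<notin> Q" if "cba_point M Q" for Q
    using that abM cba_point_meet[OF that] by (auto simp: ab(3) cba_point_def)
  have "Q = P" if Q: "cba_point M Q" "b \<in> Q" "a \<notin> Q" for Q
  proof -
    have nQ: "n \<in> Q" using iff Q by blast
    have "e \<in> Q \<longleftrightarrow> e \<in> P" if e: "e \<in> carrier M" for e
    proof (cases "e \<in> P")
      case True
      then show ?thesis
        using cba_point_mono[OF M Q(1) nQ e least] by simp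
    next
      case False
      then have "compl M e \<in> P"
        using P e by (simp add: cba_point_def)
      then have "compl M e \<in> Q"
        using cba_point_mono[OF M Q(1) nQ _ least] e by simp
      then show ?thesis
        using Q(1) e False by (simp add: cba_point_def)
    qed
    moreover have "Q \<subseteq> carrier M"
      using Q(1) by (simp add: cba_point_def)
    ultimately show ?thesis
      using sub by blast
  qed
  then show ?thesis
    using ab iff[OF P] n(2) by blast
qed

section \<open>The Funayama embedding\<close>

text \<open>
  A complete lattice with a dense set \<open>P\<close> of elements is a complete Boolean algebra as soon as \<open>P\<close>
  is separative (\<open>disjoint\<close>) and its elements are covered by any join above them (\<open>cover\<close>). The
  complement of \<open>a\<close> is the join of the elements of \<open>P\<close> with no common lower bound with \<open>a\<close> in \<open>P\<close>.
\<close>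

lemma cba_from_dense_set:
  fixes L :: "'a gorder" (structure)
  assumes complete: "complete_lattice L" and P: "P \<subseteq> carrier L"
    and dense: "\<And>x y. x \<in> carrier L \<Longrightarrow> y \<in> carrier L \<Longrightarrow> (\<And>p. p \<in> P \<Longrightarrow> p \<sqsubseteq> x \<Longrightarrow> p \<sqsubseteq> y) \<Longrightarrow> x \<sqsubseteq> y"
    and disjoint: "\<And>p x. p \<in> P \<Longrightarrow> x \<in> carrier L \<Longrightarrow> \<not> p \<sqsubseteq> x \<Longrightarrow>
      \<exists>q\<in>P. q \<sqsubseteq> p \<and> \<not> (\<exists>r\<in>P. r \<sqsubseteq> q \<and> r \<sqsubseteq> x)"
    and cover: "\<And>p S. p \<in> P \<Longrightarrow> S \<subseteq> carrier L \<Longrightarrow> p \<sqsubseteq> \<Squnion>S \<Longrightarrow>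
      \<exists>r\<in>P. r \<sqsubseteq> p \<and> (\<exists>s\<in>S. r \<sqsubseteq> s)"
  shows "is_cba L"
proof -
  interpret complete_lattice L by (rule complete)
  show ?thesis
    unfolding is_cba_def
  proof (intro conjI ballI)
    show "complete_lattice L" by (rule complete)
    have PL: "p \<in> carrier L" if "p \<in> P" for p
      using P that by blast
    have not_bottom: "\<not> p \<sqsubseteq> \<bottom>" if "p \<in> P" for p
      using cover[OF that, of "{}"] by (auto simp: sup_empty_eq)
    fix a assume a: "a \<in> carrier L"
    define b where "b = \<Squnion>{p \<in> P. \<not> (\<exists>r\<in>P. r \<sqsubseteq> p \<and> r \<sqsubseteq> a)}"
    have sub: "{p \<in> P. \<not> (\<exists>r\<in>P. r \<sqsubseteq> p \<and> r \<sqsubseteq> a)} \<subseteq> carrier L"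
      using P by blast
    then have b: "b \<in> carrier L"
      by (simp add: b_def)
    have below_b: "p \<sqsubseteq> b" if "p \<in> P" "\<not> (\<exists>r\<in>P. r \<sqsubseteq> p \<and> r \<sqsubseteq> a)" for p
      unfolding b_def using sub that by (intro sup_upper) auto
    have "a \<sqinter> b \<sqsubseteq> \<bottom>"
    proof (rule dense)
      fix p assume p: "p \<in> P" "p \<sqsubseteq> a \<sqinter> b"
      then have le: "p \<sqsubseteq> a" "p \<sqsubseteq> b"
        using le_meet_iff[OF a b PL] by auto
      obtain r s where r: "r \<in> P" "r \<sqsubseteq> p" "r \<sqsubseteq> s" "\<not> (\<exists>r\<in>P. r \<sqsubseteq> s \<and> r \<sqsubseteq> a)"
        using cover[OF p(1) sub] le(2) unfolding b_def by blast
      then show "p \<sqsubseteq> \<bottom>"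
        using le_trans[OF r(2) le(1)] PL a p by blast
    qed (use a b in auto)
    moreover have "\<top> \<sqsubseteq> a \<squnion> b"
    proof (rule dense)
      fix p assume p: "p \<in> P"
      show "p \<sqsubseteq> a \<squnion> b"
      proof (rule ccontr)
        assume "\<not> p \<sqsubseteq> a \<squnion> b"
        then obtain q where q: "q \<in> P" "\<not> (\<exists>r\<in>P. r \<sqsubseteq> q \<and> r \<sqsubseteq> a \<squnion> b)"
          using disjoint[OF p] a b by (meson join_closed)
        have "\<not> r \<sqsubseteq> a" if r: "r \<in> P" "r \<sqsubseteq> q" for r
        proof
          assume "r \<sqsubseteq> a"
          then have "r \<sqsubseteq> a \<squnion> b"
            using le_trans[OF _ join_left[OF a b]] PL[OF r(1)] a b by simp
          then show False
            using q(2) r by blast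
        qed
        then have "q \<sqsubseteq> b"
          by (intro below_b[OF q(1)]) blast
        then show False
          using q a b PL le_trans[of q b "a \<squnion> b"] join_right[OF a b] le_refl[OF PL[OF q(1)]] by auto
      qed
    qed (use a b in auto)
    ultimately have "is_complement L a b"
      using a b le_bottom_iff top_le_iff by (simp add: is_complement_def)
    then show "\<exists>b. is_complement L a b" ..
  next
    have PL: "p \<in> carrier L" if "p \<in> P" for p
      using P that by blast
    fix a b c assume a: "a \<in> carrier L" and b: "b \<in> carrier L" and c: "c \<in> carrier L"
    let ?r = "(a \<sqinter> b) \<squnion> (a \<sqinter> c)"
    have r: "?r \<in> carrier L" using a b c by simp
    have "a \<sqinter> (b \<squnion> c) \<sqsubseteq> ?r"
    proof (rule dense)
      fix p assume p: "p \<in> P" "p \<sqsubseteq> a \<sqinter> (b \<squnion> c)"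
      show "p \<sqsubseteq> ?r"
      proof (rule ccontr)
        assume "\<not> p \<sqsubseteq> ?r"
        then obtain q where q: "q \<in> P" "q \<sqsubseteq> p" "\<not> (\<exists>r\<in>P. r \<sqsubseteq> q \<and> r \<sqsubseteq> ?r)"
          using disjoint[OF p(1) r] by blast
        have "q \<sqsubseteq> a \<sqinter> (b \<squnion> c)"
          using le_trans[OF q(2) p(2)] PL p q a b c by simp
        then have qa: "q \<sqsubseteq> a" and "q \<sqsubseteq> \<Squnion>{b, c}"
          using le_meet_iff[of a "b \<squnion> c" q] PL q a b c by (auto simp: join_def)
        then obtain s where s: "s \<in> P" "s \<sqsubseteq> q" "s \<sqsubseteq> b \<or> s \<sqsubseteq> c"
          using cover[OF q(1), of "{b, c}"] b c by auto
        have "s \<sqsubseteq> a"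
          using le_trans[OF s(2) qa] PL s q a by simp
        then have "s \<sqsubseteq> a \<sqinter> b \<or> s \<sqsubseteq> a \<sqinter> c"
          using s a b c PL le_meet_iff by auto
        then have "s \<sqsubseteq> ?r"
          using s(1) PL a b c le_trans[OF _ join_left[of "a \<sqinter> b" "a \<sqinter> c"]]
            le_trans[OF _ join_right[of "a \<sqinter> b" "a \<sqinter> c"]] by auto
        then show False
          using q(3) s by blast
      qed
    qed (use a b c in auto)
    moreover have "?r \<sqsubseteq> a \<sqinter> (b \<squnion> c)"
      using a b c le_trans[OF meet_right join_left] le_trans[OF meet_right join_right]
      by (simp add: join_le_iff le_meet_iff meet_left)
    ultimately show "a \<sqinter> (b \<squnion> c) = ?r"
      using a b c by (intro le_antisym) auto
  qed
qed

text \<open>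
  The join of a family of sublocales consists of all meets of their elements.
\<close>

definition sublocale_join :: "'a gorder \<Rightarrow> 'a set set \<Rightarrow> 'a set" where
  "sublocale_join L \<F> = {\<Sqinter>\<^bsub>L\<^esub> B | B. B \<subseteq> \<Union>\<F>}"

lemma sublocale_join_mono: "\<F> \<subseteq> \<G> \<Longrightarrow> sublocale_join L \<F> \<subseteq> sublocale_join L \<G>"
  using Union_mono[of \<F> \<G>] unfolding sublocale_join_def
  by (intro Collect_mono impI) (elim exE, intro exI, auto)

text \<open>
  The intersections of a closed and an open sublocale, which generate the Funayama algebra.
\<close>

definition differences :: "'a gorder \<Rightarrow> 'a set set" where
  "differences L = {closed_sublocale L a \<inter> open_sublocale L b | a b. a \<in> carrier L \<and> b \<in> carrier L}"

context frame
begin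

abbreviation imp (infixr \<open>\<leadsto>\<close> 60) where "a \<leadsto> b \<equiv> heyting_imp L a b"

lemma imp_closed [simp]: "a \<leadsto> b \<in> carrier L"
  unfolding heyting_imp_def by (rule sup_closed) blast

lemma le_imp_iff:
  assumes a: "a \<in> carrier L" and b: "b \<in> carrier L" and c: "c \<in> carrier L"
  shows "c \<sqsubseteq> a \<leadsto> b \<longleftrightarrow> a \<sqinter> c \<sqsubseteq> b"
proof
  let ?S = "{c \<in> carrier L. a \<sqinter> c \<sqsubseteq> b}"
  have S: "?S \<subseteq> carrier L" by blast
  assume "c \<sqsubseteq> a \<leadsto> b"
  then have "a \<sqinter> c \<sqsubseteq> a \<sqinter> (a \<leadsto> b)"
    using a c le_trans[OF meet_right[OF a c]] by (simp add: le_meet_iff meet_left)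
  also have "a \<sqinter> (a \<leadsto> b) = \<Squnion>((\<lambda>s. a \<sqinter> s) ` ?S)"
    unfolding heyting_imp_def by (rule meet_sup_distrib[OF a S])
  also have "\<dots> \<sqsubseteq> b"
    using a b by (intro sup_least) auto
  finally show "a \<sqinter> c \<sqsubseteq> b"
    using a b c S by (simp add: image_subset_iff)
next
  assume "a \<sqinter> c \<sqsubseteq> b"
  then show "c \<sqsubseteq> a \<leadsto> b"
    unfolding heyting_imp_def using c by (intro sup_upper) auto
qed

lemma le_imp: "a \<in> carrier L \<Longrightarrow> b \<in> carrier L \<Longrightarrow> b \<sqsubseteq> a \<leadsto> b"
  by (simp add: le_imp_iff meet_right)

lemma imp_eq_top_iff: "a \<in> carrier L \<Longrightarrow> b \<in> carrier L \<Longrightarrow> a \<leadsto> b = \<top> \<longleftrightarrow> a \<sqsubseteq> b"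
  using top_le_iff[of "a \<leadsto> b"] le_imp_iff[of a b "\<top>"] by simp

lemma imp_imp:
  assumes "a \<in> carrier L" "b \<in> carrier L" "c \<in> carrier L"
  shows "a \<leadsto> (b \<leadsto> c) = (a \<sqinter> b) \<leadsto> c"
proof (rule eq_by_lower)
  fix z assume z: "z \<in> carrier L"
  have "b \<sqinter> (a \<sqinter> z) = (a \<sqinter> b) \<sqinter> z"
    using assms z meet_assoc by (metis meet_commute)
  then show "z \<sqsubseteq> a \<leadsto> (b \<leadsto> c) \<longleftrightarrow> z \<sqsubseteq> (a \<sqinter> b) \<leadsto> c"
    using assms z by (simp add: le_imp_iff)
qed (use assms in auto)

lemma imp_idem: "a \<in> carrier L \<Longrightarrow> b \<in> carrier L \<Longrightarrow> a \<leadsto> (a \<leadsto> b) = a \<leadsto> b"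
  using imp_imp[of a a b] meet_eq_left[of a a] by simp

lemma imp_inf:
  assumes a: "a \<in> carrier L" and B: "B \<subseteq> carrier L"
  shows "a \<leadsto> \<Sqinter>B = \<Sqinter>((\<lambda>b. a \<leadsto> b) ` B)"
proof (rule inf_eqI[OF partial_order, symmetric])
  show "z \<sqsubseteq> a \<leadsto> \<Sqinter>B \<longleftrightarrow> (\<forall>x\<in>(\<lambda>b. a \<leadsto> b) ` B. z \<sqsubseteq> x)" if "z \<in> carrier L" for z
    using that a B le_inf_iff[of B "a \<sqinter> z"] by (auto simp: le_imp_iff subset_iff)
qed auto

lemma sup_imp:
  assumes c: "c \<in> carrier L" and A: "A \<subseteq> carrier L"
  shows "(\<Squnion>A) \<leadsto> c = \<Sqinter>((\<lambda>a. a \<leadsto> c) ` A)"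
proof (rule inf_eqI[OF partial_order, symmetric])
  fix z assume z: "z \<in> carrier L"
  have "z \<sqsubseteq> (\<Squnion>A) \<leadsto> c \<longleftrightarrow> z \<sqinter> \<Squnion>A \<sqsubseteq> c"
    using z A c by (simp add: le_imp_iff meet_commute)
  also have "z \<sqinter> \<Squnion>A = \<Squnion>((\<lambda>a. z \<sqinter> a) ` A)"
    by (rule meet_sup_distrib[OF z A])
  also have "\<dots> \<sqsubseteq> c \<longleftrightarrow> (\<forall>a\<in>A. z \<sqinter> a \<sqsubseteq> c)"
  proof -
    have "(\<lambda>a. z \<sqinter> a) ` A \<subseteq> carrier L"
      using z A by auto
    then show ?thesis
      using c sup_le_iff[of "(\<lambda>a. z \<sqinter> a) ` A" c] by simp
  qed
  also have "\<dots> \<longleftrightarrow> (\<forall>x\<in>(\<lambda>a. a \<leadsto> c) ` A. z \<sqsubseteq> x)"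
    using z A c by (auto simp: le_imp_iff meet_commute subset_iff)
  finally show "z \<sqsubseteq> (\<Squnion>A) \<leadsto> c \<longleftrightarrow> (\<forall>x\<in>(\<lambda>a. a \<leadsto> c) ` A. z \<sqsubseteq> x)" .
qed auto

lemma in_open_sublocale: "a \<in> carrier L \<Longrightarrow> x \<in> open_sublocale L a \<longleftrightarrow> x \<in> carrier L \<and> a \<leadsto> x = x"
  unfolding open_sublocale_def using imp_idem by force

lemma in_closed_sublocale: "x \<in> closed_sublocale L a \<longleftrightarrow> x \<in> carrier L \<and> a \<sqsubseteq> x"
  by (simp add: closed_sublocale_def)

lemma sublocale_closed: "is_sublocale L S \<Longrightarrow> x \<in> S \<Longrightarrow> x \<in> carrier L"
  by (auto simp: is_sublocale_def)

lemma sublocale_inf: "is_sublocale L S \<Longrightarrow> B \<subseteq> S \<Longrightarrow> \<Sqinter>B \<in> S"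
  by (simp add: is_sublocale_def)

lemma sublocale_imp: "is_sublocale L S \<Longrightarrow> a \<in> carrier L \<Longrightarrow> x \<in> S \<Longrightarrow> a \<leadsto> x \<in> S"
  by (simp add: is_sublocale_def)

lemma sublocale_top: "is_sublocale L S \<Longrightarrow> \<top> \<in> S"
  using sublocale_inf[of S "{}"] by (simp add: inf_empty_eq)

lemma is_sublocale_open:
  assumes a: "a \<in> carrier L"
  shows "is_sublocale L (open_sublocale L a)"
  unfolding is_sublocale_def
proof (intro conjI allI impI ballI)
  show "open_sublocale L a \<subseteq> carrier L"
    using a in_open_sublocale by blast
  show "\<Sqinter>B \<in> open_sublocale L a" if "B \<subseteq> open_sublocale L a" for B
  proof -
    have B: "B \<subseteq> carrier L" and "\<And>x. x \<in> B \<Longrightarrow> a \<leadsto> x = x"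
      using that a in_open_sublocale by auto
    then have "(\<lambda>b. a \<leadsto> b) ` B = B"
      by force
    then show ?thesis
      using imp_inf[OF a B] a B by (simp add: in_open_sublocale)
  qed
  show "c \<leadsto> s \<in> open_sublocale L a" if "c \<in> carrier L" "s \<in> open_sublocale L a" for c s
    using that a imp_imp[of a c s] imp_imp[of c a s] by (auto simp: in_open_sublocale meet_commute)
qed

lemma is_sublocale_closed:
  assumes a: "a \<in> carrier L"
  shows "is_sublocale L (closed_sublocale L a)"
  unfolding is_sublocale_def
proof (intro conjI allI impI ballI)
  show "closed_sublocale L a \<subseteq> carrier L"
    by (auto simp: closed_sublocale_def)
  show "\<Sqinter>B \<in> closed_sublocale L a" if "B \<subseteq> closed_sublocale L a" for B
    using that a by (auto simp: closed_sublocale_def subset_iff le_inf_iff)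
  show "c \<leadsto> s \<in> closed_sublocale L a" if "c \<in> carrier L" "s \<in> closed_sublocale L a" for c s
    using that a le_trans[OF _ le_imp[of c s]] by (auto simp: closed_sublocale_def)
qed

lemma is_sublocale_Int: "is_sublocale L S \<Longrightarrow> is_sublocale L T \<Longrightarrow> is_sublocale L (S \<inter> T)"
  by (auto simp: is_sublocale_def)

lemma is_sublocale_join:
  assumes \<F>: "\<And>S. S \<in> \<F> \<Longrightarrow> is_sublocale L S"
  shows "is_sublocale L (sublocale_join L \<F>)"
  unfolding is_sublocale_def
proof (intro conjI allI impI ballI)
  have sub: "\<Union>\<F> \<subseteq> carrier L"
    using \<F> sublocale_closed by blast
  then show "sublocale_join L \<F> \<subseteq> carrier L"
    by (auto simp: sublocale_join_def subset_iff)
  show "\<Sqinter>B \<in> sublocale_join L \<F>" if B: "B \<subseteq> sublocale_join L \<F>" for B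
  proof -
    obtain C where C: "\<And>b. b \<in> B \<Longrightarrow> C b \<subseteq> \<Union>\<F>" "\<And>b. b \<in> B \<Longrightarrow> b = \<Sqinter>(C b)"
      using B unfolding sublocale_join_def subset_iff mem_Collect_eq by metis
    have U: "(\<Union>b\<in>B. C b) \<subseteq> \<Union>\<F>" using C(1) by blast
    have BL: "B \<subseteq> carrier L"
      using B \<open>sublocale_join L \<F> \<subseteq> carrier L\<close> by blast
    have "\<Sqinter>B = \<Sqinter>(\<Union>b\<in>B. C b)"
    proof (rule inf_eqI[OF partial_order])
      fix y assume y: "y \<in> carrier L"
      have "y \<sqsubseteq> b \<longleftrightarrow> (\<forall>x\<in>C b. y \<sqsubseteq> x)" if "b \<in> B" for b
      proof -
        have "C b \<subseteq> carrier L" using C(1)[OF that] sub by blast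
        then show ?thesis using le_inf_iff[of "C b" y] C(2)[OF that] y by simp
      qed
      moreover have "(\<Union>b\<in>B. C b) \<subseteq> carrier L" using U sub by blast
      ultimately show "y \<sqsubseteq> \<Sqinter>(\<Union>b\<in>B. C b) \<longleftrightarrow> (\<forall>x\<in>B. y \<sqsubseteq> x)"
        using le_inf_iff[of "\<Union>b\<in>B. C b" y] y by auto
    next
      have "(\<Union>b\<in>B. C b) \<subseteq> carrier L" using U sub by blast
      then show "\<Sqinter>(\<Union>b\<in>B. C b) \<in> carrier L" by simp
    qed (rule BL)
    then show ?thesis
      using U unfolding sublocale_join_def by blast
  qed
  show "a \<leadsto> s \<in> sublocale_join L \<F>" if a: "a \<in> carrier L" and s: "s \<in> sublocale_join L \<F>" for a s
  proof -
    obtain B where B: "B \<subseteq> \<Union>\<F>" "s = \<Sqinter>B"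
      using s by (auto simp: sublocale_join_def)
    have "a \<leadsto> s = \<Sqinter>((\<lambda>b. a \<leadsto> b) ` B)"
      using imp_inf[OF a] B sub by blast
    moreover have "(\<lambda>b. a \<leadsto> b) ` B \<subseteq> \<Union>\<F>"
      using B(1) \<F> sublocale_imp a by blast
    ultimately show ?thesis
      unfolding sublocale_join_def by blast
  qed
qed

lemma sublocale_join_le_iff:
  assumes \<F>: "\<And>S. S \<in> \<F> \<Longrightarrow> is_sublocale L S" and T: "is_sublocale L T"
  shows "sublocale_join L \<F> \<subseteq> T \<longleftrightarrow> (\<forall>S\<in>\<F>. S \<subseteq> T)"
proof
  assume le: "sublocale_join L \<F> \<subseteq> T"
  have "x \<in> sublocale_join L \<F>" if "S \<in> \<F>" "x \<in> S" for S x
  proof -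
    have "\<Sqinter>{x} = x"
      using \<F>[OF that(1)] that(2) sublocale_closed by auto
    then show ?thesis
      using that unfolding sublocale_join_def by (intro CollectI exI[of _ "{x}"]) auto
  qed
  then show "\<forall>S\<in>\<F>. S \<subseteq> T"
    using le by blast
next
  assume "\<forall>S\<in>\<F>. S \<subseteq> T"
  then have "\<Union>\<F> \<subseteq> T"
    by blast
  then show "sublocale_join L \<F> \<subseteq> T"
    using sublocale_inf[OF T] by (auto simp: sublocale_join_def)
qed

lemma sublocales_partial_order: "partial_order (sublocales L)"
  by unfold_locales (auto simp: sublocales_def)

lemma sublocales_sup:
  assumes \<F>: "\<And>S. S \<in> \<F> \<Longrightarrow> is_sublocale L S"
  shows "\<Squnion>\<^bsub>sublocales L\<^esub> \<F> = sublocale_join L \<F>"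
  by (rule sup_eqI[OF sublocales_partial_order])
    (use \<F> is_sublocale_join[OF \<F>] sublocale_join_le_iff[OF \<F>] in \<open>auto simp: sublocales_def\<close>)

lemma difference_sublocale: "D \<in> differences L \<Longrightarrow> is_sublocale L D"
  unfolding differences_def using is_sublocale_open is_sublocale_closed is_sublocale_Int by blast

lemma in_Funayama_iff:
  "S \<in> carrier (Funayama L) \<longleftrightarrow>
     is_sublocale L S \<and> S = sublocale_join L {D \<in> differences L. D \<subseteq> S}"
proof
  assume "S \<in> carrier (Funayama L)"
  then obtain \<F> where \<F>: "\<F> \<subseteq> differences L" "S = \<Squnion>\<^bsub>sublocales L\<^esub> \<F>"
    by (auto simp: Funayama_def differences_def)
  have sl: "\<And>D. D \<in> \<F> \<Longrightarrow> is_sublocale L D"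
    using \<F>(1) difference_sublocale by blast
  have S: "S = sublocale_join L \<F>"
    using \<F>(2) sublocales_sup[OF sl] by simp
  have "is_sublocale L S"
    using is_sublocale_join[OF sl] S by simp
  moreover have "\<forall>D\<in>\<F>. D \<subseteq> S"
    using sublocale_join_le_iff[OF sl \<open>is_sublocale L S\<close>] S by blast
  then have "S \<subseteq> sublocale_join L {D \<in> differences L. D \<subseteq> S}"
    using \<F>(1) sublocale_join_mono[of \<F> "{D \<in> differences L. D \<subseteq> S}" L] S by blast
  moreover have "sublocale_join L {D \<in> differences L. D \<subseteq> S} \<subseteq> S"
    using sublocale_join_le_iff[of "{D \<in> differences L. D \<subseteq> S}"] \<open>is_sublocale L S\<close>
      difference_sublocale by blast
  ultimately show "is_sublocale L S \<and> S = sublocale_join L {D \<in> differences L. D \<subseteq> S}"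
    by blast
next
  assume "is_sublocale L S \<and> S = sublocale_join L {D \<in> differences L. D \<subseteq> S}"
  then have "S = \<Squnion>\<^bsub>sublocales L\<^esub> {D \<in> differences L. D \<subseteq> S}"
    using sublocales_sup[of "{D \<in> differences L. D \<subseteq> S}"] difference_sublocale by auto
  then show "S \<in> carrier (Funayama L)"
    by (force simp: Funayama_def differences_def)
qed

lemma Funayama_sublocale: "S \<in> carrier (Funayama L) \<Longrightarrow> is_sublocale L S"
  by (simp add: in_Funayama_iff)

lemma Funayama_le [simp]: "S \<sqsubseteq>\<^bsub>Funayama L\<^esub> T \<longleftrightarrow> S \<subseteq> T"
  and Funayama_eq [simp]: "eq (Funayama L) = (=)"
  by (auto simp: Funayama_def sublocales_def)

lemma Funayama_dense:
  assumes S: "S \<in> carrier (Funayama L)" and T: "is_sublocale L T"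
    and le: "\<And>D. D \<in> differences L \<Longrightarrow> D \<subseteq> S \<Longrightarrow> D \<subseteq> T"
  shows "S \<subseteq> T"
proof -
  have "sublocale_join L {D \<in> differences L. D \<subseteq> S} \<subseteq> T"
    using sublocale_join_le_iff[OF _ T, of "{D \<in> differences L. D \<subseteq> S}"] le difference_sublocale
    by blast
  then show ?thesis
    using S in_Funayama_iff by blast
qed

lemma Funayama_join_closed:
  assumes \<F>: "\<F> \<subseteq> carrier (Funayama L)"
  shows "sublocale_join L \<F> \<in> carrier (Funayama L)"
proof -
  let ?J = "sublocale_join L \<F>" let ?K = "sublocale_join L {D \<in> differences L. D \<subseteq> ?J}"
  have sl: "is_sublocale L S" if "S \<in> \<F>" for S
    using \<F> that Funayama_sublocale by blast
  have J: "is_sublocale L ?J" and K: "is_sublocale L ?K"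
    using is_sublocale_join[of \<F>] sl is_sublocale_join[of "{D \<in> differences L. D \<subseteq> ?J}"]
      difference_sublocale by auto
  have up: "S \<subseteq> ?J" if "S \<in> \<F>" for S
    using sublocale_join_le_iff[OF _ J] sl that by blast
  have upK: "D \<subseteq> ?K" if "D \<in> differences L" "D \<subseteq> ?J" for D
    using sublocale_join_le_iff[OF _ K, of "{D \<in> differences L. D \<subseteq> ?J}"] difference_sublocale that
    by blast
  have "S \<subseteq> ?K" if "S \<in> \<F>" for S
  proof (rule Funayama_dense[OF _ K])
    show "S \<in> carrier (Funayama L)"
      using that \<F> by blast
    show "D \<subseteq> ?K" if "D \<in> differences L" "D \<subseteq> S" for D
      using upK[OF that(1)] up[OF \<open>S \<in> \<F>\<close>] that(2) by simp
  qed
  then have "?J \<subseteq> ?K"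
    using sublocale_join_le_iff[OF _ K] sl by blast
  moreover have "?K \<subseteq> ?J"
    using sublocale_join_le_iff[OF _ J, of "{D \<in> differences L. D \<subseteq> ?J}"] difference_sublocale by blast
  ultimately show ?thesis
    using J in_Funayama_iff by blast
qed

lemma Funayama_complete: "complete_lattice (Funayama L)"
proof (rule complete_lattice_from_sups)
  fix S assume S: "S \<subseteq> carrier (Funayama L)"
  then show "\<exists>s\<in>carrier (Funayama L). \<forall>y\<in>carrier (Funayama L).
      s \<sqsubseteq>\<^bsub>Funayama L\<^esub> y \<longleftrightarrow> (\<forall>x\<in>S. x \<sqsubseteq>\<^bsub>Funayama L\<^esub> y)"
    using Funayama_join_closed[OF S] Funayama_sublocale sublocale_join_le_iff[of S]
    by (intro bexI[of _ "sublocale_join L S"]) (auto simp: subset_iff)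
qed auto

lemma Funayama_sup:
  assumes S: "S \<subseteq> carrier (Funayama L)"
  shows "\<Squnion>\<^bsub>Funayama L\<^esub> S = sublocale_join L S"
proof (rule sup_eqI[OF complete_lattice.partial_order[OF Funayama_complete] S Funayama_join_closed[OF S]])
  have "\<And>T. T \<in> S \<Longrightarrow> is_sublocale L T"
    using S Funayama_sublocale by blast
  then show "sublocale_join L S \<sqsubseteq>\<^bsub>Funayama L\<^esub> y \<longleftrightarrow> (\<forall>x\<in>S. x \<sqsubseteq>\<^bsub>Funayama L\<^esub> y)"
    if "y \<in> carrier (Funayama L)" for y
    using sublocale_join_le_iff[of S y] Funayama_sublocale[OF that] by simp
qed

lemma difference_in_Funayama: "D \<in> differences L \<Longrightarrow> D \<in> carrier (Funayama L)"
proof -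
  assume D: "D \<in> differences L"
  note sl = difference_sublocale
  have K: "is_sublocale L (sublocale_join L {E \<in> differences L. E \<subseteq> D})"
    by (rule is_sublocale_join) (use sl in blast)
  have "D \<subseteq> sublocale_join L {E \<in> differences L. E \<subseteq> D}"
    using sublocale_join_le_iff[OF _ K, of "{E \<in> differences L. E \<subseteq> D}"] sl D by blast
  moreover have "sublocale_join L {E \<in> differences L. E \<subseteq> D} \<subseteq> D"
    using sublocale_join_le_iff[OF _ sl[OF D], of "{E \<in> differences L. E \<subseteq> D}"] sl by blast
  ultimately show ?thesis
    using sl[OF D] in_Funayama_iff by blast
qed

lemma open_sublocale_Int:
  assumes a: "a \<in> carrier L" and b: "b \<in> carrier L"
  shows "open_sublocale L a \<inter> open_sublocale L b = open_sublocale L (a \<sqinter> b)"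
proof -
  have "a \<leadsto> x = x \<and> b \<leadsto> x = x \<longleftrightarrow> (a \<sqinter> b) \<leadsto> x = x" if x: "x \<in> carrier L" for x
  proof
    assume "a \<leadsto> x = x \<and> b \<leadsto> x = x"
    then show "(a \<sqinter> b) \<leadsto> x = x"
      using imp_imp[OF a b x] by simp
  next
    assume *: "(a \<sqinter> b) \<leadsto> x = x"
    then have "a \<leadsto> (b \<leadsto> x) = x" "b \<leadsto> (a \<leadsto> x) = x"
      using imp_imp[OF a b x] imp_imp[OF b a x] by (auto simp: meet_commute)
    then show "a \<leadsto> x = x \<and> b \<leadsto> x = x"
      using imp_idem[of a "b \<leadsto> x"] imp_idem[of b "a \<leadsto> x"] a b by simp
  qed
  then show ?thesis
    unfolding set_eq_iff Int_iff in_open_sublocale[OF a] in_open_sublocale[OF b]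
      in_open_sublocale[OF meet_closed[OF a b]] by blast
qed

lemma difference_Int:
  assumes "D \<in> differences L" "E \<in> differences L"
  shows "D \<inter> E \<in> differences L"
proof -
  obtain a b where D: "a \<in> carrier L" "b \<in> carrier L" "D = closed_sublocale L a \<inter> open_sublocale L b"
    using assms(1) by (auto simp: differences_def)
  obtain c d where E: "c \<in> carrier L" "d \<in> carrier L" "E = closed_sublocale L c \<inter> open_sublocale L d"
    using assms(2) by (auto simp: differences_def)
  have "closed_sublocale L a \<inter> closed_sublocale L c = closed_sublocale L (a \<squnion> c)"
    using D E by (auto simp: in_closed_sublocale join_le_iff)
  then have "D \<inter> E = closed_sublocale L (a \<squnion> c) \<inter> open_sublocale L (b \<sqinter> d)"
    using D E open_sublocale_Int[of b d] by blast
  then show ?thesis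
    unfolding differences_def using join_closed[OF D(1) E(1)] meet_closed[OF D(2) E(2)] by blast
qed

text \<open>A difference not contained in a sublocale \<open>S\<close> contains a non-trivial difference disjoint from \<open>S\<close>.\<close>

lemma difference_disjoint:
  assumes D: "D \<in> differences L" and S: "is_sublocale L S" and not_le: "\<not> D \<subseteq> S"
  shows "\<exists>E\<in>differences L. E \<subseteq> D \<and> E \<noteq> {\<top>} \<and> E \<inter> S = {\<top>}"
proof -
  obtain a b where ab: "a \<in> carrier L" "b \<in> carrier L" "D = closed_sublocale L a \<inter> open_sublocale L b"
    using D by (auto simp: differences_def)
  obtain y where "y \<in> D" "y \<notin> S"
    using not_le by blast
  then have y: "y \<in> carrier L" "a \<sqsubseteq> y" "b \<leadsto> y = y" "y \<notin> S"
    using ab in_open_sublocale in_closed_sublocale by auto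
  \<comment> \<open>For \<open>s\<close> the value at \<open>y\<close> of the nucleus of \<open>S\<close>, the witness is \<open>\<up>y \<inter> \<oo>(s \<and> b)\<close>.\<close>
  define s where "s = \<Sqinter>{t \<in> S. y \<sqsubseteq> t}"
  have sub: "{t \<in> S. y \<sqsubseteq> t} \<subseteq> carrier L"
    using S sublocale_closed by blast
  have s: "s \<in> carrier L" "s \<in> S" "y \<sqsubseteq> s"
    using sub sublocale_inf[OF S, of "{t \<in> S. y \<sqsubseteq> t}"] y(1) le_inf_iff[OF sub y(1)]
    by (auto simp: s_def)
  have s_least: "s \<sqsubseteq> t" if "t \<in> S" "y \<sqsubseteq> t" for t
    unfolding s_def using sub that by (intro inf_lower) auto
  have sb: "s \<sqinter> b \<in> carrier L" using s ab by simp
  let ?E = "closed_sublocale L y \<inter> open_sublocale L (s \<sqinter> b)"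
  have E: "?E \<in> differences L"
    using y sb unfolding differences_def by blast
  have "x \<in> D" if "x \<in> ?E" for x
  proof -
    have x: "x \<in> carrier L" "y \<sqsubseteq> x" "(s \<sqinter> b) \<leadsto> x = x"
      using that sb in_open_sublocale in_closed_sublocale by auto
    \<comment> \<open>Since \<open>((s \<and> b) \<rightarrow> x) = (b \<rightarrow> (s \<rightarrow> x))\<close>, this \<open>x\<close> is of the form \<open>b \<rightarrow> _\<close>, hence in \<open>\<oo>(b)\<close>.\<close>
    have "b \<leadsto> (s \<leadsto> x) = x"
      using imp_imp[of b s x] x s ab by (simp add: meet_commute)
    then have "b \<leadsto> x = x"
      using imp_idem[of b "s \<leadsto> x"] ab by simp
    moreover have "a \<sqsubseteq> x"
      using le_trans[OF y(2) x(2)] ab x y by simp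
    ultimately show ?thesis
      using ab x in_open_sublocale in_closed_sublocale by simp
  qed
  moreover have "?E \<noteq> {\<top>}"
  proof
    assume triv: "?E = {\<top>}"
    \<comment> \<open>If this element of \<open>?E\<close> is the top element, then \<open>s \<le> b \<rightarrow> y = y\<close>, and \<open>y\<close> lies in \<open>S\<close>.\<close>
    have "(s \<sqinter> b) \<leadsto> y \<in> ?E"
      using sb y le_imp imp_idem by (simp add: in_open_sublocale in_closed_sublocale)
    then have "(s \<sqinter> b) \<leadsto> y = \<top>"
      using triv by blast
    then have "s \<sqsubseteq> b \<leadsto> y"
      using imp_eq_top_iff[OF sb y(1)] le_imp_iff[OF ab(2) y(1) s(1)] by (simp add: meet_commute)
    then have "s = y"
      using s y le_antisym by simp
    then show False
      using s y by simp
  qed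
  moreover have "?E \<inter> S = {\<top>}"
  proof -
    have "x = \<top>" if "x \<in> ?E" "x \<in> S" for x
    proof -
      have x: "x \<in> carrier L" "y \<sqsubseteq> x" "(s \<sqinter> b) \<leadsto> x = x"
        using that sb in_open_sublocale in_closed_sublocale by auto
      have "s \<sqinter> b \<sqsubseteq> x"
        using le_trans[OF meet_left[OF s(1) ab(2)] s_least[OF that(2) x(2)]] s ab x by simp
      then show ?thesis
        using imp_eq_top_iff[OF sb x(1)] x(3) by simp
    qed
    then show ?thesis
      using sublocale_top[OF S] sublocale_top[OF difference_sublocale[OF E]] by blast
  qed
  ultimately show ?thesis
    using E by blast
qed

text \<open>A non-trivial difference below a join meets one of the joinands non-trivially.\<close>

lemma difference_cover:
  assumes D: "D \<in> differences L" "D \<noteq> {\<top>}" and \<F>: "\<F> \<subseteq> differences L" and le: "D \<subseteq> sublocale_join L \<F>"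
  shows "\<exists>S\<in>\<F>. D \<inter> S \<noteq> {\<top>}"
proof -
  obtain a b where ab: "a \<in> carrier L" "b \<in> carrier L" "D = closed_sublocale L a \<inter> open_sublocale L b"
    using D by (auto simp: differences_def)
  obtain y where y: "y \<in> D" "y \<noteq> \<top>"
    using D sublocale_top[OF difference_sublocale[OF D(1)]] by blast
  then have y': "y \<in> carrier L" "a \<sqsubseteq> y" "b \<leadsto> y = y"
    using ab in_open_sublocale in_closed_sublocale by auto
  have nb: "\<not> b \<sqsubseteq> y"
    using imp_eq_top_iff[OF ab(2) y'(1)] y y' by simp
  obtain B where B: "B \<subseteq> \<Union>\<F>" "y = \<Sqinter>B"
    using le y(1) by (auto simp: sublocale_join_def)
  have BL: "B \<subseteq> carrier L"
    using B(1) \<F> difference_sublocale sublocale_closed by blast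
  obtain t where t: "t \<in> B" "\<not> b \<sqsubseteq> t"
    using nb le_inf_iff[OF BL ab(2)] B(2) by blast
  obtain S where S: "S \<in> \<F>" "t \<in> S"
    using t(1) B(1) by blast
  have tL: "t \<in> carrier L" using t BL by blast
  have "y \<sqsubseteq> t"
    using inf_lower[OF BL t(1)] B(2) by simp
  then have "a \<sqsubseteq> t"
    using le_trans[OF y'(2)] ab y' tL by simp
  then have "a \<sqsubseteq> b \<leadsto> t"
    using le_trans[OF _ le_imp[OF ab(2) tL]] ab tL by simp
  then have "b \<leadsto> t \<in> D"
    using ab tL imp_idem by (simp add: in_open_sublocale in_closed_sublocale)
  moreover have "b \<leadsto> t \<in> S"
    using sublocale_imp[OF difference_sublocale ab(2) S(2)] \<F> S by blast
  moreover have "b \<leadsto> t \<noteq> \<top>"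
    using imp_eq_top_iff[OF ab(2) tL] t by simp
  ultimately show ?thesis
    using S(1) by blast
qed

lemma Funayama_cba: "is_cba (Funayama L)"
proof -
  interpret F: complete_lattice "Funayama L" by (rule Funayama_complete)
  have triv: "{\<top>} \<subseteq> S" if "is_sublocale L S" for S
    using sublocale_top[OF that] by simp
  show ?thesis
  proof (rule cba_from_dense_set[OF Funayama_complete, of "differences L - {{\<top>}}"])
    show "differences L - {{\<top>}} \<subseteq> carrier (Funayama L)"
      using difference_in_Funayama by blast
    show "S \<sqsubseteq>\<^bsub>Funayama L\<^esub> T" if "S \<in> carrier (Funayama L)" "T \<in> carrier (Funayama L)"
      "\<And>p. p \<in> differences L - {{\<top>}} \<Longrightarrow> p \<sqsubseteq>\<^bsub>Funayama L\<^esub> S \<Longrightarrow> p \<sqsubseteq>\<^bsub>Funayama L\<^esub> T" for S T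
    proof -
      have "D \<subseteq> T" if "D \<in> differences L" "D \<subseteq> S" for D
        using that \<open>\<And>p. p \<in> differences L - {{\<top>}} \<Longrightarrow> p \<sqsubseteq>\<^bsub>Funayama L\<^esub> S \<Longrightarrow> p \<sqsubseteq>\<^bsub>Funayama L\<^esub> T\<close>[of D]
          triv[OF Funayama_sublocale[OF \<open>T \<in> carrier (Funayama L)\<close>]] by (cases "D = {\<top>}") auto
      then show ?thesis
        using Funayama_dense[OF that(1) Funayama_sublocale[OF that(2)]] by simp
    qed
    show "\<exists>q\<in>differences L - {{\<top>}}. q \<sqsubseteq>\<^bsub>Funayama L\<^esub> D \<and>
        \<not> (\<exists>r\<in>differences L - {{\<top>}}. r \<sqsubseteq>\<^bsub>Funayama L\<^esub> q \<and> r \<sqsubseteq>\<^bsub>Funayama L\<^esub> S)"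
      if D: "D \<in> differences L - {{\<top>}}" and S: "S \<in> carrier (Funayama L)"
        and not_le: "\<not> D \<sqsubseteq>\<^bsub>Funayama L\<^esub> S" for D S
    proof -
      obtain E where E: "E \<in> differences L" "E \<subseteq> D" "E \<noteq> {\<top>}" "E \<inter> S = {\<top>}"
        using difference_disjoint[of D S] D not_le Funayama_sublocale[OF S] by auto
      have "G = {\<top>}" if "G \<in> differences L" "G \<subseteq> E" "G \<subseteq> S" for G
        using that E(4) triv[OF difference_sublocale[OF that(1)]] by blast
      then have "\<not> (\<exists>r\<in>differences L - {{\<top>}}. r \<sqsubseteq>\<^bsub>Funayama L\<^esub> E \<and> r \<sqsubseteq>\<^bsub>Funayama L\<^esub> S)"
        by (metis DiffE Funayama_le singletonI)
      then show ?thesis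
        using E by (intro bexI[of _ E]) auto
    qed
    show "\<exists>r\<in>differences L - {{\<top>}}. r \<sqsubseteq>\<^bsub>Funayama L\<^esub> D \<and> (\<exists>s\<in>\<S>. r \<sqsubseteq>\<^bsub>Funayama L\<^esub> s)"
      if D: "D \<in> differences L - {{\<top>}}" and \<S>: "\<S> \<subseteq> carrier (Funayama L)"
        and le: "D \<sqsubseteq>\<^bsub>Funayama L\<^esub> \<Squnion>\<^bsub>Funayama L\<^esub> \<S>" for D \<S>
    proof -
      \<comment> \<open>The join of \<open>\<S>\<close> is the join of the differences below its members, to which
        \<open>difference_cover\<close> applies.\<close>
      define \<F> where "\<F> = {E \<in> differences L. \<exists>S\<in>\<S>. E \<subseteq> S}"
      have \<F>: "\<F> \<subseteq> differences L"
        by (auto simp: \<F>_def)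
      have J: "is_sublocale L (sublocale_join L \<F>)"
        using is_sublocale_join difference_sublocale \<F> by blast
      have up: "E \<subseteq> sublocale_join L \<F>" if "E \<in> \<F>" for E
        using sublocale_join_le_iff[OF _ J] difference_sublocale \<F> that by blast
      have "S \<subseteq> sublocale_join L \<F>" if "S \<in> \<S>" for S
        by (rule Funayama_dense) (use that \<S> J up in \<open>auto simp: \<F>_def\<close>)
      then have "sublocale_join L \<S> \<subseteq> sublocale_join L \<F>"
        using sublocale_join_le_iff[OF _ J, of \<S>] \<S> Funayama_sublocale by blast
      then have "D \<subseteq> sublocale_join L \<F>"
        using le Funayama_sup[OF \<S>] by simp
      then obtain E where E: "E \<in> \<F>" "D \<inter> E \<noteq> {\<top>}"
        using difference_cover[OF _ _ \<F>, of D] D by auto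
      have "D \<inter> E \<in> differences L"
        using difference_Int[of D E] D E(1) \<F> by auto
      moreover obtain S where "S \<in> \<S>" "E \<subseteq> S"
        using E(1) unfolding \<F>_def by auto
      moreover have "D \<inter> E \<subseteq> S"
        using \<open>E \<subseteq> S\<close> by auto
      ultimately show ?thesis
        using E(2) by (intro bexI[of _ "D \<inter> E"] conjI bexI[of _ S]) simp_all
    qed
  qed
qed

lemma open_is_difference: "a \<in> carrier L \<Longrightarrow> open_sublocale L a \<in> differences L"
proof -
  assume a: "a \<in> carrier L"
  have "closed_sublocale L \<bottom> \<inter> open_sublocale L a = open_sublocale L a"
    using a in_open_sublocale in_closed_sublocale bottom_lower by auto
  then show ?thesis
    using a unfolding differences_def by blast
qed

lemma closed_is_difference: "a \<in> carrier L \<Longrightarrow> closed_sublocale L a \<in> differences L"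
proof -
  assume a: "a \<in> carrier L"
  have "\<top> \<leadsto> x = x" if "x \<in> carrier L" for x
    by (rule eq_by_lower) (use that le_imp_iff in auto)
  then have "closed_sublocale L a \<inter> open_sublocale L \<top> = closed_sublocale L a"
    using a in_open_sublocale in_closed_sublocale by auto
  then show ?thesis
    using a unfolding differences_def by blast
qed

lemma open_in_Funayama [simp]: "a \<in> carrier L \<Longrightarrow> open_sublocale L a \<in> carrier (Funayama L)"
  using open_is_difference difference_in_Funayama by blast

lemma open_sublocale_le_iff:
  assumes a: "a \<in> carrier L" and b: "b \<in> carrier L"
  shows "open_sublocale L a \<subseteq> open_sublocale L b \<longleftrightarrow> a \<sqsubseteq> b"
proof
  assume le: "open_sublocale L a \<subseteq> open_sublocale L b"
  have "a \<leadsto> b \<in> open_sublocale L b"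
    using le imp_idem[OF a b] in_open_sublocale[OF a, of "a \<leadsto> b"] by auto
  then have "b \<leadsto> (a \<leadsto> b) = a \<leadsto> b"
    using b in_open_sublocale by blast
  moreover have "b \<leadsto> (a \<leadsto> b) = \<top>"
    using imp_eq_top_iff[OF b imp_closed] le_imp[OF a b] by simp
  ultimately show "a \<sqsubseteq> b"
    using imp_eq_top_iff[OF a b] by simp
next
  assume le: "a \<sqsubseteq> b"
  show "open_sublocale L a \<subseteq> open_sublocale L b"
  proof
    fix x assume "x \<in> open_sublocale L a"
    then have x: "x \<in> carrier L" "a \<leadsto> x = x"
      using in_open_sublocale a by auto
    then have "b \<leadsto> x = (b \<sqinter> a) \<leadsto> x"
      using imp_imp[OF b a x(1)] by simp
    also have "b \<sqinter> a = a"
      using le a b meet_eq_left by (simp add: meet_commute)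
    finally show "x \<in> open_sublocale L b"
      using x b in_open_sublocale by simp
  qed
qed

lemma inj_on_open_sublocale: "inj_on (open_sublocale L) (carrier L)"
  by (rule inj_onI, rule le_antisym) (simp_all flip: open_sublocale_le_iff)

lemma Funayama_meet:
  assumes "S \<in> carrier (Funayama L)" "T \<in> carrier (Funayama L)" "S \<inter> T \<in> carrier (Funayama L)"
  shows "S \<sqinter>\<^bsub>Funayama L\<^esub> T = S \<inter> T"
  unfolding meet_def
  by (rule inf_eqI[OF complete_lattice.partial_order[OF Funayama_complete]]) (use assms in auto)

lemma Funayama_meet_difference:
  "D \<in> differences L \<Longrightarrow> E \<in> differences L \<Longrightarrow> D \<sqinter>\<^bsub>Funayama L\<^esub> E = D \<inter> E"
  using Funayama_meet difference_Int difference_in_Funayama by simp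

lemma open_sublocale_meet:
  assumes a: "a \<in> carrier L" and b: "b \<in> carrier L"
  shows "open_sublocale L (a \<sqinter> b) = open_sublocale L a \<sqinter>\<^bsub>Funayama L\<^esub> open_sublocale L b"
  using a b by (simp add: open_sublocale_Int Funayama_meet_difference open_is_difference)

lemma open_sublocale_top: "open_sublocale L \<top> = \<top>\<^bsub>Funayama L\<^esub>"
proof -
  interpret F: complete_lattice "Funayama L" by (rule Funayama_complete)
  have "\<top>\<^bsub>Funayama L\<^esub> \<subseteq> open_sublocale L \<top>"
  proof
    fix x assume "x \<in> \<top>\<^bsub>Funayama L\<^esub>"
    then have x: "x \<in> carrier L"
      using sublocale_closed[OF Funayama_sublocale[OF F.top_closed]] by blast
    moreover have "\<top> \<leadsto> x = x"
      by (rule eq_by_lower) (use x le_imp_iff in auto)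
    ultimately show "x \<in> open_sublocale L \<top>"
      using in_open_sublocale by simp
  qed
  then show ?thesis
    using F.top_le_iff[of "open_sublocale L \<top>"] by simp
qed

lemma open_sublocale_sup:
  assumes A: "A \<subseteq> carrier L"
  shows "open_sublocale L (\<Squnion>A) = \<Squnion>\<^bsub>Funayama L\<^esub> (open_sublocale L ` A)"
proof -
  have sub: "open_sublocale L ` A \<subseteq> carrier (Funayama L)"
    using A by auto
  have "open_sublocale L (\<Squnion>A) \<subseteq> sublocale_join L (open_sublocale L ` A)"
  proof
    fix x assume "x \<in> open_sublocale L (\<Squnion>A)"
    then have x: "x \<in> carrier L" "x = \<Sqinter>((\<lambda>a. a \<leadsto> x) ` A)"
      using A in_open_sublocale sup_imp[OF _ A, of x] by auto
    have "(\<lambda>a. a \<leadsto> x) ` A \<subseteq> \<Union>(open_sublocale L ` A)"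
    proof -
      have "a \<leadsto> x \<in> open_sublocale L a" if "a \<in> A" for a
        using A x(1) imp_idem[of a x] in_open_sublocale[of a] that by auto
      then show ?thesis by blast
    qed
    then show "x \<in> sublocale_join L (open_sublocale L ` A)"
      using x(2) unfolding sublocale_join_def by blast
  qed
  moreover have "sublocale_join L (open_sublocale L ` A) \<subseteq> open_sublocale L (\<Squnion>A)"
    using sublocale_join_le_iff[of "open_sublocale L ` A" "open_sublocale L (\<Squnion>A)"]
      A is_sublocale_open open_sublocale_le_iff sup_upper[OF A] by (auto simp: subset_iff)
  ultimately show ?thesis
    using Funayama_sup[OF sub] by simp
qed

lemma subframe_Funayama: "is_subframe (open_sublocale L ` carrier L) (Funayama L)"
  unfolding is_subframe_def
proof (intro conjI ballI allI impI)
  show "\<top>\<^bsub>Funayama L\<^esub> \<in> open_sublocale L ` carrier L"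
    using open_sublocale_top by (metis imageI top_closed)
  show "S \<sqinter>\<^bsub>Funayama L\<^esub> T \<in> open_sublocale L ` carrier L"
    if "S \<in> open_sublocale L ` carrier L" "T \<in> open_sublocale L ` carrier L" for S T
    using that open_sublocale_meet by (auto simp flip: open_sublocale_meet)
  show "\<Squnion>\<^bsub>Funayama L\<^esub> S \<in> open_sublocale L ` carrier L" if "S \<subseteq> open_sublocale L ` carrier L" for S
  proof -
    obtain A where "A \<subseteq> carrier L" "S = open_sublocale L ` A"
      using \<open>S \<subseteq> open_sublocale L ` carrier L\<close> by (auto simp: subset_image_iff)
    then show ?thesis
      using open_sublocale_sup sup_closed by (metis imageI)
  qed
qed auto

lemma compl_open_sublocale:
  assumes a: "a \<in> carrier L"
  shows "compl (Funayama L) (open_sublocale L a) = closed_sublocale L a"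
proof -
  interpret F: complete_boolean_algebra "Funayama L" by unfold_locales (rule Funayama_cba)
  have c: "closed_sublocale L a \<in> carrier (Funayama L)"
    using closed_is_difference[OF a] difference_in_Funayama by blast
  have "x = \<top>" if "x \<in> open_sublocale L a \<inter> closed_sublocale L a" for x
    using that a imp_eq_top_iff[of a x] by (auto simp: in_open_sublocale in_closed_sublocale)
  then have "open_sublocale L a \<sqinter>\<^bsub>Funayama L\<^esub> closed_sublocale L a \<subseteq> {\<top>}"
    using a by (auto simp: Funayama_meet_difference open_is_difference closed_is_difference)
  moreover have "{\<top>} \<subseteq> \<bottom>\<^bsub>Funayama L\<^esub>"
    using sublocale_top[OF Funayama_sublocale[OF F.bottom_closed]] by simp
  ultimately have "open_sublocale L a \<sqinter>\<^bsub>Funayama L\<^esub> closed_sublocale L a = \<bottom>\<^bsub>Funayama L\<^esub>"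
    using F.le_bottom_iff[OF F.meet_closed[OF open_in_Funayama[OF a] c]] by auto
  moreover have "\<top>\<^bsub>Funayama L\<^esub> \<subseteq> open_sublocale L a \<squnion>\<^bsub>Funayama L\<^esub> closed_sublocale L a"
  proof
    fix x assume "x \<in> \<top>\<^bsub>Funayama L\<^esub>"
    then have x: "x \<in> carrier L"
      using sublocale_closed[OF Funayama_sublocale[OF F.top_closed]] by blast
    \<comment> \<open>The open and the closed sublocale of \<open>a\<close> are jointly everything, since
      \<open>x = (a \<rightarrow> x) \<and> (a \<or> x)\<close>.\<close>
    have "\<Sqinter>{a \<leadsto> x, a \<squnion> x} = x"
    proof (rule inf_eqI[OF partial_order])
      fix y assume y: "y \<in> carrier L"
      have "y \<sqsubseteq> x" if "y \<sqsubseteq> a \<leadsto> x" "y \<sqsubseteq> a \<squnion> x"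
      proof -
        have ay: "y \<sqinter> a \<sqsubseteq> x"
          using that(1) le_imp_iff[OF a x y] by (simp add: meet_commute)
        have "y = y \<sqinter> \<Squnion>{a, x}"
          using that(2) meet_eq_left[of y "a \<squnion> x"] a x y by (simp add: join_def)
        also have "\<dots> = \<Squnion>((\<lambda>s. y \<sqinter> s) ` {a, x})"
          using a x y by (intro meet_sup_distrib) auto
        also have "\<dots> \<sqsubseteq> x"
          using ay a x y by (intro sup_least) (auto simp: meet_right)
        finally show ?thesis .
      qed
      moreover have "y \<sqsubseteq> a \<leadsto> x \<and> y \<sqsubseteq> a \<squnion> x" if "y \<sqsubseteq> x"
        using le_trans[OF that le_imp[OF a x]] le_trans[OF that join_right[OF a x]] a x y by simp
      ultimately show "y \<sqsubseteq> x \<longleftrightarrow> (\<forall>z\<in>{a \<leadsto> x, a \<squnion> x}. y \<sqsubseteq> z)"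
        by auto
    qed (use a x in auto)
    moreover have "{a \<leadsto> x, a \<squnion> x} \<subseteq> \<Union>{open_sublocale L a, closed_sublocale L a}"
      using a x imp_idem by (simp add: in_open_sublocale in_closed_sublocale join_left)
    ultimately have "x \<in> sublocale_join L {open_sublocale L a, closed_sublocale L a}"
      unfolding sublocale_join_def by (metis (mono_tags, lifting) mem_Collect_eq)
    then show "x \<in> open_sublocale L a \<squnion>\<^bsub>Funayama L\<^esub> closed_sublocale L a"
      using Funayama_sup[of "{open_sublocale L a, closed_sublocale L a}"] a c by (simp add: join_def)
  qed
  then have "open_sublocale L a \<squnion>\<^bsub>Funayama L\<^esub> closed_sublocale L a = \<top>\<^bsub>Funayama L\<^esub>"
    using F.top_le_iff[OF F.join_closed[OF open_in_Funayama[OF a] c]] by simp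
  ultimately show ?thesis
    using a c by (intro F.compl_eqI) (auto simp: is_complement_def)
qed

lemma difference_eq_meet_compl:
  "a \<in> carrier L \<Longrightarrow> b \<in> carrier L \<Longrightarrow> closed_sublocale L a \<inter> open_sublocale L b =
     open_sublocale L b \<sqinter>\<^bsub>Funayama L\<^esub> compl (Funayama L) (open_sublocale L a)"
  by (simp add: compl_open_sublocale Funayama_meet_difference open_is_difference
      closed_is_difference Int_commute)

lemma Funayama_difference_generated:
  "difference_generated (open_sublocale L ` carrier L) (Funayama L)"
  unfolding difference_generated_def
proof
  fix S assume S: "S \<in> carrier (Funayama L)"
  let ?F = "{D \<in> differences L. D \<subseteq> S}"
  have "?F \<subseteq> carrier (Funayama L)"
    using difference_in_Funayama by blast
  then have "S = \<Squnion>\<^bsub>Funayama L\<^esub> ?F"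
    using S in_Funayama_iff Funayama_sup by simp
  moreover have "?F \<subseteq> {b \<sqinter>\<^bsub>Funayama L\<^esub> compl (Funayama L) a | a b.
      a \<in> open_sublocale L ` carrier L \<and> b \<in> open_sublocale L ` carrier L}"
    using difference_eq_meet_compl unfolding differences_def by blast
  ultimately show "\<exists>F. F \<subseteq> {b \<sqinter>\<^bsub>Funayama L\<^esub> compl (Funayama L) a | a b.
      a \<in> open_sublocale L ` carrier L \<and> b \<in> open_sublocale L ` carrier L} \<and> S = \<Squnion>\<^bsub>Funayama L\<^esub> F"
    by blast
qed

end

section \<open>Concrete categories\<close>

lemma is_categoryI:
  fixes C :: "('o, 'u::universe) cat" and u :: "'o \<Rightarrow> 'u set"
  assumes Cmp: "Cmp C = vcomp" and Idt: "\<And>a. a \<in> Ob C \<Longrightarrow> Idt C a = vid (u a)"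
    and small: "\<And>a. a \<in> Ob C \<Longrightarrow> small (u a)"
    and Hom: "\<And>a b f. a \<in> Ob C \<Longrightarrow> b \<in> Ob C \<Longrightarrow> f \<in> Hom C a b \<Longrightarrow> f \<in> maps (u a) (u b)"
    and id: "\<And>a. a \<in> Ob C \<Longrightarrow> vid (u a) \<in> Hom C a a"
    and comp: "\<And>a b c f g. a \<in> Ob C \<Longrightarrow> b \<in> Ob C \<Longrightarrow> c \<in> Ob C \<Longrightarrow> f \<in> Hom C a b \<Longrightarrow>
      g \<in> Hom C b c \<Longrightarrow> vcomp g f \<in> Hom C a c"
  shows "is_category C"
  unfolding is_category_def Cmp
proof (intro conjI ballI)
  fix a b c d f g h
  assume "a \<in> Ob C" "b \<in> Ob C" "c \<in> Ob C" "d \<in> Ob C"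
    and "f \<in> Hom C a b" "g \<in> Hom C b c" "h \<in> Hom C c d"
  then show "vcomp h (vcomp g f) = vcomp (vcomp h g) f"
    using vcomp_assoc[of "u a" "u b" f g "u c" h] small Hom by blast
next
  fix a b f assume "a \<in> Ob C" "b \<in> Ob C" "f \<in> Hom C a b"
  then show "vcomp f (Idt C a) = f" "vcomp (Idt C b) f = f"
    using Idt small Hom vcomp_vid_right[of "u a" f "u b"] vcomp_vid_left[of "u a" "u b" f] by auto
next
  fix a assume "a \<in> Ob C" then show "Idt C a \<in> Hom C a a"
    using Idt id by simp
next
  fix a b c f g
  assume "a \<in> Ob C" "b \<in> Ob C" "c \<in> Ob C" "f \<in> Hom C a b" "g \<in> Hom C b c"
  then show "vcomp g f \<in> Hom C a c"
    by (rule comp)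
qed

lemma inverse_arrows_unique:
  assumes C: "is_category C" and ab: "a \<in> Ob C" "b \<in> Ob C"
    and g: "inverse_arrows C a b f g" and h: "inverse_arrows C a b f h"
  shows "g = h"
proof -
  have f: "f \<in> Hom C a b" and g': "g \<in> Hom C b a" "Cmp C f g = Idt C b"
    and h': "h \<in> Hom C b a" "Cmp C h f = Idt C a"
    using g h by (auto simp: inverse_arrows_def)
  have "Cmp C h (Cmp C f g) = Cmp C (Cmp C h f) g"
    using C ab f g'(1) h'(1) unfolding is_category_def by blast
  moreover have "Cmp C h (Idt C b) = h" "Cmp C (Idt C a) g = g"
    using C ab g'(1) h'(1) unfolding is_category_def by blast+
  ultimately show ?thesis
    using g'(2) h'(2) by simp
qed

lemma inv_arr_eqI:
  "is_category C \<Longrightarrow> a \<in> Ob C \<Longrightarrow> b \<in> Ob C \<Longrightarrow> inverse_arrows C a b f g \<Longrightarrow> inv_arr C a b f = g"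
  unfolding inv_arr_def using inverse_arrows_unique by (metis the_equality)

lemma inverse_arrows_comp:
  assumes C: "is_category C" and abc: "a \<in> Ob C" "b \<in> Ob C" "c \<in> Ob C"
    and f: "inverse_arrows C a b f f'" and g: "inverse_arrows C b c g g'"
  shows "inverse_arrows C a c (Cmp C g f) (Cmp C f' g')"
proof -
  have f': "f \<in> Hom C a b" "f' \<in> Hom C b a" "Cmp C f' f = Idt C a" "Cmp C f f' = Idt C b"
    and g': "g \<in> Hom C b c" "g' \<in> Hom C c b" "Cmp C g' g = Idt C b" "Cmp C g g' = Idt C c"
    using f g by (auto simp: inverse_arrows_def)
  have assoc: "\<And>a b c d f g h. a \<in> Ob C \<Longrightarrow> b \<in> Ob C \<Longrightarrow> c \<in> Ob C \<Longrightarrow> d \<in> Ob C \<Longrightarrow> f \<in> Hom C a b \<Longrightarrow>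
      g \<in> Hom C b c \<Longrightarrow> h \<in> Hom C c d \<Longrightarrow> Cmp C h (Cmp C g f) = Cmp C (Cmp C h g) f"
    and comp: "\<And>a b c f g. a \<in> Ob C \<Longrightarrow> b \<in> Ob C \<Longrightarrow> c \<in> Ob C \<Longrightarrow> f \<in> Hom C a b \<Longrightarrow>
      g \<in> Hom C b c \<Longrightarrow> Cmp C g f \<in> Hom C a c"
    and unit: "\<And>a b f. a \<in> Ob C \<Longrightarrow> b \<in> Ob C \<Longrightarrow> f \<in> Hom C a b \<Longrightarrow> Cmp C (Idt C b) f = f"
    using C by (auto simp: is_category_def)
  have "Cmp C (Cmp C f' g') (Cmp C g f) = Cmp C f' (Cmp C g' (Cmp C g f))"
    using assoc[OF abc(1) abc(3) abc(2) abc(1) comp[OF abc f'(1) g'(1)] g'(2) f'(2)] by simp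
  also have "Cmp C g' (Cmp C g f) = f"
    using assoc[OF abc abc(2) f'(1) g'(1) g'(2)] unit[OF abc(1,2) f'(1)] g' by simp
  finally have 1: "Cmp C (Cmp C f' g') (Cmp C g f) = Idt C a"
    using f' by simp
  have "Cmp C (Cmp C g f) (Cmp C f' g') = Cmp C g (Cmp C f (Cmp C f' g'))"
    using assoc[OF abc(3) abc(1) abc(2) abc(3) comp[OF abc(3) abc(2) abc(1) g'(2) f'(2)] f'(1) g'(1)] by simp
  also have "Cmp C f (Cmp C f' g') = g'"
    using assoc[OF abc(3) abc(2) abc(1) abc(2) g'(2) f'(2) f'(1)] unit[OF abc(3,2) g'(2)] f' by simp
  finally have 2: "Cmp C (Cmp C g f) (Cmp C f' g') = Idt C c"
    using g' by simp
  show ?thesis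
    unfolding inverse_arrows_def
    using 1 2 comp[OF abc f'(1) g'(1)] comp[OF abc(3) abc(2) abc(1) g'(2) f'(2)] by simp
qed

lemma inverse_arrows_sym: "inverse_arrows C a b f g \<longleftrightarrow> inverse_arrows C b a g f"
  by (auto simp: inverse_arrows_def)

lemma inverse_arrows_Idt: "is_category C \<Longrightarrow> a \<in> Ob C \<Longrightarrow> inverse_arrows C a a (Idt C a) (Idt C a)"
  by (auto simp: inverse_arrows_def is_category_def)

lemma is_iso_Idt: "is_category C \<Longrightarrow> a \<in> Ob C \<Longrightarrow> is_iso C a a (Idt C a)"
  unfolding is_iso_def by (intro exI) (rule inverse_arrows_Idt)

section \<open>Frames\<close>

lemma Ob_Frm: "L \<in> Ob Frm \<longleftrightarrow> small (carrier L) \<and> is_frame L"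
  by (simp add: Frm_def)

lemma Hom_Frm: "f \<in> Hom Frm L L' \<longleftrightarrow> f \<in> maps (carrier L) (carrier L') \<and> is_frame_hom L L' (app f)"
  by (simp add: Frm_def)

lemma Frm_simps [simp]: "Cmp Frm = vcomp" "Idt Frm L = vid (carrier L)"
  by (simp_all add: Frm_def)

lemma frame_hom_closed: "is_frame_hom L M f \<Longrightarrow> a \<in> carrier L \<Longrightarrow> f a \<in> carrier M"
  by (auto simp: is_frame_hom_def)

lemma frame_hom_cong:
  assumes L: "is_frame L" and eq: "\<And>a. a \<in> carrier L \<Longrightarrow> f a = g a"
  shows "is_frame_hom L M f \<longleftrightarrow> is_frame_hom L M g"
proof -
  interpret frame L by unfold_locales (rule L)
  have "f ` S = g ` S" if "S \<subseteq> carrier L" for S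
    using that eq by (auto intro!: image_cong)
  then show ?thesis
    using eq by (auto simp: is_frame_hom_def Pi_iff)
qed

lemma frame_hom_mono:
  assumes "is_frame L" "is_frame M" "is_frame_hom L M f" "a \<in> carrier L" "b \<in> carrier L" "a \<sqsubseteq>\<^bsub>L\<^esub> b"
  shows "f a \<sqsubseteq>\<^bsub>M\<^esub> f b"
proof -
  interpret L: frame L by unfold_locales (rule assms)
  interpret M: frame M by unfold_locales (rule assms)
  have "f (a \<sqinter>\<^bsub>L\<^esub> b) = f a \<sqinter>\<^bsub>M\<^esub> f b"
    using assms by (simp add: is_frame_hom_def)
  then show ?thesis
    using assms frame_hom_closed[OF assms(3)] by (simp add: L.meet_eq_left M.meet_eq_left)
qed

lemma is_category_Frm: "is_category (Frm :: ('u::universe gorder, 'u) cat)"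
proof (rule is_categoryI[where u = carrier])
  show "vid (carrier a) \<in> Hom Frm a a" if "a \<in> Ob Frm" for a :: "'u gorder"
  proof -
    have "is_frame_hom a a (\<lambda>x. x)"
      by (simp add: is_frame_hom_def)
    then have "is_frame_hom a a (app (vid (carrier a)))"
      using that frame_hom_cong[of a "app (vid (carrier a))" "\<lambda>x. x" a] by (simp add: Ob_Frm)
    then show ?thesis by (simp add: Hom_Frm vid_maps)
  qed
  show "vcomp g f \<in> Hom Frm a c" if "a \<in> Ob Frm" "b \<in> Ob Frm" "c \<in> Ob Frm" "f \<in> Hom Frm a b" "g \<in> Hom Frm b c"
    for a b c :: "'u gorder" and f g
  proof -
    have sm: "small (carrier a)" "small (carrier b)" and fr: "is_frame a"
      and f: "f \<in> maps (carrier a) (carrier b)" "is_frame_hom a b (app f)"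
      and g: "g \<in> maps (carrier b) (carrier c)" "is_frame_hom b c (app g)"
      using that by (auto simp: Ob_Frm Hom_Frm)
    have "app f ` S \<subseteq> carrier b" if "S \<subseteq> carrier a" for S
      using that f by (auto simp: is_frame_hom_def)
    then have "is_frame_hom a c (\<lambda>x. app g (app f x))"
      using f(2) g(2) by (auto simp: is_frame_hom_def Pi_iff image_image)
    then have "is_frame_hom a c (app (vcomp g f))"
      using frame_hom_cong[OF fr, of "app (vcomp g f)" "\<lambda>x. app g (app f x)" c] app_vcomp[OF sm(1) f(1)]
      by simp
    then show ?thesis
      using vcomp_maps[OF sm f(1) g(1)] by (simp add: Hom_Frm)
  qed
qed (auto simp: Ob_Frm Hom_Frm)

lemma inverse_arrows_FrmD:
  assumes "inverse_arrows Frm L L' \<theta> \<theta>'" "L \<in> Ob Frm" "L' \<in> Ob Frm"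
  shows "\<And>a. a \<in> carrier L \<Longrightarrow> app \<theta> a \<in> carrier L'" "\<And>b. b \<in> carrier L' \<Longrightarrow> app \<theta>' b \<in> carrier L"
    "\<And>a. a \<in> carrier L \<Longrightarrow> app \<theta>' (app \<theta> a) = a" "\<And>b. b \<in> carrier L' \<Longrightarrow> app \<theta> (app \<theta>' b) = b"
    "\<And>a b. a \<in> carrier L \<Longrightarrow> b \<in> carrier L \<Longrightarrow> app \<theta> a \<sqsubseteq>\<^bsub>L'\<^esub> app \<theta> b \<longleftrightarrow> a \<sqsubseteq>\<^bsub>L\<^esub> b"
proof -
  have sm: "small (carrier L)" "small (carrier L')" and fr: "is_frame L" "is_frame L'"
    using assms by (auto simp: Ob_Frm)
  have m: "\<theta> \<in> maps (carrier L) (carrier L')" "\<theta>' \<in> maps (carrier L') (carrier L)"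
    and h: "is_frame_hom L L' (app \<theta>)" "is_frame_hom L' L (app \<theta>')"
    and c: "vcomp \<theta>' \<theta> = vid (carrier L)" "vcomp \<theta> \<theta>' = vid (carrier L')"
    using assms(1) by (auto simp: inverse_arrows_def Hom_Frm)
  show 1: "\<And>a. a \<in> carrier L \<Longrightarrow> app \<theta> a \<in> carrier L'" and 2: "\<And>b. b \<in> carrier L' \<Longrightarrow> app \<theta>' b \<in> carrier L"
    using app_maps m sm by blast+
  show 3: "app \<theta>' (app \<theta> a) = a" if "a \<in> carrier L" for a
    using app_vcomp[OF sm(1) m(1) that, of \<theta>'] c sm that by simp
  show "app \<theta> (app \<theta>' b) = b" if "b \<in> carrier L'" for b
    using app_vcomp[OF sm(2) m(2) that, of \<theta>] c sm that by simp
  show "app \<theta> a \<sqsubseteq>\<^bsub>L'\<^esub> app \<theta> b \<longleftrightarrow> a \<sqsubseteq>\<^bsub>L\<^esub> b" if "a \<in> carrier L" "b \<in> carrier L" for a b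
    using frame_hom_mono[OF fr h(1) that] frame_hom_mono[OF fr(2,1) h(2) 1[OF that(1)] 1[OF that(2)]]
    unfolding 3[OF that(1)] 3[OF that(2)] by blast
qed

text \<open>Order isomorphisms preserve all the structure in question.\<close>

lemma order_iso_sup:
  assumes M: "complete_lattice M" and N: "partial_order N" and bij: "bij_betw f (carrier M) (carrier N)"
    and le: "\<And>x y. x \<in> carrier M \<Longrightarrow> y \<in> carrier M \<Longrightarrow> f x \<sqsubseteq>\<^bsub>N\<^esub> f y \<longleftrightarrow> x \<sqsubseteq>\<^bsub>M\<^esub> y"
    and S: "S \<subseteq> carrier M"
  shows "\<Squnion>\<^bsub>N\<^esub> (f ` S) = f (\<Squnion>\<^bsub>M\<^esub> S)"
proof (rule sup_eqI[OF N])
  interpret complete_lattice M by (rule M)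
  have f: "f ` carrier M = carrier N" using bij by (simp add: bij_betw_def)
  then show "f ` S \<subseteq> carrier N" "f (\<Squnion>\<^bsub>M\<^esub> S) \<in> carrier N"
    using S sup_closed[OF S] by blast+
  fix y assume "y \<in> carrier N"
  then obtain z where z: "z \<in> carrier M" "y = f z"
    using f by blast
  have "f x \<sqsubseteq>\<^bsub>N\<^esub> f z \<longleftrightarrow> x \<sqsubseteq>\<^bsub>M\<^esub> z" if "x \<in> S" for x
    by (rule le) (use z S that in auto)
  then show "f (\<Squnion>\<^bsub>M\<^esub> S) \<sqsubseteq>\<^bsub>N\<^esub> y \<longleftrightarrow> (\<forall>x\<in>f ` S. x \<sqsubseteq>\<^bsub>N\<^esub> y)"
    using z S le[of "\<Squnion>\<^bsub>M\<^esub> S" z] sup_le_iff[of S z] by simp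
qed

lemma order_iso_inf:
  assumes M: "complete_lattice M" and N: "partial_order N" and bij: "bij_betw f (carrier M) (carrier N)"
    and le: "\<And>x y. x \<in> carrier M \<Longrightarrow> y \<in> carrier M \<Longrightarrow> f x \<sqsubseteq>\<^bsub>N\<^esub> f y \<longleftrightarrow> x \<sqsubseteq>\<^bsub>M\<^esub> y"
    and S: "S \<subseteq> carrier M"
  shows "\<Sqinter>\<^bsub>N\<^esub> (f ` S) = f (\<Sqinter>\<^bsub>M\<^esub> S)"
proof (rule inf_eqI[OF N])
  interpret complete_lattice M by (rule M)
  have f: "f ` carrier M = carrier N" using bij by (simp add: bij_betw_def)
  then show "f ` S \<subseteq> carrier N" "f (\<Sqinter>\<^bsub>M\<^esub> S) \<in> carrier N"
    using S inf_closed[OF S] by blast+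
  fix y assume "y \<in> carrier N"
  then obtain z where z: "z \<in> carrier M" "y = f z"
    using f by blast
  have "f z \<sqsubseteq>\<^bsub>N\<^esub> f x \<longleftrightarrow> z \<sqsubseteq>\<^bsub>M\<^esub> x" if "x \<in> S" for x
    by (rule le) (use z S that in auto)
  then show "y \<sqsubseteq>\<^bsub>N\<^esub> f (\<Sqinter>\<^bsub>M\<^esub> S) \<longleftrightarrow> (\<forall>x\<in>f ` S. y \<sqsubseteq>\<^bsub>N\<^esub> x)"
    using z S le[of z "\<Sqinter>\<^bsub>M\<^esub> S"] le_inf_iff[of S z] by simp
qed

lemma order_iso_complete_lattice:
  assumes M: "complete_lattice M" and bij: "bij_betw f (carrier M) (carrier N)" and eq: "eq N = (=)"
    and le: "\<And>x y. x \<in> carrier M \<Longrightarrow> y \<in> carrier M \<Longrightarrow> f x \<sqsubseteq>\<^bsub>N\<^esub> f y \<longleftrightarrow> x \<sqsubseteq>\<^bsub>M\<^esub> y"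
  shows "complete_lattice N"
proof -
  interpret complete_lattice M by (rule M)
  have f: "carrier N = f ` carrier M" using bij by (simp add: bij_betw_def)
  show ?thesis
  proof (rule complete_lattice_from_sups[OF eq])
    show "x = y" if "x \<in> carrier N" "y \<in> carrier N" "x \<sqsubseteq>\<^bsub>N\<^esub> y" "y \<sqsubseteq>\<^bsub>N\<^esub> x" for x y
    proof -
      obtain a b where "a \<in> carrier M" "b \<in> carrier M" "x = f a" "y = f b"
        using \<open>x \<in> carrier N\<close> \<open>y \<in> carrier N\<close> unfolding f by blast
      then show ?thesis
        using le_antisym[of a b] \<open>x \<sqsubseteq>\<^bsub>N\<^esub> y\<close> \<open>y \<sqsubseteq>\<^bsub>N\<^esub> x\<close> le by simp
    qed
    show "x \<sqsubseteq>\<^bsub>N\<^esub> z" if "x \<in> carrier N" "y \<in> carrier N" "z \<in> carrier N" "x \<sqsubseteq>\<^bsub>N\<^esub> y" "y \<sqsubseteq>\<^bsub>N\<^esub> z" for x y z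
    proof -
      obtain a b c where "a \<in> carrier M" "b \<in> carrier M" "c \<in> carrier M" "x = f a" "y = f b" "z = f c"
        using \<open>x \<in> carrier N\<close> \<open>y \<in> carrier N\<close> \<open>z \<in> carrier N\<close> unfolding f by blast
      then show ?thesis
        using le_trans[of a b c] \<open>x \<sqsubseteq>\<^bsub>N\<^esub> y\<close> \<open>y \<sqsubseteq>\<^bsub>N\<^esub> z\<close> le by simp
    qed
    show "x \<sqsubseteq>\<^bsub>N\<^esub> x" if "x \<in> carrier N" for x
      using that le unfolding f by auto
    fix S assume "S \<subseteq> carrier N"
    then obtain T where T: "T \<subseteq> carrier M" "S = f ` T"
      unfolding f by (auto simp: subset_image_iff)
    have "f (\<Squnion>\<^bsub>M\<^esub> T) \<sqsubseteq>\<^bsub>N\<^esub> f z \<longleftrightarrow> (\<forall>x\<in>T. f x \<sqsubseteq>\<^bsub>N\<^esub> f z)" if "z \<in> carrier M" for z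
      using that T(1) le sup_le_iff[OF T(1) that] by (auto simp: subset_iff)
    then show "\<exists>s\<in>carrier N. \<forall>y\<in>carrier N. s \<sqsubseteq>\<^bsub>N\<^esub> y \<longleftrightarrow> (\<forall>x\<in>S. x \<sqsubseteq>\<^bsub>N\<^esub> y)"
      unfolding f T(2) using sup_closed[OF T(1)] by auto
  qed
qed

context
  fixes M :: "'a gorder" and N :: "'b gorder" and f :: "'a \<Rightarrow> 'b"
  assumes M: "complete_lattice M" and N: "complete_lattice N" and bij: "bij_betw f (carrier M) (carrier N)"
    and le: "\<And>x y. x \<in> carrier M \<Longrightarrow> y \<in> carrier M \<Longrightarrow> f x \<sqsubseteq>\<^bsub>N\<^esub> f y \<longleftrightarrow> x \<sqsubseteq>\<^bsub>M\<^esub> y"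
begin

interpretation M: complete_lattice M by (rule M)
interpretation N: complete_lattice N by (rule N)

private lemma img: "f ` carrier M = carrier N"
  using bij by (simp add: bij_betw_def)

private lemma sup: "S \<subseteq> carrier M \<Longrightarrow> f (\<Squnion>\<^bsub>M\<^esub> S) = \<Squnion>\<^bsub>N\<^esub> (f ` S)"
  using order_iso_sup[OF M N.partial_order bij le] by simp

private lemma inf: "S \<subseteq> carrier M \<Longrightarrow> f (\<Sqinter>\<^bsub>M\<^esub> S) = \<Sqinter>\<^bsub>N\<^esub> (f ` S)"
  using order_iso_inf[OF M N.partial_order bij le] by simp

private lemma meet: "x \<in> carrier M \<Longrightarrow> y \<in> carrier M \<Longrightarrow> f (x \<sqinter>\<^bsub>M\<^esub> y) = f x \<sqinter>\<^bsub>N\<^esub> f y"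
  unfolding meet_def using inf[of "{x, y}"] by simp

private lemma join: "x \<in> carrier M \<Longrightarrow> y \<in> carrier M \<Longrightarrow> f (x \<squnion>\<^bsub>M\<^esub> y) = f x \<squnion>\<^bsub>N\<^esub> f y"
  unfolding join_def using sup[of "{x, y}"] by simp

private lemma top: "f \<top>\<^bsub>M\<^esub> = \<top>\<^bsub>N\<^esub>"
  using inf[of "{}"] by (simp add: M.inf_empty_eq N.inf_empty_eq)

private lemma bottom: "f \<bottom>\<^bsub>M\<^esub> = \<bottom>\<^bsub>N\<^esub>"
  using sup[of "{}"] by (simp add: M.sup_empty_eq N.sup_empty_eq)

lemma order_iso_frame_hom: "is_frame_hom M N f"
  using sup meet top img by (auto simp: is_frame_hom_def)

lemma order_iso_cba:
  assumes cba: "is_cba M"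
  shows "is_cba N" "is_cba_hom M N f"
proof -
  have compl: "is_complement N (f a) (f b)" if "a \<in> carrier M" "is_complement M a b" for a b
    using that img by (auto simp: is_complement_def simp flip: meet join top bottom)
  show cbaN: "is_cba N"
    unfolding is_cba_def img[symmetric]
  proof (intro conjI ballI)
    fix x y z assume "x \<in> f ` carrier M" "y \<in> f ` carrier M" "z \<in> f ` carrier M"
    then obtain a b c where abc: "a \<in> carrier M" "b \<in> carrier M" "c \<in> carrier M" "x = f a" "y = f b" "z = f c"
      by blast
    then have "f (a \<sqinter>\<^bsub>M\<^esub> (b \<squnion>\<^bsub>M\<^esub> c)) = f ((a \<sqinter>\<^bsub>M\<^esub> b) \<squnion>\<^bsub>M\<^esub> (a \<sqinter>\<^bsub>M\<^esub> c))"
      using cba by (simp add: is_cba_def)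
    then show "x \<sqinter>\<^bsub>N\<^esub> (y \<squnion>\<^bsub>N\<^esub> z) = (x \<sqinter>\<^bsub>N\<^esub> y) \<squnion>\<^bsub>N\<^esub> (x \<sqinter>\<^bsub>N\<^esub> z)"
      using abc by (simp add: meet join)
  next
    fix x assume "x \<in> f ` carrier M"
    then show "\<exists>y. is_complement N x y"
      using cba compl by (auto simp: is_cba_def) blast
  qed (rule N)
  interpret M: complete_boolean_algebra M by unfold_locales (rule cba)
  interpret N: complete_boolean_algebra N by unfold_locales (rule cbaN)
  show "is_cba_hom M N f"
  proof (rule is_cba_homI[OF cba cbaN])
    show "f (compl M a) = compl N (f a)" if "a \<in> carrier M" for a
      by (rule N.compl_eqI[OF _ compl[OF that M.is_complement_compl[OF that]], symmetric])
        (use that img in blast)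
  qed (use sup img in auto)
qed

end

lemma order_iso_Frm:
  fixes L L' :: "'u::universe gorder"
  assumes L: "L \<in> Ob Frm" and L': "L' \<in> Ob Frm" and bij: "bij_betw f (carrier L) (carrier L')"
    and le: "\<And>x y. x \<in> carrier L \<Longrightarrow> y \<in> carrier L \<Longrightarrow> f x \<sqsubseteq>\<^bsub>L'\<^esub> f y \<longleftrightarrow> x \<sqsubseteq>\<^bsub>L\<^esub> y"
  shows "inverse_arrows Frm L L' (lam (carrier L) f) (lam (carrier L') (inv_into (carrier L) f))"
proof -
  let ?g = "inv_into (carrier L) f"
  have sm: "small (carrier L)" "small (carrier L')" and fr: "is_frame L" "is_frame L'"
    using L L' by (auto simp: Ob_Frm)
  then have cl: "complete_lattice L" "complete_lattice L'"
    by (auto simp: is_frame_def)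
  have g: "?g b \<in> carrier L" "f (?g b) = b" if "b \<in> carrier L'" for b
    using bij that by (auto simp: bij_betw_def inv_into_into f_inv_into_f)
  have gf: "?g (f a) = a" and f: "f a \<in> carrier L'" if "a \<in> carrier L" for a
    using bij that by (auto simp: bij_betw_def)
  have "bij_betw ?g (carrier L') (carrier L)"
    using bij by (rule bij_betw_inv_into)
  moreover have "?g x \<sqsubseteq>\<^bsub>L\<^esub> ?g y \<longleftrightarrow> x \<sqsubseteq>\<^bsub>L'\<^esub> y" if "x \<in> carrier L'" "y \<in> carrier L'" for x y
    using le[of "?g x" "?g y"] g that by simp
  ultimately have "is_frame_hom L L' f" "is_frame_hom L' L ?g"
    using order_iso_frame_hom[OF cl bij le] order_iso_frame_hom[OF cl(2,1), of ?g] by auto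
  then have "is_frame_hom L L' (app (lam (carrier L) f))" "is_frame_hom L' L (app (lam (carrier L') ?g))"
    using frame_hom_cong[OF fr(1), of "app (lam (carrier L) f)" f]
      frame_hom_cong[OF fr(2), of "app (lam (carrier L') ?g)" ?g] sm by auto
  then show ?thesis
    using sm f g gf
    by (auto simp: inverse_arrows_def Hom_Frm vid_def intro!: maps_I lam_cong)
qed

section \<open>MT-algebras\<close>

lemma Ob_MT: "A \<in> Ob MT \<longleftrightarrow> small (carrier (snd A)) \<and> is_mt A"
  by (simp add: MT_def)

lemma Hom_MT: "f \<in> Hom MT A B \<longleftrightarrow> f \<in> maps (carrier (snd A)) (carrier (snd B)) \<and>
    is_cba_hom (snd A) (snd B) (app f) \<and> app f ` fst A \<subseteq> fst B"
  by (simp add: MT_def)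

lemma MT_simps [simp]: "Cmp MT = vcomp" "Idt MT A = vid (carrier (snd A))"
  by (simp_all add: MT_def)

lemma is_mt_iff: "is_mt A \<longleftrightarrow> is_cba (snd A) \<and> is_subframe (fst A) (snd A) \<and>
    (\<forall>m\<in>carrier (snd A). \<exists>S. S \<subseteq> {(\<Sqinter>\<^bsub>snd A\<^esub> B) \<sqinter>\<^bsub>snd A\<^esub> compl (snd A) a | B a. B \<subseteq> fst A \<and> a \<in> fst A} \<and>
      m = \<Squnion>\<^bsub>snd A\<^esub> S)"
  by (simp add: is_mt_def case_prod_unfold)

lemma is_mtD: "is_mt A \<Longrightarrow> is_cba (snd A)" "is_mt A \<Longrightarrow> is_subframe (fst A) (snd A)"
  "is_mt A \<Longrightarrow> fst A \<subseteq> carrier (snd A)"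
  by (auto simp: is_mt_iff is_subframe_def)

lemma Ob_MTD:
  assumes "A \<in> Ob MT"
  shows "small (carrier (snd A))" "is_mt A" "is_cba (snd A)" "is_subframe (fst A) (snd A)"
    "fst A \<subseteq> carrier (snd A)" "small (fst A)"
proof -
  show sm: "small (carrier (snd A))" and mt: "is_mt A"
    using assms by (simp_all add: Ob_MT)
  show "is_cba (snd A)" "is_subframe (fst A) (snd A)" "fst A \<subseteq> carrier (snd A)" "small (fst A)"
    using is_mtD[OF mt] small_subset[OF sm is_mtD(3)[OF mt]] by simp_all
qed

lemma is_mt_difference_generated:
  assumes M: "is_cba M" and L: "is_subframe L M" and gen: "difference_generated L M"
  shows "is_mt (L, M)"
proof -
  interpret complete_boolean_algebra M by unfold_locales (rule M)
  have inf: "\<Sqinter>\<^bsub>M\<^esub> {b} = b" if "b \<in> L" for b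
    using that L by (auto simp: is_subframe_def)
  have sub: "{b \<sqinter>\<^bsub>M\<^esub> compl M a | a b. a \<in> L \<and> b \<in> L} \<subseteq>
      {(\<Sqinter>\<^bsub>M\<^esub> B) \<sqinter>\<^bsub>M\<^esub> compl M a | B a. B \<subseteq> L \<and> a \<in> L}" (is "?D \<subseteq> ?E")
  proof clarify
    fix a b assume "a \<in> L" "b \<in> L"
    then show "\<exists>B a'. b \<sqinter>\<^bsub>M\<^esub> compl M a = \<Sqinter>\<^bsub>M\<^esub> B \<sqinter>\<^bsub>M\<^esub> compl M a' \<and> B \<subseteq> L \<and> a' \<in> L"
      using inf by (intro exI[of _ "{b}"] exI[of _ a]) simp
  qed
  have "\<exists>S. S \<subseteq> ?E \<and> m = \<Squnion>\<^bsub>M\<^esub> S" if m: "m \<in> carrier M" for m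
  proof -
    obtain S where "S \<subseteq> ?D" "m = \<Squnion>\<^bsub>M\<^esub> S"
      using gen m unfolding difference_generated_def by blast
    then show ?thesis
      using sub by (intro exI[of _ S]) auto
  qed
  then show ?thesis
    using M L by (simp add: is_mt_iff)
qed

text \<open>
  By the \<open>T\<^sub>0\<close> condition, an MT-algebra is generated by its open elements as a complete Boolean
  algebra.
\<close>

lemma mt_induct [consumes 2, case_names opens sup inf compl]:
  assumes A: "is_mt A" and m: "m \<in> carrier (snd A)"
    and opn: "\<And>a. a \<in> fst A \<Longrightarrow> Q a"
    and sup: "\<And>S. S \<subseteq> carrier (snd A) \<Longrightarrow> (\<And>s. s \<in> S \<Longrightarrow> Q s) \<Longrightarrow> Q (\<Squnion>\<^bsub>snd A\<^esub> S)"
    and inf: "\<And>S. S \<subseteq> carrier (snd A) \<Longrightarrow> (\<And>s. s \<in> S \<Longrightarrow> Q s) \<Longrightarrow> Q (\<Sqinter>\<^bsub>snd A\<^esub> S)"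
    and compl: "\<And>a. a \<in> carrier (snd A) \<Longrightarrow> Q a \<Longrightarrow> Q (compl (snd A) a)"
  shows "Q m"
proof -
  interpret complete_boolean_algebra "snd A" by unfold_locales (rule is_mtD(1)[OF A])
  note L = is_mtD(3)[OF A]
  obtain S where S: "S \<subseteq> {(\<Sqinter>\<^bsub>snd A\<^esub> B) \<sqinter>\<^bsub>snd A\<^esub> compl (snd A) a | B a. B \<subseteq> fst A \<and> a \<in> fst A}"
    and eq: "m = \<Squnion>\<^bsub>snd A\<^esub> S"
    using A m by (auto simp: is_mt_iff)
  have "s \<in> carrier (snd A) \<and> Q s" if sS: "s \<in> S" for s
  proof -
    obtain B a where Ba: "B \<subseteq> fst A" "a \<in> fst A" "s = (\<Sqinter>\<^bsub>snd A\<^esub> B) \<sqinter>\<^bsub>snd A\<^esub> compl (snd A) a"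
      using sS S by blast
    then have c: "B \<subseteq> carrier (snd A)" "a \<in> carrier (snd A)"
      using L by auto
    have "Q (\<Sqinter>\<^bsub>snd A\<^esub> B)" "Q (compl (snd A) a)"
      using inf[OF c(1)] compl[OF c(2)] opn Ba by auto
    then have "Q s"
      unfolding Ba(3) meet_def using c by (intro inf) auto
    then show ?thesis
      using c Ba(3) by simp
  qed
  then show ?thesis
    unfolding eq by (intro sup) auto
qed

lemma cba_homs_agree:
  assumes A: "is_mt A" and f: "is_cba_hom (snd A) N f" and g: "is_cba_hom (snd A) N g"
    and eq: "\<And>a. a \<in> fst A \<Longrightarrow> f a = g a" and m: "m \<in> carrier (snd A)"
  shows "f m = g m"
  using A m
proof (induction rule: mt_induct)
  case (sup S)
  then have "f ` S = g ` S" by (auto intro!: image_cong)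
  with sup show ?case using f g by (simp add: cba_hom_sup)
next
  case (inf S)
  then have "f ` S = g ` S" by (auto intro!: image_cong)
  with inf show ?case using f g by (simp add: cba_hom_inf)
qed (use eq f g in \<open>auto simp: cba_hom_compl\<close>)

lemma cba_hom_onto:
  assumes A: "is_mt A" and N: "is_cba N" and g: "is_cba_hom N (snd A) g" and L: "fst A \<subseteq> g ` carrier N"
  shows "g ` carrier N = carrier (snd A)"
proof
  interpret N: complete_boolean_algebra N by unfold_locales (rule N)
  show "g ` carrier N \<subseteq> carrier (snd A)"
    using g by (auto simp: is_cba_hom_def)
  show "carrier (snd A) \<subseteq> g ` carrier N"
  proof
    fix m assume "m \<in> carrier (snd A)"
    with A show "m \<in> g ` carrier N"
    proof (induction rule: mt_induct)
      case (sup S)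
      then have "S \<subseteq> g ` carrier N" by blast
      then obtain T where "T \<subseteq> carrier N" "S = g ` T"
        by (auto simp: subset_image_iff)
      then show ?case
        using cba_hom_sup[OF g] N.sup_closed by (metis imageI)
    next
      case (inf S)
      then have "S \<subseteq> g ` carrier N" by blast
      then obtain T where "T \<subseteq> carrier N" "S = g ` T"
        by (auto simp: subset_image_iff)
      then show ?case
        using cba_hom_inf[OF g] N.inf_closed by (metis imageI)
    next
      case (compl a)
      then show ?case
        using cba_hom_compl[OF g] N.compl_closed by (auto simp flip: cba_hom_compl[OF g])
    qed (use L in auto)
  qed
qed

text \<open>
  On an algebra generated by differences, a homomorphism reflecting the order of the open elements
  is injective: its kernel is trivial, since a difference \<open>b \<and> \<not> a\<close> is sent to the bottom element
  only if the image of \<open>b\<close> is below that of \<open>a\<close>.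
\<close>

lemma cba_hom_inj:
  assumes M: "is_cba M" and N: "is_cba N" and g: "is_cba_hom M N g"
    and L: "L \<subseteq> carrier M" and gen: "difference_generated L M"
    and emb: "\<And>a b. a \<in> L \<Longrightarrow> b \<in> L \<Longrightarrow> g b \<sqsubseteq>\<^bsub>N\<^esub> g a \<Longrightarrow> b \<sqsubseteq>\<^bsub>M\<^esub> a"
  shows "inj_on g (carrier M)"
proof -
  interpret M: complete_boolean_algebra M by unfold_locales (rule M)
  interpret N: complete_boolean_algebra N by unfold_locales (rule N)
  have kernel: "m = \<bottom>\<^bsub>M\<^esub>" if m: "m \<in> carrier M" "g m = \<bottom>\<^bsub>N\<^esub>" for m
  proof -
    obtain S where S: "S \<subseteq> {b \<sqinter>\<^bsub>M\<^esub> compl M a | a b. a \<in> L \<and> b \<in> L}" and eq: "m = \<Squnion>\<^bsub>M\<^esub> S"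
      using gen m(1) by (auto simp: difference_generated_def)
    have "b \<sqinter>\<^bsub>M\<^esub> compl M a \<in> carrier M" if "a \<in> L" "b \<in> L" for a b
      using that L by (simp add: subset_iff)
    then have SM: "S \<subseteq> carrier M" using S by blast
    have "s = \<bottom>\<^bsub>M\<^esub>" if sS: "s \<in> S" for s
    proof -
      obtain a b where ab: "a \<in> L" "b \<in> L" "s = b \<sqinter>\<^bsub>M\<^esub> compl M a"
        using sS S by blast
      then have c: "a \<in> carrier M" "b \<in> carrier M" using L by auto
      have "s \<sqsubseteq>\<^bsub>M\<^esub> m" using eq sS SM M.sup_upper by simp
      then have "g s \<sqsubseteq>\<^bsub>N\<^esub> \<bottom>\<^bsub>N\<^esub>"
        using cba_hom_mono[OF M N g _ m(1)] m(2) sS SM by auto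
      then have "g b \<sqinter>\<^bsub>N\<^esub> compl N (g a) = \<bottom>\<^bsub>N\<^esub>"
        using ab(3) c cba_hom_meet[OF g] cba_hom_compl[OF g] cba_hom_closed[OF g] N.le_bottom_iff by simp
      then have "g b \<sqsubseteq>\<^bsub>N\<^esub> g a"
        using N.le_iff_meet_compl cba_hom_closed[OF g] c by simp
      then show ?thesis
        using emb[OF ab(1,2)] M.le_iff_meet_compl[OF c] ab(3) by simp
    qed
    then have "\<Squnion>\<^bsub>M\<^esub> S \<sqsubseteq>\<^bsub>M\<^esub> \<bottom>\<^bsub>M\<^esub>"
      using SM by (intro M.sup_least) auto
    then show ?thesis
      using eq m(1) M.le_bottom_iff by simp
  qed
  have le: "x \<sqsubseteq>\<^bsub>M\<^esub> y" if "x \<in> carrier M" "y \<in> carrier M" "g x = g y" for x y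
  proof -
    have "g (x \<sqinter>\<^bsub>M\<^esub> compl M y) = g y \<sqinter>\<^bsub>N\<^esub> compl N (g y)"
      using that cba_hom_meet[OF g] cba_hom_compl[OF g] by simp
    then have "x \<sqinter>\<^bsub>M\<^esub> compl M y = \<bottom>\<^bsub>M\<^esub>"
      using kernel that cba_hom_closed[OF g] by simp
    then show ?thesis
      using M.le_iff_meet_compl that by simp
  qed
  show ?thesis
  proof (rule inj_onI)
    fix x y assume "x \<in> carrier M" "y \<in> carrier M" "g x = g y"
    then show "x = y"
      using le[of x y] le[of y x] M.le_antisym by auto
  qed
qed

lemma cba_hom_image_subframe:
  assumes M: "is_cba M" and N: "is_cba N" and g: "is_cba_hom M N g" and L: "is_subframe L M"
  shows "is_subframe (g ` L) N"
proof -
  have sub: "L \<subseteq> carrier M" "\<top>\<^bsub>M\<^esub> \<in> L" "\<And>S. S \<subseteq> L \<Longrightarrow> \<Squnion>\<^bsub>M\<^esub> S \<in> L" "\<And>a b. a \<in> L \<Longrightarrow> b \<in> L \<Longrightarrow> a \<sqinter>\<^bsub>M\<^esub> b \<in> L"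
    using L by (auto simp: is_subframe_def)
  show ?thesis
    unfolding is_subframe_def
  proof (intro conjI ballI allI impI)
    show "g ` L \<subseteq> carrier N"
      using sub cba_hom_closed[OF g] by blast
    show "\<top>\<^bsub>N\<^esub> \<in> g ` L"
      using cba_hom_top[OF M N g] sub(2) by (metis imageI)
    show "x \<sqinter>\<^bsub>N\<^esub> y \<in> g ` L" if "x \<in> g ` L" "y \<in> g ` L" for x y
    proof -
      obtain a b where ab: "a \<in> L" "b \<in> L" "x = g a" "y = g b"
        using \<open>x \<in> g ` L\<close> \<open>y \<in> g ` L\<close> by blast
      then have "x \<sqinter>\<^bsub>N\<^esub> y = g (a \<sqinter>\<^bsub>M\<^esub> b)"
        using cba_hom_meet[OF g] sub(1) by (simp add: subset_iff)
      then show ?thesis using sub(4) ab by simp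
    qed
    show "\<Squnion>\<^bsub>N\<^esub> S \<in> g ` L" if "S \<subseteq> g ` L" for S
    proof -
      obtain T where T: "T \<subseteq> L" "S = g ` T"
        using \<open>S \<subseteq> g ` L\<close> by (auto simp: subset_image_iff)
      then have "\<Squnion>\<^bsub>N\<^esub> S = g (\<Squnion>\<^bsub>M\<^esub> T)"
        using cba_hom_sup[OF g, of T] sub(1) by simp
      then show ?thesis using sub(3) T by simp
    qed
  qed
qed

lemma cba_hom_image_difference_generated:
  assumes M: "is_cba M" and N: "is_cba N" and g: "is_cba_hom M N g" and onto: "g ` carrier M = carrier N"
    and L: "L \<subseteq> carrier M" and gen: "difference_generated L M"
  shows "difference_generated (g ` L) N"
  unfolding difference_generated_def
proof
  interpret M: complete_boolean_algebra M by unfold_locales (rule M)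
  fix n assume "n \<in> carrier N"
  then obtain m where m: "m \<in> carrier M" "n = g m"
    using onto by blast
  obtain S where S: "S \<subseteq> {b \<sqinter>\<^bsub>M\<^esub> compl M a | a b. a \<in> L \<and> b \<in> L}" "m = \<Squnion>\<^bsub>M\<^esub> S"
    using gen m(1) by (auto simp: difference_generated_def)
  have d: "b \<sqinter>\<^bsub>M\<^esub> compl M a \<in> carrier M"
    "g (b \<sqinter>\<^bsub>M\<^esub> compl M a) = g b \<sqinter>\<^bsub>N\<^esub> compl N (g a)" if "a \<in> L" "b \<in> L" for a b
    using that L cba_hom_meet[OF g] cba_hom_compl[OF g] by (simp_all add: subset_iff)
  have "S \<subseteq> carrier M"
    using S(1) d(1) by blast
  then have "n = \<Squnion>\<^bsub>N\<^esub> (g ` S)"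
    using m S(2) cba_hom_sup[OF g] by simp
  moreover have "g ` S \<subseteq> {b \<sqinter>\<^bsub>N\<^esub> compl N a | a b. a \<in> g ` L \<and> b \<in> g ` L}"
    using S(1) d(2) by (fastforce simp: subset_iff)
  ultimately show "\<exists>S. S \<subseteq> {b \<sqinter>\<^bsub>N\<^esub> compl N a | a b. a \<in> g ` L \<and> b \<in> g ` L} \<and> n = \<Squnion>\<^bsub>N\<^esub> S"
    by blast
qed

lemma is_category_MT: "is_category (MT :: ('u::universe mt, 'u) cat)"
proof (rule is_categoryI[where u = "\<lambda>A. carrier (snd A)"])
  show "vid (carrier (snd A)) \<in> Hom MT A A" if "A \<in> Ob MT" for A :: "'u mt"
  proof -
    have A: "small (carrier (snd A))" "is_cba (snd A)" "fst A \<subseteq> carrier (snd A)"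
      using Ob_MTD[OF that] by blast+
    have "is_cba_hom (snd A) (snd A) (app (vid (carrier (snd A))))"
      using is_cba_hom_cong[OF A(2), of "app (vid (carrier (snd A)))" "\<lambda>x. x"] is_cba_hom_id A by simp
    moreover have "app (vid (carrier (snd A))) ` fst A \<subseteq> fst A"
      using A by auto
    ultimately show ?thesis
      by (simp add: Hom_MT vid_maps)
  qed
  show "vcomp g f \<in> Hom MT A C" if "A \<in> Ob MT" "B \<in> Ob MT" "C \<in> Ob MT" "f \<in> Hom MT A B" "g \<in> Hom MT B C"
    for A B C :: "'u mt" and f g
  proof -
    have sm: "small (carrier (snd A))" "small (carrier (snd B))" and cba: "is_cba (snd A)"
      and sub: "fst A \<subseteq> carrier (snd A)"
      and f: "f \<in> maps (carrier (snd A)) (carrier (snd B))" "is_cba_hom (snd A) (snd B) (app f)" "app f ` fst A \<subseteq> fst B"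
      and g: "g \<in> maps (carrier (snd B)) (carrier (snd C))" "is_cba_hom (snd B) (snd C) (app g)" "app g ` fst B \<subseteq> fst C"
      using Ob_MTD[OF that(1)] Ob_MTD[OF that(2)] that(4,5) by (auto simp: Hom_MT)
    have eq: "app (vcomp g f) x = app g (app f x)" if "x \<in> carrier (snd A)" for x
      using app_vcomp[OF sm(1) f(1) that] .
    have "is_cba_hom (snd A) (snd C) (app (vcomp g f))"
      using is_cba_hom_cong[OF cba eq] is_cba_hom_comp[OF f(2) g(2)] by simp
    moreover have "app (vcomp g f) ` fst A \<subseteq> fst C"
      using eq sub f(3) g(3) by (auto simp: subset_iff image_subset_iff)
    ultimately show ?thesis
      using vcomp_maps[OF sm f(1) g(1)] by (simp add: Hom_MT)
  qed
qed (auto simp: Ob_MT Hom_MT)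

lemma OM_simps: "fo OM A = (snd A)\<lparr>carrier := fst A\<rparr>" "fa OM A B f = lam (fst A) (app f)"
  by (simp_all add: OM_def)

lemma carrier_OM [simp]: "carrier (fo OM A) = fst A"
  by (simp add: OM_simps)

lemma le_OM [simp]: "x \<sqsubseteq>\<^bsub>fo OM A\<^esub> y \<longleftrightarrow> x \<sqsubseteq>\<^bsub>snd A\<^esub> y"
  by (simp add: OM_simps)

lemma OM_Frm: "A \<in> Ob MT \<Longrightarrow> fo OM A \<in> Ob Frm"
proof -
  assume "A \<in> Ob MT"
  then have A: "small (carrier (snd A))" "is_mt A" by (auto simp: Ob_MT)
  interpret complete_boolean_algebra "snd A" by unfold_locales (rule is_mtD(1)[OF A(2)])
  show ?thesis
    using subframe_is_frame[OF complete_lattice_axioms is_mtD(2)[OF A(2)] is_frame]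
      small_subset[OF A(1) is_mtD(3)[OF A(2)]]
    by (simp add: Ob_Frm OM_simps)
qed

lemma cba_hom_subframe_hom:
  assumes A: "is_mt A" and B: "is_mt B" and f: "is_cba_hom (snd A) (snd B) f" "f ` fst A \<subseteq> fst B"
  shows "is_frame_hom (fo OM A) (fo OM B) f"
proof -
  interpret A: complete_boolean_algebra "snd A" by unfold_locales (rule is_mtD(1)[OF A])
  interpret B: complete_boolean_algebra "snd B" by unfold_locales (rule is_mtD(1)[OF B])
  note sA = is_mtD(2)[OF A] and sB = is_mtD(2)[OF B]
  have fin: "f a \<in> fst B" if "a \<in> fst A" for a
    using f(2) that by blast
  have sub: "a \<in> carrier (snd A)" if "a \<in> fst A" for a
    using that is_mtD(3)[OF A] by blast
  show ?thesis
    unfolding is_frame_hom_def carrier_OM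
  proof (intro conjI ballI allI impI)
    show "f \<in> fst A \<rightarrow> fst B"
      using fin by blast
    show "f \<top>\<^bsub>fo OM A\<^esub> = \<top>\<^bsub>fo OM B\<^esub>"
      unfolding OM_simps subframe_top[OF A.complete_lattice_axioms sA] subframe_top[OF B.complete_lattice_axioms sB]
      using cba_hom_top[OF A.cba B.cba f(1)] .
    show "f (a \<sqinter>\<^bsub>fo OM A\<^esub> b) = f a \<sqinter>\<^bsub>fo OM B\<^esub> f b" if "a \<in> fst A" "b \<in> fst A" for a b
      unfolding OM_simps subframe_meet[OF A.complete_lattice_axioms sA that]
        subframe_meet[OF B.complete_lattice_axioms sB fin[OF that(1)] fin[OF that(2)]]
      using cba_hom_meet[OF f(1)] sub that by simp
    show "f (\<Squnion>\<^bsub>fo OM A\<^esub> S) = \<Squnion>\<^bsub>fo OM B\<^esub> (f ` S)" if S: "S \<subseteq> fst A" for S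
    proof -
      have "f ` S \<subseteq> fst B" "S \<subseteq> carrier (snd A)" using S fin sub by auto
      then show ?thesis
        unfolding OM_simps subframe_sup[OF A.complete_lattice_axioms sA S]
        using subframe_sup[OF B.complete_lattice_axioms sB] cba_hom_sup[OF f(1)] by simp
    qed
  qed
qed

lemma OM_Hom:
  assumes A: "A \<in> Ob MT" and B: "B \<in> Ob MT" and f: "f \<in> Hom MT A B"
  shows "fa OM A B f \<in> Hom Frm (fo OM A) (fo OM B)"
proof -
  have mt: "is_mt A" "is_mt B" using A B by (auto simp: Ob_MT)
  have f': "is_cba_hom (snd A) (snd B) (app f)" "app f ` fst A \<subseteq> fst B"
    using f by (auto simp: Hom_MT)
  have fr: "is_frame (fo OM A)" using OM_Frm[OF A] by (simp add: Ob_Frm)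
  have sm: "small (fst A)" using Ob_MTD(6)[OF A] .
  have "is_frame_hom (fo OM A) (fo OM B) (app (lam (fst A) (app f)))"
    using frame_hom_cong[OF fr, of "app (lam (fst A) (app f))" "app f"] cba_hom_subframe_hom[OF mt f'] sm
    by simp
  moreover have "lam (fst A) (app f) \<in> maps (fst A) (fst B)"
    using f'(2) by (intro maps_I) auto
  ultimately show ?thesis
    by (simp add: Hom_Frm OM_simps(2))
qed

lemma is_functor_OM: "is_functor (MT :: ('u::universe mt, 'u) cat) Frm OM"
  unfolding is_functor_def
proof (intro conjI ballI is_category_MT is_category_Frm OM_Frm OM_Hom)
  fix A :: "'u mt" assume "A \<in> Ob MT"
  then have "small (carrier (snd A))" "fst A \<subseteq> carrier (snd A)" "small (fst A)"
    using Ob_MTD by blast+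
  then show "fa OM A A (Idt MT A) = Idt Frm (fo OM A)"
    by (auto simp: OM_simps vid_def intro!: lam_cong)
next
  fix A B C :: "'u mt" and f g
  assume A: "A \<in> Ob MT" and B: "B \<in> Ob MT" and C: "C \<in> Ob MT" and f: "f \<in> Hom MT A B" and g: "g \<in> Hom MT B C"
  have "small (carrier (snd A))" "fst A \<subseteq> carrier (snd A)" "small (fst A)" "small (fst B)"
    using Ob_MTD[OF A] Ob_MTD[OF B] by blast+
  moreover have "f \<in> maps (carrier (snd A)) (carrier (snd B))" "app f ` fst A \<subseteq> fst B"
    using f by (auto simp: Hom_MT)
  ultimately show "fa OM A C (Cmp MT g f) = Cmp Frm (fa OM B C g) (fa OM A B f)"
    by (auto simp: OM_simps app_vcomp[of "carrier (snd A)"] subset_iff image_subset_iff intro!: lam_cong)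
qed

lemma MT_Hom_eqI:
  assumes A: "A \<in> Ob MT" and f: "f \<in> Hom MT A B" and g: "g \<in> Hom MT A B"
    and eq: "\<And>a. a \<in> fst A \<Longrightarrow> app f a = app g a"
  shows "f = g"
proof -
  have A': "small (carrier (snd A))" "is_mt A" using A by (auto simp: Ob_MT)
  have f': "f \<in> maps (carrier (snd A)) (carrier (snd B))" "is_cba_hom (snd A) (snd B) (app f)"
    and g': "g \<in> maps (carrier (snd A)) (carrier (snd B))" "is_cba_hom (snd A) (snd B) (app g)"
    using f g by (auto simp: Hom_MT)
  show ?thesis
    using maps_ext[OF A'(1) f'(1) g'(1)] cba_homs_agree[OF A'(2) f'(2) g'(2) eq] by blast
qed

lemma is_faithful_OM: "is_faithful (MT :: ('u::universe mt, 'u) cat) OM"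
  unfolding is_faithful_def
proof (intro ballI inj_onI)
  fix A B :: "'u mt" and f g
  assume A: "A \<in> Ob MT" and f: "f \<in> Hom MT A B" and g: "g \<in> Hom MT A B" and eq: "fa OM A B f = fa OM A B g"
  show "f = g"
    by (rule MT_Hom_eqI[OF A f g]) (use eq Ob_MTD(6)[OF A] in \<open>auto simp: OM_simps dest: lam_eqD\<close>)
qed

section \<open>Spaces\<close>

lemma Ob_Top: "X \<in> Ob Top \<longleftrightarrow> small (topspace X) \<and> t0_space X"
  by (simp add: Top_def)

lemma Hom_Top: "f \<in> Hom Top X Y \<longleftrightarrow> f \<in> maps (topspace X) (topspace Y) \<and> continuous_map X Y (app f)"
  by (simp add: Top_def)

lemma Top_simps [simp]: "Cmp Top = vcomp" "Idt Top X = vid (topspace X)"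
  by (simp_all add: Top_def)

lemma full_subcat_simps [simp]: "Ob (full_subcat C P) = {a \<in> Ob C. P a}" "Hom (full_subcat C P) = Hom C"
  "Idt (full_subcat C P) = Idt C" "Cmp (full_subcat C P) = Cmp C"
  by (simp_all add: full_subcat_def)

lemma is_category_full_subcat: "is_category C \<Longrightarrow> is_category (full_subcat C P)"
  unfolding is_category_def full_subcat_simps by blast

lemma full_subcat_full: "is_category C \<Longrightarrow> is_full_subcategory (full_subcat C P) C"
  by (auto simp: is_full_subcategory_def is_subcategory_def is_category_full_subcat)

lemma continuous_map_app_cong:
  "(\<And>x. x \<in> topspace X \<Longrightarrow> f x = g x) \<Longrightarrow> continuous_map X Y f \<longleftrightarrow> continuous_map X Y g"
  by (metis continuous_map_eq)

lemma is_category_Top: "is_category (Top :: ('u::universe topology, 'u) cat)"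
proof (rule is_categoryI[where u = topspace])
  show "vid (topspace X) \<in> Hom Top X X" if "X \<in> Ob Top" for X :: "'u topology"
  proof -
    have "continuous_map X X (app (vid (topspace X))) \<longleftrightarrow> continuous_map X X (\<lambda>x. x)"
      by (rule continuous_map_app_cong) (use that in \<open>simp add: Ob_Top\<close>)
    then show ?thesis
      by (simp add: Hom_Top vid_maps)
  qed
  show "vcomp g f \<in> Hom Top X Z"
    if "X \<in> Ob Top" "Y \<in> Ob Top" "Z \<in> Ob Top" "f \<in> Hom Top X Y" "g \<in> Hom Top Y Z"
    for X Y Z :: "'u topology" and f g
  proof -
    have sm: "small (topspace X)" "small (topspace Y)"
      and f: "f \<in> maps (topspace X) (topspace Y)" "continuous_map X Y (app f)"
      and g: "g \<in> maps (topspace Y) (topspace Z)" "continuous_map Y Z (app g)"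
      using that by (auto simp: Ob_Top Hom_Top)
    have "continuous_map X Z (app (vcomp g f)) \<longleftrightarrow> continuous_map X Z (app g \<circ> app f)"
      by (rule continuous_map_app_cong) (simp add: app_vcomp[OF sm(1) f(1)])
    then show ?thesis
      using continuous_map_compose[OF f(2) g(2)] vcomp_maps[OF sm f(1) g(1)] by (simp add: Hom_Top)
  qed
qed (auto simp: Ob_Top Hom_Top)

lemma Ob_TopD: "X \<in> Ob TopD \<longleftrightarrow> X \<in> Ob Top \<and> td_space X"
  by (simp add: TopD_def)

lemma carrier_opens: "carrier (opens X) = vset ` {U. openin X U}"
  by (simp add: opens_def)

lemma opens_Frm: "small (topspace X) \<Longrightarrow> opens X \<in> Ob Frm"
proof -
  assume X: "small (topspace X)"
  interpret set_frame "topspace X" "{U. openin X U}"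
    using set_frame_opens[OF X] .
  have "vset ` {U. openin X U} \<subseteq> vset ` Pow (topspace X)"
    by (auto dest: openin_subset)
  then show ?thesis
    using small_subset[OF small_powerset_codes[OF X]] is_frame by (simp add: Ob_Frm opens_def)
qed

lemma in_opens_iff: "small (topspace X) \<Longrightarrow> u \<in> carrier (opens X) \<longleftrightarrow> openin X (elts u)"
proof -
  assume X: "small (topspace X)"
  interpret set_frame "topspace X" "{U. openin X U}"
    using set_frame_opens[OF X] .
  show ?thesis
    using in_carrier_iff by (simp add: opens_def)
qed

lemma in_Pow_iff: "small X \<Longrightarrow> u \<in> vset ` Pow X \<longleftrightarrow> elts u \<subseteq> X"
  by (rule small_set.pow_in_iff) (rule small_set.intro)

section \<open>The powerset algebra of a space\<close>

lemma powerset_mt_simps [simp]: "fst (powerset_mt X) = carrier (opens X)"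
  "snd (powerset_mt X) = set_order (Pow (topspace X))"
  by (simp_all add: powerset_mt_def)

lemma OM_powerset_mt: "fo OM (powerset_mt X) = opens X"
  by (simp add: OM_simps opens_def set_order_carrier_update)

lemma powerset_mt_MT:
  assumes "X \<in> Ob Top"
  shows "powerset_mt X \<in> Ob MT"
proof -
  have X: "small (topspace X)" "t0_space X"
    using assms by (auto simp: Ob_Top)
  interpret small_set "topspace X" by unfold_locales (rule X)
  interpret O: set_frame "topspace X" "{U. openin X U}"
    using set_frame_opens[OF X(1)] .
  let ?P = "set_order (Pow (topspace X))" and ?L = "carrier (opens X)"
  interpret P: complete_boolean_algebra ?P by unfold_locales (rule pow_cba)
  have LP: "u \<in> vset ` Pow (topspace X)" if "u \<in> ?L" for u
    using that openin_subset by (auto simp: in_opens_iff[OF X(1)] in_Pow_iff[OF X(1)])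
  have sub: "is_subframe ?L ?P"
    unfolding is_subframe_def
  proof (intro conjI ballI allI impI)
    show "?L \<subseteq> carrier ?P" using LP by auto
    show "\<top>\<^bsub>?P\<^esub> \<in> ?L"
      by (simp add: pow.top carrier_opens)
    show "u \<sqinter>\<^bsub>?P\<^esub> v \<in> ?L" if "u \<in> ?L" "v \<in> ?L" for u v
      using that LP by (simp add: in_opens_iff[OF X(1)] pow.elts_meet openin_Int)
    show "\<Squnion>\<^bsub>?P\<^esub> S \<in> ?L" if "S \<subseteq> ?L" for S
    proof -
      have "S \<subseteq> vset ` Pow (topspace X)" using that LP by blast
      then show ?thesis
        using that by (auto simp: in_opens_iff[OF X(1)] pow.elts_sup subset_iff)
    qed
  qed
  \<comment> \<open>By \<open>T\<^sub>0\<close>, a singleton \<open>{x}\<close> is the intersection of all open neighbourhoods of \<open>x\<close> with the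
    complement of the largest open set not containing \<open>x\<close>.\<close>
  have sing: "\<exists>B a. B \<subseteq> ?L \<and> a \<in> ?L \<and> elts ((\<Sqinter>\<^bsub>?P\<^esub> B) \<sqinter>\<^bsub>?P\<^esub> compl ?P a) = {x}" if x: "x \<in> topspace X" for x
  proof (intro exI conjI)
    let ?B = "{u \<in> ?L. x \<in> elts u}" let ?a = "vset (\<Union>{U. openin X U \<and> x \<notin> U})"
    have U: "openin X (\<Union>{U. openin X U \<and> x \<notin> U})"
      by (rule openin_Union) simp
    then show a: "?a \<in> ?L"
      unfolding carrier_opens by blast
    show B: "?B \<subseteq> ?L" by blast
    have BP: "?B \<subseteq> vset ` Pow (topspace X)" using LP by blast
    have sm: "small (\<Union>{U. openin X U \<and> x \<notin> U})"
      using small_subset[OF X(1)] openin_subset[OF U] by blast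
    have "\<Sqinter>\<^bsub>?P\<^esub> ?B \<in> vset ` Pow (topspace X)" "compl ?P ?a \<in> vset ` Pow (topspace X)"
      using P.inf_closed[of ?B] BP P.compl_closed[of ?a] LP[OF a] by simp_all
    then have e: "elts ((\<Sqinter>\<^bsub>?P\<^esub> ?B) \<sqinter>\<^bsub>?P\<^esub> compl ?P ?a) =
        {y \<in> topspace X. \<forall>A\<in>?B. y \<in> elts A} \<inter> (topspace X - \<Union>{U. openin X U \<and> x \<notin> U})"
      by (simp add: pow.elts_meet elts_pow_inf[OF BP] elts_pow_compl[OF LP[OF a]] sm)
    have "y = x" if "y \<in> topspace X" "\<forall>A\<in>?B. y \<in> elts A" "y \<notin> \<Union>{U. openin X U \<and> x \<notin> U}" for y
    proof (rule ccontr)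
      assume "y \<noteq> x"
      then obtain U where U: "openin X U" "x \<in> U \<longleftrightarrow> y \<notin> U"
        using X(2) x \<open>y \<in> topspace X\<close> by (metis t0_space_def)
      then have "vset U \<in> ?L" "elts (vset U) = U"
        using O.small_members by (auto simp: carrier_opens)
      then show False
        using U that by blast
    qed
    then show "elts ((\<Sqinter>\<^bsub>?P\<^esub> ?B) \<sqinter>\<^bsub>?P\<^esub> compl ?P ?a) = {x}"
      unfolding e using x by blast
  qed
  have "\<exists>S. S \<subseteq> {(\<Sqinter>\<^bsub>?P\<^esub> B) \<sqinter>\<^bsub>?P\<^esub> compl ?P a | B a. B \<subseteq> ?L \<and> a \<in> ?L} \<and> m = \<Squnion>\<^bsub>?P\<^esub> S"
    if m: "m \<in> carrier ?P" for m
  proof (intro exI conjI)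
    let ?E = "{(\<Sqinter>\<^bsub>?P\<^esub> B) \<sqinter>\<^bsub>?P\<^esub> compl ?P a | B a. B \<subseteq> ?L \<and> a \<in> ?L}"
    let ?S = "{s \<in> ?E. \<exists>x\<in>elts m. elts s = {x}}"
    show "?S \<subseteq> ?E" by blast
    have mX: "elts m \<subseteq> topspace X" using m by (simp add: in_Pow_iff[OF X(1)])
    have SP: "?S \<subseteq> vset ` Pow (topspace X)"
      using mX by (auto simp: in_Pow_iff[OF X(1)])
    have "x \<in> (\<Union>s\<in>?S. elts s)" if "x \<in> elts m" for x
    proof -
      have "x \<in> topspace X" using that mX by blast
      from sing[OF this] obtain B a where
        "B \<subseteq> ?L" "a \<in> ?L" "elts ((\<Sqinter>\<^bsub>?P\<^esub> B) \<sqinter>\<^bsub>?P\<^esub> compl ?P a) = {x}"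
        by blast
      then show ?thesis
        using that by (intro UN_I[of "(\<Sqinter>\<^bsub>?P\<^esub> B) \<sqinter>\<^bsub>?P\<^esub> compl ?P a"]) auto
    qed
    then have "elts m = (\<Union>s\<in>?S. elts s)" by auto
    then show "m = \<Squnion>\<^bsub>?P\<^esub> ?S"
      using pow.elts_sup[OF SP] by (intro elts_ext) simp
  qed
  then have "is_mt (powerset_mt X)"
    using pow_cba sub by (simp add: is_mt_iff)
  then show ?thesis
    using small_powerset_codes[OF X(1)] by (simp add: Ob_MT)
qed

text \<open>
  The universal property of the powerset algebra.
\<close>

lemma MT_Hom_powerset_iff:
  assumes C: "C \<in> Ob MT" and X: "small (topspace X)"
    and h: "h \<in> maps (carrier (snd C)) (vset ` Pow (topspace X))" "app h ` fst C \<subseteq> carrier (opens X)"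
  shows "h \<in> Hom MT C (powerset_mt X) \<longleftrightarrow>
    (\<forall>x\<in>topspace X. cba_point (snd C) {m \<in> carrier (snd C). x \<in> elts (app h m)})"
proof -
  interpret small_set "topspace X" by unfold_locales (rule X)
  have "app h \<in> carrier (snd C) \<rightarrow> vset ` Pow (topspace X)"
    using app_maps[OF h(1) Ob_MTD(1)[OF C]] by blast
  then show ?thesis
    using cba_hom_powerset_iff[OF Ob_MTD(3)[OF C]] h by (simp add: Hom_MT)
qed

lemma MT_Hom_two_iff:
  assumes C: "C \<in> Ob MT" and f: "f \<in> maps (carrier (snd C)) {v0, v1}"
  shows "f \<in> Hom MT C twoM \<longleftrightarrow> cba_point (snd C) {m \<in> carrier (snd C). app f m = v1}"
proof -
  have fc: "app f \<in> carrier (snd C) \<rightarrow> {v0, v1}"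
    using app_maps[OF f Ob_MTD(1)[OF C]] by blast
  then have "app f ` fst C \<subseteq> {v0, v1}"
    using Ob_MTD(5)[OF C] by blast
  then show ?thesis
    using cba_hom_two_iff[OF Ob_MTD(3)[OF C] fc] f by (simp add: Hom_MT twoM_def)
qed

lemma twoM_simps [simp]: "fst twoM = {v0, v1}" "snd twoM = two"
  by (simp_all add: twoM_def)

lemma opens_discrete_one: "opens (discrete_topology {v0}) = two"
  by (simp add: opens_def two_eq_Pow Pow_def)

lemma twoM_eq_powerset: "twoM = powerset_mt (discrete_topology {v0})"
  by (simp add: powerset_mt_def opens_discrete_one) (simp only: twoM_def two_eq_Pow set_order_simps vset_Pow_v0)

lemma discrete_one_TopD: "discrete_topology {v0} \<in> Ob TopD"
  by (auto simp: Ob_TopD Ob_Top t0_space_def td_space_def)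

section \<open>Fiber-terminal algebras\<close>

text \<open>
  Let the opens of \<open>D\<close> be identified by \<open>\<theta>\<close> with those of a \<open>T\<^sub>D\<close>-space \<open>X\<close>. Every point \<open>x\<close> of \<open>X\<close>
  is then induced by an atom of \<open>D\<close>, and these points of \<open>D\<close> together form the map to the powerset
  that extends \<open>\<theta>\<close>.
\<close>

lemma powerset_mt_fiber_terminal:
  assumes "X \<in> Ob TopD"
  shows "fiber_terminal (powerset_mt X)"
  unfolding fiber_terminal_def
proof (intro ballI allI impI)
  have X: "small (topspace X)" "td_space X"
    using assms by (auto simp: Ob_TopD Ob_Top)
  interpret O: set_frame "topspace X" "{U. openin X U}"
    using set_frame_opens[OF X(1)] .
  fix D \<theta> assume D: "D \<in> Ob MT" and iso: "is_iso Frm (fo OM D) (fo OM (powerset_mt X)) \<theta>"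
  interpret M: complete_boolean_algebra "snd D" by unfold_locales (rule Ob_MTD(3)[OF D])
  let ?M = "snd D"
  have sub: "a \<in> carrier ?M" if "a \<in> fst D" for a
    using that Ob_MTD(5)[OF D] by blast
  obtain \<theta>' where inv: "inverse_arrows Frm (fo OM D) (opens X) \<theta> \<theta>'"
    using iso by (auto simp: is_iso_def OM_powerset_mt)
  have \<theta>m: "\<theta> \<in> maps (fst D) (carrier (opens X))" and \<theta>h: "is_frame_hom (fo OM D) (opens X) (app \<theta>)"
    using inv by (auto simp: inverse_arrows_def Hom_Frm)
  note th = inverse_arrows_FrmD[OF inv OM_Frm[OF D] opens_Frm[OF X(1)], unfolded carrier_OM le_OM]
  have \<theta>le: "elts (app \<theta> a) \<subseteq> elts (app \<theta> b) \<longleftrightarrow> a \<sqsubseteq>\<^bsub>?M\<^esub> b" if "a \<in> fst D" "b \<in> fst D" for a b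
    using th(5)[OF that] by (simp add: opens_def)
  have \<theta>c: "app \<theta> a \<in> vset ` {U. openin X U}" if "a \<in> fst D" for a
    using th(1)[OF that] by (simp add: carrier_opens)
  note sf = Ob_MTD(4)[OF D]
  have \<theta>meet: "a \<sqinter>\<^bsub>?M\<^esub> b \<in> fst D" "elts (app \<theta> (a \<sqinter>\<^bsub>?M\<^esub> b)) = elts (app \<theta> a) \<inter> elts (app \<theta> b)"
    and \<theta>join: "a \<squnion>\<^bsub>?M\<^esub> b \<in> fst D" "elts (app \<theta> (a \<squnion>\<^bsub>?M\<^esub> b)) = elts (app \<theta> a) \<union> elts (app \<theta> b)"
    if ab: "a \<in> fst D" "b \<in> fst D" for a b
  proof -
    show "a \<sqinter>\<^bsub>?M\<^esub> b \<in> fst D"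
      using sf ab by (simp add: is_subframe_def)
    have S: "{a, b} \<subseteq> fst D" using ab by blast
    then show "a \<squnion>\<^bsub>?M\<^esub> b \<in> fst D"
      using sf unfolding join_def is_subframe_def by blast
    have "app \<theta> (a \<sqinter>\<^bsub>fo OM D\<^esub> b) = app \<theta> a \<sqinter>\<^bsub>opens X\<^esub> app \<theta> b"
      using \<theta>h ab by (simp add: is_frame_hom_def)
    then show "elts (app \<theta> (a \<sqinter>\<^bsub>?M\<^esub> b)) = elts (app \<theta> a) \<inter> elts (app \<theta> b)"
      using O.elts_meet \<theta>c ab by (simp add: OM_simps subframe_meet[OF M.complete_lattice_axioms sf ab] opens_def)
    have "app \<theta> (\<Squnion>\<^bsub>fo OM D\<^esub> {a, b}) = \<Squnion>\<^bsub>opens X\<^esub> (app \<theta> ` {a, b})"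
      using \<theta>h S unfolding is_frame_hom_def carrier_OM by blast
    then show "elts (app \<theta> (a \<squnion>\<^bsub>?M\<^esub> b)) = elts (app \<theta> a) \<union> elts (app \<theta> b)"
      using O.elts_sup[of "app \<theta> ` {a, b}"] \<theta>c ab
      by (simp add: OM_simps subframe_sup[OF M.complete_lattice_axioms sf S] opens_def join_def)
  qed
  have "\<exists>P. cba_point ?M P \<and> (\<forall>c\<in>fst D. c \<in> P \<longleftrightarrow> x \<in> elts (app \<theta> c))" if x: "x \<in> topspace X" for x
  proof -
    obtain U K where UK: "openin X U" "closedin X K" "U \<inter> K = {x}"
      using X(2) x unfolding td_space_def by blast
    have UK_x: "y = x" if "y \<in> U" "y \<in> K" for y
      using UK(3) that by blast
    have "openin X (U - K)"
      using UK openin_diff by blast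
    then have V: "vset (U - K) \<in> carrier (opens X)" "elts (vset (U - K)) = U - K"
      and U: "vset U \<in> carrier (opens X)" "elts (vset U) = U"
      using UK(1) O.small_members by (auto simp: carrier_opens)
    define a where "a = app \<theta>' (vset (U - K))"
    define b where "b = app \<theta>' (vset U)"
    have ab: "a \<in> fst D" "b \<in> fst D" "elts (app \<theta> a) = U - K" "elts (app \<theta> b) = U"
      using th(2,4) U V by (simp_all add: a_def b_def)
    define m where "m = b \<sqinter>\<^bsub>?M\<^esub> compl ?M a"
    have m: "m \<in> carrier ?M"
      using ab sub by (simp add: m_def)
    have m0: "m \<noteq> \<bottom>\<^bsub>?M\<^esub>"
    proof
      assume "m = \<bottom>\<^bsub>?M\<^esub>"
      then have "b \<sqsubseteq>\<^bsub>?M\<^esub> a"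
        using M.le_iff_meet_compl ab sub by (simp add: m_def)
      then show False
        using \<theta>le[OF ab(2,1)] ab UK(3) by blast
    qed
    \<comment> \<open>Since \<open>U\<close> and \<open>U - K\<close> only differ in \<open>x\<close>, every open element contains \<open>m\<close> or is disjoint
      from it. This extends to all elements by induction, and \<open>m\<close> is an atom.\<close>
    have opn: "if x \<in> elts (app \<theta> c) then m \<sqsubseteq>\<^bsub>?M\<^esub> c else m \<sqinter>\<^bsub>?M\<^esub> c = \<bottom>\<^bsub>?M\<^esub>" if c: "c \<in> fst D" for c
    proof (cases "x \<in> elts (app \<theta> c)")
      case True
      then have "elts (app \<theta> b) \<subseteq> elts (app \<theta> (a \<squnion>\<^bsub>?M\<^esub> c))"
        unfolding \<theta>join(2)[OF ab(1) c] ab(3,4) using UK_x by blast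
      then have "b \<sqsubseteq>\<^bsub>?M\<^esub> a \<squnion>\<^bsub>?M\<^esub> c"
        using \<theta>le[OF ab(2) \<theta>join(1)[OF ab(1) c]] by blast
      then have "m \<sqsubseteq>\<^bsub>?M\<^esub> c"
        using M.meet_le_iff[of "compl ?M a" b c] ab c sub by (simp add: m_def)
      then show ?thesis using True by simp
    next
      case False
      then have "elts (app \<theta> (b \<sqinter>\<^bsub>?M\<^esub> c)) \<subseteq> elts (app \<theta> a)"
        unfolding \<theta>meet(2)[OF ab(2) c] ab(3,4) using UK_x by blast
      then have "b \<sqinter>\<^bsub>?M\<^esub> c \<sqsubseteq>\<^bsub>?M\<^esub> a"
        using \<theta>le[OF \<theta>meet(1)[OF ab(2) c] ab(1)] by blast
      then have "(b \<sqinter>\<^bsub>?M\<^esub> c) \<sqinter>\<^bsub>?M\<^esub> compl ?M a = \<bottom>\<^bsub>?M\<^esub>"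
        using M.le_iff_meet_compl ab c sub by simp
      moreover have "(b \<sqinter>\<^bsub>?M\<^esub> c) \<sqinter>\<^bsub>?M\<^esub> compl ?M a = m \<sqinter>\<^bsub>?M\<^esub> c"
        using ab c sub by (intro M.eq_by_lower) (auto simp: m_def M.le_meet_iff)
      ultimately show ?thesis using False by simp
    qed
    have atom: "m \<sqsubseteq>\<^bsub>?M\<^esub> e \<or> m \<sqinter>\<^bsub>?M\<^esub> e = \<bottom>\<^bsub>?M\<^esub>" if "e \<in> carrier ?M" for e
      using Ob_MTD(2)[OF D] that
    proof (induction rule: mt_induct)
      case (opens c)
      then show ?case using opn[of c] by (auto split: if_splits)
    next
      case (sup S)
      show ?case
      proof (cases "\<exists>s\<in>S. m \<sqsubseteq>\<^bsub>?M\<^esub> s")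
        case True
        then show ?thesis
          using sup(1) m M.sup_upper[OF sup(1)] M.le_trans[of m] by (meson M.sup_closed subsetD)
      next
        case False
        then have "s \<sqsubseteq>\<^bsub>?M\<^esub> compl ?M m" if "s \<in> S" for s
        proof -
          have sM: "s \<in> carrier ?M" using sup(1) that by blast
          have "m \<sqinter>\<^bsub>?M\<^esub> s = \<bottom>\<^bsub>?M\<^esub>" using sup(2)[OF that] False that by blast
          then show ?thesis
            using M.le_compl_iff[OF m sM] by (simp add: M.meet_commute[of s m])
        qed
        then have "\<Squnion>\<^bsub>?M\<^esub> S \<sqsubseteq>\<^bsub>?M\<^esub> compl ?M m"
          using sup(1) m by (intro M.sup_least) auto
        then show ?thesis
          using M.le_compl_iff[OF m, of "\<Squnion>\<^bsub>?M\<^esub> S"] sup(1) by (simp add: M.meet_commute[of _ m])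
      qed
    next
      case (inf S)
      show ?case
      proof (cases "\<forall>s\<in>S. m \<sqsubseteq>\<^bsub>?M\<^esub> s")
        case True
        then show ?thesis
          using M.le_inf_iff[OF inf(1) m] by simp
      next
        case False
        then obtain s where s: "s \<in> S" "m \<sqinter>\<^bsub>?M\<^esub> s = \<bottom>\<^bsub>?M\<^esub>"
          using inf(2) by blast
        then have sM: "s \<in> carrier ?M" using inf(1) by blast
        have "\<Sqinter>\<^bsub>?M\<^esub> S \<sqsubseteq>\<^bsub>?M\<^esub> compl ?M m"
          using M.le_trans[OF M.inf_lower[OF inf(1) s(1)], of "compl ?M m"] M.le_compl_iff[OF m sM] s(2) m sM inf(1)
          by (simp add: M.meet_commute)
        then show ?thesis
          using M.le_compl_iff[OF m, of "\<Sqinter>\<^bsub>?M\<^esub> S"] inf(1) by (simp add: M.meet_commute)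
      qed
    next
      case (compl e)
      then show ?case
        using M.le_iff_meet_compl[OF compl(1) m] M.le_compl_iff[OF compl(1) m] by auto
    qed
    have "c \<in> {e \<in> carrier ?M. m \<sqsubseteq>\<^bsub>?M\<^esub> e} \<longleftrightarrow> x \<in> elts (app \<theta> c)" if c: "c \<in> fst D" for c
    proof -
      have "m \<sqinter>\<^bsub>?M\<^esub> c = m" if "m \<sqsubseteq>\<^bsub>?M\<^esub> c"
        using that M.meet_eq_left[OF m sub[OF c]] by simp
      then show ?thesis
        using opn[OF c] m0 sub[OF c] by (auto split: if_splits)
    qed
    then show ?thesis
      using cba_point_atom[OF Ob_MTD(3)[OF D] m m0 atom] by blast
  qed
  then obtain P where P: "\<And>x. x \<in> topspace X \<Longrightarrow> cba_point ?M (P x)"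
    "\<And>x c. x \<in> topspace X \<Longrightarrow> c \<in> fst D \<Longrightarrow> c \<in> P x \<longleftrightarrow> x \<in> elts (app \<theta> c)"
    by metis
  define p where "p = lam (carrier ?M) (\<lambda>m. vset {x \<in> topspace X. m \<in> P x})"
  have smX: "small {x \<in> topspace X. Q x}" for Q
    by (rule small_subset[OF X(1)]) blast
  have pm: "app p m = vset {x \<in> topspace X. m \<in> P x}" if "m \<in> carrier ?M" for m
    using that Ob_MTD(1)[OF D] by (simp add: p_def)
  have p\<theta>: "app p c = app \<theta> c" if "c \<in> fst D" for c
  proof (rule elts_ext)
    have "elts (app \<theta> c) \<subseteq> topspace X"
      using \<theta>c[OF that] O.elts_sub by blast
    then show "elts (app p c) = elts (app \<theta> c)"
      using P(2)[OF _ that] smX by (auto simp: pm[OF sub[OF that]])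
  qed
  have pmaps: "p \<in> maps (carrier ?M) (vset ` Pow (topspace X))"
    unfolding p_def by (rule maps_I) blast
  have "p \<in> Hom MT D (powerset_mt X)"
  proof (rule MT_Hom_powerset_iff[OF D X(1) pmaps, THEN iffD2])
    show "app p ` fst D \<subseteq> carrier (opens X)"
      using p\<theta> th(1) by auto
    show "\<forall>x\<in>topspace X. cba_point ?M {m \<in> carrier ?M. x \<in> elts (app p m)}"
    proof
      fix x assume x: "x \<in> topspace X"
      have "x \<in> elts (app p m) \<longleftrightarrow> m \<in> P x" if "m \<in> carrier ?M" for m
        using x by (simp add: pm[OF that] smX)
      moreover have "P x \<subseteq> carrier ?M"
        using P(1)[OF x] by (simp add: cba_point_def)
      ultimately have "{m \<in> carrier ?M. x \<in> elts (app p m)} = P x"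
        by blast
      then show "cba_point ?M {m \<in> carrier ?M. x \<in> elts (app p m)}"
        using P(1)[OF x] by simp
    qed
  qed
  moreover have "fa OM D (powerset_mt X) p = \<theta>"
  proof -
    have "lam (fst D) (app p) = lam (fst D) (app \<theta>)"
      using p\<theta> by (rule lam_cong)
    then show ?thesis
      using lam_app[OF Ob_MTD(6)[OF D] \<theta>m] by (simp add: OM_simps)
  qed
  ultimately show "\<exists>p\<in>Hom MT D (powerset_mt X). fa OM D (powerset_mt X) p = \<theta>"
    by blast
qed

text \<open>The MT-algebra given by the Funayama embedding, with sublocales coded in the universe.\<close>

definition funayama_mt :: "'u::universe gorder \<Rightarrow> 'u mt" where
  "funayama_mt L = (vset ` open_sublocale L ` carrier L, set_order (carrier (Funayama L)))"

lemma small_sublocale: "L \<in> Ob Frm \<Longrightarrow> S \<in> carrier (Funayama L) \<Longrightarrow> small S"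
proof -
  assume L: "L \<in> Ob Frm" and S: "S \<in> carrier (Funayama L)"
  interpret frame L by unfold_locales (use L in \<open>simp add: Ob_Frm\<close>)
  have "S \<subseteq> carrier L"
    using Funayama_sublocale[OF S] by (simp add: is_sublocale_def)
  then show "small S"
    using L small_subset by (auto simp: Ob_Frm)
qed

lemma funayama_mt_iso:
  assumes L: "L \<in> Ob Frm"
  shows "is_cba (snd (funayama_mt L))" "is_cba_hom (Funayama L) (snd (funayama_mt L)) vset"
    "bij_betw vset (carrier (Funayama L)) (carrier (snd (funayama_mt L)))"
proof -
  interpret frame L by unfold_locales (use L in \<open>simp add: Ob_Frm\<close>)
  show bij: "bij_betw vset (carrier (Funayama L)) (carrier (snd (funayama_mt L)))"
    using small_sublocale[OF L] by (auto simp: funayama_mt_def bij_betw_def inj_on_def vset_eq_iff)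
  have le: "vset S \<sqsubseteq>\<^bsub>snd (funayama_mt L)\<^esub> vset T \<longleftrightarrow> S \<sqsubseteq>\<^bsub>Funayama L\<^esub> T"
    if "S \<in> carrier (Funayama L)" "T \<in> carrier (Funayama L)" for S T
    using that small_sublocale[OF L] by (simp add: funayama_mt_def)
  have "complete_lattice (snd (funayama_mt L))"
    by (rule order_iso_complete_lattice[OF Funayama_complete bij _ le]) (simp_all add: funayama_mt_def)
  then show "is_cba (snd (funayama_mt L))" "is_cba_hom (Funayama L) (snd (funayama_mt L)) vset"
    using order_iso_cba[OF Funayama_complete _ bij le Funayama_cba] by auto
qed

lemma funayama_mt_MT:
  assumes L: "L \<in> Ob Frm"
  shows "funayama_mt L \<in> Ob MT"
proof -
  interpret frame L by unfold_locales (use L in \<open>simp add: Ob_Frm\<close>)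
  note iso = funayama_mt_iso[OF L]
  have onto: "vset ` carrier (Funayama L) = carrier (snd (funayama_mt L))"
    by (simp add: funayama_mt_def)
  have "open_sublocale L ` carrier L \<subseteq> carrier (Funayama L)"
    by auto
  then have "difference_generated (fst (funayama_mt L)) (snd (funayama_mt L))"
    using cba_hom_image_difference_generated[OF Funayama_cba iso(1,2) onto _ Funayama_difference_generated]
    by (simp add: funayama_mt_def)
  moreover have "is_subframe (fst (funayama_mt L)) (snd (funayama_mt L))"
    using cba_hom_image_subframe[OF Funayama_cba iso(1,2) subframe_Funayama] by (simp add: funayama_mt_def)
  ultimately have "is_mt (funayama_mt L)"
    using is_mt_difference_generated[OF iso(1)] by (metis prod.collapse)
  moreover have "carrier (snd (funayama_mt L)) \<subseteq> vset ` Pow (carrier L)"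
    using Funayama_sublocale by (auto simp: funayama_mt_def is_sublocale_def)
  moreover have "small (vset ` Pow (carrier L))"
    using L small_powerset_codes[of "carrier L"] by (simp add: Ob_Frm)
  ultimately show ?thesis
    using small_subset by (simp add: Ob_MT)
qed

lemma funayama_mt_opens_iso:
  assumes L: "L \<in> Ob Frm"
  defines "\<kappa> \<equiv> lam (carrier L) (\<lambda>a. vset (open_sublocale L a))"
  shows "\<exists>\<kappa>'. inverse_arrows Frm L (fo OM (funayama_mt L)) \<kappa> \<kappa>'"
proof -
  interpret frame L by unfold_locales (use L in \<open>simp add: Ob_Frm\<close>)
  have sm: "small (open_sublocale L a)" if "a \<in> carrier L" for a
    using small_sublocale[OF L] that by simp
  have "bij_betw (\<lambda>a. vset (open_sublocale L a)) (carrier L) (carrier (fo OM (funayama_mt L)))"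
    using sm inj_on_open_sublocale
    by (auto simp: bij_betw_def inj_on_def vset_eq_iff funayama_mt_def)
  moreover have "vset (open_sublocale L a) \<sqsubseteq>\<^bsub>fo OM (funayama_mt L)\<^esub> vset (open_sublocale L b) \<longleftrightarrow> a \<sqsubseteq>\<^bsub>L\<^esub> b"
    if "a \<in> carrier L" "b \<in> carrier L" for a b
    using that sm open_sublocale_le_iff by (simp add: funayama_mt_def)
  ultimately show ?thesis
    unfolding \<kappa>_def using order_iso_Frm[OF L OM_Frm[OF funayama_mt_MT[OF L]]] by blast
qed

text \<open>
  A fiber-terminal algebra over \<open>L\<close> is isomorphic to the Funayama algebra of \<open>L\<close>: terminality
  gives a map out of the latter, which is surjective by the \<open>T\<^sub>0\<close> condition on the target, and
  injective because differences of open elements are join-dense in its source.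
\<close>

lemma fiber_terminal_funayama_iso:
  assumes C: "C \<in> Ob MT" "fiber_terminal C" and L: "L \<in> Ob Frm" and \<theta>: "inverse_arrows Frm (fo OM C) L \<theta> \<theta>'"
  shows "\<exists>g. is_cba_hom (Funayama L) (snd C) g \<and> bij_betw g (carrier (Funayama L)) (carrier (snd C)) \<and>
    (\<forall>a\<in>fst C. g (open_sublocale L (app \<theta> a)) = a)"
proof -
  interpret frame L by unfold_locales (use L in \<open>simp add: Ob_Frm\<close>)
  interpret M: complete_boolean_algebra "snd C" by unfold_locales (rule Ob_MTD(3)[OF C(1)])
  note fL = funayama_mt_MT[OF L]
  have smL: "small (carrier L)" using L by (simp add: Ob_Frm)
  let ?\<kappa> = "lam (carrier L) (\<lambda>a. vset (open_sublocale L a))"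
  obtain \<kappa>' where \<kappa>: "inverse_arrows Frm L (fo OM (funayama_mt L)) ?\<kappa> \<kappa>'"
    using funayama_mt_opens_iso[OF L] by blast
  note k = inverse_arrows_FrmD[OF \<kappa> L OM_Frm[OF fL], unfolded carrier_OM]
  note t = inverse_arrows_FrmD[OF \<theta> OM_Frm[OF C(1)] L, unfolded carrier_OM le_OM]
  have "inverse_arrows Frm (fo OM (funayama_mt L)) (fo OM C) (vcomp \<theta>' \<kappa>') (vcomp ?\<kappa> \<theta>)"
    using inverse_arrows_comp[OF is_category_Frm OM_Frm[OF fL] L OM_Frm[OF C(1)]] \<kappa> \<theta>
    by (metis Frm_simps(1) inverse_arrows_sym)
  then have "is_iso Frm (fo OM (funayama_mt L)) (fo OM C) (vcomp \<theta>' \<kappa>')"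
    unfolding is_iso_def by blast
  then obtain p where p: "p \<in> Hom MT (funayama_mt L) C" "fa OM (funayama_mt L) C p = vcomp \<theta>' \<kappa>'"
    using C(2) fL unfolding fiber_terminal_def by blast
  have ph: "is_cba_hom (snd (funayama_mt L)) (snd C) (app p)"
    using p(1) by (simp add: Hom_MT)
  define g where "g = (\<lambda>S. app p (vset S))"
  have gh: "is_cba_hom (Funayama L) (snd C) g"
    unfolding g_def by (rule is_cba_hom_comp[OF funayama_mt_iso(2)[OF L] ph])
  have g_open: "g (open_sublocale L b) = app \<theta>' b" if b: "b \<in> carrier L" for b
  proof -
    have o: "vset (open_sublocale L b) \<in> fst (funayama_mt L)"
      using b by (simp add: funayama_mt_def)
    have "app p (vset (open_sublocale L b)) = app (fa OM (funayama_mt L) C p) (vset (open_sublocale L b))"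
      using o Ob_MTD(6)[OF fL] by (simp add: OM_simps)
    also have "\<dots> = app \<theta>' (app \<kappa>' (app ?\<kappa> b))"
      unfolding p(2)
      using app_vcomp[of "fst (funayama_mt L)" \<kappa>' "carrier L", OF Ob_MTD(6)[OF fL] _ o] \<kappa> b smL
      by (simp add: inverse_arrows_def Hom_Frm)
    also have "\<dots> = app \<theta>' b"
      using k(3)[OF b] by simp
    finally show ?thesis by (simp add: g_def)
  qed
  have "fst C \<subseteq> g ` carrier (Funayama L)"
  proof
    fix a assume a: "a \<in> fst C"
    then have "a = g (open_sublocale L (app \<theta> a))"
      using g_open t by simp
    then show "a \<in> g ` carrier (Funayama L)"
      by (rule image_eqI) (rule open_in_Funayama[OF t(1)[OF a]])
  qed
  then have "g ` carrier (Funayama L) = carrier (snd C)"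
    by (rule cba_hom_onto[OF Ob_MTD(2)[OF C(1)] Funayama_cba gh])
  moreover have "inj_on g (carrier (Funayama L))"
  proof (rule cba_hom_inj[OF Funayama_cba Ob_MTD(3)[OF C(1)] gh _ Funayama_difference_generated])
    show "open_sublocale L ` carrier L \<subseteq> carrier (Funayama L)" by auto
    fix A B assume "A \<in> open_sublocale L ` carrier L" "B \<in> open_sublocale L ` carrier L"
      and le: "g B \<sqsubseteq>\<^bsub>snd C\<^esub> g A"
    then obtain a b where ab: "a \<in> carrier L" "b \<in> carrier L" "A = open_sublocale L a" "B = open_sublocale L b"
      by blast
    then have "app \<theta>' b \<sqsubseteq>\<^bsub>snd C\<^esub> app \<theta>' a"
      using le g_open by simp
    then have "b \<sqsubseteq>\<^bsub>L\<^esub> a"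
      using t(5)[OF t(2)[OF ab(2)] t(2)[OF ab(1)]] t(4) ab by simp
    then show "B \<sqsubseteq>\<^bsub>Funayama L\<^esub> A"
      using ab open_sublocale_le_iff by simp
  qed
  ultimately show ?thesis
    using gh g_open t by (intro exI[of _ g]) (auto simp: bij_betw_def)
qed

section \<open>Locally exact maps\<close>

text \<open>
  The universal property of the frame of opens of a \<open>T\<^sub>D\<close>-space with respect to locally exact maps.
  It is that of the powerset, since the Funayama algebra of the opens of \<open>X\<close> is isomorphic to the
  powerset of \<open>X\<close>, the powerset algebra being fiber-terminal.
\<close>

lemma locally_exact_opens_iff:
  assumes L: "L \<in> Ob Frm" and X: "X \<in> Ob TopD" and f: "f \<in> carrier L \<rightarrow> carrier (opens X)"
  shows "locally_exact L (opens X) f \<longleftrightarrow> (\<forall>x\<in>topspace X. \<exists>P. cba_point (Funayama L) P \<and>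
    (\<forall>a\<in>carrier L. open_sublocale L a \<in> P \<longleftrightarrow> x \<in> elts (f a)))"
proof -
  interpret frame L by unfold_locales (use L in \<open>simp add: Ob_Frm\<close>)
  have XT: "X \<in> Ob Top" and smX: "small (topspace X)"
    using X by (auto simp: Ob_TopD Ob_Top)
  interpret pX: small_set "topspace X" by unfold_locales (rule smX)
  interpret oX: set_frame "topspace X" "{U. openin X U}" by (rule set_frame_opens[OF smX])
  have oF: "opens X \<in> Ob Frm" by (rule opens_Frm[OF smX])
  then interpret O: frame "opens X" by unfold_locales (simp add: Ob_Frm)
  let ?P = "set_order (Pow (topspace X))"
  have "inverse_arrows Frm (fo OM (powerset_mt X)) (opens X) (vid (carrier (opens X))) (vid (carrier (opens X)))"
    using inverse_arrows_Idt[OF is_category_Frm oF] by (simp add: OM_powerset_mt)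
  then obtain g where g: "is_cba_hom (Funayama (opens X)) ?P g"
    "bij_betw g (carrier (Funayama (opens X))) (carrier ?P)"
    "\<And>u. u \<in> carrier (opens X) \<Longrightarrow> g (open_sublocale (opens X) u) = u"
    using fiber_terminal_funayama_iso[OF powerset_mt_MT[OF XT] powerset_mt_fiber_terminal[OF X] oF] oF
    unfolding Ob_Frm powerset_mt_simps by (metis app_vid)
  have fin: "f a \<in> carrier (opens X)" if "a \<in> carrier L" for a
    using f that by blast
  show ?thesis
  proof
    assume "locally_exact L (opens X) f"
    then obtain G where G: "is_cba_hom (Funayama L) (Funayama (opens X)) G"
      "\<And>a. a \<in> carrier L \<Longrightarrow> G (open_sublocale L a) = open_sublocale (opens X) (f a)"
      unfolding locally_exact_def by blast
    have gG: "is_cba_hom (Funayama L) ?P (\<lambda>S. g (G S))"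
      by (rule is_cba_hom_comp[OF G(1) g(1)])
    have gGc: "(\<lambda>S. g (G S)) \<in> carrier (Funayama L) \<rightarrow> vset ` Pow (topspace X)"
      using gG by (simp add: is_cba_hom_def)
    show "\<forall>x\<in>topspace X. \<exists>P. cba_point (Funayama L) P \<and>
        (\<forall>a\<in>carrier L. open_sublocale L a \<in> P \<longleftrightarrow> x \<in> elts (f a))"
    proof
      fix x assume "x \<in> topspace X"
      then have "cba_point (Funayama L) {S \<in> carrier (Funayama L). x \<in> elts (g (G S))}"
        using pX.cba_hom_powerset_iff[OF Funayama_cba gGc] gG by blast
      moreover have "\<forall>a\<in>carrier L. open_sublocale L a \<in> {S \<in> carrier (Funayama L). x \<in> elts (g (G S))} \<longleftrightarrow>
          x \<in> elts (f a)"
        using G(2) g(3) fin by simp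
      ultimately show "\<exists>P. cba_point (Funayama L) P \<and> (\<forall>a\<in>carrier L. open_sublocale L a \<in> P \<longleftrightarrow> x \<in> elts (f a))"
        by blast
    qed
  next
    assume "\<forall>x\<in>topspace X. \<exists>P. cba_point (Funayama L) P \<and>
        (\<forall>a\<in>carrier L. open_sublocale L a \<in> P \<longleftrightarrow> x \<in> elts (f a))"
    then obtain P where P: "\<And>x. x \<in> topspace X \<Longrightarrow> cba_point (Funayama L) (P x)"
      "\<And>x a. x \<in> topspace X \<Longrightarrow> a \<in> carrier L \<Longrightarrow> open_sublocale L a \<in> P x \<longleftrightarrow> x \<in> elts (f a)"
      by metis
    have sm: "small {x \<in> topspace X. Q x}" for Q
      by (rule small_subset[OF smX]) blast
    let ?h = "\<lambda>S. vset {x \<in> topspace X. S \<in> P x}"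
    have hc: "?h \<in> carrier (Funayama L) \<rightarrow> vset ` Pow (topspace X)"
      by blast
    have "{S \<in> carrier (Funayama L). x \<in> elts (?h S)} = P x" if "x \<in> topspace X" for x
      using P(1)[OF that] that sm by (auto simp: cba_point_def)
    then have h: "is_cba_hom (Funayama L) ?P ?h"
      using pX.cba_hom_powerset_iff[OF Funayama_cba hc] P(1) by simp
    have h_open: "?h (open_sublocale L a) = f a" if a: "a \<in> carrier L" for a
    proof (rule elts_ext)
      have "elts (f a) \<subseteq> topspace X"
        using fin[OF a] in_opens_iff[OF smX] openin_subset by blast
      then show "elts (?h (open_sublocale L a)) = elts (f a)"
        using sm P(2)[OF _ a] by auto
    qed
    let ?g' = "inv_into (carrier (Funayama (opens X))) g"
    have g': "is_cba_hom ?P (Funayama (opens X)) ?g'"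
      using is_cba_hom_inverse[OF O.Funayama_cba pX.pow_cba g(1,2)] .
    have "?g' u = open_sublocale (opens X) u" if "u \<in> carrier (opens X)" for u
      using inv_into_f_f[of g "carrier (Funayama (opens X))" "open_sublocale (opens X) u"] g(2) g(3)[OF that] that
      by (simp add: bij_betw_def)
    then have "\<forall>a\<in>carrier L. ?g' (?h (open_sublocale L a)) = open_sublocale (opens X) (f a)"
      using h_open fin by simp
    \<comment> \<open>Points of the Funayama algebra restrict to points of the frame.\<close>
    moreover have "is_frame_hom L (opens X) f"
      unfolding opens_def
    proof (rule oX.frame_hom_set_frame_iff[THEN iffD2])
      show "is_frame L" by (rule frame)
      show "f \<in> carrier L \<rightarrow> vset ` {U. openin X U}"
        using f by (simp add: carrier_opens)
      show "\<forall>x\<in>topspace X. frame_point L {a \<in> carrier L. x \<in> elts (f a)}"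
      proof
        fix x assume x: "x \<in> topspace X"
        interpret F: complete_boolean_algebra "Funayama L" by unfold_locales (rule Funayama_cba)
        have eq: "{a \<in> carrier L. x \<in> elts (f a)} = {a \<in> carrier L. open_sublocale L a \<in> P x}"
          using P(2)[OF x] by blast
        have "\<top>\<^bsub>Funayama L\<^esub> \<in> P x"
          using P(1)[OF x] F.inf_empty_eq unfolding cba_point_def by (metis empty_subsetI)
        moreover have "open_sublocale L (a \<sqinter>\<^bsub>L\<^esub> b) \<in> P x \<longleftrightarrow> open_sublocale L a \<in> P x \<and> open_sublocale L b \<in> P x"
          if "a \<in> carrier L" "b \<in> carrier L" for a b
          using that cba_point_meet[OF P(1)[OF x]] by (simp add: open_sublocale_meet)
        moreover have "open_sublocale L (\<Squnion>\<^bsub>L\<^esub> S) \<in> P x \<longleftrightarrow> (\<exists>s\<in>S. open_sublocale L s \<in> P x)"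
          if S: "S \<subseteq> carrier L" for S
        proof -
          have "open_sublocale L ` S \<subseteq> carrier (Funayama L)" using S by auto
          then show ?thesis
            using P(1)[OF x] by (simp add: open_sublocale_sup[OF S] cba_point_def)
        qed
        ultimately show "frame_point L {a \<in> carrier L. x \<in> elts (f a)}"
          unfolding eq frame_point_def by (auto simp: open_sublocale_top)
      qed
    qed
    ultimately show "locally_exact L (opens X) f"
      unfolding locally_exact_def using is_cba_hom_comp[OF h g'] by blast
  qed
qed

lemma locally_exact_two_iff:
  assumes L: "L \<in> Ob Frm" and f: "f \<in> carrier L \<rightarrow> {v0, v1}"
  shows "locally_exact L two f \<longleftrightarrow>
    (\<exists>P. cba_point (Funayama L) P \<and> (\<forall>a\<in>carrier L. open_sublocale L a \<in> P \<longleftrightarrow> f a = v1))"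
proof -
  have "v0 \<in> elts (f a) \<longleftrightarrow> f a = v1" if "a \<in> carrier L" for a
    using f that v0_in_iff by blast
  then show ?thesis
    using locally_exact_opens_iff[OF L discrete_one_TopD, of f] f by (simp add: opens_discrete_one)
qed

text \<open>
  Replacing each of two fiber-terminal algebras by the isomorphic Funayama algebra turns lifts of a
  frame map into extensions to the Funayama algebras.
\<close>

lemma locally_exact_iff_lifts:
  assumes C: "C \<in> Ob MTT" and C': "C' \<in> Ob MTT" and L: "L \<in> Ob Frm" and L': "L' \<in> Ob Frm"
    and \<theta>: "is_iso Frm (fo OM C) L \<theta>" and \<theta>': "is_iso Frm (fo OM C') L' \<theta>'" and f: "f \<in> Hom Frm L L'"
  shows "locally_exact L L' (app f) \<longleftrightarrow> (\<exists>p\<in>Hom MTT C C'. vcomp f \<theta> = vcomp \<theta>' (fa OM C C' p))"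
proof -
  have CM: "C \<in> Ob MT" "fiber_terminal C" "C' \<in> Ob MT" "fiber_terminal C'"
    using C C' by (auto simp: MTT_def)
  interpret L: frame L by unfold_locales (use L in \<open>simp add: Ob_Frm\<close>)
  interpret L': frame L' by unfold_locales (use L' in \<open>simp add: Ob_Frm\<close>)
  obtain \<theta>i \<theta>'i where inv: "inverse_arrows Frm (fo OM C) L \<theta> \<theta>i" "inverse_arrows Frm (fo OM C') L' \<theta>' \<theta>'i"
    using \<theta> \<theta>' by (auto simp: is_iso_def)
  note t = inverse_arrows_FrmD[OF inv(1) OM_Frm[OF CM(1)] L, unfolded carrier_OM]
  note t' = inverse_arrows_FrmD[OF inv(2) OM_Frm[OF CM(3)] L', unfolded carrier_OM]
  have \<theta>m: "\<theta> \<in> maps (fst C) (carrier L)" "\<theta>' \<in> maps (fst C') (carrier L')"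
    using inv by (auto simp: inverse_arrows_def Hom_Frm)
  have fm: "f \<in> maps (carrier L) (carrier L')" "is_frame_hom L L' (app f)"
    using f by (auto simp: Hom_Frm)
  have fin: "app f b \<in> carrier L'" if "b \<in> carrier L" for b
    using frame_hom_closed[OF fm(2) that] .
  note sm = Ob_MTD(6)[OF CM(1)] Ob_MTD(6)[OF CM(3)] Ob_MTD(1)[OF CM(1)]
  have sub: "a \<in> carrier (snd C)" if "a \<in> fst C" for a
    using that Ob_MTD(5)[OF CM(1)] by blast
  obtain g where g: "is_cba_hom (Funayama L) (snd C) g" "bij_betw g (carrier (Funayama L)) (carrier (snd C))"
    "\<And>a. a \<in> fst C \<Longrightarrow> g (open_sublocale L (app \<theta> a)) = a"
    using fiber_terminal_funayama_iso[OF CM(1,2) L inv(1)] by blast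
  obtain g' where g': "is_cba_hom (Funayama L') (snd C') g'" "bij_betw g' (carrier (Funayama L')) (carrier (snd C'))"
    "\<And>a. a \<in> fst C' \<Longrightarrow> g' (open_sublocale L' (app \<theta>' a)) = a"
    using fiber_terminal_funayama_iso[OF CM(3,4) L' inv(2)] by blast
  let ?gi = "inv_into (carrier (Funayama L)) g" and ?gi' = "inv_into (carrier (Funayama L')) g'"
  have gi: "is_cba_hom (snd C) (Funayama L) ?gi" "is_cba_hom (snd C') (Funayama L') ?gi'"
    using is_cba_hom_inverse[OF L.Funayama_cba Ob_MTD(3)[OF CM(1)] g(1,2)]
      is_cba_hom_inverse[OF L'.Funayama_cba Ob_MTD(3)[OF CM(3)] g'(1,2)] by auto
  have gi_open: "?gi a = open_sublocale L (app \<theta> a)" if "a \<in> fst C" for a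
    using inv_into_f_f[of g "carrier (Funayama L)" "open_sublocale L (app \<theta> a)"] g(2) g(3)[OF that] t(1)[OF that]
    by (simp add: bij_betw_def)
  have gi'_open: "?gi' a = open_sublocale L' (app \<theta>' a)" if "a \<in> fst C'" for a
    using inv_into_f_f[of g' "carrier (Funayama L')" "open_sublocale L' (app \<theta>' a)"] g'(2) g'(3)[OF that] t'(1)[OF that]
    by (simp add: bij_betw_def)
  have MTT_Hom: "Hom MTT = Hom MT" by (simp add: MTT_def)
  show ?thesis
  proof
    assume "locally_exact L L' (app f)"
    then obtain G where G: "is_cba_hom (Funayama L) (Funayama L') G"
      "\<And>a. a \<in> carrier L \<Longrightarrow> G (open_sublocale L a) = open_sublocale L' (app f a)"
      unfolding locally_exact_def by blast
    let ?q = "\<lambda>m. g' (G (?gi m))"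
    have q: "is_cba_hom (snd C) (snd C') ?q"
      using is_cba_hom_comp[OF is_cba_hom_comp[OF gi(1) G(1)] g'(1)] .
    have q_open: "?q a = app \<theta>'i (app f (app \<theta> a))" if a: "a \<in> fst C" for a
      using gi_open[OF a] G(2)[OF t(1)[OF a]] g'(3)[OF t'(2)[OF fin[OF t(1)[OF a]]]] t'(4)[OF fin[OF t(1)[OF a]]] by simp
    let ?p = "lam (carrier (snd C)) ?q"
    have p_app: "app ?p m = ?q m" if "m \<in> carrier (snd C)" for m
      using that sm by simp
    have "?p \<in> Hom MTT C C'"
      unfolding MTT_Hom Hom_MT
    proof (intro conjI)
      show "?p \<in> maps (carrier (snd C)) (carrier (snd C'))"
        using cba_hom_closed[OF q] by (intro maps_I) blast
      show "is_cba_hom (snd C) (snd C') (app ?p)"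
        using is_cba_hom_cong[OF Ob_MTD(3)[OF CM(1)], of "app ?p" ?q] p_app q by blast
      have "app ?p a \<in> fst C'" if "a \<in> fst C" for a
        using p_app[OF sub[OF that]] q_open[OF that] t'(2)[OF fin[OF t(1)[OF that]]] by simp
      then show "app ?p ` fst C \<subseteq> fst C'" by blast
    qed
    moreover have "vcomp f \<theta> = vcomp \<theta>' (fa OM C C' ?p)"
    proof -
      have "vcomp \<theta>' (fa OM C C' ?p) = lam (fst C) (\<lambda>a. app \<theta>' (app ?p a))"
        using sm by (simp add: OM_simps)
      also have "\<dots> = lam (fst C) (\<lambda>a. app f (app \<theta> a))"
        using p_app[OF sub] q_open t'(4) fin t(1) by (intro lam_cong) simp
      finally show ?thesis
        using vcomp_eq_lam[OF sm(1) \<theta>m(1)] by simp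
    qed
    ultimately show "\<exists>p\<in>Hom MTT C C'. vcomp f \<theta> = vcomp \<theta>' (fa OM C C' p)"
      by blast
  next
    assume "\<exists>p\<in>Hom MTT C C'. vcomp f \<theta> = vcomp \<theta>' (fa OM C C' p)"
    then obtain p where p: "p \<in> Hom MT C C'" "vcomp f \<theta> = vcomp \<theta>' (fa OM C C' p)"
      unfolding MTT_Hom by blast
    have ph: "is_cba_hom (snd C) (snd C') (app p)" "app p ` fst C \<subseteq> fst C'"
      using p(1) by (auto simp: Hom_MT)
    have p_open: "app \<theta>' (app p a) = app f (app \<theta> a)" if a: "a \<in> fst C" for a
    proof -
      have "app (vcomp \<theta>' (fa OM C C' p)) a = app \<theta>' (app p a)"
        using a sm by (simp add: OM_simps)
      moreover have "app (vcomp f \<theta>) a = app f (app \<theta> a)"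
        using app_vcomp[OF sm(1) \<theta>m(1) a] .
      ultimately show ?thesis using p(2) by simp
    qed
    let ?G = "\<lambda>S. ?gi' (app p (g S))"
    have "is_cba_hom (Funayama L) (Funayama L') ?G"
      using is_cba_hom_comp[OF is_cba_hom_comp[OF g(1) ph(1)] gi(2)] .
    moreover have "?G (open_sublocale L b) = open_sublocale L' (app f b)" if b: "b \<in> carrier L" for b
    proof -
      have a: "app \<theta>i b \<in> fst C" "app \<theta> (app \<theta>i b) = b"
        using t b by auto
      have "app p (app \<theta>i b) \<in> fst C'"
        using a(1) ph(2) by blast
      then show ?thesis
        using g(3)[OF a(1)] a(2) gi'_open p_open[OF a(1)] by simp
    qed
    ultimately show "locally_exact L L' (app f)"
      unfolding locally_exact_def using fm(2) by blast
  qed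
qed

section \<open>Dual adjunctions given by points\<close>

lemma lam_cong': "A = B \<Longrightarrow> (\<And>x. x \<in> B \<Longrightarrow> f x = g x) \<Longrightarrow> lam A f = lam B g"
  using lam_cong by blast

lemma op_cat_simps [simp]: "Ob (op_cat C) = Ob C" "Hom (op_cat C) a b = Hom C b a"
  "Idt (op_cat C) = Idt C" "Cmp (op_cat C) g f = Cmp C f g"
  by (simp_all add: op_cat_def)

lemma is_category_op:
  assumes C: "is_category C"
  shows "is_category (op_cat C)"
  unfolding is_category_def op_cat_simps
proof (intro conjI ballI)
  fix a b c d f g h
  assume "a \<in> Ob C" "b \<in> Ob C" "c \<in> Ob C" "d \<in> Ob C" "f \<in> Hom C b a" "g \<in> Hom C c b" "h \<in> Hom C d c"
  then have "Cmp C f (Cmp C g h) = Cmp C (Cmp C f g) h"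
    using C unfolding is_category_def by blast
  then show "Cmp C (Cmp C f g) h = Cmp C f (Cmp C g h)"
    by simp
qed (use C in \<open>simp_all add: is_category_def\<close>)

lemma incl_simps [simp]: "fo incl a = a" "fa incl a b f = f"
  by (simp_all add: incl_def)

lemma func_comp_simps [simp]: "fo (func_comp G F) a = fo G (fo F a)"
  "fa (func_comp G F) a b f = fa G (fo F a) (fo F b) (fa F a b f)"
  by (simp_all add: func_comp_def)

text \<open>
  A sufficient condition for an adjunction of the form \<open>pt_adj\<close>. The category \<open>K\<close> is concrete,
  with underlying sets \<open>und c\<close> that contain the sets \<open>opn c\<close> of open elements; these two differ for
  MT-algebras and coincide for frames. The dualizing object \<open>t\<close> has two elements, and the spaces are
  restricted by the predicate \<open>Q\<close>. The object \<open>R X\<close> consists of (codes of) subsets of \<open>X\<close>, with the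
  open sets as its open elements. The crucial assumption \<open>R_char\<close> is the universal property of
  \<open>R X\<close>: an arrow to \<open>R X\<close> is a family of points indexed by \<open>X\<close>.
\<close>

locale pt_duality =
  fixes K :: "('o, 'u::universe) cat" and t :: 'o and opn und :: "'o \<Rightarrow> 'u set"
    and R :: "'u topology \<Rightarrow> 'o" and Q :: "'u topology \<Rightarrow> bool"
  fixes T pt
  defines "T \<equiv> full_subcat Top Q" and "pt \<equiv> \<lambda>c. pt_space (Hom K c t) (opn c)"
  assumes category: "is_category K" and Cmp_K: "Cmp K = vcomp"
    and Idt_K: "\<And>c. c \<in> Ob K \<Longrightarrow> Idt K c = vid (und c)"
    and small_und: "\<And>c. c \<in> Ob K \<Longrightarrow> small (und c)"
    and opn_und: "\<And>c. c \<in> Ob K \<Longrightarrow> opn c \<subseteq> und c"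
    and Hom_maps: "\<And>c d f. c \<in> Ob K \<Longrightarrow> d \<in> Ob K \<Longrightarrow> f \<in> Hom K c d \<Longrightarrow> f \<in> maps (und c) (und d)"
    and Hom_opn: "\<And>c d f a. c \<in> Ob K \<Longrightarrow> d \<in> Ob K \<Longrightarrow> f \<in> Hom K c d \<Longrightarrow> a \<in> opn c \<Longrightarrow> app f a \<in> opn d"
    and t_Ob: "t \<in> Ob K" and und_t: "und t = {v0, v1}"
    and R_Ob: "\<And>X. X \<in> Ob T \<Longrightarrow> R X \<in> Ob K"
    and R_opn: "\<And>X. X \<in> Ob T \<Longrightarrow> opn (R X) = carrier (opens X)"
    and R_und: "\<And>X. X \<in> Ob T \<Longrightarrow> und (R X) \<subseteq> vset ` Pow (topspace X)"
    and R_preimage: "\<And>X Y g A. X \<in> Ob T \<Longrightarrow> Y \<in> Ob T \<Longrightarrow> g \<in> Hom Top Y X \<Longrightarrow> A \<in> und (R X) \<Longrightarrow>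
      vset {y \<in> topspace Y. app g y \<in> elts A} \<in> und (R Y)"
    and R_char: "\<And>X c h. X \<in> Ob T \<Longrightarrow> c \<in> Ob K \<Longrightarrow> h \<in> maps (und c) (und (R X)) \<Longrightarrow>
      (\<And>a. a \<in> opn c \<Longrightarrow> app h a \<in> opn (R X)) \<Longrightarrow>
      h \<in> Hom K c (R X) \<longleftrightarrow>
        (\<forall>x\<in>topspace X. lam (und c) (\<lambda>m. if x \<in> elts (app h m) then v1 else v0) \<in> Hom K c t)"
    and pt_Ob: "\<And>c. c \<in> Ob K \<Longrightarrow> pt c \<in> Ob T"
    and topspace_pt: "\<And>c. c \<in> Ob K \<Longrightarrow> topspace (pt c) = Hom K c t"
    and openin_pt: "\<And>c U. c \<in> Ob K \<Longrightarrow> openin (pt c) U \<longleftrightarrow> (\<exists>a\<in>opn c. U = {f \<in> Hom K c t. app f a = v1})"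
    and R_pt: "\<And>c m. c \<in> Ob K \<Longrightarrow> m \<in> und c \<Longrightarrow> vset {f \<in> Hom K c t. app f m = v1} \<in> und (R (pt c))"
begin

text \<open>
  The action of the left adjoint on arrows is precomposition, and that of the right adjoint is the
  preimage map. The unit sends \<open>m\<close> to the set of points \<open>f\<close> with \<open>f m = 1\<close>, and the component
  of the counit at \<open>X\<close>, read as a continuous map from \<open>X\<close> to the spectrum of \<open>R X\<close>, sends \<open>x\<close> to
  the point given by membership of \<open>x\<close>.
\<close>

definition pt_map where "pt_map d p = lam (Hom K d t) (\<lambda>f. vcomp f p)"
definition preim where "preim X Y g = lam (und (R X)) (\<lambda>A. vset {y \<in> topspace Y. app g y \<in> elts A})"
definition eval where "eval X x = lam (und (R X)) (\<lambda>A. if x \<in> elts A then v1 else v0)"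
definition eta where "eta c = lam (und c) (\<lambda>m. vset {f \<in> Hom K c t. app f m = v1})"
definition eps where "eps X = lam (topspace X) (eval X)"
definition adj where "adj = pt_adj K t opn und R T"

lemma adj_simps [simp]: "LC adj = K" "RC adj = op_cat T" "fo (LF adj) = pt" "fa (LF adj) c d = pt_map d"
  "fo (RF adj) = R" "fa (RF adj) = preim" "unit adj = eta" "counit adj = eps"
  by (auto simp: adj_def pt_adj_def pt_def pt_map_def preim_def eta_def eps_def eval_def[abs_def] fun_eq_iff)

lemma T_simps [simp]: "Hom T = Hom Top" "Cmp T = vcomp" "Idt T X = vid (topspace X)"
  by (simp_all add: T_def)

lemma Ob_T: "X \<in> Ob T \<longleftrightarrow> X \<in> Ob Top \<and> Q X"
  by (simp add: T_def)

lemma category_T: "is_category T"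
  unfolding T_def by (rule is_category_full_subcat[OF is_category_Top])

lemma small_topspace: "X \<in> Ob T \<Longrightarrow> small (topspace X)"
  by (simp add: Ob_T Ob_Top)

lemma small_Hom: "c \<in> Ob K \<Longrightarrow> small (Hom K c t)"
  using small_topspace[OF pt_Ob] by (simp add: topspace_pt)

lemma small_sub: "X \<in> Ob T \<Longrightarrow> small {x \<in> topspace X. P x}"
  by (rule small_subset[OF small_topspace]) auto

lemma small_sub_Hom: "c \<in> Ob K \<Longrightarrow> small {f \<in> Hom K c t. P f}"
  by (rule small_subset[OF small_Hom]) auto

lemma Hom_comp: "c \<in> Ob K \<Longrightarrow> d \<in> Ob K \<Longrightarrow> e \<in> Ob K \<Longrightarrow> f \<in> Hom K c d \<Longrightarrow> g \<in> Hom K d e \<Longrightarrow>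
    vcomp g f \<in> Hom K c e"
  using category unfolding is_category_def Cmp_K by blast

lemma Hom_Idt: "c \<in> Ob K \<Longrightarrow> vid (und c) \<in> Hom K c c"
  using category Idt_K unfolding is_category_def by metis

lemma elts_R: "X \<in> Ob T \<Longrightarrow> m \<in> und (R X) \<Longrightarrow> elts m \<subseteq> topspace X"
  using R_und in_Pow_iff[OF small_topspace] by blast

lemma opn_R: "X \<in> Ob T \<Longrightarrow> m \<in> opn (R X) \<longleftrightarrow> openin X (elts m)"
  using R_opn in_opens_iff[OF small_topspace] by simp

lemma point_values: "c \<in> Ob K \<Longrightarrow> f \<in> Hom K c t \<Longrightarrow> m \<in> und c \<Longrightarrow> app f m = (if app f m = v1 then v1 else v0)"
  using app_maps[OF Hom_maps[OF _ t_Ob] small_und] und_t by auto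

lemma point_eq_lam:
  "c \<in> Ob K \<Longrightarrow> f \<in> Hom K c t \<Longrightarrow> lam (und c) (\<lambda>m. if app f m = v1 then v1 else v0) = f"
  using lam_cong[of "und c" "\<lambda>m. if app f m = v1 then v1 else v0" "app f"] point_values
    lam_app[OF small_und Hom_maps[OF _ t_Ob]] by metis

lemma pt_map_Top:
  assumes c: "c \<in> Ob K" and d: "d \<in> Ob K" and p: "p \<in> Hom K c d"
  shows "pt_map d p \<in> Hom Top (pt d) (pt c)"
proof -
  have val: "app (pt_map d p) f = vcomp f p" "vcomp f p \<in> Hom K c t" if "f \<in> Hom K d t" for f
    using that Hom_comp[OF c d t_Ob p] by (simp_all add: pt_map_def small_Hom[OF d])
  have ev: "app (vcomp f p) a = app f (app p a)" if "a \<in> opn c" for f a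
    using app_vcomp[OF small_und[OF c] Hom_maps[OF c d p]] opn_und[OF c] that by blast
  have "continuous_map (pt d) (pt c) (app (pt_map d p))"
    unfolding continuous_map_def topspace_pt[OF c] topspace_pt[OF d]
  proof (intro conjI allI impI)
    show "app (pt_map d p) \<in> Hom K d t \<rightarrow> Hom K c t"
      using val by auto
    fix U assume "openin (pt c) U"
    then obtain a where a: "a \<in> opn c" "U = {f \<in> Hom K c t. app f a = v1}"
      using openin_pt[OF c] by blast
    have "{f \<in> Hom K d t. app (pt_map d p) f \<in> U} = {f \<in> Hom K d t. app f (app p a) = v1}"
      using val ev[OF a(1)] by (auto simp: a(2))
    then show "openin (pt d) {f \<in> Hom K d t. app (pt_map d p) f \<in> U}"
      using openin_pt[OF d] Hom_opn[OF c d p a(1)] by blast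
  qed
  moreover have "pt_map d p \<in> maps (Hom K d t) (Hom K c t)"
    unfolding pt_map_def by (rule maps_I) (use val in auto)
  ultimately show ?thesis
    by (simp add: Hom_Top topspace_pt c d)
qed

lemma eval_Hom:
  assumes X: "X \<in> Ob T" and x: "x \<in> topspace X"
  shows "eval X x \<in> Hom K (R X) t"
proof -
  note RX = R_Ob[OF X]
  have app: "app (vid (und (R X))) a = a" if "a \<in> und (R X)" for a
    using that small_und[OF RX] by simp
  have "vid (und (R X)) \<in> Hom K (R X) (R X) \<longleftrightarrow>
    (\<forall>x\<in>topspace X. lam (und (R X)) (\<lambda>m. if x \<in> elts (app (vid (und (R X))) m) then v1 else v0) \<in> Hom K (R X) t)"
    by (rule R_char[OF X RX vid_maps]) (use app opn_und[OF RX] in auto)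
  then have "lam (und (R X)) (\<lambda>m. if x \<in> elts (app (vid (und (R X))) m) then v1 else v0) \<in> Hom K (R X) t"
    using Hom_Idt[OF RX] x by blast
  moreover have "lam (und (R X)) (\<lambda>m. if x \<in> elts (app (vid (und (R X))) m) then v1 else v0) = eval X x"
    unfolding eval_def by (rule lam_cong) (simp add: app)
  ultimately show ?thesis by simp
qed

lemma app_eval: "X \<in> Ob T \<Longrightarrow> m \<in> und (R X) \<Longrightarrow> app (eval X x) m = (if x \<in> elts m then v1 else v0)"
  by (simp add: eval_def small_und R_Ob)

lemma app_eps: "X \<in> Ob T \<Longrightarrow> x \<in> topspace X \<Longrightarrow> app (eps X) x = eval X x"
  by (simp add: eps_def small_topspace)

lemma eps_Top:
  assumes X: "X \<in> Ob T"
  shows "eps X \<in> Hom Top X (pt (R X))"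
proof -
  note RX = R_Ob[OF X]
  have "continuous_map X (pt (R X)) (app (eps X))"
    unfolding continuous_map_def topspace_pt[OF RX]
  proof (intro conjI allI impI)
    show "app (eps X) \<in> topspace X \<rightarrow> Hom K (R X) t"
      using eval_Hom[OF X] app_eps[OF X] by auto
    fix U assume "openin (pt (R X)) U"
    then obtain a where a: "a \<in> opn (R X)" "U = {f \<in> Hom K (R X) t. app f a = v1}"
      using openin_pt[OF RX] by blast
    have aU: "a \<in> und (R X)" using a(1) opn_und[OF RX] by blast
    have "{x \<in> topspace X. app (eps X) x \<in> U} = elts a"
      using elts_R[OF X aU] eval_Hom[OF X] by (auto simp: a(2) app_eps[OF X] app_eval[OF X aU] split: if_splits)
    then show "openin X {x \<in> topspace X. app (eps X) x \<in> U}"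
      using a(1) opn_R[OF X] by simp
  qed
  moreover have "eps X \<in> maps (topspace X) (Hom K (R X) t)"
    unfolding eps_def by (rule maps_I) (use eval_Hom[OF X] in auto)
  ultimately show ?thesis
    by (simp add: Hom_Top topspace_pt RX)
qed

lemma eps_maps: "X \<in> Ob T \<Longrightarrow> eps X \<in> maps (topspace X) (Hom K (R X) t)"
  using eps_Top[of X] by (simp add: Hom_Top topspace_pt R_Ob)

lemma app_preim: "X \<in> Ob T \<Longrightarrow> m \<in> und (R X) \<Longrightarrow> app (preim X Y g) m = vset {y \<in> topspace Y. app g y \<in> elts m}"
  by (simp add: preim_def small_und R_Ob)

lemma preim_maps:
  assumes "X \<in> Ob T" "Y \<in> Ob T" "g \<in> Hom Top Y X"
  shows "preim X Y g \<in> maps (und (R X)) (und (R Y))"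
  unfolding preim_def by (rule maps_I) (use R_preimage[OF assms] in auto)

lemma preim_Hom:
  assumes X: "X \<in> Ob T" and Y: "Y \<in> Ob T" and g: "g \<in> Hom Top Y X"
  shows "preim X Y g \<in> Hom K (R X) (R Y)"
proof -
  note RX = R_Ob[OF X]
  have gm: "g \<in> maps (topspace Y) (topspace X)" "continuous_map Y X (app g)"
    using g by (auto simp: Hom_Top)
  have "preim X Y g \<in> Hom K (R X) (R Y) \<longleftrightarrow>
    (\<forall>y\<in>topspace Y. lam (und (R X)) (\<lambda>m. if y \<in> elts (app (preim X Y g) m) then v1 else v0) \<in> Hom K (R X) t)"
  proof (rule R_char[OF Y RX preim_maps[OF X Y g]])
    fix a assume a: "a \<in> opn (R X)"
    then have aU: "a \<in> und (R X)" using opn_und[OF RX] by blast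
    have "openin Y {y \<in> topspace Y. app g y \<in> elts a}"
      using gm(2) a opn_R[OF X] by (simp add: continuous_map_def)
    then show "app (preim X Y g) a \<in> opn (R Y)"
      by (simp add: app_preim[OF X aU] opn_R[OF Y] small_sub[OF Y])
  qed
  moreover have "lam (und (R X)) (\<lambda>m. if y \<in> elts (app (preim X Y g) m) then v1 else v0) \<in> Hom K (R X) t"
    if y: "y \<in> topspace Y" for y
  proof -
    have "lam (und (R X)) (\<lambda>m. if y \<in> elts (app (preim X Y g) m) then v1 else v0) = eval X (app g y)"
      unfolding eval_def by (rule lam_cong) (simp add: app_preim[OF X] small_sub[OF Y] y)
    then show ?thesis
      using eval_Hom[OF X app_maps[OF gm(1) small_topspace[OF Y] y]] by simp
  qed
  ultimately show ?thesis by blast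
qed

lemma app_eta: "c \<in> Ob K \<Longrightarrow> m \<in> und c \<Longrightarrow> app (eta c) m = vset {f \<in> Hom K c t. app f m = v1}"
  by (simp add: eta_def small_und)

lemma eta_Hom:
  assumes c: "c \<in> Ob K"
  shows "eta c \<in> Hom K c (R (pt c))"
proof -
  have "eta c \<in> Hom K c (R (pt c)) \<longleftrightarrow>
    (\<forall>f\<in>topspace (pt c). lam (und c) (\<lambda>m. if f \<in> elts (app (eta c) m) then v1 else v0) \<in> Hom K c t)"
  proof (rule R_char[OF pt_Ob[OF c] c])
    show "eta c \<in> maps (und c) (und (R (pt c)))"
      unfolding eta_def by (rule maps_I) (use R_pt[OF c] in auto)
    show "app (eta c) a \<in> opn (R (pt c))" if "a \<in> opn c" for a
    proof -
      have "a \<in> und c" using that opn_und[OF c] by blast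
      then show ?thesis
        using openin_pt[OF c] that by (auto simp: opn_R[OF pt_Ob[OF c]] app_eta[OF c] small_sub_Hom[OF c])
    qed
  qed
  moreover have "lam (und c) (\<lambda>m. if f \<in> elts (app (eta c) m) then v1 else v0) = f" if f: "f \<in> Hom K c t" for f
  proof -
    have "lam (und c) (\<lambda>m. if f \<in> elts (app (eta c) m) then v1 else v0) =
        lam (und c) (\<lambda>m. if app f m = v1 then v1 else v0)"
      by (rule lam_cong) (simp add: app_eta[OF c] small_sub_Hom[OF c] f)
    then show ?thesis
      using point_eq_lam[OF c f] by simp
  qed
  ultimately show ?thesis
    by (simp add: topspace_pt[OF c])
qed

lemma functor_LF: "is_functor K (op_cat T) (LF adj)"
  unfolding is_functor_def
proof (intro conjI ballI category is_category_op category_T)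
  show "fo (LF adj) c \<in> Ob (op_cat T)" if "c \<in> Ob K" for c
    using pt_Ob[OF that] by simp
  show "fa (LF adj) c d p \<in> Hom (op_cat T) (fo (LF adj) c) (fo (LF adj) d)"
    if "c \<in> Ob K" "d \<in> Ob K" "p \<in> Hom K c d" for c d p
    using pt_map_Top[OF that] by simp
  show "fa (LF adj) c c (Idt K c) = Idt (op_cat T) (fo (LF adj) c)" if c: "c \<in> Ob K" for c
    using vcomp_vid_right[OF small_und[OF c] Hom_maps[OF c t_Ob]]
    by (simp add: pt_map_def Idt_K[OF c] topspace_pt[OF c] vid_def[of "Hom K c t"] cong: lam_cong')
  show "fa (LF adj) c e (Cmp K q p) = Cmp (op_cat T) (fa (LF adj) d e q) (fa (LF adj) c d p)"
    if c: "c \<in> Ob K" and d: "d \<in> Ob K" and e: "e \<in> Ob K" and p: "p \<in> Hom K c d" and q: "q \<in> Hom K d e" for c d e p q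
  proof -
    have "vcomp f (vcomp q p) = app (pt_map d p) (vcomp f q)" if "f \<in> Hom K e t" for f
      using vcomp_assoc[OF small_und[OF c] small_und[OF d] Hom_maps[OF c d p] Hom_maps[OF d e q]]
        Hom_comp[OF d e t_Ob q that] by (simp add: pt_map_def small_Hom[OF d])
    then have "pt_map e (vcomp q p) = vcomp (pt_map d p) (pt_map e q)"
      unfolding pt_map_def[of e] by (simp add: small_Hom[OF e] cong: lam_cong')
    then show ?thesis by (simp add: Cmp_K)
  qed
qed

lemma functor_RF: "is_functor (op_cat T) K (RF adj)"
  unfolding is_functor_def
proof (intro conjI ballI category is_category_op category_T)
  show "fo (RF adj) X \<in> Ob K" if "X \<in> Ob (op_cat T)" for X
    using R_Ob that by simp
  show "fa (RF adj) X Y g \<in> Hom K (fo (RF adj) X) (fo (RF adj) Y)"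
    if "X \<in> Ob (op_cat T)" "Y \<in> Ob (op_cat T)" "g \<in> Hom (op_cat T) X Y" for X Y g
    using preim_Hom[of X Y g] that by simp
  show "fa (RF adj) X X (Idt (op_cat T) X) = Idt K (fo (RF adj) X)" if "X \<in> Ob (op_cat T)" for X
  proof -
    have X: "X \<in> Ob T" using that by simp
    have "vset {x \<in> topspace X. app (vid (topspace X)) x \<in> elts m} = m" if "m \<in> und (R X)" for m
    proof -
      have "{x \<in> topspace X. app (vid (topspace X)) x \<in> elts m} = elts m"
        using elts_R[OF X that] small_topspace[OF X] by auto
      then show ?thesis by simp
    qed
    then show ?thesis
      by (simp add: preim_def Idt_K[OF R_Ob[OF X]] vid_def[of "und (R X)"] cong: lam_cong')
  qed
  show "fa (RF adj) X Z (Cmp (op_cat T) g f) = Cmp K (fa (RF adj) Y Z g) (fa (RF adj) X Y f)"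
    if "X \<in> Ob (op_cat T)" "Y \<in> Ob (op_cat T)" "Z \<in> Ob (op_cat T)"
      "f \<in> Hom (op_cat T) X Y" "g \<in> Hom (op_cat T) Y Z" for X Y Z f g
  proof -
    have X: "X \<in> Ob T" and Y: "Y \<in> Ob T" and Z: "Z \<in> Ob T" and f: "f \<in> Hom Top Y X" and g: "g \<in> Hom Top Z Y"
      using that by auto
    have gm: "g \<in> maps (topspace Z) (topspace Y)" using g by (simp add: Hom_Top)
    have "vset {z \<in> topspace Z. app (vcomp f g) z \<in> elts m} =
        app (preim Y Z g) (vset {y \<in> topspace Y. app f y \<in> elts m})" if m: "m \<in> und (R X)" for m
    proof -
      have "{z \<in> topspace Z. app (vcomp f g) z \<in> elts m} =
          {z \<in> topspace Z. app g z \<in> {y \<in> topspace Y. app f y \<in> elts m}}"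
        using app_vcomp[OF small_topspace[OF Z] gm] app_maps[OF gm small_topspace[OF Z]] by auto
      then show ?thesis
        using R_preimage[OF X Y f m] by (simp add: app_preim[OF Y] small_sub[OF Y])
    qed
    then have "preim X Z (vcomp f g) = vcomp (preim Y Z g) (preim X Y f)"
      unfolding preim_def[of X] by (simp add: small_und R_Ob[OF X] cong: lam_cong')
    then show ?thesis by (simp add: Cmp_K)
  qed
qed

lemma unit_natural: "is_nat_trans K K incl (func_comp (RF adj) (LF adj)) (unit adj)"
  unfolding is_nat_trans_def
proof (intro conjI ballI)
  show "unit adj c \<in> Hom K (fo incl c) (fo (func_comp (RF adj) (LF adj)) c)" if "c \<in> Ob K" for c
    using eta_Hom[OF that] by simp
  fix c d p assume c: "c \<in> Ob K" and d: "d \<in> Ob K" and p: "p \<in> Hom K c d"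
  have pm: "p \<in> maps (und c) (und d)" by (rule Hom_maps[OF c d p])
  have "app (eta d) (app p m) = app (preim (pt c) (pt d) (pt_map d p)) (app (eta c) m)" if m: "m \<in> und c" for m
  proof -
    have "app (preim (pt c) (pt d) (pt_map d p)) (app (eta c) m) =
        vset {f \<in> Hom K d t. app (pt_map d p) f \<in> {f \<in> Hom K c t. app f m = v1}}"
      using R_pt[OF c m]
      by (simp add: app_eta[OF c m] app_preim[OF pt_Ob[OF c]] topspace_pt[OF d] small_sub_Hom[OF c])
    also have "{f \<in> Hom K d t. app (pt_map d p) f \<in> {f \<in> Hom K c t. app f m = v1}} =
        {f \<in> Hom K d t. app f (app p m) = v1}"
      using Hom_comp[OF c d t_Ob p] app_vcomp[OF small_und[OF c] pm m] by (auto simp: pt_map_def small_Hom[OF d])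
    finally show ?thesis
      using app_eta[OF d app_maps[OF pm small_und[OF c] m]] by simp
  qed
  then show "Cmp K (unit adj d) (fa incl c d p) = Cmp K (fa (func_comp (RF adj) (LF adj)) c d p) (unit adj c)"
    using vcomp_eq_lam[OF small_und[OF c] pm] vcomp_eq_lam[OF small_und[OF c] Hom_maps[OF c R_Ob[OF pt_Ob[OF c]] eta_Hom[OF c]]]
    by (simp add: Cmp_K cong: lam_cong')
qed

lemma counit_natural: "is_nat_trans (op_cat T) (op_cat T) (func_comp (LF adj) (RF adj)) incl (counit adj)"
  unfolding is_nat_trans_def
proof (intro conjI ballI)
  show "counit adj X \<in> Hom (op_cat T) (fo (func_comp (LF adj) (RF adj)) X) (fo incl X)" if "X \<in> Ob (op_cat T)" for X
    using eps_Top[of X] that by simp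
  fix X Y f assume "X \<in> Ob (op_cat T)" "Y \<in> Ob (op_cat T)" "f \<in> Hom (op_cat T) X Y"
  then have X: "X \<in> Ob T" and Y: "Y \<in> Ob T" and f: "f \<in> Hom Top Y X" by auto
  have fm: "f \<in> maps (topspace Y) (topspace X)" using f by (simp add: Hom_Top)
  have "app (pt_map (R Y) (preim X Y f)) (app (eps Y) y) = app (eps X) (app f y)" if y: "y \<in> topspace Y" for y
  proof -
    have fy: "app f y \<in> topspace X" using app_maps[OF fm small_topspace[OF Y] y] .
    have "app (pt_map (R Y) (preim X Y f)) (app (eps Y) y) = vcomp (eval Y y) (preim X Y f)"
      by (simp add: app_eps[OF Y y] pt_map_def small_Hom[OF R_Ob[OF Y]] eval_Hom[OF Y y])
    also have "\<dots> = eval X (app f y)"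
      unfolding preim_def eval_def[of X]
      using R_preimage[OF X Y f] y by (simp add: small_und R_Ob[OF X] app_eval[OF Y] small_sub[OF Y] cong: lam_cong')
    finally show ?thesis
      using app_eps[OF X fy] by simp
  qed
  then show "Cmp (op_cat T) (counit adj Y) (fa (func_comp (LF adj) (RF adj)) X Y f) = Cmp (op_cat T) (fa incl X Y f) (counit adj X)"
    using vcomp_eq_lam[OF small_topspace[OF Y] fm] vcomp_eq_lam[OF small_topspace[OF Y] eps_maps[OF Y]]
    by (simp cong: lam_cong')
qed

theorem is_adjunction: "is_adjunction adj"
  unfolding is_adjunction_def
proof (intro conjI ballI)
  show "is_functor (LC adj) (RC adj) (LF adj)" using functor_LF by simp
  show "is_functor (RC adj) (LC adj) (RF adj)" using functor_RF by simp
  show "is_nat_trans (LC adj) (LC adj) incl (func_comp (RF adj) (LF adj)) (unit adj)" using unit_natural by simp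
  show "is_nat_trans (RC adj) (RC adj) (func_comp (LF adj) (RF adj)) incl (counit adj)" using counit_natural by simp
next
  fix c assume "c \<in> Ob (LC adj)"
  then have c: "c \<in> Ob K" by simp
  note P = pt_Ob[OF c] and RP = R_Ob[OF pt_Ob[OF c]]
  have "app (pt_map (R (pt c)) (eta c)) (app (eps (pt c)) f) = f" if f: "f \<in> Hom K c t" for f
  proof -
    have fT: "f \<in> topspace (pt c)" using f topspace_pt[OF c] by simp
    have "app (pt_map (R (pt c)) (eta c)) (app (eps (pt c)) f) = vcomp (eval (pt c) f) (eta c)"
      by (simp add: app_eps[OF P fT] pt_map_def small_Hom[OF RP] eval_Hom[OF P fT])
    also have "\<dots> = lam (und c) (\<lambda>m. if app f m = v1 then v1 else v0)"
      unfolding eta_def using R_pt[OF c] f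
      by (simp add: small_und[OF c] app_eval[OF P] small_sub_Hom[OF c] cong: lam_cong')
    finally show ?thesis using point_eq_lam[OF c f] by simp
  qed
  then have "vcomp (pt_map (R (pt c)) (eta c)) (eps (pt c)) = vid (Hom K c t)"
    using vcomp_eq_lam[OF small_topspace[OF P] eps_maps[OF P]]
    by (simp add: topspace_pt[OF c] vid_def cong: lam_cong')
  then show "Cmp (RC adj) (counit adj (fo (LF adj) c)) (fa (LF adj) c (fo (RF adj) (fo (LF adj) c)) (unit adj c)) =
      Idt (RC adj) (fo (LF adj) c)"
    by (simp add: topspace_pt[OF c])
next
  fix X assume "X \<in> Ob (RC adj)"
  then have X: "X \<in> Ob T" by simp
  note RX = R_Ob[OF X] and PRX = pt_Ob[OF R_Ob[OF X]]
  have "app (preim (pt (R X)) X (eps X)) (app (eta (R X)) m) = m" if m: "m \<in> und (R X)" for m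
  proof -
    have "app (preim (pt (R X)) X (eps X)) (app (eta (R X)) m) =
        vset {x \<in> topspace X. app (eps X) x \<in> {f \<in> Hom K (R X) t. app f m = v1}}"
      using R_pt[OF RX m] by (simp add: app_eta[OF RX m] app_preim[OF PRX] small_sub_Hom[OF RX])
    also have "{x \<in> topspace X. app (eps X) x \<in> {f \<in> Hom K (R X) t. app f m = v1}} = elts m"
      using elts_R[OF X m] eval_Hom[OF X] by (auto simp: app_eps[OF X] app_eval[OF X m] split: if_splits)
    finally show ?thesis by simp
  qed
  then have "vcomp (preim (pt (R X)) X (eps X)) (eta (R X)) = vid (und (R X))"
    using vcomp_eq_lam[OF small_und[OF RX] Hom_maps[OF RX R_Ob[OF PRX] eta_Hom[OF RX]]]
    by (simp add: vid_def cong: lam_cong')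
  then show "Cmp (LC adj) (fa (RF adj) (fo (LF adj) (fo (RF adj) X)) X (counit adj X)) (unit adj (fo (RF adj) X)) =
      Idt (LC adj) (fo (RF adj) X)"
    by (simp add: Cmp_K Idt_K[OF RX])
qed

end

text \<open>
  The condition passes to a full subcategory \<open>K'\<close> and fewer spaces, if these still correspond to each
  other under the object maps of the two functors.
\<close>

lemma pt_duality_full_subcategory:
  assumes D: "pt_duality K t opn und R Q" and sub: "is_full_subcategory K' K" and Cmp: "Cmp K' = vcomp"
    and t: "t \<in> Ob K'" and Q: "\<And>X. X \<in> Ob Top \<Longrightarrow> Q' X \<Longrightarrow> Q X"
    and R: "\<And>X. X \<in> Ob Top \<Longrightarrow> Q' X \<Longrightarrow> R X \<in> Ob K'"
    and pt: "\<And>c. c \<in> Ob K' \<Longrightarrow> Q' (pt_space (Hom K c t) (opn c))"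
  shows "pt_duality K' t opn und R Q'"
proof -
  interpret D: pt_duality K t opn und R Q "full_subcat Top Q" "\<lambda>c. pt_space (Hom K c t) (opn c)"
    using D by simp_all
  have Ob: "c \<in> Ob K" if "c \<in> Ob K'" for c
    using sub that by (auto simp: is_full_subcategory_def is_subcategory_def)
  have Hom: "Hom K' c d = Hom K c d" if "c \<in> Ob K'" "d \<in> Ob K'" for c d
    using sub that by (simp add: is_full_subcategory_def)
  have Top: "X \<in> Ob (full_subcat Top Q)" if "X \<in> Ob (full_subcat Top Q')" for X
    using that Q by simp
  show ?thesis
  proof (unfold_locales, goal_cases)
    case 1 then show ?case using sub by (simp add: is_full_subcategory_def is_subcategory_def)
  next
    case 2 then show ?case by (rule Cmp)
  next
    case (3 c) then show ?case
      using sub D.Idt_K[OF Ob] by (simp add: is_full_subcategory_def is_subcategory_def)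
  next
    case (4 c) then show ?case using D.small_und Ob by blast
  next
    case (5 c) then show ?case using D.opn_und Ob by blast
  next
    case (6 c d f) then show ?case using D.Hom_maps[of c d f] Ob Hom by simp
  next
    case (7 c d f a) then show ?case using D.Hom_opn[of c d f a] Ob Hom by simp
  next
    case 8 then show ?case by (rule t)
  next
    case 9 then show ?case by (rule D.und_t)
  next
    case (10 X) then show ?case using R by simp
  next
    case (11 X) then show ?case using D.R_opn[OF Top] by simp
  next
    case (12 X) then show ?case using D.R_und[OF Top] by simp
  next
    case (13 X Y g A) then show ?case using D.R_preimage[OF Top Top] by blast
  next
    case (14 X c h)
    then have "R X \<in> Ob K'" using R by simp
    then show ?case using D.R_char[OF Top[OF 14(1)] Ob[OF 14(2)] 14(3)] 14(4) Hom[OF 14(2)] t by simp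
  next
    case (15 c) then show ?case using D.pt_Ob[OF Ob[OF 15]] pt[OF 15] Hom[OF 15 t] by simp
  next
    case (16 c) then show ?case using D.topspace_pt[OF Ob[OF 16]] Hom[OF 16 t] by simp
  next
    case (17 c U) then show ?case using D.openin_pt[OF Ob[OF 17]] Hom[OF 17 t] by simp
  next
    case (18 c m) then show ?case using D.R_pt[OF Ob[OF 18(1)] 18(2)] Hom[OF 18(1) t] by simp
  qed
qed

text \<open>
  A functor that restricts underlying functions, preserves the open elements and is bijective
  on points gives a strong adjunction morphism if it commutes with the right adjoints. Then
  \<open>\<zeta>\<close> is the identity and \<open>\<xi>\<close> is the action of the functor on points.
\<close>

locale pt_duality_morphism =
  D1: pt_duality K t opn und R Q T pt + D2: pt_duality K' t' opn' und' R' Q' T' pt'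
  for K :: "('o, 'u::universe) cat" and t opn und R Q T pt
    and K' :: "('p, 'u) cat" and t' opn' und' R' Q' T' pt' +
  fixes M :: "('o, 'u, 'u topology, 'u, 'p, 'u, 'u topology, 'u) adjn_mor"
  assumes UF_functor: "is_functor K K' (UF M)" and VF: "VF M = incl"
    and UF_t: "fo (UF M) t = t'"
    and und_sub: "\<And>c. c \<in> Ob K \<Longrightarrow> und' (fo (UF M) c) \<subseteq> und c"
    and opn_eq: "\<And>c. c \<in> Ob K \<Longrightarrow> opn' (fo (UF M) c) = opn c"
    and UF_fa: "\<And>c d f. c \<in> Ob K \<Longrightarrow> d \<in> Ob K \<Longrightarrow> f \<in> Hom K c d \<Longrightarrow>
      fa (UF M) c d f = lam (und' (fo (UF M) c)) (app f)"
    and Q_sub: "\<And>X. X \<in> Ob Top \<Longrightarrow> Q X \<Longrightarrow> Q' X"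
    and UF_R: "\<And>X. X \<in> Ob T \<Longrightarrow> fo (UF M) (R X) = R' X"
    and UF_bij: "\<And>c. c \<in> Ob K \<Longrightarrow> bij_betw (fa (UF M) c t) (Hom K c t) (Hom K' (fo (UF M) c) t')"
    and zeta: "\<And>X. X \<in> Ob T \<Longrightarrow> zeta M X = vid (und' (R' X))"
    and xi: "\<And>c. c \<in> Ob K \<Longrightarrow> xi M c = lam (Hom K c t) (\<lambda>f. fa (UF M) c t f)"
begin

abbreviation "H \<equiv> fo (UF M)"

lemma H_Ob: "c \<in> Ob K \<Longrightarrow> H c \<in> Ob K'"
  using UF_functor by (simp add: is_functor_def)

lemma H_Hom: "c \<in> Ob K \<Longrightarrow> d \<in> Ob K \<Longrightarrow> f \<in> Hom K c d \<Longrightarrow> fa (UF M) c d f \<in> Hom K' (H c) (H d)"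
  using UF_functor by (simp add: is_functor_def)

lemma H_pt: "c \<in> Ob K \<Longrightarrow> f \<in> Hom K c t \<Longrightarrow> fa (UF M) c t f \<in> Hom K' (H c) t'"
  using H_Hom[OF _ D1.t_Ob] by (simp add: UF_t)

lemma T_sub: "X \<in> Ob T \<Longrightarrow> X \<in> Ob T'"
  by (simp add: D1.Ob_T D2.Ob_T Q_sub)

lemma app_H: "c \<in> Ob K \<Longrightarrow> d \<in> Ob K \<Longrightarrow> f \<in> Hom K c d \<Longrightarrow> m \<in> und' (H c) \<Longrightarrow> app (fa (UF M) c d f) m = app f m"
  by (simp add: UF_fa D2.small_und H_Ob)

lemma app_H_open: "c \<in> Ob K \<Longrightarrow> d \<in> Ob K \<Longrightarrow> f \<in> Hom K c d \<Longrightarrow> a \<in> opn c \<Longrightarrow> app (fa (UF M) c d f) a = app f a"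
  using app_H[of c d f a] D2.opn_und[OF H_Ob, of c] opn_eq[of c] by auto

lemma xi_inverse:
  assumes c: "c \<in> Ob K"
  shows "\<exists>g. inverse_arrows (op_cat T') (pt' (H c)) (pt c) (xi M c) g"
proof -
  let ?h = "fa (UF M) c t" and ?g = "inv_into (Hom K c t) (fa (UF M) c t)"
  note sm = D1.small_Hom[OF c] D2.small_Hom[OF H_Ob[OF c]]
  have h: "?h f \<in> Hom K' (H c) t'" "?g (?h f) = f" if "f \<in> Hom K c t" for f
    using UF_bij[OF c] that by (auto simp: bij_betw_def)
  have g: "?g f \<in> Hom K c t" "?h (?g f) = f" if "f \<in> Hom K' (H c) t'" for f
    using UF_bij[OF c] that by (auto simp: bij_betw_def inv_into_into f_inv_into_f)
  have g_app: "app (?g f) a = app f a" if "f \<in> Hom K' (H c) t'" "a \<in> opn c" for f a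
    using app_H_open[OF c D1.t_Ob g(1)[OF that(1)] that(2)] g(2)[OF that(1)] by simp
  have "continuous_map (pt c) (pt' (H c)) (app (lam (Hom K c t) ?h))"
    unfolding continuous_map_def D1.topspace_pt[OF c] D2.topspace_pt[OF H_Ob[OF c]]
  proof (intro conjI allI impI)
    show "app (lam (Hom K c t) ?h) \<in> Hom K c t \<rightarrow> Hom K' (H c) t'"
      using h sm by auto
    fix U assume "openin (pt' (H c)) U"
    then obtain a where a: "a \<in> opn c" "U = {f \<in> Hom K' (H c) t'. app f a = v1}"
      using D2.openin_pt[OF H_Ob[OF c]] opn_eq[OF c] by auto
    then have "{f \<in> Hom K c t. app (lam (Hom K c t) ?h) f \<in> U} = {f \<in> Hom K c t. app f a = v1}"
      using h sm app_H_open[OF c D1.t_Ob] by auto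
    then show "openin (pt c) {f \<in> Hom K c t. app (lam (Hom K c t) ?h) f \<in> U}"
      using a(1) D1.openin_pt[OF c] by auto
  qed
  moreover have "continuous_map (pt' (H c)) (pt c) (app (lam (Hom K' (H c) t') ?g))"
    unfolding continuous_map_def D1.topspace_pt[OF c] D2.topspace_pt[OF H_Ob[OF c]]
  proof (intro conjI allI impI)
    show "app (lam (Hom K' (H c) t') ?g) \<in> Hom K' (H c) t' \<rightarrow> Hom K c t"
      using g sm by auto
    fix U assume "openin (pt c) U"
    then obtain a where a: "a \<in> opn c" "U = {f \<in> Hom K c t. app f a = v1}"
      using D1.openin_pt[OF c] by auto
    then have "{f \<in> Hom K' (H c) t'. app (lam (Hom K' (H c) t') ?g) f \<in> U} = {f \<in> Hom K' (H c) t'. app f a = v1}"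
      using g sm g_app by auto
    then show "openin (pt' (H c)) {f \<in> Hom K' (H c) t'. app (lam (Hom K' (H c) t') ?g) f \<in> U}"
      using a(1) D2.openin_pt[OF H_Ob[OF c]] opn_eq[OF c] by auto
  qed
  moreover have "lam (Hom K c t) ?h \<in> maps (Hom K c t) (Hom K' (H c) t')"
    "lam (Hom K' (H c) t') ?g \<in> maps (Hom K' (H c) t') (Hom K c t)"
    using h g by (auto intro!: maps_I)
  moreover have "vcomp (lam (Hom K c t) ?h) (lam (Hom K' (H c) t') ?g) = vid (Hom K' (H c) t')"
    "vcomp (lam (Hom K' (H c) t') ?g) (lam (Hom K c t) ?h) = vid (Hom K c t)"
    unfolding vid_def using sm h g by (simp_all add: cong: lam_cong')
  ultimately show ?thesis
    unfolding inverse_arrows_def xi[OF c]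
    by (intro exI[of _ "lam (Hom K' (H c) t') ?g"])
      (simp add: Hom_Top D1.topspace_pt[OF c] D2.topspace_pt[OF H_Ob[OF c]])
qed

theorem is_SADJ_map: "is_SADJ_map D1.adj D2.adj M"
proof -
  have V: "is_functor (op_cat T) (op_cat T') incl"
    unfolding is_functor_def using T_sub
    by (simp add: is_category_op D1.category_T D2.category_T)
  have Z: "is_nat_iso (op_cat T) K' (func_comp (UF M) (RF D1.adj)) (func_comp (RF D2.adj) incl) (zeta M)"
    unfolding is_nat_iso_def is_nat_trans_def
  proof (intro conjI ballI)
    fix X assume "X \<in> Ob (op_cat T)"
    then have X: "X \<in> Ob T" by simp
    note R' = D2.R_Ob[OF T_sub[OF X]]
    show "zeta M X \<in> Hom K' (fo (func_comp (UF M) (RF D1.adj)) X) (fo (func_comp (RF D2.adj) incl) X)"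
      using D2.Hom_Idt[OF R'] by (simp add: zeta[OF X] UF_R[OF X])
    show "is_iso K' (fo (func_comp (UF M) (RF D1.adj)) X) (fo (func_comp (RF D2.adj) incl) X) (zeta M X)"
      using is_iso_Idt[OF D2.category R'] by (simp add: zeta[OF X] UF_R[OF X] D2.Idt_K[OF R'])
    fix Y f assume "Y \<in> Ob (op_cat T)" "f \<in> Hom (op_cat T) X Y"
    then have Y: "Y \<in> Ob T" and f: "f \<in> Hom Top Y X" by auto
    note R'Y = D2.R_Ob[OF T_sub[OF Y]]
    have sub: "und' (R' X) \<subseteq> und (R X)"
      using und_sub[OF D1.R_Ob[OF X]] by (simp add: UF_R[OF X])
    have "fa (UF M) (R X) (R Y) (D1.preim X Y f) = D2.preim X Y f"
      unfolding UF_fa[OF D1.R_Ob[OF X] D1.R_Ob[OF Y] D1.preim_Hom[OF X Y f]] UF_R[OF X] D2.preim_def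
      by (rule lam_cong) (use sub D1.app_preim[OF X] in auto)
    moreover have pm: "D2.preim X Y f \<in> maps (und' (R' X)) (und' (R' Y))"
      by (rule D2.preim_maps[OF T_sub[OF X] T_sub[OF Y] f])
    ultimately show "Cmp K' (zeta M Y) (fa (func_comp (UF M) (RF D1.adj)) X Y f) =
        Cmp K' (fa (func_comp (RF D2.adj) incl) X Y f) (zeta M X)"
      using vcomp_vid_left[OF D2.small_und[OF R'] D2.small_und[OF R'Y] pm] vcomp_vid_right[OF D2.small_und[OF R'] pm]
      by (simp add: D2.Cmp_K zeta[OF X] zeta[OF Y])
  qed
  have Xn: "is_nat_trans K (op_cat T') (func_comp (LF D2.adj) (UF M)) (func_comp incl (LF D1.adj)) (xi M)"
    unfolding is_nat_trans_def
  proof (intro conjI ballI)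
    fix c assume c: "c \<in> Ob K"
    show "xi M c \<in> Hom (op_cat T') (fo (func_comp (LF D2.adj) (UF M)) c) (fo (func_comp incl (LF D1.adj)) c)"
      using xi_inverse[OF c] by (auto simp: inverse_arrows_def)
    fix d p assume d: "d \<in> Ob K" and p: "p \<in> Hom K c d"
    have "app (D2.pt_map (H d) (fa (UF M) c d p)) (fa (UF M) d t f) = fa (UF M) c t (vcomp f p)"
      if f: "f \<in> Hom K d t" for f
    proof -
      have "app (D2.pt_map (H d) (fa (UF M) c d p)) (fa (UF M) d t f) = vcomp (fa (UF M) d t f) (fa (UF M) c d p)"
        using H_pt[OF d f] by (simp add: D2.pt_map_def D2.small_Hom[OF H_Ob[OF d]])
      also have "\<dots> = fa (UF M) c t (vcomp f p)"
        using UF_functor c d D1.t_Ob p f by (simp add: is_functor_def D1.Cmp_K D2.Cmp_K)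
      finally show ?thesis .
    qed
    moreover have "app (xi M c) (vcomp f p) = fa (UF M) c t (vcomp f p)" if "f \<in> Hom K d t" for f
      using D1.Hom_comp[OF c d D1.t_Ob p that] by (simp add: xi[OF c] D1.small_Hom[OF c])
    ultimately show "Cmp (op_cat T') (xi M d) (fa (func_comp (LF D2.adj) (UF M)) c d p) =
        Cmp (op_cat T') (fa (func_comp incl (LF D1.adj)) c d p) (xi M c)"
      by (simp add: xi[OF d] D1.pt_map_def D1.small_Hom[OF d] cong: lam_cong')
  qed
  \<comment> \<open>The mate of \<open>\<zeta>\<close> sends a point \<open>f\<close> of \<open>c\<close> to the composite of the image of the unit with evaluation
    at \<open>f\<close>, which is \<open>f\<close> itself on the smaller underlying set.\<close>
  have mate: "xi M c = vcomp (vcomp (D2.pt_map (R' (pt c)) (fa (UF M) c (R (pt c)) (D1.eta c)))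
      (D2.pt_map (R' (pt c)) (zeta M (pt c)))) (D2.eps (pt c))" if c: "c \<in> Ob K" for c
  proof -
    note P = D1.pt_Ob[OF c] and P' = T_sub[OF D1.pt_Ob[OF c]]
    note R' = D2.R_Ob[OF P']
    let ?e = "fa (UF M) c (R (pt c)) (D1.eta c)"
    have e: "?e \<in> Hom K' (H c) (R' (pt c))"
      using H_Hom[OF c D1.R_Ob[OF P] D1.eta_Hom[OF c]] by (simp add: UF_R[OF P])
    have z: "D2.pt_map (R' (pt c)) (zeta M (pt c)) \<in> maps (Hom K' (R' (pt c)) t') (Hom K' (R' (pt c)) t')"
      using D2.pt_map_Top[OF R' R', of "zeta M (pt c)"] D2.Hom_Idt[OF R']
      by (simp add: zeta[OF P] Hom_Top D2.topspace_pt[OF R'])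
    have "app (vcomp (D2.pt_map (R' (pt c)) ?e) (D2.pt_map (R' (pt c)) (zeta M (pt c)))) (app (D2.eps (pt c)) f) =
        fa (UF M) c t f" if f: "f \<in> Hom K c t" for f
    proof -
      have fT: "f \<in> topspace (pt c)" using f D1.topspace_pt[OF c] by simp
      note ev = D2.eval_Hom[OF P' fT]
      have "app (D2.pt_map (R' (pt c)) (zeta M (pt c))) (D2.eval (pt c) f) = D2.eval (pt c) f"
        using ev vcomp_vid_right[OF D2.small_und[OF R'] D2.Hom_maps[OF R' D2.t_Ob ev]]
        by (simp add: D2.pt_map_def zeta[OF P] D2.small_Hom[OF R'])
      then have "app (vcomp (D2.pt_map (R' (pt c)) ?e) (D2.pt_map (R' (pt c)) (zeta M (pt c)))) (app (D2.eps (pt c)) f) =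
          app (D2.pt_map (R' (pt c)) ?e) (D2.eval (pt c) f)"
        using app_vcomp[OF D2.small_Hom[OF R'] z ev] by (simp add: D2.app_eps[OF P' fT])
      also have "\<dots> = vcomp (D2.eval (pt c) f) ?e"
        using ev by (simp add: D2.pt_map_def D2.small_Hom[OF R'])
      also have "\<dots> = fa (UF M) c t f"
      proof -
        have "app (D2.eval (pt c) f) (app ?e m) = app f m" if m: "m \<in> und' (H c)" for m
        proof -
          have mU: "m \<in> und c" using m und_sub[OF c] by blast
          have em: "app ?e m = vset {f \<in> Hom K c t. app f m = v1}"
            using app_H[OF c D1.R_Ob[OF P] D1.eta_Hom[OF c] m] D1.app_eta[OF c mU] by simp
          moreover have "app ?e m \<in> und' (R' (pt c))"
            using app_maps[OF D2.Hom_maps[OF H_Ob[OF c] R' e] D2.small_und[OF H_Ob[OF c]] m] .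
          ultimately show ?thesis
            using D1.point_values[OF c f mU] f
            by (simp add: D2.app_eval[OF P'] D1.small_sub_Hom[OF c])
        qed
        then show ?thesis
          using vcomp_eq_lam[OF D2.small_und[OF H_Ob[OF c]] D2.Hom_maps[OF H_Ob[OF c] R' e]]
          by (simp add: UF_fa[OF c D1.t_Ob f] cong: lam_cong')
      qed
      finally show ?thesis .
    qed
    then show ?thesis
      using vcomp_eq_lam[OF D2.small_topspace[OF P'] D2.eps_maps[OF P']]
      by (simp add: xi[OF c] D1.topspace_pt[OF c] cong: lam_cong')
  qed
  have "is_RADJ_map D1.adj D2.adj M"
    unfolding is_RADJ_map_def
    using D1.is_adjunction D2.is_adjunction UF_functor V Z Xn mate UF_R[OF D1.pt_Ob]
    by (simp add: VF Let_def)
  moreover have "is_nat_iso (LC D1.adj) (RC D2.adj) (func_comp (LF D2.adj) (UF M)) (func_comp (VF M) (LF D1.adj)) (xi M)"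
    using Xn xi_inverse by (auto simp: is_nat_iso_def is_iso_def VF)
  ultimately show ?thesis
    by (simp add: is_SADJ_map_def)
qed

end

section \<open>Spaces of points\<close>

text \<open>
  If the elements of \<open>H\<close> are points of the frame \<open>L\<close>, the sets used to define \<open>pt_space\<close> already form
  a topology.
\<close>

lemma pt_space_open:
  assumes L: "is_frame L" and pts: "\<And>f. f \<in> H \<Longrightarrow> frame_point L {a \<in> carrier L. app f a = v1}"
  shows "openin (pt_space H (carrier L)) U \<longleftrightarrow> (\<exists>a\<in>carrier L. U = {f \<in> H. app f a = v1})"
    and "topspace (pt_space H (carrier L)) = H"
proof -
  interpret frame L by unfold_locales (rule L)
  let ?O = "\<lambda>U. \<exists>a\<in>carrier L. U = {f \<in> H. app f a = v1}"
  have meet: "app f (a \<sqinter>\<^bsub>L\<^esub> b) = v1 \<longleftrightarrow> app f a = v1 \<and> app f b = v1"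
    if "f \<in> H" "a \<in> carrier L" "b \<in> carrier L" for f a b
    using pts[OF that(1)] that(2,3) by (simp add: frame_point_def)
  have sup: "app f (\<Squnion>\<^bsub>L\<^esub> S) = v1 \<longleftrightarrow> (\<exists>s\<in>S. app f s = v1)" if "f \<in> H" "S \<subseteq> carrier L" for f S
    using pts[OF that(1)] that(2) by (simp add: frame_point_def ex_in_sub_iff)
  have "istopology ?O"
    unfolding istopology_def
  proof (intro conjI allI impI)
    fix U V assume "?O U" "?O V"
    then obtain a b where ab: "a \<in> carrier L" "b \<in> carrier L" "U = {f \<in> H. app f a = v1}" "V = {f \<in> H. app f b = v1}"
      by blast
    have "U \<inter> V = {f \<in> H. app f (a \<sqinter>\<^bsub>L\<^esub> b) = v1}"
      using meet ab by blast
    then show "?O (U \<inter> V)"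
      using ab by (intro bexI[of _ "a \<sqinter>\<^bsub>L\<^esub> b"]) auto
  next
    fix \<U> assume \<U>: "\<forall>U\<in>\<U>. ?O U"
    let ?S = "{a \<in> carrier L. {f \<in> H. app f a = v1} \<in> \<U>}"
    have S: "?S \<subseteq> carrier L" by blast
    have "\<Union>\<U> = {f \<in> H. \<exists>s\<in>?S. app f s = v1}"
    proof
      show "\<Union>\<U> \<subseteq> {f \<in> H. \<exists>s\<in>?S. app f s = v1}"
      proof
        fix f assume "f \<in> \<Union>\<U>"
        then obtain U where U: "U \<in> \<U>" "f \<in> U" by blast
        then obtain a where "a \<in> carrier L" "U = {f \<in> H. app f a = v1}"
          using \<U> by blast
        with U show "f \<in> {f \<in> H. \<exists>s\<in>?S. app f s = v1}" by blast
      qed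
    qed blast
    also have "\<dots> = {f \<in> H. app f (\<Squnion>\<^bsub>L\<^esub> ?S) = v1}"
      using sup[OF _ S] by blast
    finally show "?O (\<Union>\<U>)"
      using S by (intro bexI[of _ "\<Squnion>\<^bsub>L\<^esub> ?S"]) auto
  qed
  then have eq: "openin (pt_space H (carrier L)) = ?O"
    unfolding pt_space_def by (rule topology_inverse')
  then show "openin (pt_space H (carrier L)) U \<longleftrightarrow> (\<exists>a\<in>carrier L. U = {f \<in> H. app f a = v1})"
    by simp
  have "H = {f \<in> H. app f \<top>\<^bsub>L\<^esub> = v1}"
    using pts by (auto simp: frame_point_def)
  then have "openin (pt_space H (carrier L)) H"
    unfolding eq by blast
  moreover have "topspace (pt_space H (carrier L)) \<subseteq> H"
    using openin_topspace[of "pt_space H (carrier L)"] unfolding eq by blast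
  ultimately show "topspace (pt_space H (carrier L)) = H"
    using openin_subset by blast
qed

context
  fixes L :: "'u::universe gorder" and H :: "'u set"
  assumes L: "is_frame L" and pts: "\<And>f. f \<in> H \<Longrightarrow> frame_point L {a \<in> carrier L. app f a = v1}"
begin

lemma openin_pt_space: "a \<in> carrier L \<Longrightarrow> openin (pt_space H (carrier L)) {f \<in> H. app f a = v1}"
  using pt_space_open(1)[OF L pts] by blast

lemma pt_space_t0:
  assumes sep: "\<And>f g. f \<in> H \<Longrightarrow> g \<in> H \<Longrightarrow> (\<And>a. a \<in> carrier L \<Longrightarrow> app f a = v1 \<longleftrightarrow> app g a = v1) \<Longrightarrow> f = g"
  shows "t0_space (pt_space H (carrier L))"
  unfolding t0_space_def
proof (intro ballI impI)
  fix f g assume "f \<in> topspace (pt_space H (carrier L))" "g \<in> topspace (pt_space H (carrier L))" and "f \<noteq> g"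
  then have fg: "f \<in> H" "g \<in> H" "f \<noteq> g"
    by (simp_all add: pt_space_open(2)[OF L pts])
  then obtain a where "a \<in> carrier L" "\<not> (app f a = v1 \<longleftrightarrow> app g a = v1)"
    using sep by blast
  then show "\<exists>U. openin (pt_space H (carrier L)) U \<and> (f \<notin> U \<longleftrightarrow> g \<in> U)"
    using fg openin_pt_space[of a] by (intro exI[of _ "{f \<in> H. app f a = v1}"]) auto
qed

lemma pt_space_td:
  assumes "\<And>f. f \<in> H \<Longrightarrow> \<exists>a\<in>carrier L. \<exists>b\<in>carrier L. app f b = v1 \<and> app f a \<noteq> v1 \<and>
    (\<forall>h\<in>H. app h b = v1 \<and> app h a \<noteq> v1 \<longrightarrow> h = f)"
  shows "td_space (pt_space H (carrier L))"
  unfolding td_space_def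
proof
  fix f assume "f \<in> topspace (pt_space H (carrier L))"
  then have f: "f \<in> H" by (simp add: pt_space_open(2)[OF L pts])
  obtain a b where ab: "a \<in> carrier L" "b \<in> carrier L" "app f b = v1" "app f a \<noteq> v1"
    "\<forall>h\<in>H. app h b = v1 \<and> app h a \<noteq> v1 \<longrightarrow> h = f"
    using assms[OF f] by blast
  have "openin (pt_space H (carrier L)) {h \<in> H. app h b = v1}"
    "closedin (pt_space H (carrier L)) (H - {h \<in> H. app h a = v1})"
    using openin_pt_space[OF ab(1)] openin_pt_space[OF ab(2)] pt_space_open(2)[OF L pts]
    by (auto simp: openin_closedin_eq)
  moreover have "{h \<in> H. app h b = v1} \<inter> (H - {h \<in> H. app h a = v1}) = {f}"
    using ab f by blast
  ultimately show "\<exists>U K. openin (pt_space H (carrier L)) U \<and> closedin (pt_space H (carrier L)) K \<and> U \<inter> K = {f}"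
    by blast
qed

end

section \<open>The duality for MT-algebras\<close>

lemma twoM_MT: "twoM \<in> Ob MT"
  unfolding twoM_eq_powerset by (rule powerset_mt_MT[OF Ob_TopD[THEN iffD1, THEN conjunct1, OF discrete_one_TopD]])

lemma twoM_fiber_terminal: "fiber_terminal twoM"
  unfolding twoM_eq_powerset by (rule powerset_mt_fiber_terminal[OF discrete_one_TopD])

lemma MT_point:
  assumes c: "c \<in> Ob MT" and f: "f \<in> Hom MT c twoM"
  shows "f \<in> maps (carrier (snd c)) {v0, v1}" "cba_point (snd c) {m \<in> carrier (snd c). app f m = v1}"
proof -
  show "f \<in> maps (carrier (snd c)) {v0, v1}"
    using f by (simp add: Hom_MT)
  then show "cba_point (snd c) {m \<in> carrier (snd c). app f m = v1}"
    using MT_Hom_two_iff[OF c] f by blast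
qed

lemma MT_frame_point:
  assumes c: "c \<in> Ob MT" and f: "f \<in> Hom MT c twoM"
  shows "frame_point (fo OM c) {a \<in> carrier (fo OM c). app f a = v1}"
proof -
  have "{m \<in> carrier (snd c). app f m = v1} \<inter> fst c = {a \<in> fst c. app f a = v1}"
    using Ob_MTD(5)[OF c] by blast
  then show ?thesis
    using cba_point_subframe[OF Ob_MTD(3,4)[OF c] MT_point(2)[OF c f]] by (simp add: OM_simps)
qed

lemma MT_point_value:
  assumes c: "c \<in> Ob MT" and f: "f \<in> Hom MT c twoM" and m: "m \<in> carrier (snd c)"
  shows "app f m = (if app f m = v1 then v1 else v0)"
  using app_maps[OF MT_point(1)[OF c f] Ob_MTD(1)[OF c] m] by auto

lemma MT_point_eqI:
  assumes c: "c \<in> Ob MT" and f: "f \<in> Hom MT c twoM" and g: "g \<in> Hom MT c twoM"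
    and eq: "\<And>a. a \<in> fst c \<Longrightarrow> app f a = v1 \<longleftrightarrow> app g a = v1"
  shows "f = g"
proof (rule MT_Hom_eqI[OF c f g])
  fix a assume a: "a \<in> fst c"
  then have "a \<in> carrier (snd c)" using Ob_MTD(5)[OF c] by blast
  then show "app f a = app g a"
    using MT_point_value[OF c f] MT_point_value[OF c g] eq[OF a] by metis
qed

lemma MT_pt_open:
  assumes c: "c \<in> Ob MT"
  shows "openin (pt_space (Hom MT c twoM) (fst c)) U \<longleftrightarrow> (\<exists>a\<in>fst c. U = {f \<in> Hom MT c twoM. app f a = v1})"
    and "topspace (pt_space (Hom MT c twoM) (fst c)) = Hom MT c twoM"
    and "t0_space (pt_space (Hom MT c twoM) (fst c))"
proof -
  have fr: "is_frame (fo OM c)" using OM_Frm[OF c] by (simp add: Ob_Frm)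
  note pts = MT_frame_point[OF c]
  show "openin (pt_space (Hom MT c twoM) (fst c)) U \<longleftrightarrow> (\<exists>a\<in>fst c. U = {f \<in> Hom MT c twoM. app f a = v1})"
    "topspace (pt_space (Hom MT c twoM) (fst c)) = Hom MT c twoM"
    using pt_space_open[OF fr pts] by simp_all
  show "t0_space (pt_space (Hom MT c twoM) (fst c))"
    using pt_space_t0[OF fr pts] MT_point_eqI[OF c] by simp
qed

lemma MT_pt_Ob: "c \<in> Ob MT \<Longrightarrow> pt_space (Hom MT c twoM) (fst c) \<in> Ob Top"
proof -
  assume c: "c \<in> Ob MT"
  have "Hom MT c twoM \<subseteq> maps (carrier (snd c)) {v0, v1}"
    using MT_point(1)[OF c] by blast
  then have "small (Hom MT c twoM)"
    using small_subset[OF small_maps[OF Ob_MTD(1)[OF c] small_v0_v1]] by blast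
  then show ?thesis
    using MT_pt_open[OF c] by (simp add: Ob_Top)
qed

lemma Top_eq_full: "Top = full_subcat Top (\<lambda>_. True)"
  by (simp add: full_subcat_def)

lemma MT_duality:
  "pt_duality MT twoM fst (\<lambda>A. carrier (snd A)) powerset_mt (\<lambda>_. True)"
proof (unfold_locales, goal_cases)
  case 1 show ?case by (rule is_category_MT)
next
  case 2 show ?case by simp
next
  case (3 c) show ?case by simp
next
  case (4 c) then show ?case by (rule Ob_MTD)
next
  case (5 c) then show ?case by (rule Ob_MTD)
next
  case (6 c d f) then show ?case by (simp add: Hom_MT)
next
  case (7 c d f a) then show ?case by (auto simp: Hom_MT)
next
  case 8 show ?case by (rule twoM_MT)
next
  case 9 show ?case by simp
next
  case (10 X) then show ?case using powerset_mt_MT by simp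
next
  case (11 X) then show ?case by simp
next
  case (12 X) then show ?case by simp
next
  case (13 X Y g A) then show ?case by auto
next
  case (14 X c h)
  then have X: "small (topspace X)" by (simp add: Ob_Top)
  have h: "h \<in> maps (carrier (snd c)) (vset ` Pow (topspace X))" "app h ` fst c \<subseteq> carrier (opens X)"
    using 14 by auto
  have "lam (carrier (snd c)) (\<lambda>m. if x \<in> elts (app h m) then v1 else v0) \<in> Hom MT c twoM \<longleftrightarrow>
      cba_point (snd c) {m \<in> carrier (snd c). x \<in> elts (app h m)}" for x
  proof -
    let ?f = "lam (carrier (snd c)) (\<lambda>m. if x \<in> elts (app h m) then v1 else v0)"
    have "?f \<in> maps (carrier (snd c)) {v0, v1}"
      by (rule maps_I) auto
    moreover have "{m \<in> carrier (snd c). app ?f m = v1} = {m \<in> carrier (snd c). x \<in> elts (app h m)}"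
      using Ob_MTD(1)[OF 14(2)] by (auto split: if_splits)
    ultimately show ?thesis
      using MT_Hom_two_iff[OF 14(2)] by simp
  qed
  then show ?case
    using MT_Hom_powerset_iff[OF 14(2) X h] by simp
next
  case (15 c) then show ?case using MT_pt_Ob by simp
next
  case (16 c) then show ?case by (rule MT_pt_open)
next
  case (17 c U) then show ?case by (rule MT_pt_open)
next
  case (18 c m) then show ?case using MT_pt_open(2)[OF 18(1)] by auto
qed

text \<open>By the isomorphism with the Funayama algebra, a fiber-terminal algebra is generated by differences.\<close>

lemma fiber_terminal_difference_generated:
  assumes C: "C \<in> Ob MT" "fiber_terminal C"
  shows "difference_generated (fst C) (snd C)"
proof -
  let ?L = "fo OM C"
  note L = OM_Frm[OF C(1)]
  interpret frame ?L by unfold_locales (use L in \<open>simp add: Ob_Frm\<close>)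
  have "inverse_arrows Frm ?L ?L (vid (fst C)) (vid (fst C))"
    using inverse_arrows_Idt[OF is_category_Frm L] by simp
  then obtain g where g: "is_cba_hom (Funayama ?L) (snd C) g" "bij_betw g (carrier (Funayama ?L)) (carrier (snd C))"
    "\<forall>a\<in>fst C. g (open_sublocale ?L (app (vid (fst C)) a)) = a"
    using fiber_terminal_funayama_iso[OF C L] by blast
  have "g ` open_sublocale ?L ` carrier ?L = (\<lambda>a. a) ` fst C"
    unfolding image_image carrier_OM using g(3) Ob_MTD(6)[OF C(1)] by (intro image_cong) auto
  moreover have "open_sublocale ?L ` carrier ?L \<subseteq> carrier (Funayama ?L)"
    using open_in_Funayama by blast
  ultimately show ?thesis
    using cba_hom_image_difference_generated[OF Funayama_cba Ob_MTD(3)[OF C(1)] g(1) _ _ Funayama_difference_generated] g(2)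
    by (simp add: bij_betw_def)
qed

lemma fiber_terminal_pt_td:
  assumes c: "c \<in> Ob MT" "fiber_terminal c"
  shows "td_space (pt_space (Hom MT c twoM) (fst c))"
proof -
  have fr: "is_frame (fo OM c)" using OM_Frm[OF c(1)] by (simp add: Ob_Frm)
  have "td_space (pt_space (Hom MT c twoM) (carrier (fo OM c)))"
  proof (rule pt_space_td[OF fr MT_frame_point[OF c(1)]])
    fix f assume f: "f \<in> Hom MT c twoM"
    let ?P = "\<lambda>f. {m \<in> carrier (snd c). app f m = v1}"
    obtain a b where ab: "a \<in> fst c" "b \<in> fst c" "b \<in> ?P f" "a \<notin> ?P f"
      "\<forall>Q. cba_point (snd c) Q \<and> b \<in> Q \<and> a \<notin> Q \<longrightarrow> Q = ?P f"
      using cba_point_isolated[OF Ob_MTD(3,5)[OF c(1)] fiber_terminal_difference_generated[OF c] MT_point(2)[OF c(1) f]]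
      by blast
    have abM: "a \<in> carrier (snd c)" "b \<in> carrier (snd c)"
      using ab Ob_MTD(5)[OF c(1)] by auto
    have "h = f" if h: "h \<in> Hom MT c twoM" "app h b = v1" "app h a \<noteq> v1" for h
    proof -
      have "?P h = ?P f"
        using ab(5) MT_point(2)[OF c(1) h(1)] h abM by blast
      then have "app h m = v1 \<longleftrightarrow> app f m = v1" if "m \<in> fst c" for m
        using that Ob_MTD(5)[OF c(1)] by blast
      then show ?thesis
        by (rule MT_point_eqI[OF c(1) h(1) f])
    qed
    then show "\<exists>a\<in>carrier (fo OM c). \<exists>b\<in>carrier (fo OM c). app f b = v1 \<and> app f a \<noteq> v1 \<and>
        (\<forall>h\<in>Hom MT c twoM. app h b = v1 \<and> app h a \<noteq> v1 \<longrightarrow> h = f)"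
      using ab abM by (intro bexI[of _ a] bexI[of _ b]) auto
  qed
  then show ?thesis by simp
qed

lemma MTT_simps: "Ob MTT = {c \<in> Ob MT. fiber_terminal c}" "Hom MTT = Hom MT" "Cmp MTT = vcomp"
  "Idt MTT c = vid (carrier (snd c))"
  by (simp_all add: MTT_def)

lemma MTT_duality: "pt_duality MTT twoM fst (\<lambda>A. carrier (snd A)) powerset_mt td_space"
proof (rule pt_duality_full_subcategory[OF MT_duality])
  show "is_full_subcategory MTT MT"
    unfolding MTT_def by (rule full_subcat_full[OF is_category_MT])
  show "twoM \<in> Ob MTT"
    using twoM_MT twoM_fiber_terminal by (simp add: MTT_simps)
  show "powerset_mt X \<in> Ob MTT" if "X \<in> Ob Top" "td_space X" for X
    using powerset_mt_MT[OF that(1)] powerset_mt_fiber_terminal[of X] that by (simp add: MTT_simps Ob_TopD)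
  show "td_space (pt_space (Hom MT c twoM) (fst c))" if "c \<in> Ob MTT" for c
    by (rule fiber_terminal_pt_td) (use that in \<open>simp_all add: MTT_simps\<close>)
qed (simp_all add: MTT_simps)

section \<open>The dualities for frames\<close>

lemma FrmLE_simps: "Ob FrmLE = Ob Frm" "Cmp FrmLE = vcomp" "Idt FrmLE L = vid (carrier L)"
  "f \<in> Hom FrmLE L M \<longleftrightarrow> f \<in> Hom Frm L M \<and> locally_exact L M (app f)"
  by (simp_all add: FrmLE_def)

lemma locally_exact_cong:
  assumes L: "is_frame L" and eq: "\<And>a. a \<in> carrier L \<Longrightarrow> f a = g a"
  shows "locally_exact L M f \<longleftrightarrow> locally_exact L M g"
  unfolding locally_exact_def using frame_hom_cong[OF L eq] eq by simp

lemma is_category_FrmLE: "is_category (FrmLE :: ('u::universe gorder, 'u) cat)"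
proof (rule is_categoryI[where u = carrier])
  have Frm: "is_category (Frm :: ('u gorder, 'u) cat)" by (rule is_category_Frm)
  show "vid (carrier a) \<in> Hom FrmLE a a" if "a \<in> Ob FrmLE" for a :: "'u gorder"
  proof -
    have a: "a \<in> Ob Frm" using that by (simp add: FrmLE_simps)
    then have "Idt Frm a \<in> Hom Frm a a"
      using Frm unfolding is_category_def by blast
    then have "vid (carrier a) \<in> Hom Frm a a"
      by simp
    moreover have "locally_exact a a (\<lambda>x. x)"
      using is_cba_hom_id by (auto simp: locally_exact_def is_frame_hom_def)
    then have "locally_exact a a (app (vid (carrier a)))"
      using locally_exact_cong[of a "app (vid (carrier a))" "\<lambda>x. x"] a by (simp add: Ob_Frm)
    ultimately show ?thesis by (simp add: FrmLE_simps)
  qed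
  show "vcomp g f \<in> Hom FrmLE a c"
    if "a \<in> Ob FrmLE" "b \<in> Ob FrmLE" "c \<in> Ob FrmLE" "f \<in> Hom FrmLE a b" "g \<in> Hom FrmLE b c"
    for a b c :: "'u gorder" and f g
  proof -
    have Ob: "a \<in> Ob Frm" "b \<in> Ob Frm" "c \<in> Ob Frm" and f: "f \<in> Hom Frm a b" "locally_exact a b (app f)"
      and g: "g \<in> Hom Frm b c" "locally_exact b c (app g)"
      using that by (auto simp: FrmLE_simps)
    have gf: "vcomp g f \<in> Hom Frm a c"
    proof -
      have "Cmp Frm g f \<in> Hom Frm a c"
        using Frm Ob f(1) g(1) unfolding is_category_def by blast
      then show ?thesis by simp
    qed
    obtain F where F: "is_cba_hom (Funayama a) (Funayama b) F"
      "\<forall>x\<in>carrier a. F (open_sublocale a x) = open_sublocale b (app f x)"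
      using f(2) by (auto simp: locally_exact_def)
    obtain G where G: "is_cba_hom (Funayama b) (Funayama c) G"
      "\<forall>x\<in>carrier b. G (open_sublocale b x) = open_sublocale c (app g x)"
      using g(2) by (auto simp: locally_exact_def)
    have fm: "f \<in> maps (carrier a) (carrier b)" "small (carrier a)"
      using f(1) Ob by (auto simp: Hom_Frm Ob_Frm)
    have "\<forall>x\<in>carrier a. G (F (open_sublocale a x)) = open_sublocale c (app (vcomp g f) x)"
      using F(2) G(2) app_vcomp[OF fm(2,1)] app_maps[OF fm] by simp
    then have "locally_exact a c (app (vcomp g f))"
      using gf is_cba_hom_comp[OF F(1) G(1)] unfolding locally_exact_def by (auto simp: Hom_Frm)
    with gf show ?thesis by (simp add: FrmLE_simps)
  qed
qed (auto simp: FrmLE_simps Ob_Frm Hom_Frm)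

lemma two_Frm: "two \<in> Ob Frm"
  using two_frame by (simp add: Ob_Frm)

text \<open>
  A locally exact point of \<open>L\<close> is one that extends to a point of the Funayama algebra.
\<close>

lemma FrmLE_two_iff:
  assumes L: "L \<in> Ob Frm" and f: "f \<in> maps (carrier L) {v0, v1}"
  shows "f \<in> Hom FrmLE L two \<longleftrightarrow>
    (\<exists>P. cba_point (Funayama L) P \<and> (\<forall>a\<in>carrier L. open_sublocale L a \<in> P \<longleftrightarrow> app f a = v1))"
proof -
  have "app f \<in> carrier L \<rightarrow> {v0, v1}"
    using app_maps[OF f] L by (auto simp: Ob_Frm)
  then have "locally_exact L two (app f) \<longleftrightarrow>
      (\<exists>P. cba_point (Funayama L) P \<and> (\<forall>a\<in>carrier L. open_sublocale L a \<in> P \<longleftrightarrow> app f a = v1))"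
    by (rule locally_exact_two_iff[OF L])
  then show ?thesis
    using f by (auto simp: FrmLE_simps Hom_Frm locally_exact_def)
qed

lemma FrmLE_opens_iff:
  assumes L: "L \<in> Ob Frm" and X: "X \<in> Ob TopD" and f: "f \<in> maps (carrier L) (carrier (opens X))"
  shows "f \<in> Hom FrmLE L (opens X) \<longleftrightarrow> (\<forall>x\<in>topspace X. \<exists>P. cba_point (Funayama L) P \<and>
    (\<forall>a\<in>carrier L. open_sublocale L a \<in> P \<longleftrightarrow> x \<in> elts (app f a)))"
proof -
  have "app f \<in> carrier L \<rightarrow> carrier (opens X)"
    using app_maps[OF f] L by (auto simp: Ob_Frm)
  then have "locally_exact L (opens X) (app f) \<longleftrightarrow> (\<forall>x\<in>topspace X. \<exists>P. cba_point (Funayama L) P \<and>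
    (\<forall>a\<in>carrier L. open_sublocale L a \<in> P \<longleftrightarrow> x \<in> elts (app f a)))"
    by (rule locally_exact_opens_iff[OF L X])
  then show ?thesis
    using f by (auto simp: FrmLE_simps Hom_Frm locally_exact_def)
qed

lemma FrmLE_point_maps: "f \<in> Hom FrmLE L two \<Longrightarrow> f \<in> maps (carrier L) {v0, v1}"
  by (simp add: FrmLE_simps Hom_Frm)

lemma FrmLE_frame_point:
  assumes L: "L \<in> Ob Frm" and f: "f \<in> Hom FrmLE L two"
  shows "frame_point L {a \<in> carrier L. app f a = v1}"
proof -
  have "app f \<in> carrier L \<rightarrow> {v0, v1}" "is_frame_hom L two (app f)"
    using f app_maps[OF FrmLE_point_maps[OF f]] L by (auto simp: FrmLE_simps Hom_Frm Ob_Frm)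
  then show ?thesis
    using frame_hom_two_iff[of L "app f"] L by (simp add: Ob_Frm)
qed

lemma FrmLE_point_eqI:
  assumes L: "L \<in> Ob Frm" and f: "f \<in> Hom FrmLE L two" and g: "g \<in> Hom FrmLE L two"
    and eq: "\<And>a. a \<in> carrier L \<Longrightarrow> app f a = v1 \<longleftrightarrow> app g a = v1"
  shows "f = g"
proof -
  have sm: "small (carrier L)" using L by (simp add: Ob_Frm)
  note fm = FrmLE_point_maps[OF f] and gm = FrmLE_point_maps[OF g]
  show ?thesis
  proof (rule maps_ext[OF sm fm gm])
    fix a assume "a \<in> carrier L"
    then show "app f a = app g a"
      using app_maps[OF fm sm, of a] app_maps[OF gm sm, of a] eq[of a] by auto
  qed
qed

text \<open>
  Each locally exact point extends to a point of the Funayama algebra, which is isolated by a difference of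
  open elements.
\<close>

lemma FrmLE_pt_td:
  assumes L: "L \<in> Ob Frm"
  shows "td_space (pt_space (Hom FrmLE L two) (carrier L))"
proof -
  have fr: "is_frame L" using L by (simp add: Ob_Frm)
  interpret frame L by unfold_locales (rule fr)
  show ?thesis
  proof (rule pt_space_td[OF fr FrmLE_frame_point[OF L]])
    fix f assume f: "f \<in> Hom FrmLE L two"
    obtain P where P: "cba_point (Funayama L) P" "\<forall>a\<in>carrier L. open_sublocale L a \<in> P \<longleftrightarrow> app f a = v1"
      using FrmLE_two_iff[OF L FrmLE_point_maps[OF f]] f by blast
    have "open_sublocale L ` carrier L \<subseteq> carrier (Funayama L)"
      using open_in_Funayama by blast
    then obtain A B where AB: "A \<in> open_sublocale L ` carrier L" "B \<in> open_sublocale L ` carrier L" "B \<in> P" "A \<notin> P"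
      "\<forall>Q. cba_point (Funayama L) Q \<and> B \<in> Q \<and> A \<notin> Q \<longrightarrow> Q = P"
      using cba_point_isolated[OF Funayama_cba _ Funayama_difference_generated P(1)] by blast
    then obtain a b where ab: "a \<in> carrier L" "A = open_sublocale L a" "b \<in> carrier L" "B = open_sublocale L b"
      by blast
    have "h = f" if h: "h \<in> Hom FrmLE L two" "app h b = v1" "app h a \<noteq> v1" for h
    proof -
      obtain Q where Q: "cba_point (Funayama L) Q" "\<forall>a\<in>carrier L. open_sublocale L a \<in> Q \<longleftrightarrow> app h a = v1"
        using FrmLE_two_iff[OF L FrmLE_point_maps[OF h(1)]] h(1) by blast
      then have "Q = P"
        using AB(5) ab h by blast
      then have "app h x = v1 \<longleftrightarrow> app f x = v1" if "x \<in> carrier L" for x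
        using P(2) Q(2) that by blast
      then show ?thesis
        by (rule FrmLE_point_eqI[OF L h(1) f])
    qed
    moreover have "app f b = v1" "app f a \<noteq> v1"
      using P(2) AB ab by auto
    ultimately show "\<exists>a\<in>carrier L. \<exists>b\<in>carrier L. app f b = v1 \<and> app f a \<noteq> v1 \<and>
        (\<forall>h\<in>Hom FrmLE L two. app h b = v1 \<and> app h a \<noteq> v1 \<longrightarrow> h = f)"
      using ab by blast
  qed
qed

lemma FrmLE_pt:
  assumes L: "L \<in> Ob Frm"
  shows "openin (pt_space (Hom FrmLE L two) (carrier L)) U \<longleftrightarrow>
      (\<exists>a\<in>carrier L. U = {f \<in> Hom FrmLE L two. app f a = v1})"
    and "topspace (pt_space (Hom FrmLE L two) (carrier L)) = Hom FrmLE L two"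
    and "pt_space (Hom FrmLE L two) (carrier L) \<in> Ob TopD"
    and "small (Hom FrmLE L two)"
proof -
  have fr: "is_frame L" and sm: "small (carrier L)" using L by (auto simp: Ob_Frm)
  note pts = FrmLE_frame_point[OF L]
  show "openin (pt_space (Hom FrmLE L two) (carrier L)) U \<longleftrightarrow>
      (\<exists>a\<in>carrier L. U = {f \<in> Hom FrmLE L two. app f a = v1})"
    and ts: "topspace (pt_space (Hom FrmLE L two) (carrier L)) = Hom FrmLE L two"
    using pt_space_open[OF fr pts] by auto
  have "Hom FrmLE L two \<subseteq> maps (carrier L) {v0, v1}"
    using FrmLE_point_maps by blast
  then show smH: "small (Hom FrmLE L two)"
    using small_subset[OF small_maps[OF sm small_v0_v1]] by blast
  show "pt_space (Hom FrmLE L two) (carrier L) \<in> Ob TopD"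
    using pt_space_t0[OF fr pts] FrmLE_point_eqI[OF L] smH ts FrmLE_pt_td[OF L]
    by (simp add: Ob_TopD Ob_Top)
qed

lemma FrmLE_duality: "pt_duality FrmLE two carrier carrier opens td_space"
proof (unfold_locales, goal_cases)
  case 1 show ?case by (rule is_category_FrmLE)
next
  case 2 show ?case by (simp add: FrmLE_simps)
next
  case (3 c) show ?case by (simp add: FrmLE_simps)
next
  case (4 c) then show ?case by (simp add: FrmLE_simps Ob_Frm)
next
  case (5 c) then show ?case by simp
next
  case (6 c d f) then show ?case by (simp add: FrmLE_simps Hom_Frm)
next
  case (7 c d f a) then show ?case
    using frame_hom_closed by (auto simp: FrmLE_simps Hom_Frm)
next
  case 8 show ?case by (simp add: FrmLE_simps two_Frm)
next
  case 9 show ?case by simp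
next
  case (10 X) then show ?case by (simp add: FrmLE_simps opens_Frm Ob_Top)
next
  case (11 X) then show ?case by simp
next
  case (12 X) then show ?case using openin_subset by (auto simp: carrier_opens)
next
  case (13 X Y g A)
  then have X: "small (topspace X)" and Y: "small (topspace Y)" and g: "continuous_map Y X (app g)"
    by (auto simp: Ob_Top Hom_Top)
  have "openin Y {y \<in> topspace Y. app g y \<in> elts A}"
    using g 13(4) in_opens_iff[OF X] by (simp add: continuous_map_def)
  then show ?case by (simp add: carrier_opens)
next
  case (14 X c h)
  then have X: "X \<in> Ob TopD" and c: "c \<in> Ob Frm"
    by (auto simp: Ob_TopD FrmLE_simps)
  have "lam (carrier c) (\<lambda>m. if x \<in> elts (app h m) then v1 else v0) \<in> Hom FrmLE c two \<longleftrightarrow>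
      (\<exists>P. cba_point (Funayama c) P \<and> (\<forall>a\<in>carrier c. open_sublocale c a \<in> P \<longleftrightarrow> x \<in> elts (app h a)))" for x
  proof -
    let ?f = "lam (carrier c) (\<lambda>m. if x \<in> elts (app h m) then v1 else v0)"
    have "?f \<in> maps (carrier c) {v0, v1}"
      by (rule maps_I) auto
    moreover have "app ?f a = v1 \<longleftrightarrow> x \<in> elts (app h a)" if "a \<in> carrier c" for a
      using that c by (simp add: Ob_Frm)
    ultimately show ?thesis
      using FrmLE_two_iff[OF c, of ?f] by simp
  qed
  then show ?case
    using FrmLE_opens_iff[OF c X 14(3)] by simp
next
  case (15 c) then show ?case using FrmLE_pt(3)[of c] by (simp add: FrmLE_simps Ob_TopD)
next
  case (16 c) then show ?case using FrmLE_pt(2)[of c] by (simp add: FrmLE_simps)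
next
  case (17 c U) then show ?case using FrmLE_pt(1)[of c U] by (simp add: FrmLE_simps)
next
  case (18 c m)
  then have c: "c \<in> Ob Frm" and m: "m \<in> carrier c" by (auto simp: FrmLE_simps)
  have "openin (pt_space (Hom FrmLE c two) (carrier c)) {f \<in> Hom FrmLE c two. app f m = v1}"
    using FrmLE_pt(1)[OF c] m by blast
  then show ?case
    by (simp add: carrier_opens)
qed

lemma FrmT_simps: "Cmp FrmT = vcomp" "Idt FrmT L = vid (carrier L)"
  by (simp_all add: FrmT_def)

lemma Ob_FrmT: "L \<in> Ob FrmT \<longleftrightarrow> L \<in> Ob Frm \<and> (\<exists>C\<in>Ob MTT. \<exists>\<theta>. is_iso Frm (fo OM C) L \<theta>)"
  by (simp add: FrmT_def)

text \<open>
  An arrow of \<open>FrmT\<close> is required to lift along some isomorphisms with frames of fiber-terminal algebras; since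
  lifting is equivalent to local exactness, it then lifts along all such isomorphisms.
\<close>

lemma Hom_FrmT:
  assumes L: "L \<in> Ob FrmT" and L': "L' \<in> Ob FrmT"
  shows "Hom FrmT L L' = Hom FrmLE L L'"
proof
  have LF: "L \<in> Ob Frm" "L' \<in> Ob Frm" using L L' by (auto simp: Ob_FrmT)
  show "Hom FrmT L L' \<subseteq> Hom FrmLE L L'"
  proof
    fix f assume "f \<in> Hom FrmT L L'"
    then obtain C C' p \<theta> \<theta>' where f: "f \<in> Hom Frm L L'" "C \<in> Ob MTT" "C' \<in> Ob MTT" "p \<in> Hom MTT C C'"
      "is_iso Frm (fo OM C) L \<theta>" "is_iso Frm (fo OM C') L' \<theta>'" "vcomp f \<theta> = vcomp \<theta>' (fa OM C C' p)"
      by (auto simp: FrmT_def)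
    then show "f \<in> Hom FrmLE L L'"
      using locally_exact_iff_lifts[OF f(2,3) LF f(5,6,1)] by (auto simp: FrmLE_simps)
  qed
  show "Hom FrmLE L L' \<subseteq> Hom FrmT L L'"
  proof
    fix f assume f: "f \<in> Hom FrmLE L L'"
    obtain C \<theta> where C: "C \<in> Ob MTT" "is_iso Frm (fo OM C) L \<theta>"
      using L by (auto simp: Ob_FrmT)
    obtain C' \<theta>' where C': "C' \<in> Ob MTT" "is_iso Frm (fo OM C') L' \<theta>'"
      using L' by (auto simp: Ob_FrmT)
    have f': "f \<in> Hom Frm L L'" "locally_exact L L' (app f)"
      using f by (auto simp: FrmLE_simps)
    then obtain p where p: "p \<in> Hom MTT C C'" "vcomp f \<theta> = vcomp \<theta>' (fa OM C C' p)"
      using locally_exact_iff_lifts[OF C(1) C'(1) LF C(2) C'(2) f'(1)] by blast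
    then show "f \<in> Hom FrmT L L'"
      using f'(1) C C' p by (simp add: FrmT_def)
        (intro bexI[of _ C] bexI[of _ C'] bexI[of _ p] exI[of _ \<theta>] exI[of _ \<theta>'] conjI; simp)
  qed
qed

lemma FrmT_full: "is_full_subcategory (FrmT :: ('u::universe gorder, 'u) cat) FrmLE"
proof -
  have FrmLE: "is_category (FrmLE :: ('u gorder, 'u) cat)" by (rule is_category_FrmLE)
  have Ob: "L \<in> Ob FrmLE" if "L \<in> Ob FrmT" for L :: "'u gorder"
    using that by (simp add: Ob_FrmT FrmLE_simps)
  have "is_category (FrmT :: ('u gorder, 'u) cat)"
  proof (rule is_categoryI[where u = carrier])
    show "vid (carrier a) \<in> Hom FrmT a a" if "a \<in> Ob FrmT" for a :: "'u gorder"
      using FrmLE Ob[OF that] Hom_FrmT[OF that that] unfolding is_category_def by (metis FrmLE_simps(3))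
    show "vcomp g f \<in> Hom FrmT a c"
      if "a \<in> Ob FrmT" "b \<in> Ob FrmT" "c \<in> Ob FrmT" "f \<in> Hom FrmT a b" "g \<in> Hom FrmT b c"
      for a b c :: "'u gorder" and f g
    proof -
      have "f \<in> Hom FrmLE a b" "g \<in> Hom FrmLE b c"
        using that Hom_FrmT by auto
      then have "Cmp FrmLE g f \<in> Hom FrmLE a c"
        using FrmLE Ob that(1-3) unfolding is_category_def by blast
      then show ?thesis
        using Hom_FrmT[OF that(1,3)] by (simp add: FrmLE_simps)
    qed
  qed (auto simp: FrmT_simps Ob_FrmT Ob_Frm Hom_FrmT FrmLE_simps Hom_Frm)
  then show ?thesis
    using FrmLE Ob Hom_FrmT
    by (auto simp: is_full_subcategory_def is_subcategory_def FrmT_simps FrmLE_simps(2,3))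
qed

lemma opens_FrmT:
  assumes X: "X \<in> Ob TopD"
  shows "opens X \<in> Ob FrmT"
proof -
  have XT: "X \<in> Ob Top" "small (topspace X)" using X by (auto simp: Ob_TopD Ob_Top)
  have "powerset_mt X \<in> Ob MTT"
    using powerset_mt_MT[OF XT(1)] powerset_mt_fiber_terminal[OF X] by (simp add: MTT_simps)
  moreover have "is_iso Frm (fo OM (powerset_mt X)) (opens X) (Idt Frm (opens X))"
    unfolding OM_powerset_mt by (rule is_iso_Idt[OF is_category_Frm opens_Frm[OF XT(2)]])
  ultimately show ?thesis
    using opens_Frm[OF XT(2)] by (auto simp: Ob_FrmT)
qed

lemma FrmT_duality: "pt_duality FrmT two carrier carrier opens td_space"
proof (rule pt_duality_full_subcategory[OF FrmLE_duality FrmT_full])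
  show "two \<in> Ob FrmT"
    using opens_FrmT[OF discrete_one_TopD] by (simp add: opens_discrete_one)
  show "opens X \<in> Ob FrmT" if "X \<in> Ob Top" "td_space X" for X
    using opens_FrmT[of X] that by (simp add: Ob_TopD)
  show "td_space (pt_space (Hom FrmLE c two) (carrier c))" if "c \<in> Ob FrmT" for c
    using FrmLE_pt_td[of c] that by (simp add: Ob_FrmT)
qed (simp_all add: FrmT_simps)

lemma OM_FrmT: "C \<in> Ob MTT \<Longrightarrow> fo OM C \<in> Ob FrmT"
proof -
  assume C: "C \<in> Ob MTT"
  then have F: "fo OM C \<in> Ob Frm"
    by (intro OM_Frm) (simp add: MTT_simps)
  then show ?thesis
    using C is_iso_Idt[OF is_category_Frm F] by (auto simp: Ob_FrmT)
qed

lemma OM_FrmT_Hom_iff: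
  assumes C: "C \<in> Ob MTT" and C': "C' \<in> Ob MTT"
  shows "f \<in> Hom FrmT (fo OM C) (fo OM C') \<longleftrightarrow> (\<exists>p\<in>Hom MTT C C'. f = fa OM C C' p)"
proof -
  have CM: "C \<in> Ob MT" "C' \<in> Ob MT" using C C' by (auto simp: MTT_simps)
  note F = OM_Frm[OF CM(1)] OM_Frm[OF CM(2)]
  note id = is_iso_Idt[OF is_category_Frm F(1)] is_iso_Idt[OF is_category_Frm F(2)]
  note sm = Ob_MTD(6)[OF CM(1)] Ob_MTD(6)[OF CM(2)]
  have unit: "vcomp g (Idt Frm (fo OM C)) = g" "vcomp (Idt Frm (fo OM C')) g = g"
    if "g \<in> Hom Frm (fo OM C) (fo OM C')" for g
    using that vcomp_vid_right[OF sm(1), of g "fst C'"] vcomp_vid_left[OF sm, of g] by (simp_all add: Hom_Frm)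
  have OMp: "fa OM C C' p \<in> Hom Frm (fo OM C) (fo OM C')" if "p \<in> Hom MTT C C'" for p
    using OM_Hom[OF CM] that by (simp add: MTT_simps)
  have "f \<in> Hom Frm (fo OM C) (fo OM C') \<Longrightarrow>
      locally_exact (fo OM C) (fo OM C') (app f) \<longleftrightarrow> (\<exists>p\<in>Hom MTT C C'. f = fa OM C C' p)"
    using locally_exact_iff_lifts[OF C C' F id, of f] unit OMp by simp
  then show ?thesis
    using OMp by (auto simp: Hom_FrmT[OF OM_FrmT[OF C] OM_FrmT[OF C']] FrmLE_simps)
qed

section \<open>The Sierpinski space and characteristic maps\<close>

lemma openin_Sierp: "openin Sierp U \<longleftrightarrow> U = {} \<or> U = {v1} \<or> U = {v0, v1}"
proof -
  let ?O = "\<lambda>U. U = {} \<or> U = {v1} \<or> U = {v0, v1}"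
  have "istopology ?O"
    unfolding istopology_def
  proof (intro conjI allI impI)
    show "?O (S \<inter> T)" if "?O S" "?O T" for S T using that by auto
    fix \<U> assume \<U>: "\<forall>U\<in>\<U>. ?O U"
    show "?O (\<Union>\<U>)"
    proof (cases "{v0, v1} \<in> \<U>")
      case True
      then have "\<Union>\<U> = {v0, v1}" using \<U> by blast
      then show ?thesis by simp
    next
      case False
      then have "\<Union>\<U> \<subseteq> {v1}" using \<U> by blast
      then show ?thesis by blast
    qed
  qed
  then have "openin Sierp = ?O"
    unfolding Sierp_def by (rule topology_inverse')
  from fun_cong[OF this, of U] show ?thesis .
qed

lemma topspace_Sierp [simp]: "topspace Sierp = {v0, v1}"
  unfolding topspace_def using openin_Sierp by auto

lemma Sierp_Top: "Sierp \<in> Ob Top"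
  unfolding Ob_Top t0_space_def
proof (intro conjI ballI impI)
  fix x y :: 'a assume "x \<in> topspace Sierp" "y \<in> topspace Sierp" "x \<noteq> y"
  then show "\<exists>U. openin Sierp U \<and> (x \<notin> U \<longleftrightarrow> y \<in> U)"
    by (intro exI[of _ "{v1}"]) (auto simp: openin_Sierp)
qed simp

lemma Sierp_td: "td_space Sierp"
  unfolding td_space_def
proof
  fix x assume "x \<in> topspace Sierp"
  then consider "x = v0" | "x = v1" by auto
  then show "\<exists>U K. openin Sierp U \<and> closedin Sierp K \<and> U \<inter> K = {x}"
  proof cases
    case 1
    have "openin Sierp {v0, v1}" "closedin Sierp {v0}"
      by (auto simp: openin_Sierp closedin_def)
    then show ?thesis
      using 1 by (intro exI[of _ "{v0, v1}"] exI[of _ "{v0}"]) auto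
  next
    case 2
    have "openin Sierp {v1}" "closedin Sierp {v0, v1}"
      by (auto simp: openin_Sierp closedin_def)
    then show ?thesis
      using 2 by (intro exI[of _ "{v1}"] exI[of _ "{v0, v1}"]) auto
  qed
qed

lemma Hom_Sierp_iff:
  "g \<in> Hom Top X Sierp \<longleftrightarrow> g \<in> maps (topspace X) {v0, v1} \<and> openin X {x \<in> topspace X. app g x = v1}"
  if X: "small (topspace X)"
proof
  assume "g \<in> Hom Top X Sierp"
  then have g: "g \<in> maps (topspace X) {v0, v1}" "continuous_map X Sierp (app g)"
    by (auto simp: Hom_Top)
  have "openin X {x \<in> topspace X. app g x \<in> {v1}}"
    using g(2) openin_Sierp[of "{v1}"] unfolding continuous_map_def by blast
  then show "g \<in> maps (topspace X) {v0, v1} \<and> openin X {x \<in> topspace X. app g x = v1}"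
    using g(1) by simp
next
  assume g: "g \<in> maps (topspace X) {v0, v1} \<and> openin X {x \<in> topspace X. app g x = v1}"
  have val: "app g x \<in> {v0, v1}" if "x \<in> topspace X" for x
    using g app_maps X that by blast
  have "openin X {x \<in> topspace X. app g x \<in> U}" if "openin Sierp U" for U
  proof -
    consider "U = {}" | "U = {v1}" | "U = {v0, v1}"
      using \<open>openin Sierp U\<close> openin_Sierp by blast
    then show ?thesis
    proof cases
      case 3
      then have "{x \<in> topspace X. app g x \<in> U} = topspace X" using val by blast
      then show ?thesis by simp
    qed (use g in simp_all)
  qed
  then show "g \<in> Hom Top X Sierp"
    using g val by (auto simp: Hom_Top continuous_map_def)
qed

lemma SetC_simps [simp]: "Ob SetC = {A. small A}" "Hom SetC = maps" "Idt SetC = vid" "Cmp SetC = vcomp"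
  by (simp_all add: SetC_def)

lemma is_category_SetC: "is_category SetC"
  by (rule is_categoryI[where u = "\<lambda>A. A"]) (auto intro: vid_maps vcomp_maps)

lemma small_Hom_Top: "X \<in> Ob Top \<Longrightarrow> Y \<in> Ob Top \<Longrightarrow> small (Hom Top X Y)"
proof -
  assume "X \<in> Ob Top" "Y \<in> Ob Top"
  then have "small (maps (topspace X) (topspace Y))"
    using small_maps by (auto simp: Ob_Top)
  then show ?thesis
    by (rule small_subset) (auto simp: Hom_Top)
qed

lemma app_char_map:
  assumes X: "X \<in> Ob Top" and u: "u \<in> carrier (opens X)"
  shows "app (char_map X) u = lam (topspace X) (\<lambda>x. if x \<in> elts u then v1 else v0)"
    and "app (char_map X) u \<in> Hom Top X Sierp"
    and "x \<in> topspace X \<Longrightarrow> app (app (char_map X) u) x = (if x \<in> elts u then v1 else v0)"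
proof -
  have sm: "small (topspace X)" using X by (simp add: Ob_Top)
  have smo: "small (carrier (opens X))" using opens_Frm[OF sm] by (simp add: Ob_Frm)
  show eq: "app (char_map X) u = lam (topspace X) (\<lambda>x. if x \<in> elts u then v1 else v0)"
    using u smo by (simp add: char_map_def)
  show val: "app (app (char_map X) u) x = (if x \<in> elts u then v1 else v0)" if "x \<in> topspace X" for x
    using that sm by (simp add: eq)
  have "openin X (elts u)" using u in_opens_iff[OF sm] by simp
  moreover have "{x \<in> topspace X. app (app (char_map X) u) x = v1} = elts u"
    using val openin_subset[OF \<open>openin X (elts u)\<close>] by (auto split: if_splits)
  moreover have "app (char_map X) u \<in> maps (topspace X) {v0, v1}"
    unfolding eq by (rule maps_I) auto
  ultimately show "app (char_map X) u \<in> Hom Top X Sierp"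
    by (simp add: Hom_Sierp_iff[OF sm])
qed

text \<open>
  The inverse of \<open>char_map\<close>, sending a map to the Sierpinski space to the preimage of its open point.
\<close>

definition char_inv :: "'u::universe topology \<Rightarrow> 'u" where
  "char_inv X = lam (Hom Top X Sierp) (\<lambda>g. vset {x \<in> topspace X. app g x = v1})"

lemma char_map_inverse:
  assumes X: "X \<in> Ob Top"
  shows "inverse_arrows SetC (carrier (opens X)) (Hom Top X Sierp) (char_map X) (char_inv X)"
proof -
  have sm: "small (topspace X)" using X by (simp add: Ob_Top)
  have smo: "small (carrier (opens X))" using opens_Frm[OF sm] by (simp add: Ob_Frm)
  note smH = small_Hom_Top[OF X Sierp_Top]
  have smx: "small {x \<in> topspace X. P x}" for P
    by (rule small_subset[OF sm]) blast
  have c: "char_map X \<in> maps (carrier (opens X)) (Hom Top X Sierp)"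
    using app_char_map(1,2)[OF X] unfolding char_map_def by (intro maps_I) auto
  have i: "char_inv X \<in> maps (Hom Top X Sierp) (carrier (opens X))"
    unfolding char_inv_def by (rule maps_I) (auto simp: Hom_Sierp_iff[OF sm] in_opens_iff[OF sm] smx)
  have "vset {x \<in> topspace X. app (app (char_map X) u) x = v1} = u" if u: "u \<in> carrier (opens X)" for u
  proof -
    have "elts u \<subseteq> topspace X" using u in_opens_iff[OF sm] openin_subset by blast
    then have "{x \<in> topspace X. app (app (char_map X) u) x = v1} = elts u"
      using app_char_map(3)[OF X u] by (auto split: if_splits)
    then show ?thesis by simp
  qed
  then have 1: "vcomp (char_inv X) (char_map X) = vid (carrier (opens X))"
    unfolding vcomp_eq_lam[OF smo c] vid_def
    by (intro lam_cong) (simp add: char_inv_def smH app_char_map(2)[OF X])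
  have "app (char_map X) (vset {x \<in> topspace X. app g x = v1}) = g" if g: "g \<in> Hom Top X Sierp" for g
  proof -
    have gm: "g \<in> maps (topspace X) {v0, v1}" using g by (simp add: Hom_Top)
    have u: "vset {x \<in> topspace X. app g x = v1} \<in> carrier (opens X)"
      using g by (simp add: Hom_Sierp_iff[OF sm] in_opens_iff[OF sm] smx)
    have v0: "app g x = v0" if "x \<in> topspace X" "app g x \<noteq> v1" for x
      using app_maps[OF gm sm that(1)] that(2) by blast
    have "app (char_map X) (vset {x \<in> topspace X. app g x = v1}) = lam (topspace X) (app g)"
      unfolding app_char_map(1)[OF X u] by (intro lam_cong) (auto simp: smx v0)
    then show ?thesis using lam_app[OF sm gm] by simp
  qed
  then have 2: "vcomp (char_map X) (char_inv X) = vid (Hom Top X Sierp)"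
    unfolding char_inv_def using smH by (simp add: vid_def cong: lam_cong')
  show ?thesis
    using c i 1 2 by (simp add: inverse_arrows_def)
qed

lemma point_comp_lam:
  assumes X: "X \<in> Ob Top" and x: "x \<in> topspace X" and A: "small A" and h: "h \<in> maps A (Hom Top X Sierp)"
  shows "vcomp (vcomp (vid {v0, v1}) (chi X x)) h = lam A (\<lambda>a. app (app h a) x)"
proof -
  have sm: "small (topspace X)" using X by (simp add: Ob_Top)
  have "app (app h a) x \<in> {v0, v1}" if "a \<in> A" for a
    using app_maps[OF _ sm x, of "app h a" "{v0, v1}"] app_maps[OF h A that] by (simp add: Hom_Top)
  then show ?thesis
    unfolding vcomp_eq_lam[OF A h] chi_def using app_maps[OF h A] small_Hom_Top[OF X Sierp_Top]
    by (auto intro!: lam_cong)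
qed

lemma point_comp_char_map:
  assumes X: "X \<in> Ob Top" and x: "x \<in> topspace X" and A: "small A" and h: "h \<in> maps A (carrier (opens X))"
  shows "vcomp (vcomp (vid {v0, v1}) (chi X x)) (vcomp (char_map X) h) =
    lam A (\<lambda>a. if x \<in> elts (app h a) then v1 else v0)"
proof -
  have sm: "small (topspace X)" using X by (simp add: Ob_Top)
  have smo: "small (carrier (opens X))" using opens_Frm[OF sm] by (simp add: Ob_Frm)
  have c: "char_map X \<in> maps (carrier (opens X)) (Hom Top X Sierp)"
    using char_map_inverse[OF X] by (simp add: inverse_arrows_def)
  have "vcomp (vcomp (vid {v0, v1}) (chi X x)) (vcomp (char_map X) h) =
      lam A (\<lambda>a. app (app (vcomp (char_map X) h) a) x)"
    by (rule point_comp_lam[OF X x A vcomp_maps[OF A smo h c]])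
  also have "\<dots> = lam A (\<lambda>a. if x \<in> elts (app h a) then v1 else v0)"
    by (rule lam_cong) (simp add: app_vcomp[OF A h] app_char_map(3)[OF X app_maps[OF h A] x])
  finally show ?thesis .
qed

section \<open>Full subcategories of MT-algebras as SFC-categories\<close>

lemma OM_twoM: "fo OM twoM = two"
  by (simp add: OM_simps twoM_def)

text \<open>
  The structure of an SFC-category on a full subcategory \<open>K\<close> of MT-algebras, restricted from \<open>MT\<close>.
\<close>

definition sfc_of :: "('u::universe mt, 'u) cat \<Rightarrow> ('u mt, 'u) sfc" where
  "sfc_of K = MT_sfc\<lparr>Cat := K\<rparr>"

lemma sfc_of_simps [simp]: "Cat (sfc_of K) = K" "OF (sfc_of K) = OM" "Two (sfc_of K) = twoM"
  "iota (sfc_of K) = vid {v0, v1}" "Om (sfc_of K) = powerset_mt" "Th (sfc_of K) = char_map"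
  by (simp_all add: sfc_of_def MT_sfc_def)

lemma MT_sfc_eq: "MT_sfc = sfc_of MT"
  by (simp add: sfc_of_def MT_sfc_def)

lemma underlying_sfc_of [simp]: "fo (underlying (sfc_of K)) c = fst c" "fa (underlying (sfc_of K)) = fa OM"
  by (simp_all add: underlying_def)

lemma iota_inv_sfc_of [simp]: "iota_inv (sfc_of K) = vid {v0, v1}"
proof -
  have "inverse_arrows Frm two two (vid {v0, v1}) (vid {v0, v1})"
    using inverse_arrows_Idt[OF is_category_Frm two_Frm] by simp
  then show ?thesis
    unfolding iota_inv_def sfc_of_simps OM_twoM
    by (rule inv_arr_eqI[OF is_category_Frm two_Frm two_Frm])
qed

lemma Th_inv_sfc_of: "X \<in> Ob Top \<Longrightarrow> Th_inv (sfc_of K) X = char_inv X"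
proof -
  assume X: "X \<in> Ob Top"
  have "small (carrier (opens X))"
    using opens_Frm X by (auto simp: Ob_Frm Ob_Top)
  then show ?thesis
    unfolding Th_inv_def
    by (intro inv_arr_eqI[OF is_category_SetC])
      (use char_map_inverse[OF X] small_Hom_Top[OF X Sierp_Top] in simp_all)
qed

lemma point_family_sfc_of:
  "point_family (sfc_of K) X = {vcomp (vid {v0, v1}) (chi X x) | x. x \<in> topspace X}"
  by (simp add: point_family_def)

text \<open>
  A full subcategory of \<open>MT\<close> with a dual adjunction to the spaces satisfying \<open>Q\<close>, where \<open>Q\<close> holds for
  all spaces that have a cartesian lift. Then \<open>K\<close> is an SFC-category, the spaces satisfying \<open>Q\<close> are
  exactly those with a cartesian lift, and the abstract construction of the dual adjunction gives
  \<open>adj\<close>.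
\<close>

locale mt_duality = pt_duality K twoM fst "\<lambda>A. carrier (snd A)" powerset_mt Q T pt
  for K :: "('u::universe mt, 'u) cat" and Q T pt +
  assumes full: "is_full_subcategory K MT" and Sierp: "Q Sierp"
    and space_lift_Q: "\<And>X c \<theta>. X \<in> Ob Top \<Longrightarrow> is_space_lift (sfc_of K) X c \<theta> \<Longrightarrow> Q X"
begin

lemma Ob_K: "c \<in> Ob K \<Longrightarrow> c \<in> Ob MT"
  using full by (auto simp: is_full_subcategory_def is_subcategory_def)

lemma Hom_K: "c \<in> Ob K \<Longrightarrow> d \<in> Ob K \<Longrightarrow> Hom K c d = Hom MT c d"
  using full by (simp add: is_full_subcategory_def)

lemma functor_OM: "is_functor K Frm OM"
proof -
  have F: "is_functor (MT :: ('u mt, 'u) cat) Frm OM" by (rule is_functor_OM)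
  show ?thesis
    unfolding is_functor_def
  proof (intro conjI ballI category is_category_Frm)
    show "fo OM c \<in> Ob Frm" if "c \<in> Ob K" for c
      using OM_Frm[OF Ob_K[OF that]] .
    show "fa OM c d f \<in> Hom Frm (fo OM c) (fo OM d)" if "c \<in> Ob K" "d \<in> Ob K" "f \<in> Hom K c d" for c d f
      using OM_Hom[OF Ob_K[OF that(1)] Ob_K[OF that(2)]] that by (simp add: Hom_K)
    show "fa OM c c (Idt K c) = Idt Frm (fo OM c)" if "c \<in> Ob K" for c
      using F Ob_K[OF that] Idt_K[OF that] by (simp add: is_functor_def)
    show "fa OM c e (Cmp K g f) = Cmp Frm (fa OM d e g) (fa OM c d f)"
      if "c \<in> Ob K" "d \<in> Ob K" "e \<in> Ob K" "f \<in> Hom K c d" "g \<in> Hom K d e" for c d e f g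
    proof -
      have "f \<in> Hom MT c d" "g \<in> Hom MT d e"
        using that by (simp_all add: Hom_K)
      then show ?thesis
        using F Ob_K[OF that(1)] Ob_K[OF that(2)] Ob_K[OF that(3)] unfolding is_functor_def Cmp_K
        by simp
    qed
  qed
qed

lemma OM_Hom_K: "c \<in> Ob K \<Longrightarrow> d \<in> Ob K \<Longrightarrow> f \<in> Hom K c d \<Longrightarrow> fa OM c d f \<in> maps (fst c) (fst d)"
  using OM_Hom[OF Ob_K Ob_K] Hom_K by (simp add: Hom_Frm)

lemma OM_inj:
  "c \<in> Ob K \<Longrightarrow> d \<in> Ob K \<Longrightarrow> p \<in> Hom K c d \<Longrightarrow> q \<in> Hom K c d \<Longrightarrow> fa OM c d p = fa OM c d q \<Longrightarrow> p = q"
  using is_faithful_OM Ob_K Hom_K unfolding is_faithful_def by (metis inj_onD)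

lemma lift_of_eqI:
  assumes "c \<in> Ob K" "d \<in> Ob K" "p \<in> Hom K c d" "lam (fst c) (app p) = h"
  shows "lift_of (sfc_of K) c d h = p"
  unfolding lift_of_def
  by (rule the_equality) (use assms OM_inj in \<open>auto simp: OM_simps\<close>)

lemma is_pfc: "is_pfc (sfc_of K)"
  unfolding is_pfc_def
proof (intro conjI)
  show "is_faithful (Cat (sfc_of K)) (OF (sfc_of K))"
    using OM_inj by (auto simp: is_faithful_def inj_on_def)
  show "is_iso Frm (fo (OF (sfc_of K)) (Two (sfc_of K))) two (iota (sfc_of K))"
    using is_iso_Idt[OF is_category_Frm two_Frm] by (simp add: OM_twoM)
qed (simp_all add: functor_OM t_Ob)

lemma cartesian_lift:
  assumes X: "X \<in> Ob T"
  shows "is_space_lift (sfc_of K) X (powerset_mt X) (char_map X)"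
  unfolding is_space_lift_def is_cartesian_lift_def sfc_of_simps underlying_sfc_of
proof (intro conjI ballI)
  have XT: "X \<in> Ob Top" using X by (simp add: Ob_T)
  note smX = small_topspace[OF X]
  show "powerset_mt X \<in> Ob K" by (rule R_Ob[OF X])
  show "is_iso SetC (fst (powerset_mt X)) (Hom Top X Sierp) (char_map X)"
    using char_map_inverse[OF XT] by (auto simp: is_iso_def)
  fix D h assume D: "D \<in> Ob K" and "h \<in> Hom SetC (fst D) (fst (powerset_mt X))"
  then have h: "h \<in> maps (fst D) (carrier (opens X))" by simp
  have smD: "small (fst D)" "small (carrier (snd D))" and subD: "fst D \<subseteq> carrier (snd D)"
    using Ob_MTD[OF Ob_K[OF D]] by auto
  have lift: "lifts K (underlying (sfc_of K)) c d k \<longleftrightarrow> (\<exists>p\<in>Hom K c d. lam (fst c) (app p) = k)" for c d k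
    by (simp add: lifts_def OM_simps)
  have comp: "vcomp (vcomp (vid {v0, v1}) (chi X x)) (vcomp (char_map X) h) =
      lam (fst D) (\<lambda>a. if x \<in> elts (app h a) then v1 else v0)" if "x \<in> topspace X" for x
    by (rule point_comp_char_map[OF XT that smD(1) h])
  show "lifts K (underlying (sfc_of K)) D (powerset_mt X) h =
    (\<forall>f\<in>point_family (sfc_of K) X. lifts K (underlying (sfc_of K)) D twoM (Cmp SetC f (Cmp SetC (char_map X) h)))"
  proof
    assume "lifts K (underlying (sfc_of K)) D (powerset_mt X) h"
    then obtain p where p: "p \<in> Hom K D (powerset_mt X)" "lam (fst D) (app p) = h"
      unfolding lift by blast
    have ph: "app h a = app p a" if "a \<in> fst D" for a
      using that smD by (simp flip: p(2))
    have "lifts K (underlying (sfc_of K)) D twoM (lam (fst D) (\<lambda>a. if x \<in> elts (app h a) then v1 else v0))"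
      if x: "x \<in> topspace X" for x
    proof -
      let ?q = "lam (carrier (snd D)) (\<lambda>m. if x \<in> elts (app p m) then v1 else v0)"
      have "?q \<in> Hom K D twoM"
        using R_char[OF X D Hom_maps[OF D R_Ob[OF X] p(1)] Hom_opn[OF D R_Ob[OF X] p(1)]] p(1) x by blast
      moreover have "lam (fst D) (app ?q) = lam (fst D) (\<lambda>a. if x \<in> elts (app h a) then v1 else v0)"
        using subD smD ph by (intro lam_cong) auto
      ultimately show ?thesis unfolding lift by blast
    qed
    then show "\<forall>f\<in>point_family (sfc_of K) X. lifts K (underlying (sfc_of K)) D twoM (Cmp SetC f (Cmp SetC (char_map X) h))"
      using comp by (auto simp: point_family_sfc_of)
  next
    assume all: "\<forall>f\<in>point_family (sfc_of K) X. lifts K (underlying (sfc_of K)) D twoM (Cmp SetC f (Cmp SetC (char_map X) h))"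
    \<comment> \<open>The points that lift the components of \<open>h\<close> are combined to an arrow into the powerset by its
      universal property.\<close>
    have "\<exists>q. q \<in> Hom K D twoM \<and> lam (fst D) (app q) = lam (fst D) (\<lambda>a. if x \<in> elts (app h a) then v1 else v0)"
      if x: "x \<in> topspace X" for x
    proof -
      have "vcomp (vid {v0, v1}) (chi X x) \<in> point_family (sfc_of K) X"
        using x by (auto simp: point_family_sfc_of)
      then have "lifts K (underlying (sfc_of K)) D twoM
          (vcomp (vcomp (vid {v0, v1}) (chi X x)) (vcomp (char_map X) h))"
        using all by simp
      then show ?thesis
        unfolding comp[OF x] lift by blast
    qed
    then obtain q where q: "\<And>x. x \<in> topspace X \<Longrightarrow> q x \<in> Hom K D twoM"
      "\<And>x. x \<in> topspace X \<Longrightarrow> lam (fst D) (app (q x)) = lam (fst D) (\<lambda>a. if x \<in> elts (app h a) then v1 else v0)"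
      by metis
    have qh: "app (q x) a = v1 \<longleftrightarrow> x \<in> elts (app h a)" if "x \<in> topspace X" "a \<in> fst D" for x a
      using lam_eqD[OF q(2)[OF that(1)] smD(1) that(2)] by simp
    let ?p = "lam (carrier (snd D)) (\<lambda>m. vset {x \<in> topspace X. app (q x) m = v1})"
    have p_app: "app ?p m = vset {x \<in> topspace X. app (q x) m = v1}" if "m \<in> carrier (snd D)" for m
      using that smD by simp
    have p_open: "app ?p a = app h a" if a: "a \<in> fst D" for a
    proof -
      have "elts (app h a) \<subseteq> topspace X"
        using app_maps[OF h smD(1) a] in_opens_iff[OF smX] openin_subset by blast
      then have "{x \<in> topspace X. app (q x) a = v1} = elts (app h a)"
        using qh[OF _ a] by blast
      then show ?thesis
        using p_app[of a] a subD by auto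
    qed
    have "?p \<in> Hom K D (powerset_mt X) \<longleftrightarrow>
      (\<forall>x\<in>topspace X. lam (carrier (snd D)) (\<lambda>m. if x \<in> elts (app ?p m) then v1 else v0) \<in> Hom K D twoM)"
    proof (rule R_char[OF X D])
      show "?p \<in> maps (carrier (snd D)) (carrier (snd (powerset_mt X)))"
        by (rule maps_I) auto
      show "app ?p a \<in> fst (powerset_mt X)" if "a \<in> fst D" for a
        unfolding p_open[OF that] using app_maps[OF h smD(1) that] by simp
    qed
    moreover have "lam (carrier (snd D)) (\<lambda>m. if x \<in> elts (app ?p m) then v1 else v0) = q x" if x: "x \<in> topspace X" for x
    proof -
      have "lam (carrier (snd D)) (\<lambda>m. if x \<in> elts (app ?p m) then v1 else v0) =
          lam (carrier (snd D)) (\<lambda>m. if app (q x) m = v1 then v1 else v0)"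
        by (rule lam_cong) (simp add: p_app small_sub[OF X] x)
      then show ?thesis
        using point_eq_lam[OF D q(1)[OF x]] by simp
    qed
    ultimately have "?p \<in> Hom K D (powerset_mt X)"
      using q(1) by simp
    moreover have "lam (fst D) (app ?p) = h"
      using lam_cong[of "fst D" "app ?p" "app h"] p_open lam_app[OF smD(1) h] by simp
    ultimately show "lifts K (underlying (sfc_of K)) D (powerset_mt X) h"
      unfolding lift by blast
  qed
qed

lemma TopC_eq: "TopC (sfc_of K) = T"
proof -
  have "{X \<in> Ob Top. \<exists>c \<theta>. is_space_lift (sfc_of K) X c \<theta>} = {X \<in> Ob Top. Q X}"
    using space_lift_Q cartesian_lift Ob_T by blast
  then show ?thesis
    by (simp add: TopC_def full_subcat_def T_def)
qed

lemma ptC_eq: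
  assumes c: "c \<in> Ob K"
  shows "ptC (sfc_of K) c = pt c"
proof -
  have "{f \<in> Hom K c twoM. app (vid {v0, v1}) (app (fa OM c twoM f) a) = v1} = {f \<in> Hom K c twoM. app f a = v1}"
    if a: "a \<in> fst c" for a
  proof -
    have "app (vid {v0, v1}) (app (fa OM c twoM f) a) = app f a" if f: "f \<in> Hom K c twoM" for f
      using Ob_MTD(6)[OF Ob_K[OF c]] a app_maps[OF Hom_maps[OF c t_Ob f] small_und[OF c], of a] opn_und[OF c]
      by (auto simp: OM_simps)
    then show ?thesis by auto
  qed
  then have "(\<lambda>U. \<exists>a\<in>fst c. U = {f \<in> Hom K c twoM. app (vid {v0, v1}) (app (fa OM c twoM f) a) = v1}) =
      (\<lambda>U. \<exists>a\<in>fst c. U = {f \<in> Hom K c twoM. app f a = v1})"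
    by (intro ext) simp
  then show ?thesis
    by (simp add: ptC_def pt_def pt_space_def)
qed

theorem is_sfc: "is_sfc (sfc_of K)"
  unfolding is_sfc_def TopC_eq
  using is_pfc cartesian_lift ptC_eq pt_Ob Sierp Sierp_Top by (simp add: Ob_T)

lemma Dual_agrees: "adjunctions_agree (Dual (sfc_of K)) adj"
  unfolding adjunctions_agree_def
proof (intro conjI ballI)
  show "LC (Dual (sfc_of K)) = LC adj" "RC (Dual (sfc_of K)) = RC adj"
    by (simp_all add: Dual_def TopC_eq)
  show "functors_agree (LC (Dual (sfc_of K))) (LF (Dual (sfc_of K))) (LF adj)"
    by (simp add: functors_agree_def Dual_def ptC_eq pt_map_def Cmp_K)
  show "functors_agree (RC (Dual (sfc_of K))) (RF (Dual (sfc_of K))) (RF adj)"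
    unfolding functors_agree_def
  proof (intro conjI ballI)
    fix X Y g assume "X \<in> Ob (RC (Dual (sfc_of K)))" "Y \<in> Ob (RC (Dual (sfc_of K)))"
      "g \<in> Hom (RC (Dual (sfc_of K))) X Y"
    then have X: "X \<in> Ob T" and Y: "Y \<in> Ob T" and g: "g \<in> Hom Top Y X"
      by (simp_all add: Dual_def TopC_eq)
    have XT: "X \<in> Ob Top" and YT: "Y \<in> Ob Top" using X Y by (simp_all add: Ob_T)
    have gm: "g \<in> maps (topspace Y) (topspace X)" using g by (simp add: Hom_Top)
    have smo: "small (carrier (opens X))" using opens_Frm[OF small_topspace[OF X]] by (simp add: Ob_Frm)
    note smH = small_Hom_Top[OF XT Sierp_Top]
    have cX: "char_map X \<in> maps (carrier (opens X)) (Hom Top X Sierp)"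
      using char_map_inverse[OF XT] by (simp add: inverse_arrows_def)
    have pre: "app (preim X Y g) u \<in> carrier (opens Y)"
      "vcomp (app (char_map X) u) g = app (char_map Y) (app (preim X Y g) u)" if u: "u \<in> carrier (opens X)" for u
    proof -
      have uU: "u \<in> carrier (snd (powerset_mt X))"
        using u opn_und[OF R_Ob[OF X]] by auto
      show pu: "app (preim X Y g) u \<in> carrier (opens Y)"
        using Hom_opn[OF R_Ob[OF X] R_Ob[OF Y] preim_Hom[OF X Y g]] u by simp
      have "vcomp (app (char_map X) u) g = lam (topspace Y) (\<lambda>y. if app g y \<in> elts u then v1 else v0)"
        unfolding vcomp_eq_lam[OF small_topspace[OF Y] gm]
        by (rule lam_cong) (simp add: app_char_map(3)[OF XT u] app_maps[OF gm small_topspace[OF Y]])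
      also have "\<dots> = app (char_map Y) (app (preim X Y g) u)"
        unfolding app_char_map(1)[OF YT pu]
        by (rule lam_cong) (simp add: app_preim[OF X uU] small_sub[OF Y])
      finally show "vcomp (app (char_map X) u) g = app (char_map Y) (app (preim X Y g) u)" .
    qed
    have "lam (carrier (opens X)) (app (preim X Y g)) =
        vcomp (char_inv Y) (vcomp (lam (Hom Top X Sierp) (\<lambda>u. vcomp u g)) (char_map X))"
    proof -
      have "vcomp (lam (Hom Top X Sierp) (\<lambda>u. vcomp u g)) (char_map X) =
          lam (carrier (opens X)) (\<lambda>u. app (char_map Y) (app (preim X Y g) u))"
        unfolding vcomp_eq_lam[OF smo cX]
        by (rule lam_cong) (simp add: smH app_maps[OF cX smo] pre(2))
      moreover have "app (char_inv Y) (app (char_map Y) v) = v" if v: "v \<in> carrier (opens Y)" for v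
      proof -
        have smoY: "small (carrier (opens Y))" using opens_Frm[OF small_topspace[OF Y]] by (simp add: Ob_Frm)
        have "char_map Y \<in> maps (carrier (opens Y)) (Hom Top Y Sierp)" "vcomp (char_inv Y) (char_map Y) = vid (carrier (opens Y))"
          using char_map_inverse[OF YT] by (simp_all add: inverse_arrows_def)
        then show ?thesis
          using app_vcomp[OF smoY _ v, of "char_map Y" "Hom Top Y Sierp" "char_inv Y"] smoY v by simp
      qed
      ultimately show ?thesis
        using smo pre(1) by (simp cong: lam_cong')
    qed
    then have "lift_of (sfc_of K) (powerset_mt X) (powerset_mt Y)
        (vcomp (char_inv Y) (vcomp (lam (Hom Top X Sierp) (\<lambda>u. vcomp u g)) (char_map X))) = preim X Y g"
      by (intro lift_of_eqI[OF R_Ob[OF X] R_Ob[OF Y] preim_Hom[OF X Y g]]) simp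
    then show "fa (RF (Dual (sfc_of K))) X Y g = fa (RF adj) X Y g"
      by (simp add: Dual_def Th_inv_sfc_of[OF YT])
  qed (simp add: Dual_def)
next
  fix c assume "c \<in> Ob (LC (Dual (sfc_of K)))"
  then have c: "c \<in> Ob K" by (simp add: Dual_def)
  note P = pt_Ob[OF c]
  have PT: "pt c \<in> Ob Top" using P by (simp add: Ob_T)
  have smc: "small (fst c)" and subc: "fst c \<subseteq> carrier (snd c)" using Ob_MTD[OF Ob_K[OF c]] by auto
  let ?e = "\<lambda>a. lam (Hom K c twoM) (\<lambda>f. app (vid {v0, v1}) (app (fa OM c twoM f) a))"
  have "app (char_inv (pt c)) (?e a) = app (eta c) a" if a: "a \<in> fst c" for a
  proof -
    have aU: "a \<in> carrier (snd c)" using a subc by blast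
    have val: "app (vid {v0, v1}) (app (fa OM c twoM f) a) = app f a" "app f a \<in> {v0, v1}" if f: "f \<in> Hom K c twoM" for f
      using smc a app_maps[OF Hom_maps[OF c t_Ob f] small_und[OF c] aU] by (auto simp: OM_simps)
    have em: "?e a \<in> maps (topspace (pt c)) {v0, v1}"
      unfolding topspace_pt[OF c] by (rule maps_I) (use val in auto)
    have eqs: "{f \<in> topspace (pt c). app (?e a) f = v1} = {f \<in> Hom K c twoM. app f a = v1}"
      using val by (auto simp: topspace_pt[OF c] small_Hom[OF c])
    then have "?e a \<in> Hom Top (pt c) Sierp"
      using em openin_pt[OF c] a by (auto simp: Hom_Sierp_iff[OF small_topspace[OF P]])
    then have "app (char_inv (pt c)) (?e a) = vset {f \<in> topspace (pt c). app (?e a) f = v1}"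
      by (simp add: char_inv_def small_Hom_Top[OF PT Sierp_Top])
    then show ?thesis
      using eqs app_eta[OF c aU] by simp
  qed
  then have "lam (fst c) (app (eta c)) = vcomp (char_inv (pt c)) (lam (fst c) ?e)"
    using smc by (simp cong: lam_cong')
  then have "lift_of (sfc_of K) c (powerset_mt (pt c)) (vcomp (char_inv (pt c)) (lam (fst c) ?e)) = eta c"
    by (intro lift_of_eqI[OF c R_Ob[OF P] eta_Hom[OF c]])
  then show "unit (Dual (sfc_of K)) c = unit adj c"
    by (simp add: Dual_def ptC_eq[OF c] Th_inv_sfc_of[OF PT])
next
  fix X assume "X \<in> Ob (RC (Dual (sfc_of K)))"
  then have X: "X \<in> Ob T" by (simp add: Dual_def TopC_eq)
  have XT: "X \<in> Ob Top" using X by (simp add: Ob_T)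
  note RX = R_Ob[OF X]
  have smo: "small (carrier (opens X))" using opens_Frm[OF small_topspace[OF X]] by (simp add: Ob_Frm)
  have "lift_of (sfc_of K) (powerset_mt X) twoM (vcomp (vid {v0, v1}) (vcomp (chi X x) (char_map X))) = eval X x"
    if x: "x \<in> topspace X" for x
  proof (rule lift_of_eqI[OF RX t_Ob eval_Hom[OF X x]])
    have cX: "char_map X \<in> maps (carrier (opens X)) (Hom Top X Sierp)"
      using char_map_inverse[OF XT] by (simp add: inverse_arrows_def)
    have "vcomp (vid {v0, v1}) (vcomp (chi X x) (char_map X)) = lam (carrier (opens X)) (\<lambda>u. if x \<in> elts u then v1 else v0)"
      unfolding vcomp_eq_lam[OF smo cX] chi_def using smo
      by (simp add: small_Hom_Top[OF XT Sierp_Top] app_char_map(2,3)[OF XT] x cong: lam_cong')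
    moreover have "lam (fst (powerset_mt X)) (app (eval X x)) = lam (carrier (opens X)) (\<lambda>u. if x \<in> elts u then v1 else v0)"
    proof -
      have "app (eval X x) u = (if x \<in> elts u then v1 else v0)" if "u \<in> carrier (opens X)" for u
        by (rule app_eval[OF X]) (use that opn_und[OF RX] in auto)
      then show ?thesis by (simp cong: lam_cong')
    qed
    ultimately show "lam (fst (powerset_mt X)) (app (eval X x)) = vcomp (vid {v0, v1}) (vcomp (chi X x) (char_map X))"
      by simp
  qed
  then show "counit (Dual (sfc_of K)) X = counit adj X"
    by (simp add: Dual_def eps_def cong: lam_cong')
qed

end

text \<open>
  If \<open>X\<close> has a cartesian lift \<open>c\<close> among the fiber-terminal algebras, then the identity of \<open>c\<close>
  lifts, so every \<open>x \<in> X\<close> induces a point \<open>p x\<close> of \<open>c\<close>. By \<open>T\<^sub>0\<close> the map \<open>p\<close> is injective, it is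
  continuous, and \<open>{x}\<close> is the preimage of the locally closed set \<open>{p x}\<close>.
\<close>

lemma MTT_space_lift_td:
  assumes X: "X \<in> Ob Top" and lift: "is_space_lift (sfc_of MTT) X c \<theta>"
  shows "td_space X"
  unfolding td_space_def
proof
  have smX: "small (topspace X)" and t0: "t0_space X" using X by (auto simp: Ob_Top)
  have c: "c \<in> Ob MTT" and iso: "is_iso SetC (fst c) (Hom Top X Sierp) \<theta>"
    and cart: "\<And>D h. D \<in> Ob MTT \<Longrightarrow> h \<in> maps (fst D) (fst c) \<Longrightarrow> lifts MTT (underlying (sfc_of MTT)) D c h \<longleftrightarrow>
      (\<forall>f\<in>point_family (sfc_of MTT) X. lifts MTT (underlying (sfc_of MTT)) D twoM (vcomp f (vcomp \<theta> h)))"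
    using lift unfolding is_space_lift_def is_cartesian_lift_def by auto
  have cM: "c \<in> Ob MT" "fiber_terminal c" using c by (auto simp: MTT_simps)
  note smc = Ob_MTD(6)[OF cM(1)] and subc = Ob_MTD(5)[OF cM(1)]
  obtain \<theta>' where \<theta>: "\<theta> \<in> maps (fst c) (Hom Top X Sierp)" "\<theta>' \<in> maps (Hom Top X Sierp) (fst c)"
    "vcomp \<theta> \<theta>' = vid (Hom Top X Sierp)"
    using iso by (auto simp: is_iso_def inverse_arrows_def)
  note smH = small_Hom_Top[OF X Sierp_Top]
  have "vid (carrier (snd c)) \<in> Hom MTT c c"
    using is_category_MT cM(1) unfolding is_category_def MTT_simps by (metis MT_simps(2))
  moreover have "fa OM c c (vid (carrier (snd c))) = vid (fst c)"
    using subc Ob_MTD(1)[OF cM(1)] by (auto simp: OM_simps vid_def intro!: lam_cong)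
  ultimately have "lifts MTT (underlying (sfc_of MTT)) c c (vid (fst c))"
    by (auto simp: lifts_def)
  then have pts: "\<And>f. f \<in> point_family (sfc_of MTT) X \<Longrightarrow> lifts MTT (underlying (sfc_of MTT)) c twoM (vcomp f \<theta>)"
    using cart[OF c vid_maps] vcomp_vid_right[OF smc \<theta>(1)] by simp
  have "\<exists>p. p \<in> Hom MT c twoM \<and> (\<forall>a\<in>fst c. app p a = app (app \<theta> a) x)" if x: "x \<in> topspace X" for x
  proof -
    have "vcomp (vid {v0, v1}) (chi X x) \<in> point_family (sfc_of MTT) X"
      using x by (auto simp: point_family_sfc_of)
    then obtain p where p: "p \<in> Hom MT c twoM" "lam (fst c) (app p) = lam (fst c) (\<lambda>a. app (app \<theta> a) x)"
      using pts point_comp_lam[OF X x smc \<theta>(1)] by (fastforce simp: lifts_def OM_simps MTT_simps)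
    then show ?thesis
      using lam_eqD[OF p(2) smc] by blast
  qed
  then obtain p where p: "\<And>x. x \<in> topspace X \<Longrightarrow> p x \<in> Hom MT c twoM"
    "\<And>x a. x \<in> topspace X \<Longrightarrow> a \<in> fst c \<Longrightarrow> app (p x) a = app (app \<theta> a) x"
    by metis
  have opn: "openin X {y \<in> topspace X. app (app \<theta> a) y = v1}" if "a \<in> fst c" for a
    using app_maps[OF \<theta>(1) smc that] Hom_Sierp_iff[OF smX] by blast
  fix x assume x: "x \<in> topspace X"
  note ptc = MT_pt_open[OF cM(1)]
  obtain U K where UK: "openin (pt_space (Hom MT c twoM) (fst c)) U" "closedin (pt_space (Hom MT c twoM) (fst c)) K"
    "U \<inter> K = {p x}"
  proof -
    have "td_space (pt_space (Hom MT c twoM) (fst c))" by (rule fiber_terminal_pt_td[OF cM])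
    moreover have "p x \<in> topspace (pt_space (Hom MT c twoM) (fst c))" using p(1)[OF x] ptc(2) by simp
    ultimately show thesis
      using that unfolding td_space_def by meson
  qed
  obtain b where b: "b \<in> fst c" "U = {f \<in> Hom MT c twoM. app f b = v1}"
    using UK(1) ptc(1) by blast
  have "openin (pt_space (Hom MT c twoM) (fst c)) (Hom MT c twoM - K)"
    using UK(2) ptc(2) by (simp add: closedin_def)
  then obtain a where a: "a \<in> fst c" "Hom MT c twoM - K = {f \<in> Hom MT c twoM. app f a = v1}"
    using ptc(1) by blast
  have K: "f \<in> K \<longleftrightarrow> app f a \<noteq> v1" if "f \<in> Hom MT c twoM" for f
    using a(2) that by blast
  let ?U = "{y \<in> topspace X. app (app \<theta> b) y = v1}" and ?V = "{y \<in> topspace X. app (app \<theta> a) y = v1}"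
  have mem: "y \<in> ?U \<inter> (topspace X - ?V) \<longleftrightarrow> p y \<in> U \<inter> K" if y: "y \<in> topspace X" for y
    using p(1)[OF y] p(2)[OF y a(1)] p(2)[OF y b(1)] K[OF p(1)[OF y]] b(2) y by auto
  \<comment> \<open>Every open set of \<open>X\<close> corresponds to some element of \<open>c\<close>, so that points with the same image lie in
    the same open sets.\<close>
  have "y = x" if y: "y \<in> topspace X" "p y = p x" for y
  proof (rule ccontr)
    assume "y \<noteq> x"
    then obtain V where V: "openin X V" "y \<in> V \<longleftrightarrow> x \<notin> V"
      using t0 x y unfolding t0_space_def by metis
    have u: "vset V \<in> carrier (opens X)" "elts (vset V) = V"
      using V(1) small_subset[OF smX openin_subset[OF V(1)]] by (auto simp: carrier_opens)
    note ch = app_char_map(2)[OF X u(1)]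
    have "app \<theta>' (app (char_map X) (vset V)) \<in> fst c"
      using app_maps[OF \<theta>(2) smH ch] .
    moreover have "app \<theta> (app \<theta>' (app (char_map X) (vset V))) = app (char_map X) (vset V)"
      using app_vcomp[OF smH \<theta>(2) ch, of \<theta>] \<theta>(3) smH ch by simp
    ultimately have "app (app (char_map X) (vset V)) y = app (app (char_map X) (vset V)) x"
      using p(2)[OF x] p(2)[OF y(1)] y(2) by metis
    then show False
      using app_char_map(3)[OF X u(1) x] app_char_map(3)[OF X u(1) y(1)] u(2) V(2) by (auto split: if_splits)
  qed
  note inj = this
  have "?U \<inter> (topspace X - ?V) = {x}"
  proof (intro equalityI subsetI)
    fix y assume y: "y \<in> ?U \<inter> (topspace X - ?V)"
    then have yX: "y \<in> topspace X" by blast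
    have "p y \<in> U \<inter> K" by (rule iffD1[OF mem[OF yX] y])
    then show "y \<in> {x}" unfolding UK(3) using inj[OF yX] by simp
  next
    fix y assume "y \<in> {x}"
    then have y: "y = x" by simp
    show "y \<in> ?U \<inter> (topspace X - ?V)" unfolding y by (rule iffD2[OF mem[OF x]]) (simp add: UK(3))
  qed
  moreover have "openin X ?U" "closedin X (topspace X - ?V)"
    using opn[OF a(1)] opn[OF b(1)] by auto
  ultimately show "\<exists>U K. openin X U \<and> closedin X K \<and> U \<inter> K = {x}"
    by blast
qed

lemma full_subcategory_incl: "is_full_subcategory C D \<Longrightarrow> is_functor C D incl"
  by (auto simp: is_functor_def is_full_subcategory_def is_subcategory_def)

lemma full_subcategory_refl: "is_category C \<Longrightarrow> is_full_subcategory C C"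
  by (simp add: is_full_subcategory_def is_subcategory_def)

lemma MT_mt_duality: "mt_duality MT (\<lambda>_. True)"
  by (intro mt_duality.intro mt_duality_axioms.intro MT_duality full_subcategory_refl is_category_MT TrueI)

lemma MTT_full: "is_full_subcategory MTT MT"
  unfolding MTT_def by (rule full_subcat_full[OF is_category_MT])

lemma MTT_mt_duality: "mt_duality MTT td_space"
  by (intro mt_duality.intro mt_duality_axioms.intro MTT_duality MTT_full Sierp_td MTT_space_lift_td)

lemma MTT_sfc_eq: "MTT_sfc = sfc_of MTT"
  by (simp add: sfc_of_def MTT_sfc_def)

interpretation MT: mt_duality MT "\<lambda>_. True" "full_subcat Top (\<lambda>_. True)" "\<lambda>c. pt_space (Hom MT c twoM) (fst c)"
  using MT_mt_duality by simp_all

interpretation MTT: mt_duality MTT td_space "full_subcat Top td_space" "\<lambda>c. pt_space (Hom MTT c twoM) (fst c)"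
  using MTT_mt_duality by simp_all

interpretation FrmT: pt_duality FrmT two carrier carrier opens td_space "full_subcat Top td_space"
    "\<lambda>L. pt_space (Hom FrmT L two) (carrier L)"
  using FrmT_duality by simp_all

interpretation FrmLE: pt_duality FrmLE two carrier carrier opens td_space "full_subcat Top td_space"
    "\<lambda>L. pt_space (Hom FrmLE L two) (carrier L)"
  using FrmLE_duality by simp_all

lemma adjunction_eqs: "A1 = MT.adj" "A2 = MTT.adj" "A3 = FrmT.adj" "A4 = FrmLE.adj"
proof -
  have TopT: "TopT = full_subcat Top td_space"
    unfolding TopT_def MTT_sfc_eq by (rule MTT.TopC_eq)
  show "A1 = MT.adj"
    unfolding A1_def MT.adj_def by (simp flip: Top_eq_full)
  show "A2 = MTT.adj" "A3 = FrmT.adj" "A4 = FrmLE.adj"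
    unfolding A2_def MTT.adj_def A3_def FrmT.adj_def A4_def FrmLE.adj_def TopT TopD_def by simp_all
qed

section \<open>The inclusion of fiber-terminal algebras\<close>

lemma IT_simps [simp]: "HF IT = incl" "alpha IT C = vid (fst C)" "ii IT = vid {v0, v1}"
  by (simp_all add: IT_def)

lemma vcomp_char_map_vid: "X \<in> Ob Top \<Longrightarrow> vcomp (char_map X) (vid (carrier (opens X))) = char_map X"
proof -
  assume X: "X \<in> Ob Top"
  then have "small (carrier (opens X))" using opens_Frm by (auto simp: Ob_Frm Ob_Top)
  then show ?thesis
    using vcomp_vid_right char_map_inverse[OF X] by (auto simp: inverse_arrows_def)
qed

lemma IT_sfc_mor: "is_sfc_mor MTT_sfc MT_sfc (IT :: ('u::universe mt, 'u mt, 'u) sfc_mor)"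
  unfolding is_sfc_mor_def MTT_sfc_eq MT_sfc_eq sfc_of_simps Let_def IT_simps incl_simps iota_inv_sfc_of
proof (intro conjI ballI)
  have inv: "inverse_arrows Frm two two (vid {v0, v1}) (vid {v0, v1 :: 'u})"
    using inverse_arrows_Idt[OF is_category_Frm two_Frm] by simp
  show "is_functor MTT MT (incl :: ('u mt, 'u, 'u mt, 'u) func)"
    by (rule full_subcategory_incl[OF MTT_full])
  show "is_nat_iso MTT Frm (func_comp OM (incl :: ('u mt, 'u, 'u mt, 'u) func)) OM (\<lambda>C. vid (fst C))"
    unfolding is_nat_iso_def is_nat_trans_def
  proof (intro conjI ballI)
    fix C C' :: "'u mt" and f assume C: "C \<in> Ob MTT" and C': "C' \<in> Ob MTT" and f: "f \<in> Hom MTT C C'"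
    have sm: "small (fst C)" "small (fst C')" using MTT.Ob_K[OF C] MTT.Ob_K[OF C'] Ob_MTD(6) by blast+
    have "fa OM C C' f \<in> maps (fst C) (fst C')" by (rule MTT.OM_Hom_K[OF C C' f])
    then show "Cmp Frm (vid (fst C')) (fa (func_comp OM incl) C C' f) = Cmp Frm (fa OM C C' f) (vid (fst C))"
      using vcomp_vid_left[OF sm] vcomp_vid_right[OF sm(1)] by simp
  next
    fix C :: "'u mt" assume C: "C \<in> Ob MTT"
    note F = OM_Frm[OF MTT.Ob_K[OF C]]
    show "is_iso Frm (fo (func_comp OM incl) C) (fo OM C) (vid (fst C))"
      using is_iso_Idt[OF is_category_Frm F] by simp
    then show "vid (fst C) \<in> Hom Frm (fo (func_comp OM incl) C) (fo OM C)"
      by (auto simp: is_iso_def inverse_arrows_def)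
  qed
  have "inverse_arrows MT twoM twoM (vid {v0, v1}) (vid {v0, v1 :: 'u})"
    using inverse_arrows_Idt[OF is_category_MT twoM_MT] by simp
  then show "is_iso MT twoM twoM (vid {v0, v1 :: 'u})"
    by (auto simp: is_iso_def)
  show "vcomp (vid {v0, v1}) (fa OM twoM twoM (vid {v0, v1})) = vcomp (vid {v0, v1}) (vid (fst twoM :: 'u set))"
  proof -
    have "lam {v0, v1} (app (vid {v0, v1})) = vid {v0, v1 :: 'u}"
      by (rule lam_app[OF _ vid_maps]) simp
    then show ?thesis by (simp only: OM_simps twoM_simps)
  qed
  fix X :: "'u topology" assume "X \<in> Ob (TopC (sfc_of MTT))"
  then have X: "X \<in> Ob Top" by (simp add: MTT.TopC_eq)
  have ai: "inv_arr Frm (fo OM twoM) (fo OM twoM) (vid (fst twoM)) = vid {v0, v1 :: 'u}"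
    unfolding OM_twoM twoM_simps by (rule inv_arr_eqI[OF is_category_Frm two_Frm two_Frm inv])
  have "vcomp (vid {v0, v1}) (vcomp (vid {v0, v1}) (chi X x)) = vcomp (vid {v0, v1}) (chi X x)" if x: "x \<in> topspace X" for x
  proof -
    have "app g x \<in> {v0, v1}" if "g \<in> Hom Top X Sierp" for g
      using app_maps[of g "topspace X" "{v0, v1}" x] that x X by (simp add: Hom_Top Ob_Top)
    then show ?thesis
      unfolding chi_def using small_Hom_Top[OF X Sierp_Top] by (auto intro!: lam_cong)
  qed
  then have fam: "{vcomp (vid {v0, v1}) (vcomp (vid {v0, v1}) (chi X x)) | x. x \<in> topspace X} = point_family (sfc_of MT) X"
    unfolding point_family_sfc_of by force
  have "is_space_lift (sfc_of MT) X (powerset_mt X) (char_map X)"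
    by (rule MT.cartesian_lift) (use X in simp)
  then show "is_cartesian_lift MT SetC (underlying (sfc_of MT)) (Hom Top X Sierp) twoM
      {vcomp (inv_arr Frm (fo OM twoM) (fo OM twoM) (vid (fst twoM)))
         (vcomp (vid {v0, v1}) (chi X x)) | x. x \<in> topspace X}
      (powerset_mt X) (vcomp (char_map X) (vid (fst (powerset_mt X))))"
    unfolding ai fam powerset_mt_simps vcomp_char_map_vid[OF X] by (simp add: is_space_lift_def)
qed

lemma IT_SADJ: "is_SADJ_map A2 A1 (Dual_map MTT_sfc MT_sfc (IT :: ('u::universe mt, 'u mt, 'u) sfc_mor))"
proof -
  let ?M = "Dual_map (sfc_of MTT) (sfc_of MT) (IT :: ('u mt, 'u mt, 'u) sfc_mor)"
  have M: "UF ?M = incl" "VF ?M = incl"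
    by (simp_all add: Dual_map_def)
  interpret S: pt_duality_morphism MTT twoM fst "\<lambda>A. carrier (snd A)" powerset_mt td_space "full_subcat Top td_space"
    "\<lambda>c. pt_space (Hom MTT c twoM) (fst c)" MT twoM fst "\<lambda>A. carrier (snd A)" powerset_mt "\<lambda>_. True"
    "full_subcat Top (\<lambda>_. True)" "\<lambda>c. pt_space (Hom MT c twoM) (fst c)" ?M
  proof (intro pt_duality_morphism.intro pt_duality_morphism_axioms.intro MTT_duality MT_duality, unfold M incl_simps, goal_cases)
    case 1 show ?case by (rule full_subcategory_incl[OF MTT_full])
  next
    case (6 c d f)
    then show ?case
      using lam_app[OF MTT.small_und[OF 6(1)] MTT.Hom_maps[OF 6]] by simp
  next
    case (9 c) then show ?case
      using MTT.Hom_K[OF 9 MTT.t_Ob] by (simp add: bij_betw_def)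
  next
    case (10 X)
    then have X: "X \<in> Ob Top" and XT: "X \<in> Ob (full_subcat Top (\<lambda>_. True))" by simp_all
    have smo: "small (carrier (opens X))" and smP: "small (vset ` Pow (topspace X))"
      using opens_Frm X small_powerset_codes by (auto simp: Ob_Frm Ob_Top)
    note RX = MT.R_Ob[OF XT]
    have "lam (fst (powerset_mt X)) (app (vid (vset ` Pow (topspace X)))) = vid (carrier (opens X))"
      unfolding vid_def[of "carrier (opens X)"] powerset_mt_simps
      by (rule lam_cong) (use smP MT.opn_und[OF RX] in auto)
    moreover have "vcomp (char_inv X) (char_map X) = vid (carrier (opens X))"
      using char_map_inverse[OF X] by (simp add: inverse_arrows_def)
    moreover have "vid (vset ` Pow (topspace X)) \<in> Hom MT (powerset_mt X) (powerset_mt X)"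
      using MT.Hom_Idt[OF RX] by simp
    ultimately have "lift_of (sfc_of MT) (powerset_mt X) (powerset_mt X) (vcomp (char_inv X) (char_map X)) =
        vid (vset ` Pow (topspace X))"
      by (intro MT.lift_of_eqI[OF RX RX]) simp_all
    then show ?case
      by (simp add: Dual_map_def Th_inv_sfc_of[OF X] vcomp_char_map_vid[OF X])
  next
    case (11 c)
    have "vcomp (vid {v0, v1}) f = f" if "f \<in> Hom MTT c twoM" for f
      using vcomp_vid_left[OF MTT.small_und[OF 11] small_v0_v1] MTT.Hom_maps[OF 11 MTT.t_Ob that] by simp
    then show ?case
      by (simp add: Dual_map_def cong: lam_cong')
  qed simp_all
  show ?thesis
    using S.is_SADJ_map unfolding adjunction_eqs MTT_sfc_eq MT_sfc_eq .
qed

section \<open>Fiber-terminal algebras and their frames of opens\<close>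

text \<open>
  A fully faithful and essentially surjective functor is an equivalence. The inverse on objects is chosen
  together with isomorphisms \<open>e\<close>, along which arrows are conjugated and then lifted.
\<close>

lemma equivalence_from_fully_faithful:
  assumes F: "is_functor C D F"
    and faithful: "\<And>a b f g. a \<in> Ob C \<Longrightarrow> b \<in> Ob C \<Longrightarrow> f \<in> Hom C a b \<Longrightarrow> g \<in> Hom C a b \<Longrightarrow>
      fa F a b f = fa F a b g \<Longrightarrow> f = g"
    and full: "\<And>a b h. a \<in> Ob C \<Longrightarrow> b \<in> Ob C \<Longrightarrow> h \<in> Hom D (fo F a) (fo F b) \<Longrightarrow> \<exists>f\<in>Hom C a b. fa F a b f = h"
    and onto: "\<And>d. d \<in> Ob D \<Longrightarrow> \<exists>a\<in>Ob C. \<exists>e. is_iso D (fo F a) d e"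
  shows "is_equivalence C D F"
proof -
  have C: "is_category C" and D: "is_category D" using F by (auto simp: is_functor_def)
  have FOb: "\<And>a. a \<in> Ob C \<Longrightarrow> fo F a \<in> Ob D"
    and FHom: "\<And>a b f. a \<in> Ob C \<Longrightarrow> b \<in> Ob C \<Longrightarrow> f \<in> Hom C a b \<Longrightarrow> fa F a b f \<in> Hom D (fo F a) (fo F b)"
    and FIdt: "\<And>a. a \<in> Ob C \<Longrightarrow> fa F a a (Idt C a) = Idt D (fo F a)"
    and FCmp: "\<And>a b c f g. a \<in> Ob C \<Longrightarrow> b \<in> Ob C \<Longrightarrow> c \<in> Ob C \<Longrightarrow> f \<in> Hom C a b \<Longrightarrow> g \<in> Hom C b c \<Longrightarrow>
      fa F a c (Cmp C g f) = Cmp D (fa F b c g) (fa F a b f)"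
    using F by (auto simp: is_functor_def)
  have comp: "\<And>a b c f g. a \<in> Ob D \<Longrightarrow> b \<in> Ob D \<Longrightarrow> c \<in> Ob D \<Longrightarrow> f \<in> Hom D a b \<Longrightarrow> g \<in> Hom D b c \<Longrightarrow> Cmp D g f \<in> Hom D a c"
    and unitl: "\<And>a b f. a \<in> Ob D \<Longrightarrow> b \<in> Ob D \<Longrightarrow> f \<in> Hom D a b \<Longrightarrow> Cmp D (Idt D b) f = f"
    and unitr: "\<And>a b f. a \<in> Ob D \<Longrightarrow> b \<in> Ob D \<Longrightarrow> f \<in> Hom D a b \<Longrightarrow> Cmp D f (Idt D a) = f"
    and assoc: "\<And>a b c d f g h. a \<in> Ob D \<Longrightarrow> b \<in> Ob D \<Longrightarrow> c \<in> Ob D \<Longrightarrow> d \<in> Ob D \<Longrightarrow> f \<in> Hom D a b \<Longrightarrow>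
      g \<in> Hom D b c \<Longrightarrow> h \<in> Hom D c d \<Longrightarrow> Cmp D h (Cmp D g f) = Cmp D (Cmp D h g) f"
    and ident: "\<And>a. a \<in> Ob D \<Longrightarrow> Idt D a \<in> Hom D a a"
    using D by (auto simp: is_category_def)
  have compC: "\<And>a b c f g. a \<in> Ob C \<Longrightarrow> b \<in> Ob C \<Longrightarrow> c \<in> Ob C \<Longrightarrow> f \<in> Hom C a b \<Longrightarrow> g \<in> Hom C b c \<Longrightarrow> Cmp C g f \<in> Hom C a c"
    and identC: "\<And>a. a \<in> Ob C \<Longrightarrow> Idt C a \<in> Hom C a a"
    using C by (auto simp: is_category_def)
  obtain G where G: "\<And>d. d \<in> Ob D \<Longrightarrow> G d \<in> Ob C" "\<And>d. d \<in> Ob D \<Longrightarrow> \<exists>e. is_iso D (fo F (G d)) d e"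
    using onto by metis
  obtain e e' where e: "\<And>d. d \<in> Ob D \<Longrightarrow> inverse_arrows D (fo F (G d)) d (e d) (e' d)"
    using G(2) unfolding is_iso_def by metis
  have eH: "e d \<in> Hom D (fo F (G d)) d" "e' d \<in> Hom D d (fo F (G d))"
    "Cmp D (e' d) (e d) = Idt D (fo F (G d))" "Cmp D (e d) (e' d) = Idt D d" if "d \<in> Ob D" for d
    using e[OF that] by (auto simp: inverse_arrows_def)
  note FG = FOb[OF G(1)]
  define Ga where "Ga = (\<lambda>c d h. SOME f. f \<in> Hom C (G c) (G d) \<and> fa F (G c) (G d) f = Cmp D (e' d) (Cmp D h (e c)))"
  have Ga: "Ga c d h \<in> Hom C (G c) (G d)" "fa F (G c) (G d) (Ga c d h) = Cmp D (e' d) (Cmp D h (e c))"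
    if c: "c \<in> Ob D" and d: "d \<in> Ob D" and h: "h \<in> Hom D c d" for c d h
  proof -
    have "Cmp D (e' d) (Cmp D h (e c)) \<in> Hom D (fo F (G c)) (fo F (G d))"
      by (rule comp[OF FG[OF c] d FG[OF d] comp[OF FG[OF c] c d eH(1)[OF c] h] eH(2)[OF d]])
    then have "\<exists>f. f \<in> Hom C (G c) (G d) \<and> fa F (G c) (G d) f = Cmp D (e' d) (Cmp D h (e c))"
      using full[OF G(1)[OF c] G(1)[OF d]] by blast
    then show "Ga c d h \<in> Hom C (G c) (G d)" "fa F (G c) (G d) (Ga c d h) = Cmp D (e' d) (Cmp D h (e c))"
      unfolding Ga_def by (rule someI2_ex; simp)+
  qed
  have eGa: "Cmp D (e d) (fa F (G c) (G d) (Ga c d h)) = Cmp D h (e c)"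
    if c: "c \<in> Ob D" and d: "d \<in> Ob D" and h: "h \<in> Hom D c d" for c d h
  proof -
    have he: "Cmp D h (e c) \<in> Hom D (fo F (G c)) d"
      by (rule comp[OF FG[OF c] c d eH(1)[OF c] h])
    show ?thesis
      unfolding Ga(2)[OF c d h] assoc[OF FG[OF c] d FG[OF d] d he eH(2)[OF d] eH(1)[OF d]] eH(4)[OF d]
      by (rule unitl[OF FG[OF c] d he])
  qed
  let ?G = "\<lparr>fo = G, fa = Ga\<rparr>"
  have functor_G: "is_functor D C ?G"
    unfolding is_functor_def
  proof (intro conjI ballI C D)
    show "fo ?G d \<in> Ob C" if "d \<in> Ob D" for d using G(1)[OF that] by simp
    show "fa ?G c d h \<in> Hom C (fo ?G c) (fo ?G d)" if "c \<in> Ob D" "d \<in> Ob D" "h \<in> Hom D c d" for c d h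
      using Ga(1)[OF that] by simp
    show "fa ?G d d (Idt D d) = Idt C (fo ?G d)" if d: "d \<in> Ob D" for d
    proof -
      have "fa F (G d) (G d) (Ga d d (Idt D d)) = fa F (G d) (G d) (Idt C (G d))"
        unfolding Ga(2)[OF d d ident[OF d]] FIdt[OF G(1)[OF d]] unitl[OF FG[OF d] d eH(1)[OF d]] by (rule eH(3)[OF d])
      then show ?thesis
        using faithful[OF G(1)[OF d] G(1)[OF d] Ga(1)[OF d d ident[OF d]] identC[OF G(1)[OF d]]] by simp
    qed
    show "fa ?G a c (Cmp D g f) = Cmp C (fa ?G b c g) (fa ?G a b f)"
      if a: "a \<in> Ob D" and b: "b \<in> Ob D" and c: "c \<in> Ob D" and f: "f \<in> Hom D a b" and g: "g \<in> Hom D b c" for a b c f g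
    proof -
      note gf = comp[OF a b c f g]
      note Gf = Ga(1)[OF a b f] and Gg = Ga(1)[OF b c g]
      have fe: "Cmp D f (e a) \<in> Hom D (fo F (G a)) b" by (rule comp[OF FG[OF a] a b eH(1)[OF a] f])
      have Ff: "fa F (G a) (G b) (Ga a b f) \<in> Hom D (fo F (G a)) (fo F (G b))"
        by (rule FHom[OF G(1)[OF a] G(1)[OF b] Gf])
      have ge: "Cmp D g (e b) \<in> Hom D (fo F (G b)) c" by (rule comp[OF FG[OF b] b c eH(1)[OF b] g])
      have "fa F (G a) (G c) (Cmp C (Ga b c g) (Ga a b f)) = Cmp D (Cmp D (e' c) (Cmp D g (e b))) (fa F (G a) (G b) (Ga a b f))"
        using FCmp[OF G(1)[OF a] G(1)[OF b] G(1)[OF c] Gf Gg] Ga(2)[OF b c g] by simp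
      also have "\<dots> = Cmp D (e' c) (Cmp D (Cmp D g (e b)) (fa F (G a) (G b) (Ga a b f)))"
        by (rule assoc[OF FG[OF a] FG[OF b] c FG[OF c] Ff ge eH(2)[OF c], symmetric])
      also have "Cmp D (Cmp D g (e b)) (fa F (G a) (G b) (Ga a b f)) = Cmp D g (Cmp D f (e a))"
        using assoc[OF FG[OF a] FG[OF b] b c Ff eH(1)[OF b] g] eGa[OF a b f] by simp
      also have "\<dots> = Cmp D (Cmp D g f) (e a)"
        by (rule assoc[OF FG[OF a] a b c eH(1)[OF a] f g])
      also have "Cmp D (e' c) (Cmp D (Cmp D g f) (e a)) = fa F (G a) (G c) (Ga a c (Cmp D g f))"
        by (rule Ga(2)[OF a c gf, symmetric])
      finally show ?thesis
        using faithful[OF G(1)[OF a] G(1)[OF c] Ga(1)[OF a c gf] compC[OF G(1)[OF a] G(1)[OF b] G(1)[OF c] Gf Gg]] by simp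
    qed
  qed
  have counit: "is_nat_iso D D (func_comp F ?G) incl e"
  proof -
    have "is_iso D (fo F (G d)) d (e d)" if "d \<in> Ob D" for d
      unfolding is_iso_def using e[OF that] by blast
    then show ?thesis
      unfolding is_nat_iso_def is_nat_trans_def using eH(1) eGa by simp
  qed
  \<comment> \<open>The unit at \<open>a\<close> is the lift of the inverse of the chosen isomorphism \<open>F (G (F a)) \<cong> F a\<close>.\<close>
  have "\<exists>s s'. s \<in> Hom C a (G (fo F a)) \<and> s' \<in> Hom C (G (fo F a)) a \<and>
      fa F a (G (fo F a)) s = e' (fo F a) \<and> fa F (G (fo F a)) a s' = e (fo F a)" if a: "a \<in> Ob C" for a
    using full[OF a G(1)[OF FOb[OF a]] eH(2)[OF FOb[OF a]]] full[OF G(1)[OF FOb[OF a]] a eH(1)[OF FOb[OF a]]] by blast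
  then obtain s s' where s: "\<And>a. a \<in> Ob C \<Longrightarrow> s a \<in> Hom C a (G (fo F a))" "\<And>a. a \<in> Ob C \<Longrightarrow> s' a \<in> Hom C (G (fo F a)) a"
    "\<And>a. a \<in> Ob C \<Longrightarrow> fa F a (G (fo F a)) (s a) = e' (fo F a)" "\<And>a. a \<in> Ob C \<Longrightarrow> fa F (G (fo F a)) a (s' a) = e (fo F a)"
    by metis
  have s_inv: "inverse_arrows C a (G (fo F a)) (s a) (s' a)" if a: "a \<in> Ob C" for a
  proof -
    note Fa = FOb[OF a] and GFa = G(1)[OF FOb[OF a]]
    have "fa F a a (Cmp C (s' a) (s a)) = fa F a a (Idt C a)"
      using FCmp[OF a GFa a s(1)[OF a] s(2)[OF a]] s(3,4)[OF a] eH(4)[OF Fa] FIdt[OF a] by simp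
    moreover have "fa F (G (fo F a)) (G (fo F a)) (Cmp C (s a) (s' a)) = fa F (G (fo F a)) (G (fo F a)) (Idt C (G (fo F a)))"
      using FCmp[OF GFa a GFa s(2)[OF a] s(1)[OF a]] s(3,4)[OF a] eH(3)[OF Fa] FIdt[OF GFa] by simp
    ultimately show ?thesis
      unfolding inverse_arrows_def
      using s(1,2)[OF a] faithful[OF a a compC[OF a GFa a s(1)[OF a] s(2)[OF a]] identC[OF a]]
        faithful[OF GFa GFa compC[OF GFa a GFa s(2)[OF a] s(1)[OF a]] identC[OF GFa]] by simp
  qed
  have "is_nat_iso C C incl (func_comp ?G F) s"
    unfolding is_nat_iso_def is_nat_trans_def
  proof (intro conjI ballI)
    fix a b f assume a: "a \<in> Ob C" and b: "b \<in> Ob C" and f: "f \<in> Hom C a b"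
    note Fa = FOb[OF a] and Fb = FOb[OF b] and GFa = G(1)[OF FOb[OF a]] and GFb = G(1)[OF FOb[OF b]]
    note Ff = FHom[OF a b f]
    note Gf = Ga(1)[OF Fa Fb Ff]
    have fe: "Cmp D (fa F a b f) (e (fo F a)) \<in> Hom D (fo F (G (fo F a))) (fo F b)"
      by (rule comp[OF FG[OF Fa] Fa Fb eH(1)[OF Fa] Ff])
    have "fa F a (G (fo F b)) (Cmp C (Ga (fo F a) (fo F b) (fa F a b f)) (s a)) =
        Cmp D (Cmp D (e' (fo F b)) (Cmp D (fa F a b f) (e (fo F a)))) (e' (fo F a))"
      using FCmp[OF a GFa GFb s(1)[OF a] Gf] Ga(2)[OF Fa Fb Ff] s(3)[OF a] by simp
    also have "\<dots> = Cmp D (e' (fo F b)) (Cmp D (Cmp D (fa F a b f) (e (fo F a))) (e' (fo F a)))"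
      by (rule assoc[OF Fa FG[OF Fa] Fb FG[OF Fb] eH(2)[OF Fa] fe eH(2)[OF Fb], symmetric])
    also have "Cmp D (Cmp D (fa F a b f) (e (fo F a))) (e' (fo F a)) = fa F a b f"
      using assoc[OF Fa FG[OF Fa] Fa Fb eH(2)[OF Fa] eH(1)[OF Fa] Ff] eH(4)[OF Fa] unitr[OF Fa Fb Ff] by simp
    also have "Cmp D (e' (fo F b)) (fa F a b f) = fa F a (G (fo F b)) (Cmp C (s b) f)"
      using FCmp[OF a b GFb f s(1)[OF b]] s(3)[OF b] by simp
    finally have "Cmp C (s b) f = Cmp C (Ga (fo F a) (fo F b) (fa F a b f)) (s a)"
      using faithful[OF a GFb compC[OF a b GFb f s(1)[OF b]] compC[OF a GFa GFb s(1)[OF a] Gf]] by simp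
    then show "Cmp C (s b) (fa incl a b f) = Cmp C (fa (func_comp ?G F) a b f) (s a)"
      by simp
  qed (use s(1) s_inv in \<open>auto simp: is_iso_def\<close>)
  then show ?thesis
    unfolding is_equivalence_def using F functor_G counit by blast
qed

lemma OM_functor_FrmT: "is_functor (MTT :: ('u::universe mt, 'u) cat) FrmT (func_comp OM incl)"
  unfolding is_functor_def
proof (intro conjI ballI)
  have "is_full_subcategory (FrmT :: ('u gorder, 'u) cat) FrmLE" by (rule FrmT_full)
  then show "is_category (FrmT :: ('u gorder, 'u) cat)"
    by (simp add: is_full_subcategory_def is_subcategory_def)
  show "fa (func_comp OM incl) C C' f \<in> Hom FrmT (fo (func_comp OM incl) C) (fo (func_comp OM incl) C')"
    if "C \<in> Ob MTT" "C' \<in> Ob MTT" "f \<in> Hom MTT C C'" for C C' :: "'u mt" and f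
    using OM_FrmT_Hom_iff[OF that(1,2)] that(3) by auto
  have F: "is_functor (MTT :: ('u mt, 'u) cat) Frm OM" by (rule MTT.functor_OM)
  show "is_category (MTT :: ('u mt, 'u) cat)"
    using F by (simp add: is_functor_def)
  show "fo (func_comp OM incl) C \<in> Ob FrmT" if "C \<in> Ob MTT" for C :: "'u mt"
    using OM_FrmT[OF that] by simp
  show "fa (func_comp OM incl) C C (Idt MTT C) = Idt FrmT (fo (func_comp OM incl) C)" if "C \<in> Ob MTT" for C :: "'u mt"
    using F that by (simp add: is_functor_def FrmT_simps)
  show "fa (func_comp OM incl) B D (Cmp MTT g f) = Cmp FrmT (fa (func_comp OM incl) C D g) (fa (func_comp OM incl) B C f)"
    if "B \<in> Ob MTT" "C \<in> Ob MTT" "D \<in> Ob MTT" "f \<in> Hom MTT B C" "g \<in> Hom MTT C D" for B C D :: "'u mt" and f g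
    using F that by (simp add: is_functor_def FrmT_simps)
qed

lemma OM_equivalence: "is_equivalence (MTT :: ('u::universe mt, 'u) cat) FrmT (func_comp OM incl)"
proof (rule equivalence_from_fully_faithful[OF OM_functor_FrmT])
  show "f = g" if "C \<in> Ob MTT" "C' \<in> Ob MTT" "f \<in> Hom MTT C C'" "g \<in> Hom MTT C C'"
    "fa (func_comp OM incl) C C' f = fa (func_comp OM incl) C C' g" for C C' :: "'u mt" and f g
    using MTT.OM_inj that by simp
  show "\<exists>f\<in>Hom MTT C C'. fa (func_comp OM incl) C C' f = h"
    if "C \<in> Ob MTT" "C' \<in> Ob MTT" "h \<in> Hom FrmT (fo (func_comp OM incl) C) (fo (func_comp OM incl) C')"
    for C C' :: "'u mt" and h
    using OM_FrmT_Hom_iff[OF that(1,2)] that(3) by auto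
  show "\<exists>C\<in>Ob MTT. \<exists>\<theta>. is_iso FrmT (fo (func_comp OM incl) C) L \<theta>" if L: "L \<in> Ob FrmT" for L :: "'u gorder"
  proof -
    obtain C \<theta> \<theta>' where C: "C \<in> Ob MTT" and inv: "inverse_arrows Frm (fo OM C) L \<theta> \<theta>'"
      using L by (auto simp: Ob_FrmT is_iso_def)
    have LF: "L \<in> Ob Frm" using L by (simp add: Ob_FrmT)
    note CF = OM_Frm[OF MTT.Ob_K[OF C]]
    have idC: "vid (carrier (snd C)) \<in> Hom MTT C C" "fa OM C C (vid (carrier (snd C))) = vid (fst C)"
      using MTT.Hom_Idt[OF C] MTT.functor_OM C MTT.Idt_K[OF C] by (auto simp: is_functor_def)
    have id: "is_iso Frm (fo OM C) (fo OM C) (vid (fst C))"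
      using is_iso_Idt[OF is_category_Frm CF] by simp
    have \<theta>: "is_iso Frm (fo OM C) L \<theta>" using inv by (auto simp: is_iso_def)
    have hom: "\<theta> \<in> Hom Frm (fo OM C) L" "\<theta>' \<in> Hom Frm L (fo OM C)" "vcomp \<theta>' \<theta> = vid (fst C)" "vcomp \<theta> \<theta>' = vid (carrier L)"
      using inv by (auto simp: inverse_arrows_def)
    have smC: "small (fst C)" using Ob_MTD(6)[OF MTT.Ob_K[OF C]] .
    have "vcomp \<theta> (vid (fst C)) = vcomp \<theta> (fa OM C C (vid (carrier (snd C))))"
      using idC(2) by simp
    then have "locally_exact (fo OM C) L (app \<theta>)"
      using locally_exact_iff_lifts[OF C C CF LF id \<theta> hom(1)] idC(1) by blast
    moreover have "locally_exact L (fo OM C) (app \<theta>')"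
    proof -
      have "vcomp \<theta>' \<theta> = vcomp (vid (fst C)) (fa OM C C (vid (carrier (snd C))))"
        using hom(3) idC(2) vcomp_vid_left[OF smC smC vid_maps] by simp
      then show ?thesis
        using locally_exact_iff_lifts[OF C C LF CF \<theta> id hom(2)] idC(1) by blast
    qed
    ultimately have "inverse_arrows FrmT (fo OM C) L \<theta> \<theta>'"
      using hom by (simp add: inverse_arrows_def Hom_FrmT OM_FrmT[OF C] L FrmLE_simps FrmT_simps)
    then show ?thesis
      using C by (auto simp: is_iso_def)
  qed
qed

lemma map23_SADJ: "is_SADJ_map A2 A3 map23"
proof -
  have M: "UF map23 = func_comp OM incl" "VF map23 = incl" "zeta map23 = (\<lambda>X. vid (carrier (opens X)))"
    by (simp_all add: map23_def)
  interpret S: pt_duality_morphism MTT twoM fst "\<lambda>A. carrier (snd A)" powerset_mt td_space "full_subcat Top td_space"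
    "\<lambda>c. pt_space (Hom MTT c twoM) (fst c)" FrmT two carrier carrier opens td_space
    "full_subcat Top td_space" "\<lambda>L. pt_space (Hom FrmT L two) (carrier L)" map23
  proof (intro pt_duality_morphism.intro pt_duality_morphism_axioms.intro MTT_duality FrmT_duality, unfold M, goal_cases)
    case 1 show ?case by (rule OM_functor_FrmT)
  next
    case 3 show ?case by (simp add: OM_twoM)
  next
    case (4 c) then show ?case using MTT.opn_und by simp
  next
    case (6 c d f) then show ?case by (simp add: OM_simps)
  next
    case (8 X) then show ?case by (simp add: OM_powerset_mt)
  next
    case (9 c)
    have "h \<in> Hom FrmT (fo OM c) two \<longleftrightarrow> (\<exists>p\<in>Hom MTT c twoM. h = fa OM c twoM p)" for h
      using OM_FrmT_Hom_iff[OF 9 MTT.t_Ob, of h] by (simp add: OM_twoM)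
    then show ?case
      using MTT.OM_inj[OF 9 MTT.t_Ob] by (auto simp: bij_betw_def inj_on_def)
  next
    case (11 c) then show ?case by (simp add: map23_def)
  qed simp_all
  show ?thesis
    using S.is_SADJ_map unfolding adjunction_eqs .
qed

lemma map34_SADJ: "is_SADJ_map A3 A4 map34"
proof -
  have M: "UF map34 = incl" "VF map34 = incl" "zeta map34 = (\<lambda>X. vid (carrier (opens X)))"
    by (simp_all add: map34_def)
  interpret S: pt_duality_morphism FrmT two carrier carrier opens td_space "full_subcat Top td_space"
    "\<lambda>L. pt_space (Hom FrmT L two) (carrier L)" FrmLE two carrier carrier opens td_space
    "full_subcat Top td_space" "\<lambda>L. pt_space (Hom FrmLE L two) (carrier L)" map34
  proof (intro pt_duality_morphism.intro pt_duality_morphism_axioms.intro FrmT_duality FrmLE_duality,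
      unfold M incl_simps, goal_cases)
    case 1 show ?case by (rule full_subcategory_incl[OF FrmT_full])
  next
    case (6 c d f)
    then show ?case
      using lam_app[OF FrmT.small_und[OF 6(1)] FrmT.Hom_maps[OF 6]] by simp
  next
    case (9 c) then show ?case
      using Hom_FrmT[OF 9 FrmT.t_Ob] by (simp add: bij_betw_def)
  next
    case (11 c) then show ?case by (simp add: map34_def)
  qed simp_all
  show ?thesis
    using S.is_SADJ_map unfolding adjunction_eqs .
qed

theorem theorem3p39:
  shows "is_sfc (MT_sfc :: ('u::universe mt, 'u) sfc) \<and>
    is_sfc (MTT_sfc :: ('u mt, 'u) sfc) \<and>
    is_full_subcategory (MTT :: ('u mt, 'u) cat) MT \<and>
    is_sfc_mor (MTT_sfc :: ('u mt, 'u) sfc) MT_sfc IT \<and>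
    is_adjunction (A1 :: ('u mt, 'u, 'u topology, 'u) adjn) \<and>
    adjunctions_agree (Dual (MT_sfc :: ('u mt, 'u) sfc)) A1 \<and>
    is_adjunction (A2 :: ('u mt, 'u, 'u topology, 'u) adjn) \<and>
    adjunctions_agree (Dual (MTT_sfc :: ('u mt, 'u) sfc)) A2 \<and>
    (TopT :: ('u topology, 'u) cat) = TopD \<and>
    is_adjunction (A3 :: ('u gorder, 'u, 'u topology, 'u) adjn) \<and>
    is_adjunction (A4 :: ('u gorder, 'u, 'u topology, 'u) adjn) \<and>
    is_full_subcategory (TopD :: ('u topology, 'u) cat) Top \<and>
    is_SADJ_map (A2 :: ('u mt, 'u, 'u topology, 'u) adjn) A1 (Dual_map MTT_sfc MT_sfc IT) \<and>
    is_equivalence (MTT :: ('u mt, 'u) cat) FrmT (func_comp OM incl) \<and>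
    is_SADJ_map (A2 :: ('u mt, 'u, 'u topology, 'u) adjn) A3 map23 \<and>
    is_subcategory (FrmT :: ('u gorder, 'u) cat) FrmLE \<and>
    is_SADJ_map (A3 :: ('u gorder, 'u, 'u topology, 'u) adjn) A4 map34"
proof (intro conjI)
  show "is_sfc (MT_sfc :: ('u mt, 'u) sfc)"
    unfolding MT_sfc_eq by (rule MT.is_sfc)
  show "is_sfc (MTT_sfc :: ('u mt, 'u) sfc)"
    unfolding MTT_sfc_eq by (rule MTT.is_sfc)
  show "is_adjunction (A1 :: ('u mt, 'u, 'u topology, 'u) adjn)"
    unfolding adjunction_eqs by (rule MT.is_adjunction)
  show "adjunctions_agree (Dual (MT_sfc :: ('u mt, 'u) sfc)) A1"
    unfolding adjunction_eqs MT_sfc_eq by (rule MT.Dual_agrees)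
  show "is_adjunction (A2 :: ('u mt, 'u, 'u topology, 'u) adjn)"
    unfolding adjunction_eqs by (rule MTT.is_adjunction)
  show "adjunctions_agree (Dual (MTT_sfc :: ('u mt, 'u) sfc)) A2"
    unfolding adjunction_eqs MTT_sfc_eq by (rule MTT.Dual_agrees)
  show "(TopT :: ('u topology, 'u) cat) = TopD"
    unfolding TopT_def TopD_def MTT_sfc_eq by (rule MTT.TopC_eq)
  show "is_adjunction (A3 :: ('u gorder, 'u, 'u topology, 'u) adjn)"
    unfolding adjunction_eqs by (rule FrmT.is_adjunction)
  show "is_adjunction (A4 :: ('u gorder, 'u, 'u topology, 'u) adjn)"
    unfolding adjunction_eqs by (rule FrmLE.is_adjunction)
  show "is_full_subcategory (TopD :: ('u topology, 'u) cat) Top"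
    unfolding TopD_def by (rule full_subcat_full[OF is_category_Top])
  show "is_subcategory (FrmT :: ('u gorder, 'u) cat) FrmLE"
    by (rule FrmT_full[unfolded is_full_subcategory_def, THEN conjunct1])
qed (rule MTT_full IT_sfc_mor IT_SADJ OM_equivalence map23_SADJ map34_SADJ)+

end
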